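(* Let $\lambda>0$ and let $\Xi=\bigcup_{i\ge1}(\Xi_i+X_i)$ be the stationary Poisson grain model in $\mathbb{R}^d$, $d\ge1$, with intensity $\lambda$ and compact typical grain $\Xi_0$ satisfying $M(a):=\mathsf{E}\exp\{a|\Xi_0|\}<\infty$ for some $a>0$ and $\mathsf{E}|\Xi_0|>0$. Let $(W_n)_{n\ge1}$ be a convex averaging sequence in $\mathbb{R}^d$, $\hat p_n:=|\Xi\cap W_n|/|W_n|$, $p:=\mathsf{P}(o\in\Xi)$, $$\Delta(a):=\frac{8(a+\lambda M(a))(1+\exp\{\lambda\mathsf{E}|\Xi_0|\})}{a^2},\qquad L(h):=\lim_{n\to\infty}\frac1{|W_n|}\log\mathsf{E}\exp\{h|\Xi\cap W_n|\}\quad\text{for }|h|<1/\Delta(a).$$ Then $$\lim_{n\to\infty}\frac{\log\mathsf{P}(\hat p_n-p\ge\varepsilon)}{|W_n|}=\inf_{0\le h<1/\Delta(a)}g(h)=g(h_0(\varepsilon))$$ holds for all $\varepsilon$ in the interval $0\le\varepsilon<\varepsilon^*:=\lim_{h\uparrow1/\Delta(a)}L'(h)-p$, where $g(h):=L(h)-h(\varepsilon+p)$ and $h_0(\varepsilon)$ is the unique solution in $[0,1/\Delta(a))$ of the equation $g'(h)=0$, that is, $L'(h)=\varepsilon+p$. The corresponding relationship is valid for $\mathsf{P}(\hat p_n-p\le-\varepsilon)$, where $g$ is defined for $h\in(-1/\Delta(a),0]$ and with $-\varepsilon$ instead of $\varepsilon$: for $0\le\varepsilon<p-\lim_{h\downarrow-1/\Delta(a)}L'(h)$,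 $$\lim_{n\to\infty}\frac{\log\mathsf{P}(\hat p_n-p\le-\varepsilon)}{|W_n|}=\inf_{-1/\Delta(a)<h\le0}\bigl(L(h)-h(p-\varepsilon)\bigr)=L(h_0)-h_0(p-\varepsilon),$$ where $h_0\in(-1/\Delta(a),0]$ is the unique solution of $L'(h)=p-\varepsilon$.
   Context: $|\cdot|$ denotes $d$-dimensional Lebesgue measure (and absolute value for numbers), $o$ the origin of $\mathbb{R}^d$. Poisson grain model (PGM, Boolean model): $\Pi_\lambda=\sum_{i\ge1}\delta_{X_i}$ is a stationary Poisson process on $\mathbb{R}^d$ with intensity $\lambda>0$; $\Xi_0$ (the typical grain) is a random compact set, i.e. a measurable map into the space $\mathcal{K}$ of non-empty compact subsets of $\mathbb{R}^d$ with the Borel $\sigma$-field of the Hausdorff metric; $\Xi_1,\Xi_2,\dots$ are independent copies of $\Xi_0$, independent of $\Pi_\lambda$; and $\Xi:=\bigcup_{i\ge1}(\Xi_i+X_i)$. ($\Xi$ need not be closed.) The underlying probability space $[\Omega,\mathfrak{A},\mathsf{P}]$ is chosen such that $(x,\omega)\mapsto\mathbf{1}_{\Xi(\omega)}(x)$ is jointly measurable. A convex averaging sequence $(W_n)_{n\ge1}$ is a non-decreasing sequence of (deterministic) compact convex sets in $\mathbb{R}^d$ with $\bigcup_nW_n=\mathbb{R}^d$ (with $|W_n|>0$). Under the stated hypotheses the limit $L(h)$ exists for $|h|<1/\Delta(a)$ (indeed for complex $h$ in this disk, where it is analytic), so that $L'$ is well defined. *)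

theory Defs
  imports "HOL-Probability.Probability"
begin

abbreviation vol :: "'a::euclidean_space set \<Rightarrow> real" where
  "vol A \<equiv> measure lborel A"

definition nonempty_compacts :: "'a::euclidean_space set set" where
  "nonempty_compacts = {K. compact K \<and> K \<noteq> {}}"

text \<open>Outside the non-empty compact sets the distance is set to 0, because the suprema need not
  exist there and \<^locale>\<open>Metric_space\<close> demands non-negativity for all arguments.\<close>

definition hausdorff_dist :: "'a::euclidean_space set \<Rightarrow> 'a set \<Rightarrow> real" where
  "hausdorff_dist A B =
    (if A \<in> nonempty_compacts \<and> B \<in> nonempty_compacts
     then max (SUP x\<in>A. infdist x B) (SUP y\<in>B. infdist y A) else 0)"

lemma bdd_above_infdist:
  assumes "A \<in> nonempty_compacts"
  shows "bdd_above ((\<lambda>x. infdist x B) ` A)"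
proof -
  have "compact ((\<lambda>x. infdist x B) ` A)"
    using assms unfolding nonempty_compacts_def
    by (auto intro!: compact_continuous_image continuous_intros)
  then show ?thesis
    by (intro bounded_imp_bdd_above compact_imp_bounded)
qed

lemma hausdorff_dist_le_iff:
  assumes "A \<in> nonempty_compacts" "B \<in> nonempty_compacts"
  shows "hausdorff_dist A B \<le> r \<longleftrightarrow> (\<forall>x\<in>A. infdist x B \<le> r) \<and> (\<forall>y\<in>B. infdist y A \<le> r)"
  using assms bdd_above_infdist[OF assms(1), of B] bdd_above_infdist[OF assms(2), of A]
  by (auto simp: hausdorff_dist_def cSUP_le_iff nonempty_compacts_def)

lemma hausdorff_dist_nonneg: "0 \<le> hausdorff_dist A B"
proof (cases "A \<in> nonempty_compacts \<and> B \<in> nonempty_compacts")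
  case True
  then obtain x where "x \<in> A" by (auto simp: nonempty_compacts_def)
  then have "infdist x B \<le> hausdorff_dist A B"
    using True hausdorff_dist_le_iff[of A B "hausdorff_dist A B"] by auto
  then show ?thesis using infdist_nonneg[of x B] by linarith
qed (auto simp: hausdorff_dist_def)

lemma infdist_le_hausdorff_dist:
  assumes "A \<in> nonempty_compacts" "B \<in> nonempty_compacts" "C \<in> nonempty_compacts" "x \<in> A"
  shows "infdist x C \<le> hausdorff_dist A B + hausdorff_dist B C"
proof -
  obtain y where y: "y \<in> B" "infdist x B = dist x y"
    using infdist_attains_inf[of B x] assms by (auto simp: nonempty_compacts_def compact_imp_closed)
  have "infdist x B \<le> hausdorff_dist A B"
    using hausdorff_dist_le_iff[of A B "hausdorff_dist A B"] assms by auto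
  moreover have "infdist y C \<le> hausdorff_dist B C"
    using hausdorff_dist_le_iff[of B C "hausdorff_dist B C"] assms y by auto
  ultimately show ?thesis
    using infdist_triangle[of x C y] y by linarith
qed

lemma hausdorff_dist_commute: "hausdorff_dist A B = hausdorff_dist B A"
  by (auto simp: hausdorff_dist_def)

lemma Metric_space_hausdorff_dist:
  "Metric_space (nonempty_compacts :: 'a::euclidean_space set set) hausdorff_dist"
proof
  fix A B C :: "'a set"
  show "0 \<le> hausdorff_dist A B" by (rule hausdorff_dist_nonneg)
  show "hausdorff_dist A B = hausdorff_dist B A" by (rule hausdorff_dist_commute)
  assume AB: "A \<in> nonempty_compacts" "B \<in> nonempty_compacts"
  show "hausdorff_dist A B = 0 \<longleftrightarrow> A = B"
  proof
    assume "hausdorff_dist A B = 0"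
    then have *: "\<forall>x\<in>A. infdist x B \<le> 0" "\<forall>y\<in>B. infdist y A \<le> 0"
      using hausdorff_dist_le_iff[OF AB, of 0] by auto
    have cl: "closed A" "closed B" "A \<noteq> {}" "B \<noteq> {}"
      using AB by (auto simp: nonempty_compacts_def compact_imp_closed)
    show "A = B"
    proof (intro subset_antisym subsetI)
      show "x \<in> B" if "x \<in> A" for x
        using * cl that in_closed_iff_infdist_zero[of B x] infdist_nonneg[of x B] by force
      show "x \<in> A" if "x \<in> B" for x
        using * cl that in_closed_iff_infdist_zero[of A x] infdist_nonneg[of x A] by force
    qed
  next
    assume "A = B"
    then have "hausdorff_dist A B \<le> 0"
      using hausdorff_dist_le_iff[OF AB, of 0] by auto
    then show "hausdorff_dist A B = 0" using hausdorff_dist_nonneg[of A B] by linarith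
  qed
  assume C: "C \<in> nonempty_compacts"
  show "hausdorff_dist A C \<le> hausdorff_dist A B + hausdorff_dist B C"
    using infdist_le_hausdorff_dist[OF AB C] infdist_le_hausdorff_dist[OF C AB(2,1)]
    by (auto simp: hausdorff_dist_le_iff AB C hausdorff_dist_commute add.commute)
qed

definition compacts_borel :: "'a::euclidean_space set measure" where
  "compacts_borel = sigma nonempty_compacts
     {U. openin (Metric_space.mtopology nonempty_compacts hausdorff_dist) U}"

text \<open>The points are \<open>X 1, X 2, \<dots>\<close>; the value of \<open>X 0\<close> is irrelevant throughout.\<close>

definition point_count :: "(nat \<Rightarrow> 'w \<Rightarrow> 'a) \<Rightarrow> 'a set \<Rightarrow> 'w \<Rightarrow> enat" where
  "point_count X B \<omega> =
    (if finite {i. 1 \<le> i \<and> X i \<omega> \<in> B} then enat (card {i. 1 \<le> i \<and> X i \<omega> \<in> B}) else \<infinity>)"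

definition (in prob_space) poisson_process ::
    "real \<Rightarrow> (nat \<Rightarrow> 'a \<Rightarrow> 'b::euclidean_space) \<Rightarrow> bool" where
  "poisson_process lam X \<longleftrightarrow>
    (\<forall>i\<ge>1. random_variable borel (X i)) \<and>
    (\<forall>B k. bounded B \<longrightarrow> B \<in> sets borel \<longrightarrow>
       prob {\<omega> \<in> space M. point_count X B \<omega> = enat k} =
         (lam * vol B) ^ k / fact k * exp (- (lam * vol B))) \<and>
    (\<forall>(B :: nat \<Rightarrow> 'b set) J. finite J \<longrightarrow> (\<forall>j\<in>J. bounded (B j) \<and> B j \<in> sets borel) \<longrightarrow>
       disjoint_family_on B J \<longrightarrow>
       indep_vars (\<lambda>_. count_space UNIV) (\<lambda>j. point_count X (B j)) J)"

definition grain_union ::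
    "(nat \<Rightarrow> 'w \<Rightarrow> 'a::euclidean_space) \<Rightarrow> (nat \<Rightarrow> 'w \<Rightarrow> 'a set) \<Rightarrow> 'w \<Rightarrow> 'a set" where
  "grain_union X G \<omega> = (\<Union>i\<in>{1..}. (\<lambda>x. x + X i \<omega>) ` G i \<omega>)"

text \<open>\<open>G 0\<close> is the typical grain and \<open>G 1, G 2, \<dots>\<close> are its independent copies.  The grain
  sequence is independent of the point sequence, i.e. of the enumerated process; independence of
  the unordered point process alone would allow an enumeration that depends on the grains.\<close>

locale poisson_grain_model = prob_space M for M :: "'w measure" +
  fixes lam :: real
    and X :: "nat \<Rightarrow> 'w \<Rightarrow> 'a::euclidean_space"
    and G :: "nat \<Rightarrow> 'w \<Rightarrow> 'a set"
  assumes intensity_pos: "0 < lam"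
    and points_poisson: "poisson_process lam X"
    and grain_measurable: "\<And>i. G i \<in> M \<rightarrow>\<^sub>M compacts_borel"
    and grains_distr: "\<And>i. distr M compacts_borel (G i) = distr M compacts_borel (G 0)"
    and grains_indep: "indep_vars (\<lambda>_. compacts_borel) G {1..}"
    and grains_points_indep:
      "indep_set
         (sets (vimage_algebra (space M) (\<lambda>\<omega>. \<lambda>i\<in>{1..}. G i \<omega>) (\<Pi>\<^sub>M i\<in>{1..}. compacts_borel)))
         (sets (vimage_algebra (space M) (\<lambda>\<omega>. \<lambda>i\<in>{1..}. X i \<omega>) (\<Pi>\<^sub>M i\<in>{1..}. borel)))"
    and jointly_measurable:
      "(\<lambda>(x, \<omega>). indicator (grain_union X G \<omega>) x :: real) \<in> borel_measurable (borel \<Otimes>\<^sub>M M)"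

definition convex_averaging_sequence :: "(nat \<Rightarrow> 'a::euclidean_space set) \<Rightarrow> bool" where
  "convex_averaging_sequence W \<longleftrightarrow>
    incseq W \<and> (\<forall>n. compact (W n) \<and> convex (W n) \<and> 0 < vol (W n)) \<and> (\<Union>n. W n) = UNIV"

definition log_mgf_rate ::
    "'w measure \<Rightarrow> ('w \<Rightarrow> 'a::euclidean_space set) \<Rightarrow> (nat \<Rightarrow> 'a set) \<Rightarrow> real \<Rightarrow> nat \<Rightarrow> real" where
  "log_mgf_rate M Xi W h n = ln (LINT \<omega>|M. exp (h * vol (Xi \<omega> \<inter> W n))) / vol (W n)"

definition Delta :: "'w measure \<Rightarrow> real \<Rightarrow> ('w \<Rightarrow> 'a::euclidean_space set) \<Rightarrow> real \<Rightarrow> real" where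
  "Delta M lam grain a =
     8 * (a + lam * (LINT \<omega>|M. exp (a * vol (grain \<omega>))))
       * (1 + exp (lam * (LINT \<omega>|M. vol (grain \<omega>)))) / a\<^sup>2"

end

theory Submission
  imports Defs
begin

text \<open>The moment generating function of the covered volume at \<open>h\<close> is, up to the factor \<open>exp (h |W|)\<close>,
  that of the vacant volume at \<open>- h\<close>.  More generally, for a function \<open>\<zeta>\<close> bounded by \<open>\<theta> = 1 / \<Delta>(a)\<close>
  let \<open>Z \<zeta> A\<close> be the expectation of the exponential of the integral of \<open>\<zeta>\<close> over the vacant points,
  restricted to the event that \<open>A\<close> is vacant, and let \<open>rho \<zeta> A y = Z \<zeta> (A \<union> {y}) / Z \<zeta> A\<close>.  By the
  independence properties of Poisson processes, restoring the grains through a vacant point \<open>x\<close> means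
  adding an independent Poisson cluster.  Hence the influence of the vacancy of \<open>x\<close> on \<open>rho \<zeta> A y\<close>
  is at most a kernel \<open>k(x, y)\<close>, coming from the grains that contain both points, plus \<open>\<theta>\<close> times the
  convolution of \<open>k\<close> with the influence itself.  Since \<open>\<theta> \<integral> k < 1\<close>, the influence is integrable, so
  \<open>rho\<close> at a point deep inside a window is nearly independent of the window.  This gives the
  convergence of the derivatives of the cumulant generating functions, uniformly in \<open>|h| \<le> \<theta>\<close>.  The
  same recursion bounds their second derivatives from below by a positive multiple of \<open>|W|\<close>, because
  two points covered by the same grain are positively correlated.  So \<open>L\<close> is differentiable with a
  continuous, strictly increasing derivative, and exponential tilting (the Gaertner-Ellis argument)
  yields both tails.\<close>

section \<open>Vacancies of random sets\<close>

text \<open>The recursion forces generality. Restoring a cluster adds a point to the conditioning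
  set and cuts a random hole into the field, so even for a constant field on a window an estimate
  closes only if it is uniform over all fields bounded by \<theta> and all finite sets. A second
  obstacle is that \<Xi> is given by an enumerated family of grains and need not be closed. Hence no
  process is conditioned or thinned explicitly: laws are compared only through the probabilities
  that finite sets are vacant, which equal \<open>exp (- hit_measure A)\<close> and determine all
  exponential functionals of the vacant volume by moment expansion. Contraction yields existence and
  differentiability of L, but uniqueness of the minimiser needs strict monotonicity of L', that is,
  a direct effect of common grains that outweighs the effect propagated by the recursion for every
  |h| < 1/\<Delta>(a). The two involve moments of the grain volume tilted by -\<theta> and by
  \<theta>; Cauchy-Schwarz bounds their discrepancy by a moment tilted by 3\<theta>, which is finite
  because 3\<theta> < a.\<close>

definition random_set :: "'w measure \<Rightarrow> ('w \<Rightarrow> 'a::euclidean_space set) \<Rightarrow> bool" where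
  "random_set M Xi \<longleftrightarrow> Measurable.pred (lborel \<Otimes>\<^sub>M M) (\<lambda>p. fst p \<in> Xi (snd p))"

definition clear :: "('w \<Rightarrow> 'a set) \<Rightarrow> 'a set \<Rightarrow> 'w \<Rightarrow> real" where
  "clear Xi A \<omega> = (if Xi \<omega> \<inter> A = {} then 1 else 0)"

text \<open>For the indicator of a window W this is the vacant volume in W. General weights \<zeta>
  are kept because the fields met in the recursion are multiples of indicators with random
  holes.\<close>

definition vacant_int :: "('w \<Rightarrow> 'a::euclidean_space set) \<Rightarrow> ('a \<Rightarrow> real) \<Rightarrow> 'w \<Rightarrow> real" where
  "vacant_int Xi \<zeta> \<omega> = (LINT x|lborel. \<zeta> x * clear Xi {x} \<omega>)"

lemma clear_Un: "clear Xi (A \<union> B) \<omega> = clear Xi A \<omega> * clear Xi B \<omega>"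
  by (auto simp: clear_def)

lemma clear_insert: "clear Xi (insert x A) \<omega> = clear Xi {x} \<omega> * clear Xi A \<omega>"
  by (auto simp: clear_def)

lemma clear_empty [simp]: "clear Xi {} \<omega> = 1"
  by (simp add: clear_def)

lemma clear_nonneg [simp]: "0 \<le> clear Xi A \<omega>" and clear_le_1 [simp]: "clear Xi A \<omega> \<le> 1"
  and abs_clear [simp]: "\<bar>clear Xi A \<omega>\<bar> = clear Xi A \<omega>"
  by (auto simp: clear_def)

lemma measurable_clear_pair:
  assumes "random_set M Xi"
  shows "(\<lambda>p. clear Xi {fst p} (snd p)) \<in> borel_measurable (lborel \<Otimes>\<^sub>M M)"
proof -
  have [measurable]: "Measurable.pred (lborel \<Otimes>\<^sub>M M) (\<lambda>p. fst p \<in> Xi (snd p))"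
    using assms by (simp add: random_set_def)
  have "(\<lambda>p. clear Xi {fst p} (snd p)) = (\<lambda>p. if fst p \<in> Xi (snd p) then 0 else 1)"
    by (auto simp: clear_def)
  then show ?thesis by simp
qed

lemma measurable_clear_point:
  assumes "random_set M Xi"
  shows "clear Xi {x} \<in> borel_measurable M"
proof -
  have "(\<lambda>\<omega>. (\<lambda>p. clear Xi {fst p} (snd p)) (x, \<omega>)) \<in> borel_measurable M"
    by (rule measurable_compose[OF _ measurable_clear_pair[OF assms]]) simp
  then show ?thesis by simp
qed

lemma measurable_clear_section:
  assumes "random_set M Xi" "\<omega> \<in> space M"
  shows "(\<lambda>x. clear Xi {x} \<omega>) \<in> borel_measurable lborel"
proof -
  have "(\<lambda>x. (\<lambda>p. clear Xi {fst p} (snd p)) (x, \<omega>)) \<in> borel_measurable lborel"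
    by (rule measurable_compose[OF _ measurable_clear_pair[OF assms(1)]]) (use assms(2) in simp)
  then show ?thesis by simp
qed

lemma measurable_clear:
  assumes "random_set M Xi" "finite A"
  shows "clear Xi A \<in> borel_measurable M"
  using assms(2)
proof induction
  case empty
  have "clear Xi {} = (\<lambda>\<omega>. 1)" by (auto simp: clear_def)
  then show ?case by simp
next
  case (insert x A)
  have "clear Xi (insert x A) = (\<lambda>\<omega>. clear Xi {x} \<omega> * clear Xi A \<omega>)"
    by (rule ext) (rule clear_insert)
  then show ?case using insert.IH measurable_clear_point[OF assms(1)] by simp
qed

lemma measurable_vacant_int:
  assumes "random_set M Xi" "\<zeta> \<in> borel_measurable lborel"
  shows "vacant_int Xi \<zeta> \<in> borel_measurable M"
proof -
  have [measurable]: "(\<lambda>p. clear Xi {fst p} (snd p)) \<in> borel_measurable (lborel \<Otimes>\<^sub>M M)"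
    by (rule measurable_clear_pair) fact
  have [measurable]: "\<zeta> \<in> borel_measurable borel" using assms by simp
  have "(\<lambda>\<omega>. \<lambda>x. (\<lambda>p. \<zeta> (fst p) * clear Xi {fst p} (snd p)) (x, \<omega>)) = (\<lambda>\<omega> x. \<zeta> x * clear Xi {x} \<omega>)"
    by simp
  have *: "(\<lambda>p. \<zeta> (fst p) * clear Xi {fst p} (snd p)) \<in> borel_measurable (lborel \<Otimes>\<^sub>M M)" by measurable
  have "(\<lambda>q. (\<lambda>p. \<zeta> (fst p) * clear Xi {fst p} (snd p)) (snd q, fst q)) \<in> borel_measurable (M \<Otimes>\<^sub>M lborel)"
    by (rule measurable_compose[OF _ *]) simp
  then have "(\<lambda>(\<omega>, x). \<zeta> x * clear Xi {x} \<omega>) \<in> borel_measurable (M \<Otimes>\<^sub>M lborel)"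
    by (simp add: case_prod_beta)
  then show ?thesis unfolding vacant_int_def
    by (rule lborel.borel_measurable_lebesgue_integral)
qed

lemma integrable_vacant:
  assumes "random_set M Xi" "integrable lborel \<zeta>" "\<omega> \<in> space M"
  shows "integrable lborel (\<lambda>x. \<zeta> x * clear Xi {x} \<omega>)"
  by (rule Bochner_Integration.integrable_bound[OF assms(2)])
     (use assms measurable_clear_section[OF assms(1,3)] in
       \<open>auto simp: abs_mult intro!: mult_left_le\<close>)

lemma vacant_int_le:
  assumes "random_set M Xi" "integrable lborel \<zeta>" "\<omega> \<in> space M"
  shows "\<bar>vacant_int Xi \<zeta> \<omega>\<bar> \<le> (LINT x|lborel. \<bar>\<zeta> x\<bar>)"
proof -
  have "\<bar>vacant_int Xi \<zeta> \<omega>\<bar> \<le> (LINT x|lborel. \<bar>\<zeta> x * clear Xi {x} \<omega>\<bar>)"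
    unfolding vacant_int_def using integral_abs_bound by blast
  also have "\<dots> \<le> (LINT x|lborel. \<bar>\<zeta> x\<bar>)"
    by (intro integral_mono integrable_abs integrable_vacant[OF assms] assms(2))
       (auto simp: abs_mult intro!: mult_left_le)
  finally show ?thesis .
qed

section \<open>Campbell's formula and moment expansions for bounded functionals\<close>

lemma (in finite_measure) integrable_bounded:
  fixes f :: "'a \<Rightarrow> real"
  assumes "f \<in> borel_measurable M" "\<And>\<omega>. \<omega> \<in> space M \<Longrightarrow> \<bar>f \<omega>\<bar> \<le> B"
  shows "integrable M f"
  by (rule integrable_const_bound[of _ B]) (use assms in auto)

text \<open>Fubini turns a factor \<open>vacant_int\<close> under the expectation into an integral
  over one additional point that has to be vacant. All moments and derivatives of the vacant volume
  are computed in this way.\<close>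

lemma (in finite_measure) campbell_vacant:
  assumes Xi: "random_set M Xi" and \<zeta>: "integrable lborel \<zeta>"
    and F: "F \<in> borel_measurable M" "\<And>\<omega>. \<omega> \<in> space M \<Longrightarrow> \<bar>F \<omega>\<bar> \<le> B"
  shows "(LINT \<omega>|M. F \<omega> * vacant_int Xi \<zeta> \<omega>) =
         (LINT x|lborel. \<zeta> x * (LINT \<omega>|M. F \<omega> * clear Xi {x} \<omega>))"
proof -
  interpret P: pair_sigma_finite lborel M ..
  have [measurable]: "(\<lambda>p. clear Xi {fst p} (snd p)) \<in> borel_measurable (lborel \<Otimes>\<^sub>M M)"
    by (rule measurable_clear_pair) fact
  have [measurable]: "\<zeta> \<in> borel_measurable borel" "F \<in> borel_measurable M" using \<zeta> F by auto
  have B: "integrable M (\<lambda>\<omega>. F \<omega> * clear Xi {x} \<omega>)" for x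
    by (rule integrable_bounded[of _ B])
       (use F measurable_clear_point[OF Xi] in \<open>auto simp: abs_mult intro!: order_trans[OF mult_left_le]\<close>)
  let ?f = "\<lambda>x \<omega>. \<zeta> x * (F \<omega> * clear Xi {x} \<omega>)"
  have meas: "case_prod ?f \<in> borel_measurable (lborel \<Otimes>\<^sub>M M)"
  proof -
    have "case_prod ?f = (\<lambda>p. \<zeta> (fst p) * (F (snd p) * clear Xi {fst p} (snd p)))" by auto
    then show ?thesis by (simp only:) measurable
  qed
  have le: "(LINT \<omega>|M. norm (?f x \<omega>)) \<le> \<bar>\<zeta> x\<bar> * (B * measure M (space M))" for x
  proof -
    have "(LINT \<omega>|M. norm (?f x \<omega>)) \<le> (LINT \<omega>|M. \<bar>\<zeta> x\<bar> * B)"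
      by (intro integral_mono Bochner_Integration.integrable_norm integrable_mult_right B)
         (auto simp: abs_mult intro!: mult_left_mono order_trans[OF mult_left_le] F(2))
    then show ?thesis by (simp add: mult_ac)
  qed
  have int: "integrable (lborel \<Otimes>\<^sub>M M) (case_prod ?f)"
  proof (rule P.Fubini_integrable[OF meas])
    have m: "(\<lambda>x. LINT \<omega>|M. norm (case_prod ?f (x, \<omega>))) \<in> borel_measurable lborel"
      using meas by measurable
    show "integrable lborel (\<lambda>x. LINT \<omega>|M. norm (case_prod ?f (x, \<omega>)))"
      by (rule Bochner_Integration.integrable_bound[OF _ m, of "\<lambda>x. \<bar>\<zeta> x\<bar> * (B * measure M (space M))"])
         (use \<zeta> le in \<open>auto intro!: AE_I2 order_trans[OF _ abs_ge_self] \<close>)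
    show "AE x in lborel. integrable M (\<lambda>\<omega>. case_prod ?f (x, \<omega>))"
      using B by simp
  qed
  have "(LINT \<omega>|M. F \<omega> * vacant_int Xi \<zeta> \<omega>) = (LINT \<omega>|M. LINT x|lborel. ?f x \<omega>)"
    unfolding vacant_int_def by (simp flip: integral_mult_right_zero add: mult_ac)
  also have "\<dots> = (LINT x|lborel. LINT \<omega>|M. ?f x \<omega>)"
    by (rule P.Fubini_integral[OF int])
  finally show ?thesis by simp
qed

lemma (in finite_measure) measurable_clear_integral:
  assumes Xi: "random_set M Xi" and F: "F \<in> borel_measurable M"
  shows "(\<lambda>x. LINT \<omega>|M. F \<omega> * clear Xi {x} \<omega>) \<in> borel_measurable lborel"
proof -
  have [measurable]: "(\<lambda>p. clear Xi {fst p} (snd p)) \<in> borel_measurable (lborel \<Otimes>\<^sub>M M)" "F \<in> borel_measurable M"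
    by (rule measurable_clear_pair) fact+
  have "(\<lambda>(x, \<omega>). F \<omega> * clear Xi {x} \<omega>) = (\<lambda>p. F (snd p) * clear Xi {fst p} (snd p))" by auto
  then have "(\<lambda>(x, \<omega>). F \<omega> * clear Xi {x} \<omega>) \<in> borel_measurable (lborel \<Otimes>\<^sub>M M)"
    by (simp only:) measurable
  then show ?thesis by (rule borel_measurable_lebesgue_integral)
qed

text \<open>Boundedness of w and U provides the constant majorant B exp C for all partial sums of
  the exponential series, which may therefore be integrated term by term.\<close>

lemma (in finite_measure) exp_moment_sums:
  fixes w U :: "'a \<Rightarrow> real"
  assumes w: "w \<in> borel_measurable M" "\<And>\<omega>. \<omega> \<in> space M \<Longrightarrow> \<bar>w \<omega>\<bar> \<le> B"
    and U: "U \<in> borel_measurable M" "\<And>\<omega>. \<omega> \<in> space M \<Longrightarrow> \<bar>U \<omega>\<bar> \<le> C"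
  shows "(\<lambda>k. (LINT \<omega>|M. w \<omega> * U \<omega> ^ k) / fact k) sums (LINT \<omega>|M. w \<omega> * exp (U \<omega>))"
proof -
  have "(\<lambda>n. LINT \<omega>|M. w \<omega> * (\<Sum>k<n. U \<omega> ^ k / fact k)) \<longlonglongrightarrow> (LINT \<omega>|M. w \<omega> * exp (U \<omega>))"
  proof (rule integral_dominated_convergence[where w="\<lambda>_. B * exp C"])
    show "AE \<omega> in M. (\<lambda>n. w \<omega> * (\<Sum>k<n. U \<omega> ^ k / fact k)) \<longlonglongrightarrow> w \<omega> * exp (U \<omega>)"
    proof (rule AE_I2, rule tendsto_mult_left)
      fix \<omega>
      show "(\<lambda>n. \<Sum>k<n. U \<omega> ^ k / fact k) \<longlonglongrightarrow> exp (U \<omega>)"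
        using exp_converges[of "U \<omega>"] by (simp add: sums_def divide_inverse mult.commute)
    qed
    show "AE \<omega> in M. norm (w \<omega> * (\<Sum>k<n. U \<omega> ^ k / fact k)) \<le> B * exp C" for n
    proof (rule AE_I2)
      fix \<omega> assume \<omega>: "\<omega> \<in> space M"
      have "\<bar>\<Sum>k<n. U \<omega> ^ k / fact k\<bar> \<le> (\<Sum>k<n. \<bar>U \<omega> ^ k / fact k\<bar>)" by (rule sum_abs)
      also have "\<dots> = (\<Sum>k<n. \<bar>U \<omega>\<bar> ^ k / fact k)" by (simp add: power_abs)
      also have "\<dots> \<le> (\<Sum>k. \<bar>U \<omega>\<bar> ^ k / fact k)"
        by (rule sum_le_suminf) (auto intro: summable_exp simp: divide_inverse mult.commute summable_exp)
      also have "\<dots> = exp \<bar>U \<omega>\<bar>" by (simp add: exp_def divide_inverse mult.commute)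
      also have "\<dots> \<le> exp C" using U(2)[OF \<omega>] by simp
      finally have "\<bar>\<Sum>k<n. U \<omega> ^ k / fact k\<bar> \<le> exp C" .
      then show "norm (w \<omega> * (\<Sum>k<n. U \<omega> ^ k / fact k)) \<le> B * exp C"
        unfolding real_norm_def abs_mult
        by (intro mult_mono w(2)[OF \<omega>]) (use w(2)[OF \<omega>] in auto)
    qed
  qed (use w U in measurable)
  moreover have "(LINT \<omega>|M. w \<omega> * (\<Sum>k<n. U \<omega> ^ k / fact k)) = (\<Sum>k<n. (LINT \<omega>|M. w \<omega> * U \<omega> ^ k) / fact k)" for n
  proof -
    have i: "integrable M (\<lambda>\<omega>. w \<omega> * U \<omega> ^ k)" for k
    proof (rule integrable_bounded[of _ "B * C ^ k"])
      fix \<omega> assume \<omega>: "\<omega> \<in> space M"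
      have "\<bar>U \<omega>\<bar> ^ k \<le> C ^ k" by (rule power_mono) (use U(2)[OF \<omega>] in auto)
      then show "\<bar>w \<omega> * U \<omega> ^ k\<bar> \<le> B * C ^ k"
        unfolding abs_mult power_abs using w(2)[OF \<omega>] by (intro mult_mono) auto
    qed (use w U in measurable)
    have "(LINT \<omega>|M. w \<omega> * (\<Sum>k<n. U \<omega> ^ k / fact k)) = (LINT \<omega>|M. (\<Sum>k<n. w \<omega> * U \<omega> ^ k / fact k))"
      by (simp add: sum_distrib_left)
    also have "\<dots> = (\<Sum>k<n. (LINT \<omega>|M. w \<omega> * U \<omega> ^ k / fact k))"
      by (rule Bochner_Integration.integral_sum) (use i in auto)
    finally show ?thesis by simp
  qed
  ultimately show ?thesis by (simp add: sums_def)
qed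

text \<open>A random set enters its vacant-volume functionals only through its vacancy probabilities;
  the weights allow conditioning and changes of measure.\<close>

lemma exp_vacant_int_cong:
  fixes M1 :: "'v measure" and M2 :: "'w measure" and Xi1 :: "'v \<Rightarrow> 'a::euclidean_space set"
  assumes fin: "finite_measure M1" "finite_measure M2"
    and Xi: "random_set M1 Xi1" "random_set M2 Xi2"
    and w1: "w1 \<in> borel_measurable M1" "\<And>\<omega>. \<omega> \<in> space M1 \<Longrightarrow> \<bar>w1 \<omega>\<bar> \<le> B"
    and w2: "w2 \<in> borel_measurable M2" "\<And>\<omega>. \<omega> \<in> space M2 \<Longrightarrow> \<bar>w2 \<omega>\<bar> \<le> B"
    and eq: "\<And>C. finite C \<Longrightarrow> (LINT \<omega>|M1. w1 \<omega> * clear Xi1 C \<omega>) = (LINT \<omega>|M2. w2 \<omega> * clear Xi2 C \<omega>)"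
    and \<zeta>: "integrable lborel \<zeta>"
  shows "(LINT \<omega>|M1. w1 \<omega> * exp (vacant_int Xi1 \<zeta> \<omega>)) = (LINT \<omega>|M2. w2 \<omega> * exp (vacant_int Xi2 \<zeta> \<omega>))"
proof -
  interpret M1: finite_measure M1 by fact
  interpret M2: finite_measure M2 by fact
  define b where "b = (LINT x|lborel. \<bar>\<zeta> x\<bar>)"
  have \<zeta>m: "\<zeta> \<in> borel_measurable lborel" using \<zeta> by auto
  note U1 = measurable_vacant_int[OF Xi(1) \<zeta>m] vacant_int_le[OF Xi(1) \<zeta>, folded b_def]
  note U2 = measurable_vacant_int[OF Xi(2) \<zeta>m] vacant_int_le[OF Xi(2) \<zeta>, folded b_def]
  \<comment> \<open>Induction on the power, with C arbitrary: Campbell's formula replaces one factor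
    of the vacant integral by a new point x, and the weighted vacancies of \<open>insert x C\<close>
    are covered by the induction hypothesis.\<close>
  have mom: "(LINT \<omega>|M1. w1 \<omega> * clear Xi1 C \<omega> * vacant_int Xi1 \<zeta> \<omega> ^ k) =
             (LINT \<omega>|M2. w2 \<omega> * clear Xi2 C \<omega> * vacant_int Xi2 \<zeta> \<omega> ^ k)" if "finite C" for k C
    using that
  proof (induction k arbitrary: C)
    case 0
    then show ?case using eq by simp
  next
    case (Suc k)
    have bd: "\<bar>w * c * u ^ k\<bar> \<le> B * b ^ k" if "\<bar>w\<bar> \<le> B" "\<bar>u\<bar> \<le> b" "0 \<le> c" "c \<le> 1" for w c u :: real
    proof -
      have "\<bar>w * c\<bar> \<le> B * 1" unfolding abs_mult using that by (intro mult_mono) auto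
      moreover have "\<bar>u ^ k\<bar> \<le> b ^ k" using that by (auto simp: power_abs intro!: power_mono)
      ultimately have "\<bar>w * c\<bar> * \<bar>u ^ k\<bar> \<le> B * 1 * b ^ k" by (intro mult_mono) auto
      then show ?thesis by (simp add: abs_mult)
    qed
    have 1: "(LINT \<omega>|M1. (w1 \<omega> * clear Xi1 C \<omega> * vacant_int Xi1 \<zeta> \<omega> ^ k) * vacant_int Xi1 \<zeta> \<omega>) =
       (LINT x|lborel. \<zeta> x * (LINT \<omega>|M1. (w1 \<omega> * clear Xi1 C \<omega> * vacant_int Xi1 \<zeta> \<omega> ^ k) * clear Xi1 {x} \<omega>))"
      by (rule M1.campbell_vacant[OF Xi(1) \<zeta>, where B = "B * b ^ k"])
         (use w1(1) U1(1) measurable_clear[OF Xi(1) Suc.prems] in measurable,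
          rule bd, use w1(2) U1(2) in auto)
    have 2: "(LINT \<omega>|M2. (w2 \<omega> * clear Xi2 C \<omega> * vacant_int Xi2 \<zeta> \<omega> ^ k) * vacant_int Xi2 \<zeta> \<omega>) =
       (LINT x|lborel. \<zeta> x * (LINT \<omega>|M2. (w2 \<omega> * clear Xi2 C \<omega> * vacant_int Xi2 \<zeta> \<omega> ^ k) * clear Xi2 {x} \<omega>))"
      by (rule M2.campbell_vacant[OF Xi(2) \<zeta>, where B = "B * b ^ k"])
         (use w2(1) U2(1) measurable_clear[OF Xi(2) Suc.prems] in measurable,
          rule bd, use w2(2) U2(2) in auto)
    have 3: "(LINT \<omega>|M1. (w1 \<omega> * clear Xi1 C \<omega> * vacant_int Xi1 \<zeta> \<omega> ^ k) * clear Xi1 {x} \<omega>) =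
             (LINT \<omega>|M2. (w2 \<omega> * clear Xi2 C \<omega> * vacant_int Xi2 \<zeta> \<omega> ^ k) * clear Xi2 {x} \<omega>)" for x
      using Suc.IH[of "insert x C"] Suc.prems by (simp add: clear_insert[of _ x C] mult_ac)
    show ?case using 1 2 unfolding 3 by (simp add: mult_ac)
  qed
  have "(\<lambda>k. (LINT \<omega>|M1. w1 \<omega> * vacant_int Xi1 \<zeta> \<omega> ^ k) / fact k) sums (LINT \<omega>|M1. w1 \<omega> * exp (vacant_int Xi1 \<zeta> \<omega>))"
    by (rule M1.exp_moment_sums[OF w1 U1])
  moreover have "(\<lambda>k. (LINT \<omega>|M2. w2 \<omega> * vacant_int Xi2 \<zeta> \<omega> ^ k) / fact k) sums (LINT \<omega>|M2. w2 \<omega> * exp (vacant_int Xi2 \<zeta> \<omega>))"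
    by (rule M2.exp_moment_sums[OF w2 U2])
  moreover have "(LINT \<omega>|M1. w1 \<omega> * vacant_int Xi1 \<zeta> \<omega> ^ k) = (LINT \<omega>|M2. w2 \<omega> * vacant_int Xi2 \<zeta> \<omega> ^ k)" for k
    using mom[of "{}" k] by simp
  ultimately show ?thesis by (simp add: sums_iff)
qed

section \<open>Poisson clusters of grains\<close>

lemma random_set_measurable_vol:
  assumes "random_set M Xi"
  shows "(\<lambda>\<omega>. vol (Xi \<omega>)) \<in> borel_measurable M"
proof -
  have [measurable]: "Measurable.pred (lborel \<Otimes>\<^sub>M M) (\<lambda>p. fst p \<in> Xi (snd p))"
    using assms by (simp add: random_set_def)
  have "Measurable.pred (M \<Otimes>\<^sub>M lborel) (\<lambda>q. (\<lambda>p. fst p \<in> Xi (snd p)) (snd q, fst q))"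
    by (rule measurable_compose[of _ _ "lborel \<Otimes>\<^sub>M M"]) measurable
  then have "{q \<in> space (M \<Otimes>\<^sub>M lborel). snd q \<in> Xi (fst q)} \<in> sets (M \<Otimes>\<^sub>M lborel)"
    by (simp add: pred_def)
  from lborel.measurable_emeasure_Pair[OF this]
  have "(\<lambda>\<omega>. emeasure lborel (Pair \<omega> -` {q \<in> space (M \<Otimes>\<^sub>M lborel). snd q \<in> Xi (fst q)})) \<in> borel_measurable M" .
  then have "(\<lambda>\<omega>. enn2real (emeasure lborel (Pair \<omega> -` {q \<in> space (M \<Otimes>\<^sub>M lborel). snd q \<in> Xi (fst q)}))) \<in> borel_measurable M"
    by measurable
  also have "?this \<longleftrightarrow> ?thesis"
    by (intro measurable_cong) (auto simp: measure_def space_pair_measure vimage_def)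
  finally show ?thesis .
qed

lemma random_set_section:
  assumes "random_set M Xi" "\<omega> \<in> space M"
  shows "Xi \<omega> \<in> sets lborel"
proof -
  have "Measurable.pred lborel (\<lambda>x. (\<lambda>p. fst p \<in> Xi (snd p)) (x, \<omega>))"
    by (rule measurable_compose[of _ _ "lborel \<Otimes>\<^sub>M M"]) (use assms in \<open>auto simp: random_set_def\<close>)
  then show ?thesis by (simp add: pred_def)
qed

text \<open>A Poisson number of independent marks, encoded as a count together with an infinite
  i.i.d. sequence of which only the entries below the count matter. Functionals of the sample are
  then countable case distinctions on the count over one fixed product space.\<close>

definition poisson_sample :: "real \<Rightarrow> 'e measure \<Rightarrow> (nat \<times> (nat \<Rightarrow> 'e)) measure" where
  "poisson_sample l \<nu> = measure_pmf (poisson_pmf l) \<Otimes>\<^sub>M (\<Pi>\<^sub>M i\<in>UNIV. \<nu>)"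

lemma prob_space_poisson_sample:
  assumes "prob_space \<nu>" shows "prob_space (poisson_sample l \<nu>)"
proof -
  interpret \<nu>: prob_space \<nu> by fact
  interpret P: product_prob_space "\<lambda>_::nat. \<nu>" UNIV ..
  interpret Q: prob_space "measure_pmf (poisson_pmf l)" by (rule measure_pmf.prob_space_axioms)
  interpret PQ: pair_prob_space "measure_pmf (poisson_pmf l)" "\<Pi>\<^sub>M i\<in>(UNIV::nat set). \<nu>" ..
  show ?thesis unfolding poisson_sample_def by (rule PQ.prob_space_axioms)
qed

lemma measurable_poisson_sample [measurable]:
  "fst \<in> poisson_sample l \<nu> \<rightarrow>\<^sub>M count_space UNIV"
  "(\<lambda>s. snd s i) \<in> poisson_sample l \<nu> \<rightarrow>\<^sub>M \<nu>"
  unfolding poisson_sample_def by measurable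

lemma measurable_sample_prod:
  fixes F :: "'e \<Rightarrow> real"
  assumes [measurable]: "F \<in> borel_measurable \<nu>"
  shows "(\<lambda>s. \<Prod>i<fst s. F (snd s i)) \<in> borel_measurable (poisson_sample l \<nu>)"
proof -
  have "(\<lambda>s. (\<lambda>n s. \<Prod>i<n. F (snd s i)) (fst s) s) \<in> borel_measurable (poisson_sample l \<nu>)"
    by (rule measurable_compose_countable) measurable
  then show ?thesis by simp
qed

lemma measurable_sample_sum:
  fixes F :: "'e \<Rightarrow> real"
  assumes [measurable]: "F \<in> borel_measurable \<nu>"
  shows "(\<lambda>s. \<Sum>i<fst s. F (snd s i)) \<in> borel_measurable (poisson_sample l \<nu>)"
proof -
  have "(\<lambda>s. (\<lambda>n s. \<Sum>i<n. F (snd s i)) (fst s) s) \<in> borel_measurable (poisson_sample l \<nu>)"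
    by (rule measurable_compose_countable) measurable
  then show ?thesis by simp
qed

lemma nn_integral_PiM_prod:
  assumes "\<And>i. i \<in> I \<Longrightarrow> prob_space (N i)" "finite J" "J \<subseteq> I"
    and F: "\<And>i. i \<in> J \<Longrightarrow> F i \<in> borel_measurable (N i)"
  shows "(\<integral>\<^sup>+e. (\<Prod>i\<in>J. F i (e i)) \<partial>(\<Pi>\<^sub>M i\<in>I. N i)) = (\<Prod>i\<in>J. \<integral>\<^sup>+x. F i x \<partial>N i)"
proof -
  \<comment> \<open>Coordinates outside I get a point mass: the locale of product probability spaces
    asks for a probability measure at every index.\<close>
  define N' where "N' i = (if i \<in> I then N i else return (count_space UNIV) undefined)" for i
  have N': "prob_space (N' i)" for i using assms(1) by (auto simp: N'_def prob_space_return)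
  interpret N': prob_space "N' i" for i by (rule N')
  interpret P: product_prob_space N' I ..
  have eqI: "PiM I N = PiM I N'" by (rule PiM_cong) (auto simp: N'_def)
  have m: "F i \<in> borel_measurable (N' i)" if "i \<in> J" for i using F[OF that] that assms(3) by (auto simp: N'_def)
  have m1: "(\<lambda>x. restrict x J) \<in> PiM I N' \<rightarrow>\<^sub>M PiM J N'" using assms(3) by (rule measurable_restrict_subset)
  have m2: "(\<lambda>e. \<Prod>i\<in>J. F i (e i)) \<in> borel_measurable (PiM J N')"
    using m by (intro borel_measurable_prod_ennreal) (auto intro!: measurable_compose[OF measurable_component_singleton])
  have "(\<integral>\<^sup>+e. (\<Prod>i\<in>J. F i (e i)) \<partial>PiM I N') = (\<integral>\<^sup>+e. (\<Prod>i\<in>J. F i (restrict e J i)) \<partial>PiM I N')"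
    by (intro nn_integral_cong prod.cong) auto
  also have "\<dots> = (\<integral>\<^sup>+e. (\<Prod>i\<in>J. F i (e i)) \<partial>distr (PiM I N') (PiM J N') (\<lambda>x. restrict x J))"
    by (rule nn_integral_distr[OF m1, symmetric]) (simp add: m2)
  also have "distr (PiM I N') (PiM J N') (\<lambda>x. restrict x J) = PiM J N'"
    using P.distr_PiM_restrict_finite[OF assms(2,3)] .
  also have "(\<integral>\<^sup>+e. (\<Prod>i\<in>J. F i (e i)) \<partial>PiM J N') = (\<Prod>i\<in>J. \<integral>\<^sup>+x. F i x \<partial>N' i)"
    by (rule P.product_nn_integral_prod) (use assms(2) m in auto)
  also have "\<dots> = (\<Prod>i\<in>J. \<integral>\<^sup>+x. F i x \<partial>N i)" by (rule prod.cong) (use assms(3) in \<open>auto simp: N'_def\<close>)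
  finally show ?thesis by (simp add: eqI)
qed

text \<open>Given the count n, independence of the marks gives the mean b^n, and averaging over the
  Poisson law of n sums to an exponential. The function f may exceed 1, as it must for exponential
  weights of volumes.\<close>

lemma poisson_sample_pgfl:
  fixes f :: "'e \<Rightarrow> real"
  assumes l: "0 < l" and \<nu>: "prob_space \<nu>" and f: "\<And>e. 0 \<le> f e" "integrable \<nu> f"
  shows "has_bochner_integral (poisson_sample l \<nu>) (\<lambda>s. \<Prod>i<fst s. f (snd s i))
           (exp (l * ((LINT e|\<nu>. f e) - 1)))"
proof (rule has_bochner_integral_nn_integral)
  interpret \<nu>: prob_space \<nu> by fact
  interpret P: product_prob_space "\<lambda>_::nat. \<nu>" UNIV ..
  define b where "b = (LINT e|\<nu>. f e)"
  have b0: "0 \<le> b" unfolding b_def by (simp add: f(1))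
  have fm [measurable]: "f \<in> borel_measurable \<nu>" using f by auto
  have nnf: "(\<integral>\<^sup>+e. f e \<partial>\<nu>) = ennreal b"
    unfolding b_def by (rule nn_integral_eq_integral) (use f in auto)
  show meas: "(\<lambda>s. \<Prod>i<fst s. f (snd s i)) \<in> borel_measurable (poisson_sample l \<nu>)"
    by (rule measurable_sample_prod) fact
  have fixed: "(\<integral>\<^sup>+e. (\<Prod>i<n. ennreal (f (e i))) \<partial>(\<Pi>\<^sub>M i\<in>UNIV. \<nu>)) = ennreal (b ^ n)" for n :: nat
    using nn_integral_PiM_prod[of UNIV "\<lambda>_. \<nu>" "{..<n}" "\<lambda>_ e. ennreal (f e)"]
    by (simp add: \<nu> nnf ennreal_power b0)
  have "(\<integral>\<^sup>+s. ennreal (\<Prod>i<fst s. f (snd s i)) \<partial>poisson_sample l \<nu>) =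
        (\<integral>\<^sup>+n. \<integral>\<^sup>+e. ennreal (\<Prod>i<n. f (e i)) \<partial>(\<Pi>\<^sub>M i\<in>UNIV. \<nu>) \<partial>measure_pmf (poisson_pmf l))"
    using meas unfolding poisson_sample_def
    by (subst P.nn_integral_fst[symmetric]) auto
  also have "\<dots> = (\<integral>\<^sup>+n. ennreal (b ^ n) \<partial>measure_pmf (poisson_pmf l))"
    by (simp add: fixed[symmetric] prod_ennreal f(1))
  also have "\<dots> = (\<Sum>n. ennreal (pmf (poisson_pmf l) n) * ennreal (b ^ n))"
    by (simp add: nn_integral_measure_pmf nn_integral_count_space_nat)
  also have "\<dots> = (\<Sum>n. ennreal (exp (-l) * ((l * b) ^ n / fact n)))"
    by (intro suminf_cong) (simp add: l b0 less_imp_le ennreal_mult[symmetric] power_mult_distrib mult_ac)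
  also have "\<dots> = ennreal (\<Sum>n. exp (-l) * ((l * b) ^ n / fact n))"
    using b0 l summable_exp[of "l * b"]
    by (intro suminf_ennreal2 summable_mult) (auto simp: divide_inverse mult.commute)
  also have "(\<Sum>n. exp (-l) * ((l * b) ^ n / fact n)) = exp (-l) * exp (l * b)"
    using summable_exp[of "l * b"]
    by (subst suminf_mult) (auto simp: divide_inverse mult.commute exp_def)
  also have "\<dots> = exp (l * (b - 1))" by (simp add: exp_add[symmetric] algebra_simps)
  finally show "(\<integral>\<^sup>+s. ennreal (\<Prod>i<fst s. f (snd s i)) \<partial>poisson_sample l \<nu>) = ennreal (exp (l * ((LINT e|\<nu>. f e) - 1)))"
    by (simp add: b_def)
qed (auto intro!: prod_nonneg f AE_I2)

text \<open>\<open>\<Lambda>\<close> is the intensity of a Poisson process of grains \<open>S e\<close>, and \<open>l\<close> the mean number of grains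
  through a point.\<close>

locale grain_intensity = sigma_finite_measure \<Lambda> for \<Lambda> :: "'e measure" +
  fixes S :: "'e \<Rightarrow> 'a::euclidean_space set" and l :: real
  assumes S_measurable: "random_set \<Lambda> S"
    and hit_point: "\<And>x. emeasure \<Lambda> {e \<in> space \<Lambda>. x \<in> S e} = ennreal l"
    and l_pos: "0 < l"
    and finite_grain: "\<And>e. e \<in> space \<Lambda> \<Longrightarrow> emeasure lborel (S e) < \<infinity>"
begin

section \<open>Grains through a point and through a finite set\<close>

definition hit :: "'a \<Rightarrow> 'e \<Rightarrow> real" where "hit x e = 1 - clear S {x} e"

lemma hit_eq: "hit x e = indicator (S e) x"
  by (auto simp: hit_def clear_def indicator_def)

lemma hit_bounds [simp]: "0 \<le> hit x e" "hit x e \<le> 1" "\<bar>hit x e\<bar> = hit x e"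
  by (auto simp: hit_eq)

lemma measurable_S [measurable]: "clear S {x} \<in> borel_measurable \<Lambda>" "hit x \<in> borel_measurable \<Lambda>"
  and measurable_vol_S [measurable]: "(\<lambda>e. vol (S e)) \<in> borel_measurable \<Lambda>"
  using measurable_clear_point[OF S_measurable, of x] random_set_measurable_vol[OF S_measurable]
  by (auto simp: hit_def[abs_def])

lemma measurable_clear_S [measurable]: "finite A \<Longrightarrow> clear S A \<in> borel_measurable \<Lambda>"
  using measurable_clear[OF S_measurable] .

lemma sets_hit [measurable]: "{e \<in> space \<Lambda>. x \<in> S e} \<in> sets \<Lambda>"
proof -
  have "{e \<in> space \<Lambda>. x \<in> S e} = {e \<in> space \<Lambda>. hit x e = 1}"
    by (auto simp: hit_eq indicator_def split: if_splits)
  then show ?thesis by simp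
qed

lemma hit_integral: "integrable \<Lambda> (hit x)" "(LINT e|\<Lambda>. hit x e) = l"
proof -
  have "has_bochner_integral \<Lambda> (indicator {e \<in> space \<Lambda>. x \<in> S e}) (measure \<Lambda> {e \<in> space \<Lambda>. x \<in> S e})"
    by (rule has_bochner_integral_real_indicator) (auto simp: hit_point)
  also have "measure \<Lambda> {e \<in> space \<Lambda>. x \<in> S e} = l" using l_pos by (simp add: measure_def hit_point)
  also have "has_bochner_integral \<Lambda> (indicator {e \<in> space \<Lambda>. x \<in> S e}) l \<longleftrightarrow> has_bochner_integral \<Lambda> (hit x) l"
    by (intro has_bochner_integral_cong) (auto simp: hit_eq indicator_def)
  finally show "integrable \<Lambda> (hit x)" "(LINT e|\<Lambda>. hit x e) = l"
    by (auto simp: has_bochner_integral_iff)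
qed

lemma integrable_hit_mult:
  assumes "f \<in> borel_measurable \<Lambda>" "\<And>e. \<bar>f e\<bar> \<le> B"
  shows "integrable \<Lambda> (\<lambda>e. hit x e * f e)"
proof (rule Bochner_Integration.integrable_bound[of _ "\<lambda>e. hit x e * B"])
  show "AE e in \<Lambda>. norm (hit x e * f e) \<le> norm (hit x e * B)"
  proof (rule AE_I2)
    fix e
    have "\<bar>f e\<bar> \<le> \<bar>B\<bar>" using assms(2)[of e] by linarith
    then show "norm (hit x e * f e) \<le> norm (hit x e * B)" by (auto simp: abs_mult intro!: mult_left_mono)
  qed
qed (use assms hit_integral in auto)

text \<open>The mass of the grains that meet A, written with vacancy indicators so that it splits
  when a point is added. Its negative is the logarithm of the void probability of A.\<close>

definition hit_measure :: "'a set \<Rightarrow> real" where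
  "hit_measure A = (LINT e|\<Lambda>. 1 - clear S A e)"

text \<open>Union bound: a grain that meets A contains one of its points, and the grains through a
  single point have mass l.\<close>

lemma integrable_hit_set: "finite A \<Longrightarrow> integrable \<Lambda> (\<lambda>e. 1 - clear S A e)"
proof (rule Bochner_Integration.integrable_bound[of _ "\<lambda>e. \<Sum>x\<in>A. hit x e"])
  assume A: "finite A"
  show "AE e in \<Lambda>. norm (1 - clear S A e) \<le> norm (\<Sum>x\<in>A. hit x e)"
  proof (rule AE_I2)
    fix e
    have "1 - clear S A e \<le> (\<Sum>x\<in>A. hit x e)"
    proof (cases "S e \<inter> A = {}")
      case False
      then obtain x where x: "x \<in> A" "x \<in> S e" by auto
      then have "1 = hit x e" by (simp add: hit_eq)
      also have "\<dots> \<le> (\<Sum>x\<in>A. hit x e)" by (rule member_le_sum) (use A x in auto)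
      finally show ?thesis using clear_nonneg[of S A e] by linarith
    qed (simp add: clear_def sum_nonneg)
    then show "norm (1 - clear S A e) \<le> norm (\<Sum>x\<in>A. hit x e)" by (auto simp: sum_nonneg)
  qed
qed (use hit_integral in auto)

lemma hit_measure_insert:
  assumes "finite A"
  shows "hit_measure (insert x A) = hit_measure A + (LINT e|\<Lambda>. hit x e * clear S A e)"
proof -
  have "hit_measure (insert x A) = (LINT e|\<Lambda>. (1 - clear S A e) + hit x e * clear S A e)"
    unfolding hit_measure_def by (intro Bochner_Integration.integral_cong) (auto simp: clear_insert[of S x A] hit_def algebra_simps)
  also have "\<dots> = hit_measure A + (LINT e|\<Lambda>. hit x e * clear S A e)"
    unfolding hit_measure_def
    by (intro Bochner_Integration.integral_add integrable_hit_set assms integrable_hit_mult[where B=1]) (use assms in auto)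
  finally show ?thesis .
qed

text \<open>The Poisson process of the grains through x: their total mass is l, so their number is
  Poisson with mean l and each follows the normalised restriction of \<Lambda>.\<close>

definition cluster :: "'a \<Rightarrow> (nat \<times> (nat \<Rightarrow> 'e)) measure" where
  "cluster x = poisson_sample l (uniform_measure \<Lambda> {e \<in> space \<Lambda>. x \<in> S e})"

text \<open>Grains that meet B are discarded, because the cluster is put back into a configuration
  in which B has to stay vacant.\<close>

definition cluster_set :: "'a set \<Rightarrow> nat \<times> (nat \<Rightarrow> 'e) \<Rightarrow> 'a set" where
  "cluster_set B s = (\<Union>i\<in>{i. i < fst s \<and> S (snd s i) \<inter> B = {}}. S (snd s i))"

text \<open>Overlaps are counted repeatedly, and the discarded grains are counted too. The sum
  bounds the volume of \<open>cluster_set\<close> from above for every B, and its exponential is a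
  product over the grains, accessible to the generating functional.\<close>

definition cluster_vol :: "nat \<times> (nat \<Rightarrow> 'e) \<Rightarrow> real" where
  "cluster_vol s = (\<Sum>i<fst s. vol (S (snd s i)))"

section \<open>Generating functionals of a cluster\<close>

lemma prob_space_mark: "prob_space (uniform_measure \<Lambda> {e \<in> space \<Lambda>. x \<in> S e})"
  by (rule prob_space_uniform_measure) (use l_pos in \<open>auto simp: hit_point\<close>)

lemma prob_space_cluster: "prob_space (cluster x)"
  unfolding cluster_def by (rule prob_space_poisson_sample[OF prob_space_mark])

lemma mark_integral:
  assumes "\<And>e. 0 \<le> f e" "f \<in> borel_measurable \<Lambda>" "integrable \<Lambda> (\<lambda>e. hit x e * f e)"
  shows "has_bochner_integral (uniform_measure \<Lambda> {e \<in> space \<Lambda>. x \<in> S e}) f ((LINT e|\<Lambda>. hit x e * f e) / l)"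
proof (rule has_bochner_integral_nn_integral)
  have "(\<integral>\<^sup>+e. f e \<partial>uniform_measure \<Lambda> {e \<in> space \<Lambda>. x \<in> S e}) =
        (\<integral>\<^sup>+e. ennreal (f e) * indicator {e \<in> space \<Lambda>. x \<in> S e} e \<partial>\<Lambda>) / ennreal l"
    using assms by (subst nn_integral_uniform_measure) (auto simp: hit_point)
  also have "(\<integral>\<^sup>+e. ennreal (f e) * indicator {e \<in> space \<Lambda>. x \<in> S e} e \<partial>\<Lambda>) = (\<integral>\<^sup>+e. ennreal (hit x e * f e) \<partial>\<Lambda>)"
    by (intro nn_integral_cong) (auto simp: hit_eq indicator_def)
  also have "\<dots> = ennreal (LINT e|\<Lambda>. hit x e * f e)"
    by (rule nn_integral_eq_integral) (use assms in auto)
  also have "\<dots> / ennreal l = ennreal ((LINT e|\<Lambda>. hit x e * f e) / l)"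
    using l_pos assms(1) by (intro divide_ennreal) (auto intro!: integral_nonneg)
  finally show "(\<integral>\<^sup>+e. f e \<partial>uniform_measure \<Lambda> {e \<in> space \<Lambda>. x \<in> S e}) = ennreal ((LINT e|\<Lambda>. hit x e * f e) / l)" .
qed (use assms l_pos in \<open>auto intro!: divide_nonneg_pos integral_nonneg\<close>)

lemma cluster_pgfl:
  assumes f: "\<And>e. 0 \<le> f e" "f \<in> borel_measurable \<Lambda>" "integrable \<Lambda> (\<lambda>e. hit x e * f e)"
  shows "has_bochner_integral (cluster x) (\<lambda>s. \<Prod>i<fst s. f (snd s i))
           (exp ((LINT e|\<Lambda>. hit x e * f e) - l))"
proof -
  note * = mark_integral[OF f]
  have "integrable (uniform_measure \<Lambda> {e \<in> space \<Lambda>. x \<in> S e}) f" using * by (simp add: has_bochner_integral_iff)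
  from poisson_sample_pgfl[OF l_pos prob_space_mark f(1) this]
  have "has_bochner_integral (cluster x) (\<lambda>s. \<Prod>i<fst s. f (snd s i))
         (exp (l * ((LINT e|uniform_measure \<Lambda> {e \<in> space \<Lambda>. x \<in> S e}. f e) - 1)))"
    by (simp add: cluster_def)
  also have "l * ((LINT e|uniform_measure \<Lambda> {e \<in> space \<Lambda>. x \<in> S e}. f e) - 1) = (LINT e|\<Lambda>. hit x e * f e) - l"
    using has_bochner_integral_integral_eq[OF *] l_pos by (simp add: right_diff_distrib)
  finally show ?thesis .
qed

lemma measurable_cluster_component [measurable]:
  "fst \<in> cluster x \<rightarrow>\<^sub>M count_space UNIV" "(\<lambda>s. snd s i) \<in> cluster x \<rightarrow>\<^sub>M \<Lambda>"
  unfolding cluster_def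
  using measurable_poisson_sample(1) measurable_poisson_sample(2)[where \<nu>="uniform_measure \<Lambda> {e \<in> space \<Lambda>. x \<in> S e}"]
  by (auto simp: measurable_cong_sets[OF refl sets_uniform_measure])

lemma measurable_cluster_vol: "cluster_vol \<in> borel_measurable (cluster x)"
  unfolding cluster_vol_def[abs_def] cluster_def
  by (rule measurable_sample_sum) simp

lemma cluster_vol_nonneg [simp]: "0 \<le> cluster_vol s"
  by (simp add: cluster_vol_def sum_nonneg)

lemma random_set_cluster:
  assumes B: "finite B" shows "random_set (cluster x) (cluster_set B)"
proof -
  have [measurable]: "Measurable.pred (lborel \<Otimes>\<^sub>M \<Lambda>) (\<lambda>p. fst p \<in> S (snd p))"
    using S_measurable by (simp add: random_set_def)
  have 1: "Measurable.pred (lborel \<Otimes>\<^sub>M cluster x) (\<lambda>p. (\<lambda>p. fst p \<in> S (snd p)) (fst p, snd (snd p) i))" for i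
    by (rule measurable_compose[of _ _ "lborel \<Otimes>\<^sub>M \<Lambda>"]) measurable
  have "(\<lambda>p. clear S B (snd (snd p) i)) \<in> borel_measurable (lborel \<Otimes>\<^sub>M cluster x)" for i
    by (rule measurable_compose[OF _ measurable_clear_S[OF B]]) measurable
  then have 2: "Measurable.pred (lborel \<Otimes>\<^sub>M cluster x) (\<lambda>p. clear S B (snd (snd p) i) = 1)" for i
    by measurable
  have "Measurable.pred (lborel \<Otimes>\<^sub>M cluster x)
      (\<lambda>p. \<exists>i. i < fst (snd p) \<and> clear S B (snd (snd p) i) = 1 \<and> fst p \<in> S (snd (snd p) i))"
    by (intro pred_intros_countable pred_intros_logic 1[simplified] 2) measurable
  also have "(\<lambda>p. \<exists>i. i < fst (snd p) \<and> clear S B (snd (snd p) i) = 1 \<and> fst p \<in> S (snd (snd p) i)) =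
    (\<lambda>p. fst p \<in> cluster_set B (snd p))"
    by (auto simp: cluster_set_def clear_def fun_eq_iff)
  finally show ?thesis by (simp add: random_set_def)
qed

lemma cluster_set_vol:
  assumes "finite B" "s \<in> space (cluster x)"
  shows "emeasure lborel (cluster_set B s) \<le> ennreal (cluster_vol s)" "vol (cluster_set B s) \<le> cluster_vol s"
proof -
  have sp: "snd s i \<in> space \<Lambda>" for i
    using measurable_space[OF measurable_cluster_component(2) assms(2)] .
  have "emeasure lborel (cluster_set B s) \<le> emeasure lborel (\<Union>i\<in>{..<fst s}. S (snd s i))"
    by (rule emeasure_mono) (use random_set_section[OF S_measurable sp] in \<open>auto simp: cluster_set_def\<close>)
  also have "\<dots> \<le> (\<Sum>i<fst s. emeasure lborel (S (snd s i)))"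
    by (rule emeasure_subadditive_finite) (use random_set_section[OF S_measurable sp] in auto)
  also have "\<dots> = (\<Sum>i<fst s. ennreal (vol (S (snd s i))))"
    using finite_grain[OF sp] by (simp add: emeasure_eq_ennreal_measure less_top)
  also have "\<dots> = ennreal (cluster_vol s)" by (simp add: cluster_vol_def)
  finally show 1: "emeasure lborel (cluster_set B s) \<le> ennreal (cluster_vol s)" .
  then show "vol (cluster_set B s) \<le> cluster_vol s"
    unfolding measure_def by (simp add: enn2real_leI)
qed

lemma exp_cluster_vol: "exp (c * cluster_vol s) = (\<Prod>i<fst s. exp (c * vol (S (snd s i))))"
  by (simp add: cluster_vol_def sum_distrib_left exp_sum)

text \<open>A grain spoils the vacancy of C exactly if it misses B and meets C, so the indicator is
  a product over the grains and the generating functional applies.\<close>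

lemma clear_cluster_set:
  "clear (cluster_set B) C s = (\<Prod>i<fst s. 1 - clear S B (snd s i) * (1 - clear S C (snd s i)))"
proof (cases "\<exists>i<fst s. S (snd s i) \<inter> B = {} \<and> S (snd s i) \<inter> C \<noteq> {}")
  case True
  then have "clear (cluster_set B) C s = 0" by (auto simp: clear_def cluster_set_def)
  moreover have "(\<Prod>i<fst s. 1 - clear S B (snd s i) * (1 - clear S C (snd s i))) = 0"
    using True by (auto simp: clear_def)
  ultimately show ?thesis by simp
next
  case False
  then have "(\<Prod>i<fst s. 1 - clear S B (snd s i) * (1 - clear S C (snd s i))) = (\<Prod>i<fst s. 1)"
    by (intro prod.cong) (auto simp: clear_def)
  moreover have "clear (cluster_set B) C s = 1"
    using False by (auto simp: clear_def cluster_set_def)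
  ultimately show ?thesis by simp
qed

text \<open>The exponent is minus the mass of the grains through x that miss B but meet C, written
  as a difference of two masses because the first of them later cancels against
  \<open>hit_measure_insert\<close>.\<close>

lemma cluster_vacancy:
  assumes "finite B" "finite C"
  shows "(LINT s|cluster x. clear (cluster_set B) C s) =
     exp ((LINT e|\<Lambda>. hit x e * clear S (B \<union> C) e) - (LINT e|\<Lambda>. hit x e * clear S B e))"
proof -
  let ?f = "\<lambda>e. 1 - clear S B e * (1 - clear S C e)"
  have b: "0 \<le> ?f e" "\<bar>?f e\<bar> \<le> 1" for e
    by (auto simp: clear_def)
  have "has_bochner_integral (cluster x) (\<lambda>s. \<Prod>i<fst s. ?f (snd s i)) (exp ((LINT e|\<Lambda>. hit x e * ?f e) - l))"
    by (intro cluster_pgfl b integrable_hit_mult[OF _ b(2)]) (use assms in auto)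
  then have "(LINT s|cluster x. clear (cluster_set B) C s) = exp ((LINT e|\<Lambda>. hit x e * ?f e) - l)"
    by (simp add: clear_cluster_set has_bochner_integral_iff)
  also have "(LINT e|\<Lambda>. hit x e * ?f e) =
     (LINT e|\<Lambda>. hit x e + (hit x e * clear S (B \<union> C) e - hit x e * clear S B e))"
    by (intro Bochner_Integration.integral_cong) (auto simp: clear_Un algebra_simps)
  also have "\<dots> = l + ((LINT e|\<Lambda>. hit x e * clear S (B \<union> C) e) - (LINT e|\<Lambda>. hit x e * clear S B e))"
    using integrable_hit_mult[where B=1 and f="clear S (B \<union> C)" and x=x] integrable_hit_mult[where B=1 and f="clear S B" and x=x]
      assms hit_integral by simp
  finally show ?thesis by simp
qed

end

section \<open>Tilted vacancy probabilities\<close>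

text \<open>The inequality exp x - 1 \<le> x exp x holds for both signs of x and bounds the
  remainder by x (exp x - 1); the two signs differ only in how this product is estimated.\<close>

lemma exp_remainder_bound: "\<bar>exp x - 1 - x\<bar> \<le> x\<^sup>2 * exp \<bar>x\<bar>" for x :: real
proof -
  have 0: "exp x - 1 - x \<ge> 0" using exp_ge_add_one_self[of x] by linarith
  have "exp x * (1 - x) \<le> exp x * exp (-x)"
    using exp_ge_add_one_self[of "-x"] by (intro mult_left_mono) auto
  then have le: "exp x - 1 \<le> x * exp x" by (simp add: exp_minus algebra_simps)
  have "exp x - 1 - x \<le> x * (exp x - 1)" using le by (simp add: algebra_simps)
  also have "\<dots> \<le> x\<^sup>2 * exp \<bar>x\<bar>"
  proof (cases "0 \<le> x")
    case True
    have "x * (exp x - 1) \<le> x * (x * exp x)" using True le by (intro mult_left_mono) auto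
    then show ?thesis using True by (simp add: power2_eq_square mult_ac)
  next
    case False
    have "x * (exp x - 1) = (-x) * (1 - exp x)" by (simp add: algebra_simps)
    also have "\<dots> \<le> (-x) * (-x)"
    proof (rule mult_left_mono)
      show "1 - exp x \<le> - x" using exp_ge_add_one_self[of x] by linarith
    qed (use False in simp)
    also have "\<dots> \<le> x\<^sup>2 * exp \<bar>x\<bar>"
      by (simp add: power2_eq_square) (metis mult_left_mono mult.right_neutral one_le_exp_iff abs_ge_zero zero_le_square)
    finally show ?thesis .
  qed
  finally show ?thesis using 0 by simp
qed

text \<open>Differentiation under the integral by an explicit remainder: boundedness of f, u and v
  gives an error of at most C h^2 for |h| \<le> 1, with C independent of h, so the difference
  quotient converges.\<close>

lemma (in finite_measure) exp_tilt_derivative: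
  fixes f u v :: "'a \<Rightarrow> real"
  assumes m: "f \<in> borel_measurable M" "u \<in> borel_measurable M" "v \<in> borel_measurable M"
    and b: "\<And>\<omega>. \<omega> \<in> space M \<Longrightarrow> \<bar>f \<omega>\<bar> \<le> a" "\<And>\<omega>. \<omega> \<in> space M \<Longrightarrow> \<bar>u \<omega>\<bar> \<le> b"
      "\<And>\<omega>. \<omega> \<in> space M \<Longrightarrow> \<bar>v \<omega>\<bar> \<le> c"
  shows "((\<lambda>t. LINT \<omega>|M. f \<omega> * exp (u \<omega> + t * v \<omega>)) has_real_derivative
           (LINT \<omega>|M. f \<omega> * v \<omega> * exp (u \<omega> + t * v \<omega>))) (at t)"
proof -
  define F where "F t = (LINT \<omega>|M. f \<omega> * exp (u \<omega> + t * v \<omega>))" for t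
  define D where "D = (LINT \<omega>|M. f \<omega> * v \<omega> * exp (u \<omega> + t * v \<omega>))"
  have e: "exp (u \<omega> + s * v \<omega>) \<le> exp (b + \<bar>s\<bar> * c)" if "\<omega> \<in> space M" for \<omega> s
  proof -
    have "s * v \<omega> \<le> \<bar>s\<bar> * \<bar>v \<omega>\<bar>" by (simp add: abs_mult[symmetric])
    also have "\<dots> \<le> \<bar>s\<bar> * c" using b(3)[OF that] by (intro mult_left_mono) auto
    finally have "s * v \<omega> \<le> \<bar>s\<bar> * c" .
    then show ?thesis using b(2)[OF that] by simp
  qed
  have i1: "integrable M (\<lambda>\<omega>. f \<omega> * exp (u \<omega> + s * v \<omega>))" for s
  proof (rule integrable_bounded[of _ "a * exp (b + \<bar>s\<bar> * c)"])
    show "\<bar>f \<omega> * exp (u \<omega> + s * v \<omega>)\<bar> \<le> a * exp (b + \<bar>s\<bar> * c)" if "\<omega> \<in> space M" for \<omega>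
      unfolding abs_mult using b(1)[OF that] e[OF that, of s] by (intro mult_mono) auto
  qed (use m in measurable)
  have i2: "integrable M (\<lambda>\<omega>. f \<omega> * v \<omega> * exp (u \<omega> + s * v \<omega>))" for s
  proof (rule integrable_bounded[of _ "a * c * exp (b + \<bar>s\<bar> * c)"])
    show "\<bar>f \<omega> * v \<omega> * exp (u \<omega> + s * v \<omega>)\<bar> \<le> a * c * exp (b + \<bar>s\<bar> * c)" if "\<omega> \<in> space M" for \<omega>
      unfolding abs_mult using b(1,3)[OF that] e[OF that, of s] by (intro mult_mono) auto
  qed (use m in measurable)
  define C where "C = a * exp (b + \<bar>t\<bar> * c) * (c\<^sup>2 * exp c) * measure M (space M)"
  have bound: "\<bar>F (t + h) - F t - h * D\<bar> \<le> C * h\<^sup>2" if h: "\<bar>h\<bar> \<le> 1" for h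
  proof -
    have "F (t + h) - F t - h * D = (LINT \<omega>|M. f \<omega> * exp (u \<omega> + (t + h) * v \<omega>) - f \<omega> * exp (u \<omega> + t * v \<omega>)
        - h * (f \<omega> * v \<omega> * exp (u \<omega> + t * v \<omega>)))"
      unfolding F_def D_def using i1 i2 by simp
    also have "\<dots> = (LINT \<omega>|M. f \<omega> * exp (u \<omega> + t * v \<omega>) * (exp (h * v \<omega>) - 1 - h * v \<omega>))"
    proof (intro Bochner_Integration.integral_cong refl)
      fix \<omega>
      have "exp (u \<omega> + (t + h) * v \<omega>) = exp (u \<omega> + t * v \<omega>) * exp (h * v \<omega>)"
        by (simp add: distrib_right flip: exp_add add.assoc)
      then show "f \<omega> * exp (u \<omega> + (t + h) * v \<omega>) - f \<omega> * exp (u \<omega> + t * v \<omega>) - h * (f \<omega> * v \<omega> * exp (u \<omega> + t * v \<omega>))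
         = f \<omega> * exp (u \<omega> + t * v \<omega>) * (exp (h * v \<omega>) - 1 - h * v \<omega>)"
        by (simp add: algebra_simps)
    qed
    finally have "\<bar>F (t + h) - F t - h * D\<bar> =
        \<bar>LINT \<omega>|M. f \<omega> * exp (u \<omega> + t * v \<omega>) * (exp (h * v \<omega>) - 1 - h * v \<omega>)\<bar>" by (rule arg_cong)
    also have "\<dots> \<le> (LINT \<omega>|M. \<bar>f \<omega> * exp (u \<omega> + t * v \<omega>) * (exp (h * v \<omega>) - 1 - h * v \<omega>)\<bar>)"
      by (rule integral_abs_bound)
    also have "\<dots> \<le> (LINT \<omega>|M. a * exp (b + \<bar>t\<bar> * c) * (h\<^sup>2 * (c\<^sup>2 * exp c)))"
    proof (rule integral_mono)
      show le: "\<bar>f \<omega> * exp (u \<omega> + t * v \<omega>) * (exp (h * v \<omega>) - 1 - h * v \<omega>)\<bar>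
          \<le> a * exp (b + \<bar>t\<bar> * c) * (h\<^sup>2 * (c\<^sup>2 * exp c))" if \<omega>: "\<omega> \<in> space M" for \<omega>
      proof -
        have hv: "\<bar>h * v \<omega>\<bar> \<le> c"
          unfolding abs_mult by (rule order_trans[OF mult_mono[OF h b(3)[OF \<omega>]]]) auto
        have "\<bar>v \<omega>\<bar>\<^sup>2 \<le> c\<^sup>2" by (rule power_mono) (use b(3)[OF \<omega>] in auto)
        then have "(v \<omega>)\<^sup>2 \<le> c\<^sup>2" by simp
        then have "(h * v \<omega>)\<^sup>2 * exp \<bar>h * v \<omega>\<bar> \<le> (h\<^sup>2 * c\<^sup>2) * exp c"
          unfolding power_mult_distrib using hv by (intro mult_mono) auto
        then have "\<bar>exp (h * v \<omega>) - 1 - h * v \<omega>\<bar> \<le> h\<^sup>2 * (c\<^sup>2 * exp c)"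
          using exp_remainder_bound[of "h * v \<omega>"] by (simp add: mult_ac)
        moreover have "\<bar>f \<omega> * exp (u \<omega> + t * v \<omega>)\<bar> \<le> a * exp (b + \<bar>t\<bar> * c)"
          unfolding abs_mult using b(1)[OF \<omega>] e[OF \<omega>, of t] by (intro mult_mono) auto
        ultimately show ?thesis unfolding abs_mult[of "f \<omega> * exp (u \<omega> + t * v \<omega>)"]
          by (intro mult_mono) auto
      qed
      show "integrable M (\<lambda>\<omega>. \<bar>f \<omega> * exp (u \<omega> + t * v \<omega>) * (exp (h * v \<omega>) - 1 - h * v \<omega>)\<bar>)"
        by (rule integrable_bounded[of _ "a * exp (b + \<bar>t\<bar> * c) * (h\<^sup>2 * (c\<^sup>2 * exp c))"])
           (use m le in \<open>auto\<close>)
    qed simp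
    also have "\<dots> = C * h\<^sup>2" by (simp add: C_def mult_ac)
    finally show ?thesis .
  qed
  have "((\<lambda>h. (F (t + h) - F t) / h) \<longlongrightarrow> D) (at 0)"
  proof (rule Lim_transform_bound[where g = "\<lambda>h. C * h", THEN Lim_null[THEN iffD2], rotated])
    show "((\<lambda>h. C * h) \<longlongrightarrow> 0) (at 0)" by (auto intro!: tendsto_eq_intros)
    have "\<forall>\<^sub>F h in at 0. \<bar>h\<bar> < 1 \<and> h \<noteq> (0::real)"
      unfolding eventually_at by (intro exI[of _ 1]) auto
    then show "\<forall>\<^sub>F h in at 0. norm ((F (t + h) - F t) / h - D) \<le> norm (C * h)"
    proof eventually_elim
      case (elim h)
      have "(F (t + h) - F t) / h - D = (F (t + h) - F t - h * D) / h" using elim by (simp add: field_simps)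
      then have "norm ((F (t + h) - F t) / h - D) = \<bar>F (t + h) - F t - h * D\<bar> / \<bar>h\<bar>" by simp
      also have "\<dots> \<le> C * h\<^sup>2 / \<bar>h\<bar>" by (intro divide_right_mono bound) (use elim in auto)
      also have "\<dots> = C * \<bar>h\<bar>" using elim by (simp add: power2_eq_square abs_if)
      also have "\<dots> \<le> norm (C * h)" by (simp add: abs_mult mult_right_mono)
      finally show ?case .
    qed
  qed
  then show ?thesis unfolding F_def D_def by (simp add: DERIV_def)
qed

text \<open>The random set enters through its void probabilities alone. The number \<kappa> is the
  mean of the sum of vol exp (\<theta> vol) over the grains through a point, the same at every
  point; \<theta> is the largest size of a field.\<close>

locale boolean_model = grain_intensity \<Lambda> S l + M: prob_space M
  for \<Lambda> :: "'e measure" and S :: "'e \<Rightarrow> 'a::euclidean_space set" and l :: real and M :: "'w measure" +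
  fixes Xi :: "'w \<Rightarrow> 'a set" and \<theta> \<kappa> :: real
  assumes Xi_measurable: "random_set M Xi"
    and vacancy: "\<And>A. finite A \<Longrightarrow> (LINT \<omega>|M. clear Xi A \<omega>) = exp (- hit_measure A)"
    and \<theta>_nonneg: "0 \<le> \<theta>"
    and \<kappa>_integral: "\<And>x. has_bochner_integral \<Lambda> (\<lambda>e. hit x e * (vol (S e) * exp (\<theta> * vol (S e)))) \<kappa>"
begin

lemma \<kappa>_nonneg: "0 \<le> \<kappa>"
proof -
  have "0 \<le> (LINT e|\<Lambda>. hit undefined e * (vol (S e) * exp (\<theta> * vol (S e))))" by simp
  also have "\<dots> = \<kappa>" by (rule has_bochner_integral_integral_eq[OF \<kappa>_integral])
  finally show ?thesis .
qed

definition admissible :: "('a \<Rightarrow> real) \<Rightarrow> bool" where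
  "admissible \<zeta> \<longleftrightarrow> integrable lborel \<zeta> \<and> (\<forall>x. \<bar>\<zeta> x\<bar> \<le> \<theta>)"

definition Z :: "('a \<Rightarrow> real) \<Rightarrow> 'a set \<Rightarrow> real" where
  "Z \<zeta> A = (LINT \<omega>|M. clear Xi A \<omega> * exp (vacant_int Xi \<zeta> \<omega>))"

text \<open>The probability that y is vacant given that A is, under the law with density
  proportional to the exponential of the vacant integral of \<zeta>.\<close>

definition rho :: "('a \<Rightarrow> real) \<Rightarrow> 'a set \<Rightarrow> 'a \<Rightarrow> real" where
  "rho \<zeta> A y = Z \<zeta> (insert y A) / Z \<zeta> A"

lemma admissibleD:
  assumes "admissible \<zeta>"
  shows "integrable lborel \<zeta>" "\<zeta> \<in> borel_measurable lborel" "\<bar>\<zeta> x\<bar> \<le> \<theta>"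
    "vacant_int Xi \<zeta> \<in> borel_measurable M"
  using assms measurable_vacant_int[OF Xi_measurable, of \<zeta>] by (auto simp: admissible_def)

lemma measurable_exp_vacant:
  assumes "admissible \<zeta>" "finite A"
  shows "(\<lambda>\<omega>. clear Xi A \<omega> * exp (vacant_int Xi \<zeta> \<omega>)) \<in> borel_measurable M"
  using measurable_clear[OF Xi_measurable assms(2)] admissibleD(4)[OF assms(1)] by measurable

lemma exp_vacant_bound:
  assumes "admissible \<zeta>" "\<omega> \<in> space M"
  shows "exp (vacant_int Xi \<zeta> \<omega>) \<le> exp (LINT x|lborel. \<bar>\<zeta> x\<bar>)"
    "exp (- (LINT x|lborel. \<bar>\<zeta> x\<bar>)) \<le> exp (vacant_int Xi \<zeta> \<omega>)"
  using vacant_int_le[OF Xi_measurable admissibleD(1)[OF assms(1)] assms(2)] by auto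

lemma Z_integrable:
  assumes "admissible \<zeta>" "finite A"
  shows "integrable M (\<lambda>\<omega>. clear Xi A \<omega> * exp (vacant_int Xi \<zeta> \<omega>))"
proof (rule M.integrable_bounded[OF measurable_exp_vacant[OF assms], of "exp (LINT x|lborel. \<bar>\<zeta> x\<bar>)"])
  fix \<omega> assume "\<omega> \<in> space M"
  then have "clear Xi A \<omega> * exp (vacant_int Xi \<zeta> \<omega>) \<le> 1 * exp (LINT x|lborel. \<bar>\<zeta> x\<bar>)"
    by (intro mult_mono exp_vacant_bound assms) auto
  then show "\<bar>clear Xi A \<omega> * exp (vacant_int Xi \<zeta> \<omega>)\<bar> \<le> exp (LINT x|lborel. \<bar>\<zeta> x\<bar>)"
    by (simp add: abs_mult)
qed

lemma Z_pos:
  assumes "admissible \<zeta>" "finite A"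
  shows "0 < Z \<zeta> A"
proof -
  let ?b = "LINT x|lborel. \<bar>\<zeta> x\<bar>"
  have "(LINT \<omega>|M. clear Xi A \<omega> * exp (- ?b)) \<le> Z \<zeta> A"
    unfolding Z_def
    by (intro integral_mono Z_integrable assms mult_left_mono exp_vacant_bound)
       (auto intro!: M.integrable_bounded[of _ 1] measurable_clear[OF Xi_measurable assms(2)])
  moreover have "(LINT \<omega>|M. clear Xi A \<omega> * exp (- ?b)) > 0"
    by (simp add: vacancy assms)
  ultimately show ?thesis by linarith
qed

lemma Z_insert_le:
  assumes "admissible \<zeta>" "finite A"
  shows "Z \<zeta> (insert y A) \<le> Z \<zeta> A"
  unfolding Z_def
  by (intro integral_mono Z_integrable assms mult_right_mono) (use assms in \<open>auto simp: clear_def\<close>)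

lemma rho_bounds:
  assumes "admissible \<zeta>" "finite A"
  shows "0 < rho \<zeta> A y" "rho \<zeta> A y \<le> 1"
  using Z_pos[OF assms] Z_pos[OF assms(1), of "insert y A"] Z_insert_le[OF assms, of y] assms(2)
  by (auto simp: rho_def)

lemma measurable_Z_insert:
  assumes "admissible \<zeta>" "finite A"
  shows "(\<lambda>x. Z \<zeta> (insert x A)) \<in> borel_measurable lborel"
proof -
  have "(\<lambda>x. Z \<zeta> (insert x A)) = (\<lambda>x. LINT \<omega>|M. (clear Xi A \<omega> * exp (vacant_int Xi \<zeta> \<omega>)) * clear Xi {x} \<omega>)"
    unfolding Z_def by (rule ext, intro Bochner_Integration.integral_cong) (auto simp: clear_def)
  then show ?thesis
    using M.measurable_clear_integral[OF Xi_measurable measurable_exp_vacant[OF assms]] by simp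
qed

lemma measurable_rho [measurable]:
  assumes "admissible \<zeta>" "finite A"
  shows "(\<lambda>x. rho \<zeta> A x) \<in> borel_measurable lborel" "(\<lambda>x. rho \<zeta> (insert x A) y) \<in> borel_measurable lborel"
proof -
  show "(\<lambda>x. rho \<zeta> A x) \<in> borel_measurable lborel"
    unfolding rho_def using measurable_Z_insert[OF assms] by simp
  have "(\<lambda>x. Z \<zeta> (insert y (insert x A))) \<in> borel_measurable lborel"
    using measurable_Z_insert[of \<zeta> "insert y A"] assms by (simp add: insert_commute)
  then show "(\<lambda>x. rho \<zeta> (insert x A) y) \<in> borel_measurable lborel"
    unfolding rho_def using measurable_Z_insert[OF assms] by simp
qed

section \<open>Linear response to a change of the field\<close>

lemma vacant_int_linear:
  assumes "\<omega> \<in> space M" "integrable lborel \<zeta>" "integrable lborel \<eta>"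
  shows "vacant_int Xi (\<lambda>x. \<zeta> x + t * \<eta> x) \<omega> = vacant_int Xi \<zeta> \<omega> + t * vacant_int Xi \<eta> \<omega>"
proof -
  have "vacant_int Xi (\<lambda>x. \<zeta> x + t * \<eta> x) \<omega> = (LINT x|lborel. \<zeta> x * clear Xi {x} \<omega> + t * (\<eta> x * clear Xi {x} \<omega>))"
    unfolding vacant_int_def by (simp add: algebra_simps)
  also have "\<dots> = vacant_int Xi \<zeta> \<omega> + t * vacant_int Xi \<eta> \<omega>"
    unfolding vacant_int_def using integrable_vacant[OF Xi_measurable _ assms(1)] assms(2,3) by simp
  finally show ?thesis .
qed

text \<open>Differentiation in the direction \<eta> brings down the vacant integral of \<eta>, which
  Campbell's formula turns into one more vacant point.\<close>

lemma Z_derivative: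
  assumes \<zeta>: "integrable lborel \<zeta>" and \<eta>: "integrable lborel \<eta>" and A: "finite A"
    and adm: "admissible (\<lambda>x. \<zeta> x + t * \<eta> x)"
  shows "((\<lambda>t. Z (\<lambda>x. \<zeta> x + t * \<eta> x) A) has_real_derivative
     (LINT x|lborel. \<eta> x * Z (\<lambda>x. \<zeta> x + t * \<eta> x) (insert x A))) (at t)"
proof -
  have m: "vacant_int Xi \<zeta> \<in> borel_measurable M" "vacant_int Xi \<eta> \<in> borel_measurable M"
    using measurable_vacant_int[OF Xi_measurable] \<zeta> \<eta> by auto
  have "((\<lambda>t. LINT \<omega>|M. clear Xi A \<omega> * exp (vacant_int Xi \<zeta> \<omega> + t * vacant_int Xi \<eta> \<omega>)) has_real_derivative
      (LINT \<omega>|M. clear Xi A \<omega> * vacant_int Xi \<eta> \<omega> * exp (vacant_int Xi \<zeta> \<omega> + t * vacant_int Xi \<eta> \<omega>))) (at t)"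
    by (rule M.exp_tilt_derivative[of _ _ _ 1])
       (use m vacant_int_le[OF Xi_measurable \<zeta>] vacant_int_le[OF Xi_measurable \<eta>]
          measurable_clear[OF Xi_measurable A] in auto)
  also have "(\<lambda>t. LINT \<omega>|M. clear Xi A \<omega> * exp (vacant_int Xi \<zeta> \<omega> + t * vacant_int Xi \<eta> \<omega>)) =
             (\<lambda>t. Z (\<lambda>x. \<zeta> x + t * \<eta> x) A)"
    unfolding Z_def by (rule ext, intro Bochner_Integration.integral_cong) (auto simp: vacant_int_linear \<zeta> \<eta>)
  also have "(LINT \<omega>|M. clear Xi A \<omega> * vacant_int Xi \<eta> \<omega> * exp (vacant_int Xi \<zeta> \<omega> + t * vacant_int Xi \<eta> \<omega>)) =
      (LINT \<omega>|M. (clear Xi A \<omega> * exp (vacant_int Xi (\<lambda>x. \<zeta> x + t * \<eta> x) \<omega>)) * vacant_int Xi \<eta> \<omega>)"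
    by (intro Bochner_Integration.integral_cong) (auto simp: vacant_int_linear \<zeta> \<eta>)
  also have "\<dots> = (LINT x|lborel. \<eta> x * (LINT \<omega>|M. (clear Xi A \<omega> * exp (vacant_int Xi (\<lambda>x. \<zeta> x + t * \<eta> x) \<omega>)) * clear Xi {x} \<omega>))"
  proof (rule M.campbell_vacant[OF Xi_measurable \<eta> measurable_exp_vacant[OF adm A], of "1 * exp (LINT x|lborel. \<bar>\<zeta> x + t * \<eta> x\<bar>)"])
    show "\<bar>clear Xi A \<omega> * exp (vacant_int Xi (\<lambda>x. \<zeta> x + t * \<eta> x) \<omega>)\<bar> \<le> 1 * exp (LINT x|lborel. \<bar>\<zeta> x + t * \<eta> x\<bar>)"
      if "\<omega> \<in> space M" for \<omega>
      unfolding abs_mult by (intro mult_mono) (use exp_vacant_bound(1)[OF adm that] in auto)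
  qed
  also have "\<dots> = (LINT x|lborel. \<eta> x * Z (\<lambda>x. \<zeta> x + t * \<eta> x) (insert x A))"
    unfolding Z_def by (simp add: clear_insert[of Xi _ A] mult_ac)
  finally show ?thesis .
qed

text \<open>The covariance of the vacancies of x and y under the tilted law given that A is vacant,
  factored so that the influence of x on y appears.\<close>

definition covar :: "('a \<Rightarrow> real) \<Rightarrow> 'a set \<Rightarrow> 'a \<Rightarrow> 'a \<Rightarrow> real" where
  "covar \<zeta> A x y = rho \<zeta> A x * (rho \<zeta> (insert x A) y - rho \<zeta> A y)"

text \<open>Symmetry of the covariance is what allows a kernel that controls the action of x on y to
  be used with its arguments in either order.\<close>

lemma covar_commute:
  assumes "admissible \<zeta>" "finite A"
  shows "covar \<zeta> A x y = covar \<zeta> A y x"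
  using Z_pos[OF assms] Z_pos[OF assms(1), of "insert x A"] Z_pos[OF assms(1), of "insert y A"] assms(2)
  by (simp add: covar_def rho_def field_simps insert_commute)

text \<open>The quotient rule for \<open>Z (insert y A) / Z A\<close> combines the two derivatives
  into a covariance, against which the perturbation \<eta> is integrated.\<close>

lemma rho_derivative:
  assumes \<zeta>: "integrable lborel \<zeta>" and \<eta>: "integrable lborel \<eta>" and A: "finite A"
    and adm: "admissible (\<lambda>x. \<zeta> x + t * \<eta> x)"
  shows "((\<lambda>t. rho (\<lambda>x. \<zeta> x + t * \<eta> x) A y) has_real_derivative
     (LINT x|lborel. \<eta> x * covar (\<lambda>x. \<zeta> x + t * \<eta> x) A x y)) (at t)"
proof -
  let ?z = "\<lambda>x. \<zeta> x + t * \<eta> x"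
  note Zp = Z_pos[OF adm A]
  have i: "integrable lborel (\<lambda>x. \<eta> x * Z ?z (insert x B))" if "finite B" for B
  proof (rule Bochner_Integration.integrable_bound[of _ "\<lambda>x. Z ?z B * \<eta> x"])
    show "AE x in lborel. norm (\<eta> x * Z ?z (insert x B)) \<le> norm (Z ?z B * \<eta> x)"
    proof (rule AE_I2)
      fix x
      have "0 < Z ?z (insert x B)" "0 < Z ?z B" "Z ?z (insert x B) \<le> Z ?z B"
        using Z_pos[OF adm] Z_insert_le[OF adm that] that by auto
      then show "norm (\<eta> x * Z ?z (insert x B)) \<le> norm (Z ?z B * \<eta> x)"
        by (simp add: abs_mult mult.commute mult_left_mono)
    qed
  qed (use \<eta> measurable_Z_insert[OF adm that] in auto)
  have "((\<lambda>t. rho (\<lambda>x. \<zeta> x + t * \<eta> x) A y) has_real_derivative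
     ((LINT x|lborel. \<eta> x * Z ?z (insert x (insert y A))) * Z ?z A - Z ?z (insert y A) * (LINT x|lborel. \<eta> x * Z ?z (insert x A)))
      / (Z ?z A * Z ?z A)) (at t)"
    unfolding rho_def
    by (intro DERIV_divide Z_derivative \<zeta> \<eta> adm) (use A Zp in auto)
  also have "((LINT x|lborel. \<eta> x * Z ?z (insert x (insert y A))) * Z ?z A - Z ?z (insert y A) * (LINT x|lborel. \<eta> x * Z ?z (insert x A)))
      / (Z ?z A * Z ?z A) =
      (LINT x|lborel. ((\<eta> x * Z ?z (insert x (insert y A))) * Z ?z A - Z ?z (insert y A) * (\<eta> x * Z ?z (insert x A))) / (Z ?z A * Z ?z A))"
    using i[of "insert y A"] i[of A] A by simp
  also have "\<dots> = (LINT x|lborel. \<eta> x * covar ?z A x y)"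
  proof (intro Bochner_Integration.integral_cong refl)
    fix x
    have "Z ?z (insert x A) > 0" using Z_pos[OF adm] A by simp
    then show "((\<eta> x * Z ?z (insert x (insert y A))) * Z ?z A - Z ?z (insert y A) * (\<eta> x * Z ?z (insert x A))) / (Z ?z A * Z ?z A)
       = \<eta> x * covar ?z A x y"
      using Zp by (simp add: covar_def rho_def field_simps insert_commute)
  qed
  finally show ?thesis .
qed

text \<open>Extended values allow infinite series of kernels to be formed before anything is known
  about their finiteness; uniformity in \<zeta> and B makes the bound reusable after the field has
  been cut.\<close>

definition influence_bound :: "('a \<Rightarrow> 'a \<Rightarrow> ennreal) \<Rightarrow> bool" where
  "influence_bound \<Psi> \<longleftrightarrow> (\<forall>\<zeta> B x y. admissible \<zeta> \<longrightarrow> finite B \<longrightarrow>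
     ennreal \<bar>rho \<zeta> (insert x B) y - rho \<zeta> B y\<bar> \<le> \<Psi> x y)"

lemma covar_le:
  assumes "influence_bound \<Psi>" "admissible \<zeta>" "finite A"
  shows "ennreal \<bar>covar \<zeta> A x y\<bar> \<le> \<Psi> x y" "ennreal \<bar>covar \<zeta> A x y\<bar> \<le> \<Psi> y x"
proof -
  have 1: "ennreal \<bar>covar \<zeta> A x y\<bar> \<le> \<Psi> x y" for x y
  proof -
    have "\<bar>covar \<zeta> A x y\<bar> \<le> 1 * \<bar>rho \<zeta> (insert x A) y - rho \<zeta> A y\<bar>"
      unfolding covar_def abs_mult using rho_bounds[OF assms(2,3), of x] by (intro mult_mono) auto
    then have "ennreal \<bar>covar \<zeta> A x y\<bar> \<le> ennreal \<bar>rho \<zeta> (insert x A) y - rho \<zeta> A y\<bar>"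
      by (simp add: ennreal_leI)
    also have "\<dots> \<le> \<Psi> x y" using assms by (auto simp: influence_bound_def)
    finally show ?thesis .
  qed
  show "ennreal \<bar>covar \<zeta> A x y\<bar> \<le> \<Psi> x y" by (rule 1)
  show "ennreal \<bar>covar \<zeta> A x y\<bar> \<le> \<Psi> y x"
    using 1[of y x] by (simp add: covar_commute[OF assms(2,3)])
qed

text \<open>Mean value theorem along the segment from \<zeta>' to \<zeta>, which stays admissible by
  convexity: the derivative is the integral of the difference of the fields against a covariance.
  The two versions correspond to the two orders of arguments of the kernel.\<close>

lemma rho_field_diff:
  assumes \<Psi>: "influence_bound \<Psi>" and \<zeta>: "admissible \<zeta>" and \<zeta>': "admissible \<zeta>'" and A: "finite A"
  shows "ennreal \<bar>rho \<zeta> A y - rho \<zeta>' A y\<bar> \<le> (\<integral>\<^sup>+x. ennreal \<bar>\<zeta> x - \<zeta>' x\<bar> * \<Psi> x y \<partial>lborel)"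
    "ennreal \<bar>rho \<zeta> A y - rho \<zeta>' A y\<bar> \<le> (\<integral>\<^sup>+x. ennreal \<bar>\<zeta> x - \<zeta>' x\<bar> * \<Psi> y x \<partial>lborel)"
proof -
  define \<eta> where "\<eta> x = \<zeta> x - \<zeta>' x" for x
  define z where "z t = (\<lambda>x. \<zeta>' x + t * \<eta> x)" for t
  have \<eta>: "integrable lborel \<eta>" unfolding \<eta>_def[abs_def] using admissibleD(1)[OF \<zeta>] admissibleD(1)[OF \<zeta>'] by simp
  have adm: "admissible (z t)" if "0 \<le> t" "t \<le> 1" for t
  proof -
    have "\<bar>z t x\<bar> \<le> \<theta>" for x
    proof -
      have "z t x = (1 - t) * \<zeta>' x + t * \<zeta> x" by (simp add: z_def \<eta>_def algebra_simps)
      then have "\<bar>z t x\<bar> \<le> (1 - t) * \<bar>\<zeta>' x\<bar> + t * \<bar>\<zeta> x\<bar>"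
        using that abs_triangle_ineq[of "(1 - t) * \<zeta>' x" "t * \<zeta> x"] by (simp add: abs_mult)
      also have "\<dots> \<le> (1 - t) * \<theta> + t * \<theta>"
        using that admissibleD(3)[OF \<zeta>, of x] admissibleD(3)[OF \<zeta>', of x] by (intro add_mono mult_left_mono) auto
      finally show ?thesis by (simp add: algebra_simps)
    qed
    moreover have "integrable lborel (z t)" unfolding z_def using \<eta> admissibleD(1)[OF \<zeta>'] by simp
    ultimately show ?thesis by (simp add: admissible_def)
  qed
  have d: "((\<lambda>t. rho (z t) A y) has_real_derivative (LINT x|lborel. \<eta> x * covar (z t) A x y)) (at t)"
    if "0 \<le> t" "t \<le> 1" for t
    unfolding z_def by (rule rho_derivative) (use \<eta> admissibleD(1)[OF \<zeta>'] A adm[OF that] in \<open>auto simp: z_def\<close>)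
  obtain \<xi> where \<xi>: "0 < \<xi>" "\<xi> < 1" "rho (z 1) A y - rho (z 0) A y = (1 - 0) * (LINT x|lborel. \<eta> x * covar (z \<xi>) A x y)"
    using MVT2[of 0 1 "\<lambda>t. rho (z t) A y" "\<lambda>t. LINT x|lborel. \<eta> x * covar (z t) A x y"] d by auto
  have z01: "z 1 = \<zeta>" "z 0 = \<zeta>'" by (auto simp: z_def \<eta>_def)
  have a: "admissible (z \<xi>)" using adm \<xi> by simp
  have int: "integrable lborel (\<lambda>x. \<eta> x * covar (z \<xi>) A x y)"
  proof (rule Bochner_Integration.integrable_bound[OF \<eta>])
    show "(\<lambda>x. \<eta> x * covar (z \<xi>) A x y) \<in> borel_measurable lborel"
      unfolding covar_def using \<eta> measurable_rho[OF a A] by simp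
    show "AE x in lborel. norm (\<eta> x * covar (z \<xi>) A x y) \<le> norm (\<eta> x)"
    proof (rule AE_I2)
      fix x
      have "\<bar>covar (z \<xi>) A x y\<bar> \<le> 1 * 1"
        unfolding covar_def abs_mult
        using rho_bounds[OF a A, of x] rho_bounds[OF a A, of y] rho_bounds[OF a, of "insert x A" y] A
        by (intro mult_mono) auto
      then show "norm (\<eta> x * covar (z \<xi>) A x y) \<le> norm (\<eta> x)"
        by (simp add: abs_mult mult_left_le)
    qed
  qed
  have "ennreal \<bar>rho \<zeta> A y - rho \<zeta>' A y\<bar> = ennreal (norm (LINT x|lborel. \<eta> x * covar (z \<xi>) A x y))"
    using \<xi>(3) by (simp add: z01)
  also have "\<dots> \<le> (\<integral>\<^sup>+x. ennreal (norm (\<eta> x * covar (z \<xi>) A x y)) \<partial>lborel)"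
    by (rule integral_norm_bound_ennreal[OF int])
  also have "\<dots> = (\<integral>\<^sup>+x. ennreal \<bar>\<zeta> x - \<zeta>' x\<bar> * ennreal \<bar>covar (z \<xi>) A x y\<bar> \<partial>lborel)"
    by (simp add: abs_mult ennreal_mult \<eta>_def)
  finally have le: "ennreal \<bar>rho \<zeta> A y - rho \<zeta>' A y\<bar> \<le> \<dots>" .
  show "ennreal \<bar>rho \<zeta> A y - rho \<zeta>' A y\<bar> \<le> (\<integral>\<^sup>+x. ennreal \<bar>\<zeta> x - \<zeta>' x\<bar> * \<Psi> x y \<partial>lborel)"
    by (rule order_trans[OF le]) (intro nn_integral_mono mult_left_mono covar_le[OF \<Psi> a A], auto)
  show "ennreal \<bar>rho \<zeta> A y - rho \<zeta>' A y\<bar> \<le> (\<integral>\<^sup>+x. ennreal \<bar>\<zeta> x - \<zeta>' x\<bar> * \<Psi> y x \<partial>lborel)"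
    by (rule order_trans[OF le]) (intro nn_integral_mono mult_left_mono covar_le[OF \<Psi> a A], auto)
qed

end

section \<open>The influence of a vacant point\<close>

lemma exp_le_1_plus_mult_exp: "exp u \<le> 1 + u * exp u" for u :: real
proof -
  have "exp u * (1 - u) \<le> exp u * exp (-u)"
    using exp_ge_add_one_self[of "-u"] by (intro mult_left_mono) auto
  then show ?thesis by (simp add: exp_minus algebra_simps)
qed

context boolean_model
begin

definition cut :: "('a \<Rightarrow> real) \<Rightarrow> 'a set \<Rightarrow> nat \<times> (nat \<Rightarrow> 'e) \<Rightarrow> 'a \<Rightarrow> real" where
  "cut \<zeta> B s = (\<lambda>y. \<zeta> y * clear (cluster_set B) {y} s)"

section \<open>Superposition of an independent cluster\<close>

lemma cut_admissible:
  assumes "admissible \<zeta>" "finite B" "s \<in> space (cluster x)"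
  shows "admissible (cut \<zeta> B s)"
  unfolding admissible_def cut_def
proof (intro conjI allI)
  show "integrable lborel (\<lambda>y. \<zeta> y * clear (cluster_set B) {y} s)"
    by (rule integrable_vacant[OF random_set_cluster[OF assms(2)] _ assms(3)]) (use assms admissible_def in auto)
  fix y
  have "\<bar>\<zeta> y * clear (cluster_set B) {y} s\<bar> \<le> \<bar>\<zeta> y\<bar>" by (simp add: abs_mult mult_left_le)
  then show "\<bar>\<zeta> y * clear (cluster_set B) {y} s\<bar> \<le> \<theta>" using admissibleD(3)[OF assms(1), of y] by linarith
qed

definition joint_set :: "'a set \<Rightarrow> (nat \<times> (nat \<Rightarrow> 'e)) \<times> 'w \<Rightarrow> 'a set" where
  "joint_set B p = cluster_set B (fst p) \<union> Xi (snd p)"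

lemma clear_joint_set: "clear (joint_set B) A p = clear (cluster_set B) A (fst p) * clear Xi A (snd p)"
  by (auto simp: clear_def joint_set_def)

text \<open>A point is vacant for the union exactly if it lies outside the cluster and is vacant for
  \<open>Xi\<close>. Adding independent grains is thus the same as setting the field to zero on
  them.\<close>

lemma vacant_int_joint_set: "vacant_int (joint_set B) \<zeta> p = vacant_int Xi (cut \<zeta> B (fst p)) (snd p)"
  by (simp add: vacant_int_def clear_joint_set cut_def mult_ac)

lemma random_set_joint:
  assumes "finite B" shows "random_set (cluster x \<Otimes>\<^sub>M M) (joint_set B)"
proof -
  have 1: "Measurable.pred (lborel \<Otimes>\<^sub>M (cluster x \<Otimes>\<^sub>M M)) (\<lambda>p. (\<lambda>q. fst q \<in> cluster_set B (snd q)) (fst p, fst (snd p)))"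
    by (rule measurable_compose[OF _ random_set_cluster[OF assms, of x, unfolded random_set_def]]) measurable
  have 2: "Measurable.pred (lborel \<Otimes>\<^sub>M (cluster x \<Otimes>\<^sub>M M)) (\<lambda>p. (\<lambda>q. fst q \<in> Xi (snd q)) (fst p, snd (snd p)))"
    by (rule measurable_compose[OF _ Xi_measurable[unfolded random_set_def]]) measurable
  show ?thesis unfolding random_set_def joint_set_def Un_iff
    using 1 2 by (intro pred_intros_logic) simp_all
qed

lemma pair_prob_cluster: "pair_prob_space (cluster x) M"
proof -
  interpret C: prob_space "cluster x" by (rule prob_space_cluster)
  show ?thesis by unfold_locales
qed

lemma joint_weight:
  assumes \<zeta>: "admissible \<zeta>" and fin: "finite A" "finite D" "finite B"
  defines "f \<equiv> \<lambda>p. clear (cluster_set B) A (fst p) * clear Xi D (snd p) * exp (vacant_int (joint_set B) \<zeta> p)"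
  shows "f \<in> borel_measurable (cluster x \<Otimes>\<^sub>M M)" "integrable (cluster x \<Otimes>\<^sub>M M) f"
proof -
  interpret P: pair_prob_space "cluster x" M by (rule pair_prob_cluster)
  note R = random_set_joint[OF fin(3), of x]
  have [measurable]: "clear (cluster_set B) A \<in> borel_measurable (cluster x)"
      "clear Xi D \<in> borel_measurable M" "vacant_int (joint_set B) \<zeta> \<in> borel_measurable (cluster x \<Otimes>\<^sub>M M)"
    using measurable_clear[OF random_set_cluster] measurable_clear[OF Xi_measurable]
      measurable_vacant_int[OF R] admissibleD[OF \<zeta>] fin by auto
  show m: "f \<in> borel_measurable (cluster x \<Otimes>\<^sub>M M)" unfolding f_def by measurable
  have "\<bar>f p\<bar> \<le> exp (LINT y|lborel. \<bar>\<zeta> y\<bar>)" if "p \<in> space (cluster x \<Otimes>\<^sub>M M)" for p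
  proof -
    have "\<bar>f p\<bar> \<le> 1 * 1 * exp (LINT y|lborel. \<bar>\<zeta> y\<bar>)"
      unfolding f_def abs_mult
      using vacant_int_le[OF R admissibleD(1)[OF \<zeta>] that] by (intro mult_mono) auto
    then show ?thesis by simp
  qed
  then show "integrable (cluster x \<Otimes>\<^sub>M M) f"
    by (rule P.integrable_bounded[OF m])
qed

lemma measurable_Z_cut:
  assumes "admissible \<zeta>" "finite D" "finite B"
  shows "(\<lambda>s. Z (cut \<zeta> B s) D) \<in> borel_measurable (cluster x)"
proof -
  have "(\<lambda>p. clear (cluster_set B) {} (fst p) * clear Xi D (snd p) * exp (vacant_int (joint_set B) \<zeta> p)) \<in> borel_measurable (cluster x \<Otimes>\<^sub>M M)"
    by (rule joint_weight) (use assms in auto)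
  then have "(\<lambda>(s, \<omega>). clear Xi D \<omega> * exp (vacant_int Xi (cut \<zeta> B s) \<omega>)) \<in> borel_measurable (cluster x \<Otimes>\<^sub>M M)"
    by (simp add: vacant_int_joint_set case_prod_beta)
  then show ?thesis unfolding Z_def by (rule M.borel_measurable_lebesgue_integral)
qed

text \<open>Conditioning on \<open>x\<close> being vacant removes the grains through \<open>x\<close>; putting them back as an
  independent Poisson cluster changes the field \<open>\<zeta>\<close> only by cutting out the cluster.\<close>

lemma Z_mixture:
  assumes \<zeta>: "admissible \<zeta>" and A: "finite A" and B: "finite B"
  shows "Z \<zeta> (A \<union> B) = exp (LINT e|\<Lambda>. hit x e * clear S B e) *
    (LINT s|cluster x. clear (cluster_set B) A s * Z (cut \<zeta> B s) (insert x (A \<union> B)))"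
proof -
  interpret P: pair_prob_space "cluster x" M by (rule pair_prob_cluster)
  define c where "c = exp (LINT e|\<Lambda>. hit x e * clear S B e)"
  define D where "D = insert x (A \<union> B)"
  have c1: "1 \<le> c" unfolding c_def by simp
  have D: "finite D" using A B by (simp add: D_def)
  \<comment> \<open>The weight keeps A free of the cluster and
    \<open>insert x (A \<union> B)\<close> free of \<open>Xi\<close>; the cluster avoids B by
    construction. The constant c is the ratio of the void probabilities of B and of
    \<open>insert x B\<close>.\<close>
  define w where "w p = c * (clear (cluster_set B) A (fst p) * clear Xi D (snd p))" for p :: "(nat \<times> (nat \<Rightarrow> 'e)) \<times> 'w"
  have [measurable]: "clear (cluster_set B) F \<in> borel_measurable (cluster x)" "clear Xi F \<in> borel_measurable M" if "finite F" for F
    using that measurable_clear[OF random_set_cluster[OF B]] measurable_clear[OF Xi_measurable] by auto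
  have wm [measurable]: "w \<in> borel_measurable (cluster x \<Otimes>\<^sub>M M)" unfolding w_def using A D by measurable
  have "Z \<zeta> (A \<union> B) = (LINT p|(cluster x \<Otimes>\<^sub>M M). w p * exp (vacant_int (joint_set B) \<zeta> p))"
    unfolding Z_def
  proof (rule exp_vacant_int_cong[where B=c])
    show "finite_measure M" "finite_measure (cluster x \<Otimes>\<^sub>M M)" by unfold_locales
    show "\<bar>clear Xi (A \<union> B) \<omega>\<bar> \<le> c" for \<omega> using order_trans[OF clear_le_1 c1] by simp
    show "\<bar>w p\<bar> \<le> c" for p
      unfolding w_def abs_mult using c1 by (auto simp: clear_def)
    fix F :: "'a set" assume F: "finite F"
    have "(LINT p|(cluster x \<Otimes>\<^sub>M M). w p * clear (joint_set B) F p) =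
      (LINT s|cluster x. LINT \<omega>|M. w (s, \<omega>) * clear (joint_set B) F (s, \<omega>))"
    proof (rule P.integral_fst'[symmetric], rule P.integrable_bounded[where B=c])
      have "(\<lambda>p. clear (joint_set B) F p) \<in> borel_measurable (cluster x \<Otimes>\<^sub>M M)"
        using measurable_clear[OF random_set_joint[OF B] F] .
      then show "(\<lambda>p. w p * clear (joint_set B) F p) \<in> borel_measurable (cluster x \<Otimes>\<^sub>M M)" by measurable
      show "\<bar>w p * clear (joint_set B) F p\<bar> \<le> c" for p
        unfolding w_def abs_mult using c1 by (auto simp: clear_def)
    qed
    also have "\<dots> = (LINT s|cluster x. LINT \<omega>|M. c * clear (cluster_set B) (A \<union> F) s * clear Xi (D \<union> F) \<omega>)"
      by (intro Bochner_Integration.integral_cong) (auto simp: w_def clear_joint_set clear_Un)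
    also have "\<dots> = c * ((LINT s|cluster x. clear (cluster_set B) (A \<union> F) s) * (LINT \<omega>|M. clear Xi (D \<union> F) \<omega>))"
      by simp
    also have "(LINT \<omega>|M. clear Xi (D \<union> F) \<omega>) = exp (- hit_measure (insert x (A \<union> B \<union> F)))"
      using vacancy[of "D \<union> F"] D F by (simp add: D_def)
    \<comment> \<open>The additional term is the mass of the grains through x that miss A, B and F.
      It cancels against the same mass in the vacancy probability of the cluster, and c removes the
      remaining term.\<close>
    also have "hit_measure (insert x (A \<union> B \<union> F)) = hit_measure (A \<union> B \<union> F) + (LINT e|\<Lambda>. hit x e * clear S (B \<union> (A \<union> F)) e)"
      using A B F by (subst hit_measure_insert) (auto simp: Un_ac)
    also have "(LINT s|cluster x. clear (cluster_set B) (A \<union> F) s) =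
       exp ((LINT e|\<Lambda>. hit x e * clear S (B \<union> (A \<union> F)) e) - (LINT e|\<Lambda>. hit x e * clear S B e))"
      using A B F by (intro cluster_vacancy) auto
    finally have "(LINT p|(cluster x \<Otimes>\<^sub>M M). w p * clear (joint_set B) F p) = exp (- hit_measure (A \<union> B \<union> F))"
      by (simp add: c_def flip: exp_add)
    moreover have "(LINT \<omega>|M. clear Xi (A \<union> B) \<omega> * clear Xi F \<omega>) = exp (- hit_measure (A \<union> B \<union> F))"
      using vacancy[of "A \<union> B \<union> F"] A B F by (simp add: clear_Un)
    ultimately show "(LINT \<omega>|M. clear Xi (A \<union> B) \<omega> * clear Xi F \<omega>) = (LINT p|(cluster x \<Otimes>\<^sub>M M). w p * clear (joint_set B) F p)"
      by simp
  qed (use A B Xi_measurable random_set_joint admissibleD[OF \<zeta>] wm in auto)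
  also have "\<dots> = c * (LINT p|(cluster x \<Otimes>\<^sub>M M). clear (cluster_set B) A (fst p) * clear Xi D (snd p) * exp (vacant_int (joint_set B) \<zeta> p))"
    by (simp add: w_def mult_ac)
  also have "(LINT p|(cluster x \<Otimes>\<^sub>M M). clear (cluster_set B) A (fst p) * clear Xi D (snd p) * exp (vacant_int (joint_set B) \<zeta> p)) =
     (LINT s|cluster x. LINT \<omega>|M. clear (cluster_set B) A (fst (s, \<omega>)) * clear Xi D (snd (s, \<omega>)) * exp (vacant_int (joint_set B) \<zeta> (s, \<omega>)))"
    by (rule P.integral_fst'[symmetric], rule joint_weight(2)[OF \<zeta> A D B])
  also have "\<dots> = (LINT s|cluster x. clear (cluster_set B) A s * Z (cut \<zeta> B s) D)"
    unfolding Z_def by (simp add: vacant_int_joint_set mult.assoc)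
  finally show ?thesis by (simp add: c_def D_def)
qed

text \<open>The two fields differ only on the cluster, there by at most \<theta>, and the cluster
  has volume at most \<open>cluster_vol s\<close>.\<close>

lemma vacant_int_cut_diff:
  assumes \<zeta>: "admissible \<zeta>" and B: "finite B" and s: "s \<in> space (cluster x)" and \<omega>: "\<omega> \<in> space M"
  shows "\<bar>vacant_int Xi \<zeta> \<omega> - vacant_int Xi (cut \<zeta> B s) \<omega>\<bar> \<le> \<theta> * cluster_vol s"
proof -
  have C: "cluster_set B s \<in> sets lborel" by (rule random_set_section[OF random_set_cluster[OF B] s])
  have fin: "emeasure lborel (cluster_set B s) < \<infinity>"
    using cluster_set_vol(1)[OF B s] by (rule le_less_trans) simp
  have i: "integrable lborel (\<lambda>x. \<zeta> x * clear Xi {x} \<omega>)" "integrable lborel (\<lambda>x. cut \<zeta> B s x * clear Xi {x} \<omega>)"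
    using integrable_vacant[OF Xi_measurable _ \<omega>] admissibleD(1)[OF \<zeta>] admissibleD(1)[OF cut_admissible[OF \<zeta> B s]] by auto
  have "\<bar>vacant_int Xi \<zeta> \<omega> - vacant_int Xi (cut \<zeta> B s) \<omega>\<bar> =
     \<bar>LINT x|lborel. \<zeta> x * clear Xi {x} \<omega> - cut \<zeta> B s x * clear Xi {x} \<omega>\<bar>"
    using i by (simp add: vacant_int_def)
  also have "\<dots> \<le> (LINT x|lborel. \<bar>\<zeta> x * clear Xi {x} \<omega> - cut \<zeta> B s x * clear Xi {x} \<omega>\<bar>)"
    by (rule integral_abs_bound)
  also have "\<dots> \<le> (LINT x|lborel. \<theta> * indicator (cluster_set B s) x)"
  proof (rule integral_mono)
    show "integrable lborel (\<lambda>x. \<bar>\<zeta> x * clear Xi {x} \<omega> - cut \<zeta> B s x * clear Xi {x} \<omega>\<bar>)"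
      using i by simp
    show "integrable lborel (\<lambda>x. \<theta> * indicator (cluster_set B s) x)"
      using C fin by (intro integrable_mult_right integrable_real_indicator) auto
    show "\<bar>\<zeta> x * clear Xi {x} \<omega> - cut \<zeta> B s x * clear Xi {x} \<omega>\<bar> \<le> \<theta> * indicator (cluster_set B s) x" for x
      using admissibleD(3)[OF \<zeta>, of x] \<theta>_nonneg by (auto simp: cut_def clear_def indicator_def)
  qed
  also have "\<dots> = \<theta> * vol (cluster_set B s)" using C by simp
  also have "\<dots> \<le> \<theta> * cluster_vol s" using cluster_set_vol(2)[OF B s] \<theta>_nonneg by (rule mult_left_mono)
  finally show ?thesis .
qed

lemma Z_cut_bounds:
  assumes \<zeta>: "admissible \<zeta>" and B: "finite B" and D: "finite D" and s: "s \<in> space (cluster x)"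
  shows "exp (- \<theta> * cluster_vol s) * Z \<zeta> D \<le> Z (cut \<zeta> B s) D" "Z (cut \<zeta> B s) D \<le> exp (\<theta> * cluster_vol s) * Z \<zeta> D"
proof -
  let ?T = "\<theta> * cluster_vol s"
  note d = vacant_int_cut_diff[OF \<zeta> B s]
  have 1: "exp (- \<theta> * cluster_vol s) * exp (vacant_int Xi \<zeta> \<omega>) \<le> exp (vacant_int Xi (cut \<zeta> B s) \<omega>)"
    "exp (vacant_int Xi (cut \<zeta> B s) \<omega>) \<le> exp ?T * exp (vacant_int Xi \<zeta> \<omega>)" if "\<omega> \<in> space M" for \<omega>
    using d[OF that] by (auto simp flip: exp_add)
  note i = Z_integrable[OF \<zeta> D] Z_integrable[OF cut_admissible[OF \<zeta> B s] D]
  have "exp (- \<theta> * cluster_vol s) * Z \<zeta> D = (LINT \<omega>|M. exp (- \<theta> * cluster_vol s) * (clear Xi D \<omega> * exp (vacant_int Xi \<zeta> \<omega>)))"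
    by (simp add: Z_def)
  also have "\<dots> \<le> Z (cut \<zeta> B s) D" unfolding Z_def
    by (intro integral_mono integrable_mult_right i) (use 1 in \<open>auto simp: clear_def\<close>)
  finally show "exp (- \<theta> * cluster_vol s) * Z \<zeta> D \<le> Z (cut \<zeta> B s) D" .
  have "Z (cut \<zeta> B s) D \<le> (LINT \<omega>|M. exp ?T * (clear Xi D \<omega> * exp (vacant_int Xi \<zeta> \<omega>)))" unfolding Z_def
    by (intro integral_mono integrable_mult_right i) (use 1 in \<open>auto simp: clear_def\<close>)
  then show "Z (cut \<zeta> B s) D \<le> exp ?T * Z \<zeta> D" by (simp add: Z_def)
qed

text \<open>The tilted mass of the grains that contain both points. With c = \<theta> it is, up to a
  constant, the direct influence of one point on the other; with c = - \<theta> it serves in lower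
  bounds.\<close>

definition overlap :: "real \<Rightarrow> 'a \<Rightarrow> 'a \<Rightarrow> ennreal" where
  "overlap c x y = (\<integral>\<^sup>+e. ennreal (hit x e * hit y e * exp (c * vol (S e))) \<partial>\<Lambda>)"

text \<open>By exp u \<le> 1 + u exp u the tilted mass of the grains through x is at most l +
  \<theta> \<kappa>, so the moment that defines \<kappa> suffices.\<close>

lemma integrable_hit_exp:
  assumes "c \<le> \<theta>"
  shows "integrable \<Lambda> (\<lambda>e. hit x e * exp (c * vol (S e)))"
proof (rule Bochner_Integration.integrable_bound[of _ "\<lambda>e. hit x e + \<theta> * (hit x e * (vol (S e) * exp (\<theta> * vol (S e))))"])
  show "integrable \<Lambda> (\<lambda>e. hit x e + \<theta> * (hit x e * (vol (S e) * exp (\<theta> * vol (S e)))))"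
    using hit_integral(1) \<kappa>_integral[of x] by (auto simp: has_bochner_integral_iff)
  show "AE e in \<Lambda>. norm (hit x e * exp (c * vol (S e))) \<le> norm (hit x e + \<theta> * (hit x e * (vol (S e) * exp (\<theta> * vol (S e)))))"
  proof (rule AE_I2)
    fix e
    have "exp (c * vol (S e)) \<le> exp (\<theta> * vol (S e))" using assms by (simp add: mult_right_mono)
    also have "\<dots> \<le> 1 + (\<theta> * vol (S e)) * exp (\<theta> * vol (S e))" by (rule exp_le_1_plus_mult_exp)
    finally have "hit x e * exp (c * vol (S e)) \<le> hit x e * (1 + (\<theta> * vol (S e)) * exp (\<theta> * vol (S e)))"
      by (intro mult_left_mono) auto
    then show "norm (hit x e * exp (c * vol (S e))) \<le> norm (hit x e + \<theta> * (hit x e * (vol (S e) * exp (\<theta> * vol (S e)))))"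
      using \<theta>_nonneg by (simp add: algebra_simps abs_mult)
  qed
qed simp

lemma integrable_hit_exp_mult:
  assumes c: "c \<le> \<theta>" and [measurable]: "f \<in> borel_measurable \<Lambda>" and f: "\<And>e. 0 \<le> f e" "\<And>e. f e \<le> 1"
  shows "integrable \<Lambda> (\<lambda>e. hit x e * (exp (c * vol (S e)) * f e))"
proof (rule Bochner_Integration.integrable_bound[OF integrable_hit_exp[OF c, of x]])
  show "AE e in \<Lambda>. norm (hit x e * (exp (c * vol (S e)) * f e)) \<le> norm (hit x e * exp (c * vol (S e)))"
    using f by (auto simp: abs_mult intro!: AE_I2 mult_left_mono mult_left_le)
qed simp

text \<open>These differences are the logarithms of the means of
  \<open>exp (\<theta> * cluster_vol s)\<close> and \<open>exp (- \<theta> * cluster_vol s)\<close>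
  over the cluster. Both stay within \<theta> \<kappa> of 0, so every comparison with a cut field
  costs a bounded factor.\<close>

lemma hit_exp_bounds:
  shows "(LINT e|\<Lambda>. hit x e * exp (\<theta> * vol (S e))) - l \<le> \<theta> * \<kappa>"
    and "- (\<theta> * \<kappa>) \<le> (LINT e|\<Lambda>. hit x e * exp (- \<theta> * vol (S e))) - l"
proof -
  note i = integrable_hit_exp[of \<theta> x] integrable_hit_exp[of "-\<theta>" x] hit_integral(1)[of x]
  have k: "integrable \<Lambda> (\<lambda>e. \<theta> * (hit x e * (vol (S e) * exp (\<theta> * vol (S e)))))"
    "(LINT e|\<Lambda>. \<theta> * (hit x e * (vol (S e) * exp (\<theta> * vol (S e))))) = \<theta> * \<kappa>"
    using \<kappa>_integral[of x] by (auto simp: has_bochner_integral_iff)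
  have "(LINT e|\<Lambda>. hit x e * exp (\<theta> * vol (S e))) - l = (LINT e|\<Lambda>. hit x e * exp (\<theta> * vol (S e)) - hit x e)"
    using i by (simp add: hit_integral)
  also have "\<dots> \<le> (LINT e|\<Lambda>. \<theta> * (hit x e * (vol (S e) * exp (\<theta> * vol (S e)))))"
  proof (rule integral_mono)
    show "hit x e * exp (\<theta> * vol (S e)) - hit x e \<le> \<theta> * (hit x e * (vol (S e) * exp (\<theta> * vol (S e))))" for e
      using mult_left_mono[OF exp_le_1_plus_mult_exp[of "\<theta> * vol (S e)"], of "hit x e"] by (simp add: algebra_simps)
  qed (use i k in auto)
  finally show "(LINT e|\<Lambda>. hit x e * exp (\<theta> * vol (S e))) - l \<le> \<theta> * \<kappa>" by (simp only: k(2))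
  have "l - (LINT e|\<Lambda>. hit x e * exp (- \<theta> * vol (S e))) = (LINT e|\<Lambda>. hit x e - hit x e * exp (- \<theta> * vol (S e)))"
    using i \<theta>_nonneg by (simp add: hit_integral)
  also have "\<dots> \<le> (LINT e|\<Lambda>. \<theta> * (hit x e * (vol (S e) * exp (\<theta> * vol (S e)))))"
  proof (rule integral_mono)
    fix e
    have "1 - exp (- \<theta> * vol (S e)) \<le> \<theta> * vol (S e)" using exp_ge_add_one_self[of "- \<theta> * vol (S e)"] by simp
    also have "\<dots> * 1 \<le> \<theta> * vol (S e) * exp (\<theta> * vol (S e))" by (intro mult_left_mono) (use \<theta>_nonneg in auto)
    finally have "hit x e * (1 - exp (- \<theta> * vol (S e))) \<le> hit x e * (\<theta> * vol (S e) * exp (\<theta> * vol (S e)))"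
      by (intro mult_left_mono) auto
    then show "hit x e - hit x e * exp (- \<theta> * vol (S e)) \<le> \<theta> * (hit x e * (vol (S e) * exp (\<theta> * vol (S e))))"
      by (simp add: algebra_simps)
  qed (use i k \<theta>_nonneg in auto)
  finally have "l - (LINT e|\<Lambda>. hit x e * exp (- \<theta> * vol (S e))) \<le> \<theta> * \<kappa>" by (simp only: k(2))
  then show "- (\<theta> * \<kappa>) \<le> (LINT e|\<Lambda>. hit x e * exp (- \<theta> * vol (S e))) - l" by linarith
qed

lemma cluster_exp:
  assumes c: "c \<le> \<theta>"
  shows "has_bochner_integral (cluster x) (\<lambda>s. exp (c * cluster_vol s)) (exp ((LINT e|\<Lambda>. hit x e * exp (c * vol (S e))) - l))"
  unfolding exp_cluster_vol
  by (rule cluster_pgfl) (use integrable_hit_exp[OF c] in auto)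

text \<open>Volume weight and vacancy are both products over the grains, so a single generating
  functional evaluates them jointly; the second integral in the exponent belongs to the grains that
  miss B and contain y.\<close>

lemma cluster_exp_clear:
  assumes c: "c \<le> \<theta>" and B: "finite B"
  shows "has_bochner_integral (cluster x) (\<lambda>s. exp (c * cluster_vol s) * clear (cluster_set B) {y} s)
     (exp ((LINT e|\<Lambda>. hit x e * exp (c * vol (S e))) - (LINT e|\<Lambda>. hit x e * (exp (c * vol (S e)) * (clear S B e * hit y e))) - l))"
proof -
  let ?f = "\<lambda>e. exp (c * vol (S e)) * (1 - clear S B e * hit y e)"
  have b: "0 \<le> 1 - clear S B e * hit y e" "1 - clear S B e * hit y e \<le> 1" for e by (auto simp: clear_def)
  have B': "clear S B \<in> borel_measurable \<Lambda>" by (rule measurable_clear_S[OF B])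
  have eq: "exp (c * cluster_vol s) * clear (cluster_set B) {y} s = (\<Prod>i<fst s. ?f (snd s i))" for s
    by (simp add: exp_cluster_vol clear_cluster_set prod.distrib hit_def)
  have "has_bochner_integral (cluster x) (\<lambda>s. \<Prod>i<fst s. ?f (snd s i)) (exp ((LINT e|\<Lambda>. hit x e * ?f e) - l))"
    by (rule cluster_pgfl) (use b B' integrable_hit_exp_mult[OF c] in auto)
  also have "(LINT e|\<Lambda>. hit x e * ?f e) = (LINT e|\<Lambda>. hit x e * exp (c * vol (S e)) - hit x e * (exp (c * vol (S e)) * (clear S B e * hit y e)))"
    by (simp add: algebra_simps)
  also have "\<dots> = (LINT e|\<Lambda>. hit x e * exp (c * vol (S e))) - (LINT e|\<Lambda>. hit x e * (exp (c * vol (S e)) * (clear S B e * hit y e)))"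
    using integrable_hit_exp[OF c, of x] integrable_hit_exp_mult[OF c, of "\<lambda>e. clear S B e * hit y e" x] B'
    by (intro Bochner_Integration.integral_diff) (auto simp: mult_le_one)
  finally show ?thesis unfolding eq by simp
qed

lemma overlap_eq:
  assumes "c \<le> \<theta>"
  shows "overlap c x y = ennreal (LINT e|\<Lambda>. hit x e * (exp (c * vol (S e)) * hit y e))"
  unfolding overlap_def
  using integrable_hit_exp_mult[OF assms, of "hit y" x]
  by (subst nn_integral_eq_integral[symmetric]) (auto simp: mult_ac)

text \<open>The weighted mean over clusters that reach y is a difference of two generating
  functionals, exp (b - l) (1 - exp (- d)). The bound 1 - exp (- d) \<le> d makes it linear in the
  mass of the grains through both points; dropping the condition that they miss B only enlarges this
  mass.\<close>

lemma cluster_exp_covered: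
  assumes B: "finite B"
  shows "(\<integral>\<^sup>+s. ennreal (exp (\<theta> * cluster_vol s) * (1 - clear (cluster_set B) {y} s)) \<partial>cluster x)
     \<le> ennreal (exp (\<theta> * \<kappa>)) * overlap \<theta> x y"
proof -
  define b where "b = (LINT e|\<Lambda>. hit x e * exp (\<theta> * vol (S e)))"
  define d where "d = (LINT e|\<Lambda>. hit x e * (exp (\<theta> * vol (S e)) * (clear S B e * hit y e)))"
  define d' where "d' = (LINT e|\<Lambda>. hit x e * (exp (\<theta> * vol (S e)) * hit y e))"
  have B': "clear S B \<in> borel_measurable \<Lambda>" by (rule measurable_clear_S[OF B])
  have d0: "0 \<le> d'" unfolding d'_def by simp
  have dd: "d \<le> d'" unfolding d_def d'_def
    by (intro integral_mono integrable_hit_exp_mult mult_left_mono)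
       (use B' in \<open>auto simp: mult_le_one mult_left_le_one_le\<close>)
  note h1 = cluster_exp[of \<theta> x, folded b_def] and h2 = cluster_exp_clear[OF _ B, of \<theta> x y, folded b_def d_def]
  have "has_bochner_integral (cluster x) (\<lambda>s. exp (\<theta> * cluster_vol s) - exp (\<theta> * cluster_vol s) * clear (cluster_set B) {y} s)
     (exp (b - l) - exp (b - d - l))"
    using h1 h2 by (intro has_bochner_integral_diff) auto
  then have "has_bochner_integral (cluster x) (\<lambda>s. exp (\<theta> * cluster_vol s) * (1 - clear (cluster_set B) {y} s)) (exp (b - l) - exp (b - d - l))"
    by (simp add: algebra_simps)
  then have "(\<integral>\<^sup>+s. ennreal (exp (\<theta> * cluster_vol s) * (1 - clear (cluster_set B) {y} s)) \<partial>cluster x) = ennreal (exp (b - l) - exp (b - d - l))"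
    by (subst nn_integral_eq_integral) (auto simp: has_bochner_integral_iff)
  also have "\<dots> \<le> ennreal (exp (\<theta> * \<kappa>) * d')"
  proof (rule ennreal_leI)
    have "exp (b - l) - exp (b - d - l) = exp (b - l) * (1 - exp (- d))"
      by (simp add: right_diff_distrib flip: exp_add)
    also have "\<dots> \<le> exp (b - l) * d'"
    proof (rule mult_left_mono)
      show "1 - exp (- d) \<le> d'" using exp_ge_add_one_self[of "-d"] dd by linarith
    qed simp
    also have "\<dots> \<le> exp (\<theta> * \<kappa>) * d'"
      using hit_exp_bounds(1)[of x] d0 by (intro mult_right_mono) (auto simp: b_def)
    finally show "exp (b - l) - exp (b - d - l) \<le> exp (\<theta> * \<kappa>) * d'" .
  qed
  also have "\<dots> = ennreal (exp (\<theta> * \<kappa>)) * overlap \<theta> x y"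
    using d0 by (simp add: overlap_eq ennreal_mult d'_def)
  finally show ?thesis .
qed

end

lemma nn_integral_lborel_shift:
  fixes f :: "'a::euclidean_space \<Rightarrow> ennreal"
  assumes "f \<in> borel_measurable lborel"
  shows "(\<integral>\<^sup>+x. f (t + x) \<partial>lborel) = (\<integral>\<^sup>+x. f x \<partial>lborel)"
proof -
  have "(\<integral>\<^sup>+x. f x \<partial>lborel) = (\<integral>\<^sup>+x. f x \<partial>distr lborel borel ((+) t))"
    by (simp add: lborel_distr_plus)
  also have "\<dots> = (\<integral>\<^sup>+x. f (t + x) \<partial>lborel)"
    using assms by (subst nn_integral_distr) auto
  finally show ?thesis by simp
qed

context boolean_model
begin

section \<open>The influence as an average over clusters\<close>

lemma cluster_Z_integrable:
  assumes \<zeta>: "admissible \<zeta>" and B: "finite B" and D: "finite D"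
  shows "integrable (cluster x) (\<lambda>s. Z (cut \<zeta> B s) D)"
proof (rule Bochner_Integration.integrable_bound[of _ "\<lambda>s. exp (\<theta> * cluster_vol s) * Z \<zeta> D"])
  show "integrable (cluster x) (\<lambda>s. exp (\<theta> * cluster_vol s) * Z \<zeta> D)"
    using cluster_exp[of \<theta> x] by (auto simp: has_bochner_integral_iff)
  show "(\<lambda>s. Z (cut \<zeta> B s) D) \<in> borel_measurable (cluster x)" by (rule measurable_Z_cut) fact+
  show "AE s in cluster x. norm (Z (cut \<zeta> B s) D) \<le> norm (exp (\<theta> * cluster_vol s) * Z \<zeta> D)"
    using Z_cut_bounds(2)[OF \<zeta> B D] Z_pos[OF cut_admissible[OF \<zeta> B] D] Z_pos[OF \<zeta> D]
    by (auto intro!: AE_I2 simp: less_imp_le abs_mult)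
qed

text \<open>The normalising constant of the mixture: up to a factor that depends on x and B alone it
  equals \<open>Z \<zeta> B\<close>.\<close>

definition cluster_weight :: "('a \<Rightarrow> real) \<Rightarrow> 'a set \<Rightarrow> 'a \<Rightarrow> real" where
  "cluster_weight \<zeta> B x = (LINT s|cluster x. Z (cut \<zeta> B s) (insert x B))"

lemma cluster_weight_ge:
  assumes \<zeta>: "admissible \<zeta>" and B: "finite B"
  shows "exp (- (\<theta> * \<kappa>)) * Z \<zeta> (insert x B) \<le> cluster_weight \<zeta> B x" "0 < cluster_weight \<zeta> B x"
proof -
  let ?D = "insert x B"
  have D: "finite ?D" using B by simp
  have th: "- \<theta> \<le> \<theta>" using \<theta>_nonneg by simp
  have i: "integrable (cluster x) (\<lambda>s. exp (- \<theta> * cluster_vol s))"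
    and v: "(LINT s|cluster x. exp (- \<theta> * cluster_vol s)) = exp ((LINT e|\<Lambda>. hit x e * exp (- \<theta> * vol (S e))) - l)"
    using cluster_exp[OF th, of x] by (auto simp only: has_bochner_integral_iff)
  have "exp (- (\<theta> * \<kappa>)) * Z \<zeta> ?D \<le> (LINT s|cluster x. exp (- \<theta> * cluster_vol s)) * Z \<zeta> ?D"
    unfolding v using hit_exp_bounds(2)[of x] Z_pos[OF \<zeta> D] by (intro mult_right_mono) auto
  also have "\<dots> = (LINT s|cluster x. exp (- \<theta> * cluster_vol s) * Z \<zeta> ?D)"
    by (rule integral_mult_left_zero[symmetric])
  also have "\<dots> \<le> cluster_weight \<zeta> B x"
    unfolding cluster_weight_def
    by (rule integral_mono[OF integrable_mult_left[OF i] cluster_Z_integrable[OF \<zeta> B D]])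
       (rule Z_cut_bounds(1)[OF \<zeta> B D])
  finally show 1: "exp (- (\<theta> * \<kappa>)) * Z \<zeta> ?D \<le> cluster_weight \<zeta> B x" .
  show "0 < cluster_weight \<zeta> B x"
    by (rule less_le_trans[OF _ 1]) (use Z_pos[OF \<zeta> D] in simp)
qed

lemma integrable_cluster_term:
  assumes \<zeta>: "admissible \<zeta>" and B: "finite B" and D: "finite D"
  shows "integrable (cluster x) (\<lambda>s. Z (cut \<zeta> B s) D * (clear (cluster_set B) {y} s * rho (cut \<zeta> B s) D y))"
proof (rule Bochner_Integration.integrable_bound[OF cluster_Z_integrable[OF \<zeta> B D, of x]])
  show "(\<lambda>s. Z (cut \<zeta> B s) D * (clear (cluster_set B) {y} s * rho (cut \<zeta> B s) D y)) \<in> borel_measurable (cluster x)"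
    unfolding rho_def
    using measurable_Z_cut[OF \<zeta> D B, of x] measurable_Z_cut[OF \<zeta> finite.insertI[OF D] B, of y x]
      measurable_clear_point[OF random_set_cluster[OF B, of x], of y]
    by simp
  show "AE s in cluster x. norm (Z (cut \<zeta> B s) D * (clear (cluster_set B) {y} s * rho (cut \<zeta> B s) D y)) \<le> norm (Z (cut \<zeta> B s) D)"
  proof (rule AE_I2)
    fix s assume s: "s \<in> space (cluster x)"
    have "\<bar>clear (cluster_set B) {y} s * rho (cut \<zeta> B s) D y\<bar> \<le> 1 * 1"
      unfolding abs_mult using rho_bounds[OF cut_admissible[OF \<zeta> B s] D, of y] by (intro mult_mono) auto
    then show "norm (Z (cut \<zeta> B s) D * (clear (cluster_set B) {y} s * rho (cut \<zeta> B s) D y)) \<le> norm (Z (cut \<zeta> B s) D)"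
      unfolding real_norm_def abs_mult[of "Z (cut \<zeta> B s) D"] by (intro mult_left_le) auto
  qed
qed

text \<open>Both \<open>Z \<zeta> (insert y B)\<close> and \<open>Z \<zeta> B\<close> are mixtures
  with the same weights, and their common prefactor cancels. What remains compares two probabilities
  under the same conditioning set D: they differ only if the cluster covers y or through the cut in
  the field.\<close>

lemma rho_mixture:
  fixes x :: 'a
  assumes \<zeta>: "admissible \<zeta>" and B: "finite B"
  defines "D \<equiv> insert x B"
  shows "rho \<zeta> D y - rho \<zeta> B y =
    (LINT s|cluster x. Z (cut \<zeta> B s) D * (rho \<zeta> D y - clear (cluster_set B) {y} s * rho (cut \<zeta> B s) D y)) / cluster_weight \<zeta> B x"
proof -
  let ?c = "exp (LINT e|\<Lambda>. hit x e * clear S B e)"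
  let ?w = "cluster_weight \<zeta> B x"
  have D: "finite D" using B by (simp add: D_def)
  have w: "0 < ?w" by (rule cluster_weight_ge[OF \<zeta> B])
  have 1: "Z \<zeta> B = ?c * ?w"
    using Z_mixture[OF \<zeta> _ B, of "{}" x] by (simp add: cluster_weight_def D_def)
  have "Z \<zeta> (insert y B) = ?c * (LINT s|cluster x. clear (cluster_set B) {y} s * Z (cut \<zeta> B s) (insert y D))"
    using Z_mixture[OF \<zeta> _ B, of "{y}" x] by (simp add: D_def insert_commute)
  also have "(LINT s|cluster x. clear (cluster_set B) {y} s * Z (cut \<zeta> B s) (insert y D)) =
     (LINT s|cluster x. Z (cut \<zeta> B s) D * (clear (cluster_set B) {y} s * rho (cut \<zeta> B s) D y))"
  proof (intro Bochner_Integration.integral_cong refl)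
    fix s assume s: "s \<in> space (cluster x)"
    show "clear (cluster_set B) {y} s * Z (cut \<zeta> B s) (insert y D) = Z (cut \<zeta> B s) D * (clear (cluster_set B) {y} s * rho (cut \<zeta> B s) D y)"
      using Z_pos[OF cut_admissible[OF \<zeta> B s] D] by (simp add: rho_def)
  qed
  finally have 2: "rho \<zeta> B y = (LINT s|cluster x. Z (cut \<zeta> B s) D * (clear (cluster_set B) {y} s * rho (cut \<zeta> B s) D y)) / ?w"
    unfolding rho_def[of \<zeta> B y] 1 by simp
  have "(LINT s|cluster x. Z (cut \<zeta> B s) D * (rho \<zeta> D y - clear (cluster_set B) {y} s * rho (cut \<zeta> B s) D y)) =
     (LINT s|cluster x. rho \<zeta> D y * Z (cut \<zeta> B s) D - Z (cut \<zeta> B s) D * (clear (cluster_set B) {y} s * rho (cut \<zeta> B s) D y))"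
    by (intro Bochner_Integration.integral_cong) (auto simp: algebra_simps)
  also have "\<dots> = rho \<zeta> D y * ?w - (LINT s|cluster x. Z (cut \<zeta> B s) D * (clear (cluster_set B) {y} s * rho (cut \<zeta> B s) D y))"
    using cluster_Z_integrable[OF \<zeta> B D, of x] integrable_cluster_term[OF \<zeta> B D, of x y]
    by (simp add: cluster_weight_def D_def)
  finally show ?thesis using w by (simp add: 2 diff_divide_distrib)
qed

text \<open>One factor exp (\<theta> \<kappa>) bounds the tilted mean over the cluster, a second one
  the loss in the normalising constant.\<close>

definition kernel :: "'a \<Rightarrow> 'a \<Rightarrow> ennreal" where
  "kernel x y = ennreal (exp (2 * \<theta> * \<kappa>)) * overlap \<theta> x y"

definition measurable_kernel :: "('a \<Rightarrow> 'a \<Rightarrow> ennreal) \<Rightarrow> bool" where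
  "measurable_kernel \<Psi> \<longleftrightarrow> (\<lambda>p. \<Psi> (fst p) (snd p)) \<in> borel_measurable (lborel \<Otimes>\<^sub>M lborel)"

section \<open>Measurability and mass of the kernels\<close>

lemma measurable_kernelD:
  assumes "measurable_kernel \<Psi>"
  shows "(\<lambda>x. \<Psi> x y) \<in> borel_measurable lborel" "(\<lambda>y. \<Psi> x y) \<in> borel_measurable lborel"
proof -
  have "(\<lambda>x. (\<lambda>p. \<Psi> (fst p) (snd p)) (x, y)) \<in> borel_measurable lborel"
    by (rule measurable_compose[OF _ assms[unfolded measurable_kernel_def]]) simp
  then show "(\<lambda>x. \<Psi> x y) \<in> borel_measurable lborel" by simp
  have "(\<lambda>y. (\<lambda>p. \<Psi> (fst p) (snd p)) (x, y)) \<in> borel_measurable lborel"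
    by (rule measurable_compose[OF _ assms[unfolded measurable_kernel_def]]) simp
  then show "(\<lambda>y. \<Psi> x y) \<in> borel_measurable lborel" by simp
qed

lemma measurable_hit_pair: "(\<lambda>p. hit (fst p) (snd p)) \<in> borel_measurable (lborel \<Otimes>\<^sub>M \<Lambda>)"
  unfolding hit_def using measurable_clear_pair[OF S_measurable] by simp

lemma measurable_overlap: "measurable_kernel (overlap c)"
proof -
  have 1: "(\<lambda>q. (\<lambda>p. hit (fst p) (snd p)) (fst (fst q), snd q)) \<in> borel_measurable ((lborel \<Otimes>\<^sub>M lborel) \<Otimes>\<^sub>M \<Lambda>)"
    by (rule measurable_compose[OF _ measurable_hit_pair]) measurable
  have 2: "(\<lambda>q. (\<lambda>p. hit (fst p) (snd p)) (snd (fst q), snd q)) \<in> borel_measurable ((lborel \<Otimes>\<^sub>M lborel) \<Otimes>\<^sub>M \<Lambda>)"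
    by (rule measurable_compose[OF _ measurable_hit_pair]) measurable
  have "(\<lambda>q. ennreal (hit (fst (fst q)) (snd q) * hit (snd (fst q)) (snd q) * exp (c * vol (S (snd q)))))
     \<in> borel_measurable ((lborel \<Otimes>\<^sub>M lborel) \<Otimes>\<^sub>M \<Lambda>)"
    using 1 2 measurable_compose[OF measurable_snd measurable_vol_S]
    by (intro measurable_compose[OF _ measurable_ennreal] borel_measurable_times) simp_all
  then have "(\<lambda>(p, e). ennreal (hit (fst p) e * hit (snd p) e * exp (c * vol (S e)))) \<in> borel_measurable ((lborel \<Otimes>\<^sub>M lborel) \<Otimes>\<^sub>M \<Lambda>)"
    by (simp add: split_beta')
  then show ?thesis unfolding measurable_kernel_def overlap_def
    by (rule borel_measurable_nn_integral)
qed

lemma measurable_ker: "measurable_kernel kernel"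
  using measurable_overlap[of \<theta>] unfolding measurable_kernel_def kernel_def by measurable

lemma measurable_kernel_compose:
  assumes "measurable_kernel k1" "measurable_kernel k2"
  shows "measurable_kernel (\<lambda>x y. \<integral>\<^sup>+x'. k1 x x' * k2 x' y \<partial>lborel)"
proof -
  have 1: "(\<lambda>q. (\<lambda>p. k1 (fst p) (snd p)) (fst (fst q), snd q)) \<in> borel_measurable ((lborel \<Otimes>\<^sub>M lborel) \<Otimes>\<^sub>M lborel)"
    by (rule measurable_compose[OF _ assms(1)[unfolded measurable_kernel_def]]) measurable
  have 2: "(\<lambda>q. (\<lambda>p. k2 (fst p) (snd p)) (snd q, snd (fst q))) \<in> borel_measurable ((lborel \<Otimes>\<^sub>M lborel) \<Otimes>\<^sub>M lborel)"
    by (rule measurable_compose[OF _ assms(2)[unfolded measurable_kernel_def]]) measurable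
  have "(\<lambda>(p, x'). k1 (fst p) x' * k2 x' (snd p)) \<in> borel_measurable ((lborel \<Otimes>\<^sub>M lborel) \<Otimes>\<^sub>M lborel)"
    unfolding split_beta' using 1 2 by (intro borel_measurable_times_ennreal) simp_all
  then show ?thesis unfolding measurable_kernel_def
    by (rule lborel.borel_measurable_nn_integral)
qed

text \<open>After exchange of the integrations the second point ranges over the whole grain and
  contributes its volume.\<close>

lemma nn_integral_overlap_vol: "(\<integral>\<^sup>+y. overlap c x y \<partial>lborel) = (\<integral>\<^sup>+e. ennreal (hit x e * (vol (S e) * exp (c * vol (S e)))) \<partial>\<Lambda>)"
proof -
  interpret P: pair_sigma_finite lborel \<Lambda> ..
  have 1: "(\<lambda>p. hit x (snd p)) \<in> borel_measurable (lborel \<Otimes>\<^sub>M \<Lambda>)"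
    by (rule measurable_compose[OF measurable_snd]) simp
  have "(\<lambda>p. ennreal (hit x (snd p) * hit (fst p) (snd p) * exp (c * vol (S (snd p))))) \<in> borel_measurable (lborel \<Otimes>\<^sub>M \<Lambda>)"
    using measurable_hit_pair 1 by measurable
  then have "(\<lambda>(y, e). ennreal (hit x e * hit y e * exp (c * vol (S e)))) \<in> borel_measurable (lborel \<Otimes>\<^sub>M \<Lambda>)"
    by (simp add: split_beta')
  from P.Fubini'[OF this]
  have "(\<integral>\<^sup>+y. overlap c x y \<partial>lborel) = (\<integral>\<^sup>+e. \<integral>\<^sup>+y. ennreal (hit x e * hit y e * exp (c * vol (S e))) \<partial>lborel \<partial>\<Lambda>)"
    by (simp add: overlap_def)
  also have "\<dots> = (\<integral>\<^sup>+e. ennreal (hit x e * (vol (S e) * exp (c * vol (S e)))) \<partial>\<Lambda>)"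
  proof (rule nn_integral_cong)
    fix e assume e: "e \<in> space \<Lambda>"
    have S: "S e \<in> sets lborel" by (rule random_set_section[OF S_measurable e])
    have "(\<integral>\<^sup>+y. ennreal (hit x e * hit y e * exp (c * vol (S e))) \<partial>lborel) =
      (\<integral>\<^sup>+y. ennreal (hit x e * exp (c * vol (S e))) * indicator (S e) y \<partial>lborel)"
      by (intro nn_integral_cong) (auto simp: hit_eq indicator_def)
    also have "\<dots> = ennreal (hit x e * exp (c * vol (S e))) * emeasure lborel (S e)"
      by (rule nn_integral_cmult_indicator[OF S])
    also have "emeasure lborel (S e) = ennreal (vol (S e))"
      using finite_grain[OF e] by (simp add: emeasure_eq_ennreal_measure less_top)
    finally show "(\<integral>\<^sup>+y. ennreal (hit x e * hit y e * exp (c * vol (S e))) \<partial>lborel) = ennreal (hit x e * (vol (S e) * exp (c * vol (S e))))"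
      by (simp add: mult_ac flip: ennreal_mult)
  qed
  finally show ?thesis .
qed

lemma nn_integral_overlap: "(\<integral>\<^sup>+y. overlap \<theta> x y \<partial>lborel) = ennreal \<kappa>"
  unfolding nn_integral_overlap_vol
  using \<kappa>_integral[of x] by (subst nn_integral_eq_integral) (auto simp: has_bochner_integral_iff)

definition K :: real where "K = exp (2 * \<theta> * \<kappa>) * \<kappa>"

lemma K_nonneg: "0 \<le> K" by (simp add: K_def \<kappa>_nonneg)

lemma nn_integral_kernel: "(\<integral>\<^sup>+y. kernel x y \<partial>lborel) = ennreal K"
  unfolding kernel_def K_def using measurable_kernelD(2)[OF measurable_overlap]
  by (simp add: nn_integral_cmult nn_integral_overlap ennreal_mult \<kappa>_nonneg)

lemma cut_influence:
  assumes \<Psi>: "influence_bound \<Psi>" "measurable_kernel \<Psi>" and \<zeta>: "admissible \<zeta>" and B: "finite B" and D: "finite D"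
    and s: "s \<in> space (cluster x)"
  shows "ennreal \<bar>rho \<zeta> D y - rho (cut \<zeta> B s) D y\<bar> \<le>
     ennreal \<theta> * (\<integral>\<^sup>+x'. ennreal (1 - clear (cluster_set B) {x'} s) * \<Psi> x' y \<partial>lborel)"
proof -
  have "ennreal \<bar>rho \<zeta> D y - rho (cut \<zeta> B s) D y\<bar> \<le> (\<integral>\<^sup>+x'. ennreal \<bar>\<zeta> x' - cut \<zeta> B s x'\<bar> * \<Psi> x' y \<partial>lborel)"
    by (rule rho_field_diff[OF \<Psi>(1) \<zeta> cut_admissible[OF \<zeta> B s] D])
  also have "\<dots> \<le> (\<integral>\<^sup>+x'. ennreal \<theta> * (ennreal (1 - clear (cluster_set B) {x'} s) * \<Psi> x' y) \<partial>lborel)"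
  proof (rule nn_integral_mono)
    fix x'
    have "\<bar>\<zeta> x' - cut \<zeta> B s x'\<bar> \<le> \<theta> * (1 - clear (cluster_set B) {x'} s)"
      using admissibleD(3)[OF \<zeta>, of x'] by (auto simp: cut_def clear_def)
    then have "ennreal \<bar>\<zeta> x' - cut \<zeta> B s x'\<bar> \<le> ennreal \<theta> * ennreal (1 - clear (cluster_set B) {x'} s)"
      using \<theta>_nonneg by (simp add: ennreal_leI flip: ennreal_mult)
    then show "ennreal \<bar>\<zeta> x' - cut \<zeta> B s x'\<bar> * \<Psi> x' y \<le> ennreal \<theta> * (ennreal (1 - clear (cluster_set B) {x'} s) * \<Psi> x' y)"
      unfolding mult.assoc[symmetric] by (rule mult_right_mono) simp
  qed
  also have "\<dots> = ennreal \<theta> * (\<integral>\<^sup>+x'. ennreal (1 - clear (cluster_set B) {x'} s) * \<Psi> x' y \<partial>lborel)"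
    using measurable_clear_section[OF random_set_cluster[OF B] s] measurable_kernelD(1)[OF \<Psi>(2)]
    by (intro nn_integral_cmult) simp
  finally show ?thesis .
qed

text \<open>The cluster has to cover some x', which has weighted mean at most a multiple of
  \<open>overlap \<theta> x x'\<close>, and the field removed at x' acts on y through \<Psi>.
  Tonelli separates the two effects.\<close>

lemma cluster_influence:
  assumes \<Psi>: "influence_bound \<Psi>" "measurable_kernel \<Psi>" and \<zeta>: "admissible \<zeta>" and B: "finite B" and D: "finite D"
  shows "(\<integral>\<^sup>+s. ennreal (exp (\<theta> * cluster_vol s)) * ennreal \<bar>rho \<zeta> D y - rho (cut \<zeta> B s) D y\<bar> \<partial>cluster x)
    \<le> ennreal \<theta> * (ennreal (exp (\<theta> * \<kappa>)) * (\<integral>\<^sup>+x'. overlap \<theta> x x' * \<Psi> x' y \<partial>lborel))"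
proof -
  interpret C: prob_space "cluster x" by (rule prob_space_cluster)
  interpret P: pair_sigma_finite lborel "cluster x" ..
  have cl: "(\<lambda>p. clear (cluster_set B) {fst p} (snd p)) \<in> borel_measurable (lborel \<Otimes>\<^sub>M cluster x)"
    by (rule measurable_clear_pair[OF random_set_cluster[OF B]])
  have ve: "(\<lambda>s. exp (\<theta> * cluster_vol s)) \<in> borel_measurable (cluster x)"
    using measurable_cluster_vol[of x] by measurable
  have psi: "(\<lambda>x'. \<Psi> x' y) \<in> borel_measurable lborel" by (rule measurable_kernelD[OF \<Psi>(2)])
  define h where "h = (\<lambda>x' s. ennreal (exp (\<theta> * cluster_vol s) * (1 - clear (cluster_set B) {x'} s)) * \<Psi> x' y)"
  have hm: "case_prod h \<in> borel_measurable (lborel \<Otimes>\<^sub>M cluster x)"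
  proof -
    have "(\<lambda>p. exp (\<theta> * cluster_vol (snd p))) \<in> borel_measurable (lborel \<Otimes>\<^sub>M cluster x)"
      by (rule measurable_compose[OF measurable_snd ve])
    moreover have "(\<lambda>p. \<Psi> (fst p) y) \<in> borel_measurable (lborel \<Otimes>\<^sub>M cluster x)"
      by (rule measurable_compose[OF measurable_fst psi])
    ultimately show ?thesis
      unfolding h_def split_beta' using cl
      by (intro borel_measurable_times_ennreal measurable_compose[OF _ measurable_ennreal] borel_measurable_times
          borel_measurable_diff borel_measurable_const)
  qed
  have "(\<integral>\<^sup>+s. ennreal (exp (\<theta> * cluster_vol s)) * ennreal \<bar>rho \<zeta> D y - rho (cut \<zeta> B s) D y\<bar> \<partial>cluster x) \<le>
     (\<integral>\<^sup>+s. ennreal \<theta> * (\<integral>\<^sup>+x'. h x' s \<partial>lborel) \<partial>cluster x)"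
  proof (rule nn_integral_mono)
    fix s assume s: "s \<in> space (cluster x)"
    have m: "(\<lambda>x'. ennreal (1 - clear (cluster_set B) {x'} s) * \<Psi> x' y) \<in> borel_measurable lborel"
      using measurable_clear_section[OF random_set_cluster[OF B] s] psi by simp
    have "ennreal (exp (\<theta> * cluster_vol s)) * ennreal \<bar>rho \<zeta> D y - rho (cut \<zeta> B s) D y\<bar> \<le>
      ennreal (exp (\<theta> * cluster_vol s)) * (ennreal \<theta> * (\<integral>\<^sup>+x'. ennreal (1 - clear (cluster_set B) {x'} s) * \<Psi> x' y \<partial>lborel))"
      by (intro mult_left_mono cut_influence[OF \<Psi> \<zeta> B D s]) simp
    also have "\<dots> = ennreal \<theta> * (ennreal (exp (\<theta> * cluster_vol s)) * (\<integral>\<^sup>+x'. ennreal (1 - clear (cluster_set B) {x'} s) * \<Psi> x' y \<partial>lborel))"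
      by (rule mult.left_commute)
    also have "ennreal (exp (\<theta> * cluster_vol s)) * (\<integral>\<^sup>+x'. ennreal (1 - clear (cluster_set B) {x'} s) * \<Psi> x' y \<partial>lborel) =
      (\<integral>\<^sup>+x'. h x' s \<partial>lborel)"
      by (subst nn_integral_cmult[OF m, symmetric]) (simp add: h_def mult.assoc ennreal_mult)
    finally show "ennreal (exp (\<theta> * cluster_vol s)) * ennreal \<bar>rho \<zeta> D y - rho (cut \<zeta> B s) D y\<bar> \<le> ennreal \<theta> * (\<integral>\<^sup>+x'. h x' s \<partial>lborel)" .
  qed
  also have "\<dots> = ennreal \<theta> * (\<integral>\<^sup>+s. (\<integral>\<^sup>+x'. h x' s \<partial>lborel) \<partial>cluster x)"
  proof (rule nn_integral_cmult)
    have "(\<lambda>q. (case_prod h) (snd q, fst q)) \<in> borel_measurable (cluster x \<Otimes>\<^sub>M lborel)"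
      by (rule measurable_compose[OF _ hm]) measurable
    then have "(\<lambda>(s, x'). h x' s) \<in> borel_measurable (cluster x \<Otimes>\<^sub>M lborel)" by (simp add: split_beta')
    then show "(\<lambda>s. \<integral>\<^sup>+x'. h x' s \<partial>lborel) \<in> borel_measurable (cluster x)"
      by (rule lborel.borel_measurable_nn_integral)
  qed
  also have "(\<integral>\<^sup>+s. (\<integral>\<^sup>+x'. h x' s \<partial>lborel) \<partial>cluster x) = (\<integral>\<^sup>+x'. (\<integral>\<^sup>+s. h x' s \<partial>cluster x) \<partial>lborel)"
    by (rule P.Fubini'[OF hm])
  also have "\<dots> \<le> (\<integral>\<^sup>+x'. ennreal (exp (\<theta> * \<kappa>)) * (overlap \<theta> x x' * \<Psi> x' y) \<partial>lborel)"
  proof (rule nn_integral_mono)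
    fix x'
    have "(\<lambda>s. ennreal (exp (\<theta> * cluster_vol s) * (1 - clear (cluster_set B) {x'} s))) \<in> borel_measurable (cluster x)"
      using ve measurable_clear_point[OF random_set_cluster[OF B]] by simp
    then have "(\<integral>\<^sup>+s. h x' s \<partial>cluster x) = (\<integral>\<^sup>+s. ennreal (exp (\<theta> * cluster_vol s) * (1 - clear (cluster_set B) {x'} s)) \<partial>cluster x) * \<Psi> x' y"
      unfolding h_def by (rule nn_integral_multc)
    also have "\<dots> \<le> (ennreal (exp (\<theta> * \<kappa>)) * overlap \<theta> x x') * \<Psi> x' y"
      by (intro mult_right_mono cluster_exp_covered B) simp
    finally show "(\<integral>\<^sup>+s. h x' s \<partial>cluster x) \<le> ennreal (exp (\<theta> * \<kappa>)) * (overlap \<theta> x x' * \<Psi> x' y)"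
      by (simp add: mult.assoc)
  qed
  also have "\<dots> = ennreal (exp (\<theta> * \<kappa>)) * (\<integral>\<^sup>+x'. overlap \<theta> x x' * \<Psi> x' y \<partial>lborel)"
    using measurable_kernelD[OF measurable_overlap] psi by (intro nn_integral_cmult) simp
  finally show ?thesis by (simp add: mult_left_mono)
qed

text \<open>The weights of the mixture are not explicit. Each is at most
  \<open>exp (\<theta> * cluster_vol s) * Z \<zeta> D\<close> with D = \<open>insert x B\<close>,
  the normalising constant is at least exp (- \<theta> \<kappa>) times \<open>Z \<zeta> D\<close>,
  and the unknown \<open>Z \<zeta> D\<close> cancels.\<close>

lemma cluster_average_le:
  assumes \<zeta>: "admissible \<zeta>" and B: "finite B"
    and f: "integrable (cluster x) (\<lambda>s. Z (cut \<zeta> B s) (insert x B) * f s)"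
    and le: "(\<integral>\<^sup>+s. ennreal (exp (\<theta> * cluster_vol s)) * ennreal \<bar>f s\<bar> \<partial>cluster x) \<le> ennreal (exp (\<theta> * \<kappa>)) * Q"
    and meas: "(\<lambda>s. ennreal (exp (\<theta> * cluster_vol s)) * ennreal \<bar>f s\<bar>) \<in> borel_measurable (cluster x)"
  shows "ennreal \<bar>(LINT s|cluster x. Z (cut \<zeta> B s) (insert x B) * f s) / cluster_weight \<zeta> B x\<bar>
     \<le> ennreal (exp (2 * \<theta> * \<kappa>)) * Q"
proof -
  define D where "D = insert x B"
  have D: "finite D" using B by (simp add: D_def)
  define w where "w = cluster_weight \<zeta> B x"
  have w: "exp (- (\<theta> * \<kappa>)) * Z \<zeta> D \<le> w" "0 < w"
    using cluster_weight_ge[OF \<zeta> B] by (auto simp: D_def w_def)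
  have Zp: "0 < Z \<zeta> D" by (rule Z_pos[OF \<zeta> D])
  have "ennreal \<bar>LINT s|cluster x. Z (cut \<zeta> B s) D * f s\<bar> \<le> (\<integral>\<^sup>+s. ennreal (norm (Z (cut \<zeta> B s) D * f s)) \<partial>cluster x)"
    using integral_norm_bound_ennreal[OF f] by (simp add: D_def)
  also have "\<dots> \<le> (\<integral>\<^sup>+s. ennreal (Z \<zeta> D) * (ennreal (exp (\<theta> * cluster_vol s)) * ennreal \<bar>f s\<bar>) \<partial>cluster x)"
  proof (rule nn_integral_mono)
    fix s assume s: "s \<in> space (cluster x)"
    have "norm (Z (cut \<zeta> B s) D * f s) \<le> exp (\<theta> * cluster_vol s) * Z \<zeta> D * \<bar>f s\<bar>"
      unfolding real_norm_def abs_mult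
      using Z_cut_bounds(2)[OF \<zeta> B D s] Z_pos[OF cut_admissible[OF \<zeta> B s] D] by (intro mult_right_mono) auto
    then have "ennreal (norm (Z (cut \<zeta> B s) D * f s)) \<le> ennreal (exp (\<theta> * cluster_vol s) * Z \<zeta> D * \<bar>f s\<bar>)"
      by (rule ennreal_leI)
    then show "ennreal (norm (Z (cut \<zeta> B s) D * f s)) \<le> ennreal (Z \<zeta> D) * (ennreal (exp (\<theta> * cluster_vol s)) * ennreal \<bar>f s\<bar>)"
      using Zp by (simp add: ennreal_mult mult_ac less_imp_le)
  qed
  also have "\<dots> = ennreal (Z \<zeta> D) * (\<integral>\<^sup>+s. ennreal (exp (\<theta> * cluster_vol s)) * ennreal \<bar>f s\<bar> \<partial>cluster x)"
    by (rule nn_integral_cmult[OF meas])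
  also have "\<dots> \<le> ennreal (Z \<zeta> D) * (ennreal (exp (\<theta> * \<kappa>)) * Q)" by (intro mult_left_mono le) simp
  finally have X: "ennreal \<bar>LINT s|cluster x. Z (cut \<zeta> B s) D * f s\<bar> \<le> ennreal (Z \<zeta> D) * (ennreal (exp (\<theta> * \<kappa>)) * Q)" .
  have inv: "1 / w \<le> exp (\<theta> * \<kappa>) / Z \<zeta> D"
  proof -
    have "Z \<zeta> D = exp (\<theta> * \<kappa>) * (exp (- (\<theta> * \<kappa>)) * Z \<zeta> D)" by (simp flip: exp_add mult.assoc)
    also have "\<dots> \<le> exp (\<theta> * \<kappa>) * w" using w(1) by (rule mult_left_mono) simp
    finally show ?thesis using w(2) Zp by (simp add: field_simps)
  qed
  have "\<bar>(LINT s|cluster x. Z (cut \<zeta> B s) D * f s) / w\<bar> = (1 / w) * \<bar>LINT s|cluster x. Z (cut \<zeta> B s) D * f s\<bar>"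
    using w(2) by simp
  also have "\<dots> \<le> (exp (\<theta> * \<kappa>) / Z \<zeta> D) * \<bar>LINT s|cluster x. Z (cut \<zeta> B s) D * f s\<bar>"
    using inv by (rule mult_right_mono) simp
  finally have "ennreal \<bar>(LINT s|cluster x. Z (cut \<zeta> B s) D * f s) / w\<bar> \<le>
      ennreal (exp (\<theta> * \<kappa>) / Z \<zeta> D) * ennreal \<bar>LINT s|cluster x. Z (cut \<zeta> B s) D * f s\<bar>"
    using Zp by (simp add: ennreal_leI flip: ennreal_mult)
  also have "\<dots> \<le> ennreal (exp (\<theta> * \<kappa>) / Z \<zeta> D) * (ennreal (Z \<zeta> D) * (ennreal (exp (\<theta> * \<kappa>)) * Q))"
    by (intro mult_left_mono X) simp
  also have "\<dots> = (ennreal (exp (\<theta> * \<kappa>) / Z \<zeta> D) * ennreal (Z \<zeta> D) * ennreal (exp (\<theta> * \<kappa>))) * Q"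
    by (simp only: mult.assoc)
  also have "ennreal (exp (\<theta> * \<kappa>) / Z \<zeta> D) * ennreal (Z \<zeta> D) * ennreal (exp (\<theta> * \<kappa>)) = ennreal (exp (2 * \<theta> * \<kappa>))"
    using Zp by (simp flip: ennreal_mult exp_add)
  finally show ?thesis by (simp add: D_def w_def)
qed

lemma measurable_rho_cut:
  assumes \<zeta>: "admissible \<zeta>" and B: "finite B" and D: "finite D"
  shows "(\<lambda>s. rho (cut \<zeta> B s) D y) \<in> borel_measurable (cluster x)"
  unfolding rho_def
  using measurable_Z_cut[OF \<zeta> D B, of x] measurable_Z_cut[OF \<zeta> finite.insertI[OF D] B, of y x] by simp

lemma measurable_influence_terms:
  assumes \<zeta>: "admissible \<zeta>" and B: "finite B" and D: "finite D"
  shows "(\<lambda>s. ennreal (exp (\<theta> * cluster_vol s)) * ennreal \<bar>rho \<zeta> D y - rho (cut \<zeta> B s) D y\<bar>) \<in> borel_measurable (cluster x)"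
    "(\<lambda>s. ennreal (exp (\<theta> * cluster_vol s) * (1 - clear (cluster_set B) {y} s))) \<in> borel_measurable (cluster x)"
    "(\<lambda>s. ennreal (exp (\<theta> * cluster_vol s)) * ennreal \<bar>rho \<zeta> D y - clear (cluster_set B) {y} s * rho (cut \<zeta> B s) D y\<bar>) \<in> borel_measurable (cluster x)"
  using measurable_rho_cut[OF assms, of y x] measurable_cluster_vol[of x] measurable_clear_point[OF random_set_cluster[OF B, of x], of y]
  by measurable

text \<open>The conditional probability at y changes either because the cluster covers y, giving the
  kernel itself, or because the cluster has removed part of the field, giving \<theta> times the
  kernel composed with the bound already available.\<close>

theorem influence_step:
  assumes \<Psi>: "influence_bound \<Psi>" "measurable_kernel \<Psi>"
  shows "influence_bound (\<lambda>x y. kernel x y + ennreal \<theta> * (\<integral>\<^sup>+x'. kernel x x' * \<Psi> x' y \<partial>lborel))"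
  unfolding influence_bound_def
proof (intro allI impI)
  fix \<zeta> :: "'a \<Rightarrow> real" and B :: "'a set" and x y :: 'a
  assume \<zeta>: "admissible \<zeta>" and B: "finite B"
  define D where "D = insert x B"
  have D: "finite D" using B by (simp add: D_def)
  note m = measurable_influence_terms[OF \<zeta> B D, of y x]
  let ?f = "\<lambda>s. rho \<zeta> D y - clear (cluster_set B) {y} s * rho (cut \<zeta> B s) D y"
  let ?Q = "overlap \<theta> x y + ennreal \<theta> * (\<integral>\<^sup>+x'. overlap \<theta> x x' * \<Psi> x' y \<partial>lborel)"
  have "(\<integral>\<^sup>+s. ennreal (exp (\<theta> * cluster_vol s)) * ennreal \<bar>?f s\<bar> \<partial>cluster x) \<le>
    (\<integral>\<^sup>+s. ennreal (exp (\<theta> * cluster_vol s) * (1 - clear (cluster_set B) {y} s)) +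
       ennreal (exp (\<theta> * cluster_vol s)) * ennreal \<bar>rho \<zeta> D y - rho (cut \<zeta> B s) D y\<bar> \<partial>cluster x)"
  proof (rule nn_integral_mono)
    fix s
    have "\<bar>?f s\<bar> \<le> (1 - clear (cluster_set B) {y} s) + \<bar>rho \<zeta> D y - rho (cut \<zeta> B s) D y\<bar>"
      using rho_bounds[OF \<zeta> D, of y] by (auto simp: clear_def)
    then have "exp (\<theta> * cluster_vol s) * \<bar>?f s\<bar> \<le> exp (\<theta> * cluster_vol s) * ((1 - clear (cluster_set B) {y} s) + \<bar>rho \<zeta> D y - rho (cut \<zeta> B s) D y\<bar>)"
      by (rule mult_left_mono) simp
    also have "\<dots> = exp (\<theta> * cluster_vol s) * (1 - clear (cluster_set B) {y} s) + exp (\<theta> * cluster_vol s) * \<bar>rho \<zeta> D y - rho (cut \<zeta> B s) D y\<bar>"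
      by (rule distrib_left)
    finally have "ennreal (exp (\<theta> * cluster_vol s) * \<bar>?f s\<bar>) \<le> ennreal (\<dots>)" by (rule ennreal_leI)
    then show "ennreal (exp (\<theta> * cluster_vol s)) * ennreal \<bar>?f s\<bar> \<le>
      ennreal (exp (\<theta> * cluster_vol s) * (1 - clear (cluster_set B) {y} s)) +
       ennreal (exp (\<theta> * cluster_vol s)) * ennreal \<bar>rho \<zeta> D y - rho (cut \<zeta> B s) D y\<bar>"
      by (simp add: ennreal_mult)
  qed
  also have "\<dots> = (\<integral>\<^sup>+s. ennreal (exp (\<theta> * cluster_vol s) * (1 - clear (cluster_set B) {y} s)) \<partial>cluster x) +
     (\<integral>\<^sup>+s. ennreal (exp (\<theta> * cluster_vol s)) * ennreal \<bar>rho \<zeta> D y - rho (cut \<zeta> B s) D y\<bar> \<partial>cluster x)"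
    by (rule nn_integral_add[OF m(2,1)])
  also have "\<dots> \<le> ennreal (exp (\<theta> * \<kappa>)) * overlap \<theta> x y +
     ennreal \<theta> * (ennreal (exp (\<theta> * \<kappa>)) * (\<integral>\<^sup>+x'. overlap \<theta> x x' * \<Psi> x' y \<partial>lborel))"
    by (intro add_mono cluster_exp_covered B cluster_influence[OF \<Psi> \<zeta> B D])
  also have "\<dots> = ennreal (exp (\<theta> * \<kappa>)) * ?Q"
    by (simp add: distrib_left mult_ac)
  finally have Q: "(\<integral>\<^sup>+s. ennreal (exp (\<theta> * cluster_vol s)) * ennreal \<bar>?f s\<bar> \<partial>cluster x) \<le> ennreal (exp (\<theta> * \<kappa>)) * ?Q" .
  have i: "integrable (cluster x) (\<lambda>s. Z (cut \<zeta> B s) D * ?f s)"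
    using cluster_Z_integrable[OF \<zeta> B D, of x] integrable_cluster_term[OF \<zeta> B D, of x y]
    by (simp add: right_diff_distrib)
  have "ennreal \<bar>rho \<zeta> D y - rho \<zeta> B y\<bar> \<le> ennreal (exp (2 * \<theta> * \<kappa>)) * ?Q"
    using cluster_average_le[OF \<zeta> B i[unfolded D_def] Q[unfolded D_def] m(3)[unfolded D_def]]
    unfolding rho_mixture[OF \<zeta> B, of x y, folded D_def] by (simp add: D_def)
  also have "\<dots> = kernel x y + ennreal \<theta> * (\<integral>\<^sup>+x'. kernel x x' * \<Psi> x' y \<partial>lborel)"
  proof -
    have "(\<lambda>x'. overlap \<theta> x x' * \<Psi> x' y) \<in> borel_measurable lborel"
      using measurable_kernelD[OF measurable_overlap] measurable_kernelD[OF \<Psi>(2)] by (intro borel_measurable_times_ennreal)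
    then have "(\<integral>\<^sup>+x'. kernel x x' * \<Psi> x' y \<partial>lborel) = ennreal (exp (2 * \<theta> * \<kappa>)) * (\<integral>\<^sup>+x'. overlap \<theta> x x' * \<Psi> x' y \<partial>lborel)"
      unfolding kernel_def mult.assoc by (rule nn_integral_cmult)
    then show ?thesis by (simp add: kernel_def distrib_left mult_ac)
  qed
  finally show "ennreal \<bar>rho \<zeta> (insert x B) y - rho \<zeta> B y\<bar> \<le> kernel x y + ennreal \<theta> * (\<integral>\<^sup>+x'. kernel x x' * \<Psi> x' y \<partial>lborel)"
    by (simp add: D_def)
qed

section \<open>The Neumann series of the recursion\<close>

fun ladder :: "nat \<Rightarrow> 'a \<Rightarrow> 'a \<Rightarrow> ennreal" where
  "ladder 0 x y = kernel x y"
| "ladder (Suc j) x y = ennreal \<theta> * (\<integral>\<^sup>+x'. kernel x x' * ladder j x' y \<partial>lborel)"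

lemma measurable_ladder: "measurable_kernel (ladder j)"
proof (induction j)
  case 0
  then show ?case using measurable_ker by (simp add: measurable_kernel_def)
next
  case (Suc j)
  have "(\<lambda>p. ennreal \<theta> * (\<integral>\<^sup>+x'. kernel (fst p) x' * ladder j x' (snd p) \<partial>lborel)) \<in> borel_measurable (lborel \<Otimes>\<^sub>M lborel)"
    using measurable_kernel_compose[OF measurable_ker Suc, unfolded measurable_kernel_def]
    by (intro borel_measurable_times_ennreal) auto
  then show ?case by (simp add: measurable_kernel_def)
qed

text \<open>The resolvent series: term j is \<theta>^j times the composition of j + 1 kernels, so
  its mass is dominated by a geometric series with ratio \<theta> K.\<close>

definition influence :: "'a \<Rightarrow> 'a \<Rightarrow> ennreal" where
  "influence x y = (\<Sum>j. ladder j x y)"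

lemma measurable_influence: "measurable_kernel influence"
  using measurable_ladder unfolding measurable_kernel_def influence_def
  by (intro borel_measurable_suminf_order) auto

lemma nn_integral_kernel_compose:
  assumes "measurable_kernel \<Psi>" "\<And>x. (\<integral>\<^sup>+y. \<Psi> x y \<partial>lborel) \<le> c"
  shows "(\<integral>\<^sup>+y. (\<integral>\<^sup>+x'. kernel x x' * \<Psi> x' y \<partial>lborel) \<partial>lborel) \<le> ennreal K * c"
proof -
  have "(\<lambda>p. kernel x (fst p) * \<Psi> (fst p) (snd p)) \<in> borel_measurable (lborel \<Otimes>\<^sub>M lborel)"
    using measurable_compose[OF measurable_fst measurable_kernelD(2)[OF measurable_ker, of x]] assms(1)
    by (intro borel_measurable_times_ennreal) (simp_all add: measurable_kernel_def)
  then have "(\<lambda>(x', y). kernel x x' * \<Psi> x' y) \<in> borel_measurable (lborel \<Otimes>\<^sub>M lborel)"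
    by (simp add: split_beta')
  then have "(\<integral>\<^sup>+y. (\<integral>\<^sup>+x'. kernel x x' * \<Psi> x' y \<partial>lborel) \<partial>lborel) = (\<integral>\<^sup>+x'. (\<integral>\<^sup>+y. kernel x x' * \<Psi> x' y \<partial>lborel) \<partial>lborel)"
    by (rule lborel_pair.Fubini')
  also have "\<dots> = (\<integral>\<^sup>+x'. kernel x x' * (\<integral>\<^sup>+y. \<Psi> x' y \<partial>lborel) \<partial>lborel)"
    by (intro nn_integral_cong nn_integral_cmult measurable_kernelD[OF assms(1)])
  also have "\<dots> \<le> (\<integral>\<^sup>+x'. kernel x x' * c \<partial>lborel)"
    by (intro nn_integral_mono mult_left_mono assms) auto
  also have "\<dots> = ennreal K * c"
    using measurable_kernelD(2)[OF measurable_ker, of x] by (simp add: nn_integral_multc nn_integral_kernel)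
  finally show ?thesis .
qed

lemma nn_integral_ladder: "(\<integral>\<^sup>+y. ladder j x y \<partial>lborel) \<le> ennreal ((\<theta> * K) ^ j * K)"
proof (induction j arbitrary: x)
  case 0
  then show ?case by (simp add: nn_integral_kernel)
next
  case (Suc j)
  have "(\<integral>\<^sup>+y. ladder (Suc j) x y \<partial>lborel) = ennreal \<theta> * (\<integral>\<^sup>+y. (\<integral>\<^sup>+x'. kernel x x' * ladder j x' y \<partial>lborel) \<partial>lborel)"
    using measurable_kernelD(2)[OF measurable_kernel_compose[OF measurable_ker measurable_ladder]]
    by (simp add: nn_integral_cmult)
  also have "\<dots> \<le> ennreal \<theta> * (ennreal K * ennreal ((\<theta> * K) ^ j * K))"
    by (intro mult_left_mono nn_integral_kernel_compose measurable_ladder Suc) simp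
  also have "\<dots> = ennreal ((\<theta> * K) ^ Suc j * K)"
    using \<theta>_nonneg K_nonneg by (simp add: mult_ac flip: ennreal_mult)
  finally show ?case .
qed

lemma nn_integral_influence:
  assumes "\<theta> * K < 1"
  shows "(\<integral>\<^sup>+y. influence x y \<partial>lborel) \<le> ennreal (K / (1 - \<theta> * K))"
proof -
  have "(\<integral>\<^sup>+y. influence x y \<partial>lborel) = (\<Sum>j. \<integral>\<^sup>+y. ladder j x y \<partial>lborel)"
    unfolding influence_def by (rule nn_integral_suminf) (rule measurable_kernelD[OF measurable_ladder])
  also have "\<dots> \<le> (\<Sum>j. ennreal ((\<theta> * K) ^ j * K))"
    by (intro suminf_le nn_integral_ladder) auto
  also have "\<dots> = ennreal (\<Sum>j. (\<theta> * K) ^ j * K)"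
    using \<theta>_nonneg K_nonneg assms by (intro suminf_ennreal2 summable_mult2 summable_geometric) auto
  also have "(\<Sum>j. (\<theta> * K) ^ j * K) = K / (1 - \<theta> * K)"
    using \<theta>_nonneg K_nonneg assms by (subst suminf_mult2[symmetric]) (auto simp: suminf_geometric summable_geometric)
  finally show ?thesis .
qed

lemma measurable_ladder_sum: "measurable_kernel (\<lambda>x y. (\<Sum>j<n. ladder j x y) + ennreal c)"
  using measurable_ladder unfolding measurable_kernel_def by (intro borel_measurable_add borel_measurable_sum) auto

text \<open>Iteration starts from the bound 1, valid for any difference of probabilities. Each step
  multiplies the constant remainder by \<theta> K and adds the next term of the series, and the
  remainder vanishes in the limit.\<close>

theorem influence_bound_influence:
  assumes "\<theta> * K < 1"
  shows "influence_bound influence"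
proof -
  have iter: "influence_bound (\<lambda>x y. (\<Sum>j<n. ladder j x y) + ennreal ((\<theta> * K) ^ n))" for n
  proof (induction n)
    case 0
    have "\<bar>rho \<zeta> (insert x B) y - rho \<zeta> B y\<bar> \<le> 1" if "admissible \<zeta>" "finite B" for \<zeta> B x y
      using rho_bounds[OF that, of y] rho_bounds[OF that(1), of "insert x B" y] that(2) by (auto simp: abs_le_iff)
    then show ?case by (auto simp: influence_bound_def ennreal_le_1)
  next
    case (Suc n)
    have "(\<integral>\<^sup>+x'. kernel x x' * ((\<Sum>j<n. ladder j x' y) + ennreal ((\<theta> * K) ^ n)) \<partial>lborel) =
       (\<Sum>j<n. \<integral>\<^sup>+x'. kernel x x' * ladder j x' y \<partial>lborel) + ennreal K * ennreal ((\<theta> * K) ^ n)" for x y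
    proof -
      have m: "(\<lambda>x'. kernel x x' * ladder j x' y) \<in> borel_measurable lborel" for j
        using measurable_kernelD[OF measurable_ker] measurable_kernelD[OF measurable_ladder] by (intro borel_measurable_times_ennreal)
      have "(\<integral>\<^sup>+x'. kernel x x' * ((\<Sum>j<n. ladder j x' y) + ennreal ((\<theta> * K) ^ n)) \<partial>lborel) =
        (\<integral>\<^sup>+x'. (\<Sum>j<n. kernel x x' * ladder j x' y) + kernel x x' * ennreal ((\<theta> * K) ^ n) \<partial>lborel)"
        by (simp add: distrib_left sum_distrib_left)
      also have "\<dots> = (\<integral>\<^sup>+x'. (\<Sum>j<n. kernel x x' * ladder j x' y) \<partial>lborel) + (\<integral>\<^sup>+x'. kernel x x' * ennreal ((\<theta> * K) ^ n) \<partial>lborel)"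
        using m measurable_kernelD(2)[OF measurable_ker, of x] by (intro nn_integral_add borel_measurable_sum) auto
      also have "(\<integral>\<^sup>+x'. (\<Sum>j<n. kernel x x' * ladder j x' y) \<partial>lborel) = (\<Sum>j<n. \<integral>\<^sup>+x'. kernel x x' * ladder j x' y \<partial>lborel)"
        using m by (intro nn_integral_sum)
      also have "(\<integral>\<^sup>+x'. kernel x x' * ennreal ((\<theta> * K) ^ n) \<partial>lborel) = ennreal K * ennreal ((\<theta> * K) ^ n)"
        using measurable_kernelD(2)[OF measurable_ker, of x] by (simp add: nn_integral_multc nn_integral_kernel)
      finally show ?thesis .
    qed
    then have "kernel x y + ennreal \<theta> * (\<integral>\<^sup>+x'. kernel x x' * ((\<Sum>j<n. ladder j x' y) + ennreal ((\<theta> * K) ^ n)) \<partial>lborel) =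
       (\<Sum>j<Suc n. ladder j x y) + ennreal ((\<theta> * K) ^ Suc n)" for x y
      using \<theta>_nonneg K_nonneg
      by (simp add: sum.lessThan_Suc_shift distrib_left sum_distrib_left add.assoc ennreal_mult mult.assoc del: sum.lessThan_Suc)
    then show ?case using influence_step[OF Suc measurable_ladder_sum] by simp
  qed
  show ?thesis unfolding influence_bound_def
  proof (intro allI impI)
    fix \<zeta> :: "'a \<Rightarrow> real" and B :: "'a set" and x y :: 'a
    assume a: "admissible \<zeta>" "finite B"
    have "(\<lambda>n. (\<theta> * K) ^ n) \<longlonglongrightarrow> 0" using \<theta>_nonneg K_nonneg assms by (intro LIMSEQ_power_zero) auto
    then have "(\<lambda>n. influence x y + ennreal ((\<theta> * K) ^ n)) \<longlonglongrightarrow> influence x y + ennreal 0"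
      by (intro tendsto_add tendsto_const tendsto_ennrealI)
    moreover have "ennreal \<bar>rho \<zeta> (insert x B) y - rho \<zeta> B y\<bar> \<le> influence x y + ennreal ((\<theta> * K) ^ n)" for n
    proof -
      have "ennreal \<bar>rho \<zeta> (insert x B) y - rho \<zeta> B y\<bar> \<le> (\<Sum>j<n. ladder j x y) + ennreal ((\<theta> * K) ^ n)"
        using iter[of n] a by (auto simp: influence_bound_def)
      also have "(\<Sum>j<n. ladder j x y) \<le> influence x y" unfolding influence_def by (rule sum_le_suminf) auto
      finally show ?thesis by (simp add: add_right_mono)
    qed
    ultimately show "ennreal \<bar>rho \<zeta> (insert x B) y - rho \<zeta> B y\<bar> \<le> influence x y"
      using LIMSEQ_le_const[of "\<lambda>n. influence x y + ennreal ((\<theta> * K) ^ n)"] by auto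
  qed
qed

section \<open>Lower bounds for conditional vacancy\<close>

lemma cluster_weight_le:
  assumes \<zeta>: "admissible \<zeta>" and B: "finite B"
  shows "cluster_weight \<zeta> B x \<le> exp (\<theta> * \<kappa>) * Z \<zeta> (insert x B)"
proof -
  have D: "finite (insert x B)" using B by simp
  have ie: "integrable (cluster x) (\<lambda>s. exp (\<theta> * cluster_vol s))"
    and ve: "(LINT s|cluster x. exp (\<theta> * cluster_vol s)) = exp ((LINT e|\<Lambda>. hit x e * exp (\<theta> * vol (S e))) - l)"
    using cluster_exp[of \<theta> x] by (auto simp only: has_bochner_integral_iff order.refl)
  have "cluster_weight \<zeta> B x \<le> (LINT s|cluster x. exp (\<theta> * cluster_vol s) * Z \<zeta> (insert x B))"
    unfolding cluster_weight_def
    by (rule integral_mono[OF cluster_Z_integrable[OF \<zeta> B D] integrable_mult_left[OF ie]])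
       (rule Z_cut_bounds(2)[OF \<zeta> B D])
  also have "\<dots> = (LINT s|cluster x. exp (\<theta> * cluster_vol s)) * Z \<zeta> (insert x B)"
    by (rule integral_mult_left_zero)
  also have "\<dots> \<le> exp (\<theta> * \<kappa>) * Z \<zeta> (insert x B)"
    unfolding ve using hit_exp_bounds(1)[of x] Z_pos[OF \<zeta> D] by (intro mult_right_mono) auto
  finally show ?thesis .
qed

text \<open>By the mixture formula with A empty, \<open>Z \<zeta> D\<close> is the cluster average
  times the exponential of the mass of the grains through y that miss D; the average exceeds
  \<open>Z \<zeta> (insert y D)\<close> at most by the factor exp (\<theta> \<kappa>).\<close>

lemma rho_lower:
  assumes \<zeta>: "admissible \<zeta>" and D: "finite D"
  shows "exp (- (LINT e|\<Lambda>. hit y e * clear S D e) - \<theta> * \<kappa>) \<le> rho \<zeta> D y"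
proof -
  let ?c = "LINT e|\<Lambda>. hit y e * clear S D e"
  note cluster_weight_le[OF \<zeta> D, of y]
  then have "Z \<zeta> D \<le> exp ?c * (exp (\<theta> * \<kappa>) * Z \<zeta> (insert y D))"
    using Z_mixture[OF \<zeta> _ D, of "{}" y] by (simp add: cluster_weight_def)
  then have "exp (- ?c - \<theta> * \<kappa>) * Z \<zeta> D \<le> exp (- ?c - \<theta> * \<kappa>) * (exp ?c * (exp (\<theta> * \<kappa>) * Z \<zeta> (insert y D)))"
    by (intro mult_left_mono) auto
  also have "\<dots> = Z \<zeta> (insert y D)" by (simp flip: exp_add mult.assoc)
  finally show ?thesis using Z_pos[OF \<zeta> D] by (simp add: rho_def field_simps)
qed

lemma rho_lower_uniform:
  assumes \<zeta>: "admissible \<zeta>" and D: "finite D"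
  shows "exp (- l - \<theta> * \<kappa>) \<le> rho \<zeta> D y"
proof -
  have "(LINT e|\<Lambda>. hit y e * clear S D e) \<le> (LINT e|\<Lambda>. hit y e)"
    by (intro integral_mono hit_integral integrable_hit_mult[where B=1]) (use D in \<open>auto simp: mult_left_le\<close>)
  then have "exp (- l - \<theta> * \<kappa>) \<le> exp (- (LINT e|\<Lambda>. hit y e * clear S D e) - \<theta> * \<kappa>)"
    by (simp add: hit_integral)
  also have "\<dots> \<le> rho \<zeta> D y" by (rule rho_lower[OF assms])
  finally show ?thesis .
qed

end

section \<open>Repulsion of two vacant points\<close>

context boolean_model
begin

text \<open>Truncation at 1 preserves the bound, as influences are differences of probabilities, and
  makes \<open>indirect\<close> finite at every pair of points, so that it can be converted to a
  real number.\<close>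

definition capped :: "'a \<Rightarrow> 'a \<Rightarrow> ennreal" where "capped x y = min 1 (influence x y)"

lemma influence_bound_capped:
  assumes "\<theta> * K < 1"
  shows "influence_bound capped" "measurable_kernel capped"
proof -
  show "influence_bound capped"
    unfolding influence_bound_def capped_def
  proof (intro allI impI min.boundedI)
    fix \<zeta> :: "'a \<Rightarrow> real" and B :: "'a set" and x y :: 'a
    assume a: "admissible \<zeta>" "finite B"
    have "\<bar>rho \<zeta> (insert x B) y - rho \<zeta> B y\<bar> \<le> 1"
      using rho_bounds[OF a, of y] rho_bounds[OF a(1), of "insert x B" y] a(2) by (auto simp: abs_le_iff)
    then show "ennreal \<bar>rho \<zeta> (insert x B) y - rho \<zeta> B y\<bar> \<le> 1" by (simp add: ennreal_le_1)
    show "ennreal \<bar>rho \<zeta> (insert x B) y - rho \<zeta> B y\<bar> \<le> influence x y"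
      using influence_bound_influence[OF assms] a by (auto simp: influence_bound_def)
  qed
  show "measurable_kernel capped"
    using measurable_influence unfolding measurable_kernel_def capped_def by measurable
qed

text \<open>The part of the influence of x on y that passes through a point x' at which the cluster
  of x has removed the field.\<close>

definition indirect :: "'a \<Rightarrow> 'a \<Rightarrow> ennreal" where
  "indirect x y = ennreal \<theta> * (\<integral>\<^sup>+x'. kernel x x' * capped x' y \<partial>lborel)"

lemma indirect_finite: "indirect x y \<le> ennreal (\<theta> * K)"
proof -
  have "(\<integral>\<^sup>+x'. kernel x x' * capped x' y \<partial>lborel) \<le> (\<integral>\<^sup>+x'. kernel x x' * 1 \<partial>lborel)"
    by (intro nn_integral_mono mult_left_mono) (auto simp: capped_def)
  then have "indirect x y \<le> ennreal \<theta> * ennreal K"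
    unfolding indirect_def by (intro mult_left_mono) (auto simp: nn_integral_kernel)
  then show ?thesis using \<theta>_nonneg K_nonneg by (simp add: ennreal_mult)
qed

definition overlap_lo :: "'a \<Rightarrow> 'a \<Rightarrow> real" where
  "overlap_lo x y = (LINT e|\<Lambda>. hit x e * (exp (- \<theta> * vol (S e)) * hit y e))"

lemma overlap_lo_nonneg: "0 \<le> overlap_lo x y"
  unfolding overlap_lo_def by simp

lemma overlap_lo_eq: "overlap (- \<theta>) x y = ennreal (overlap_lo x y)"
  unfolding overlap_lo_def by (rule overlap_eq) (use \<theta>_nonneg in simp)

text \<open>Vacancy of x removes the grains through both points from the exponent of the general
  lower bound. Their mass is at least \<open>overlap_lo x y\<close>, since a tilt by - \<theta> only
  reduces it.\<close>

lemma rho_lower_pair: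
  assumes \<zeta>: "admissible \<zeta>"
  shows "exp (- l - \<theta> * \<kappa> + overlap_lo x y) \<le> rho \<zeta> {x} y"
proof -
  have i: "integrable \<Lambda> (\<lambda>e. hit y e * hit x e)" by (rule integrable_hit_mult[where B=1]) auto
  have "overlap_lo x y \<le> (LINT e|\<Lambda>. hit y e * hit x e)"
    unfolding overlap_lo_def
  proof (rule integral_mono[OF integrable_hit_exp_mult i])
    fix e
    have "exp (- \<theta> * vol (S e)) * (hit x e * hit y e) \<le> 1 * (hit x e * hit y e)"
      using \<theta>_nonneg by (intro mult_right_mono) auto
    then show "hit x e * (exp (- \<theta> * vol (S e)) * hit y e) \<le> hit y e * hit x e" by (simp add: mult_ac)
  qed (use \<theta>_nonneg in auto)
  moreover have "(LINT e|\<Lambda>. hit y e * clear S {x} e) = (LINT e|\<Lambda>. hit y e - hit y e * hit x e)"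
    by (simp add: hit_def algebra_simps)
  moreover have "\<dots> = l - (LINT e|\<Lambda>. hit y e * hit x e)"
    using i hit_integral by simp
  ultimately have "exp (- l - \<theta> * \<kappa> + overlap_lo x y) \<le> exp (- (LINT e|\<Lambda>. hit y e * clear S {x} e) - \<theta> * \<kappa>)"
    by simp
  also have "\<dots> \<le> rho \<zeta> {x} y" by (rule rho_lower[OF \<zeta>]) simp
  finally show ?thesis .
qed

text \<open>Replacing the weights by their lower bound
  \<open>exp (- \<theta> * cluster_vol s) * Z \<zeta> {x}\<close> makes the generating functional
  applicable. One factor exp (- \<theta> \<kappa>) comes from its value, the other from the upper
  bound on the normalising constant.\<close>

lemma covered_weight_lower:
  assumes \<zeta>: "admissible \<zeta>"
  shows "exp (- 2 * \<theta> * \<kappa>) * (1 - exp (- overlap_lo x y)) \<le>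
    (LINT s|cluster x. Z (cut \<zeta> {} s) {x} * (1 - clear (cluster_set {}) {y} s)) / cluster_weight \<zeta> {} x"
proof -
  let ?b = "LINT e|\<Lambda>. hit x e * exp (- \<theta> * vol (S e))"
  let ?c = "\<lambda>s. clear (cluster_set {}) {y} s"
  have th: "- \<theta> \<le> \<theta>" using \<theta>_nonneg by simp
  have Zp: "0 < Z \<zeta> {x}" using Z_pos[OF \<zeta>] by simp
  have w: "0 < cluster_weight \<zeta> {} x" "cluster_weight \<zeta> {} x \<le> exp (\<theta> * \<kappa>) * Z \<zeta> {x}"
    using cluster_weight_ge[OF \<zeta>] cluster_weight_le[OF \<zeta>, of "{}" x] by auto
  have "has_bochner_integral (cluster x) (\<lambda>s. exp (- \<theta> * cluster_vol s) - exp (- \<theta> * cluster_vol s) * ?c s)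
     (exp (?b - l) - exp (?b - overlap_lo x y - l))"
    using cluster_exp[OF th, of x] cluster_exp_clear[OF th finite.emptyI, of x y]
    by (intro has_bochner_integral_diff) (simp_all add: overlap_lo_def)
  then have h: "integrable (cluster x) (\<lambda>s. exp (- \<theta> * cluster_vol s) - exp (- \<theta> * cluster_vol s) * ?c s)"
    "(LINT s|cluster x. exp (- \<theta> * cluster_vol s) - exp (- \<theta> * cluster_vol s) * ?c s) = exp (?b - l) - exp (?b - overlap_lo x y - l)"
    by (simp_all only: has_bochner_integral_iff)
  have e: "1 - exp (- overlap_lo x y) \<ge> 0" using overlap_lo_nonneg[of x y] by simp
  have "exp (- (\<theta> * \<kappa>)) * (1 - exp (- overlap_lo x y)) \<le> exp (?b - l) * (1 - exp (- overlap_lo x y))"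
    using hit_exp_bounds(2)[of x] e by (intro mult_right_mono) auto
  also have "\<dots> = exp (?b - l) - exp (?b - overlap_lo x y - l)"
    by (simp add: right_diff_distrib flip: exp_add)
  finally have "exp (- (\<theta> * \<kappa>)) * (1 - exp (- overlap_lo x y)) * Z \<zeta> {x} \<le>
      (LINT s|cluster x. exp (- \<theta> * cluster_vol s) - exp (- \<theta> * cluster_vol s) * ?c s) * Z \<zeta> {x}"
    unfolding h(2) using Zp by (intro mult_right_mono) auto
  also have "\<dots> = (LINT s|cluster x. (exp (- \<theta> * cluster_vol s) - exp (- \<theta> * cluster_vol s) * ?c s) * Z \<zeta> {x})"
    by (rule integral_mult_left_zero[symmetric])
  also have "\<dots> \<le> (LINT s|cluster x. Z (cut \<zeta> {} s) {x} * (1 - ?c s))"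
  proof (rule integral_mono[OF integrable_mult_left[OF h(1)]])
    have "integrable (cluster x) (\<lambda>s. Z (cut \<zeta> {} s) {x})" by (rule cluster_Z_integrable[OF \<zeta>]) auto
    then show "integrable (cluster x) (\<lambda>s. Z (cut \<zeta> {} s) {x} * (1 - ?c s))"
    proof (rule Bochner_Integration.integrable_bound)
      show "(\<lambda>s. Z (cut \<zeta> {} s) {x} * (1 - ?c s)) \<in> borel_measurable (cluster x)"
        using measurable_Z_cut[OF \<zeta>, of "{x}" "{}" x] measurable_clear_point[OF random_set_cluster[of "{}" x], of y] by simp
      show "AE s in cluster x. norm (Z (cut \<zeta> {} s) {x} * (1 - ?c s)) \<le> norm (Z (cut \<zeta> {} s) {x})"
        by (auto simp: clear_def)
    qed
    fix s assume s: "s \<in> space (cluster x)"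
    have "exp (- \<theta> * cluster_vol s) * Z \<zeta> {x} * (1 - ?c s) \<le> Z (cut \<zeta> {} s) {x} * (1 - ?c s)"
      by (intro mult_right_mono Z_cut_bounds(1)[OF \<zeta> _ _ s]) auto
    then show "(exp (- \<theta> * cluster_vol s) - exp (- \<theta> * cluster_vol s) * ?c s) * Z \<zeta> {x} \<le> Z (cut \<zeta> {} s) {x} * (1 - ?c s)"
      by (simp add: algebra_simps)
  qed
  finally have main: "exp (- (\<theta> * \<kappa>)) * (1 - exp (- overlap_lo x y)) * Z \<zeta> {x} \<le> (LINT s|cluster x. Z (cut \<zeta> {} s) {x} * (1 - ?c s))" .
  have "exp (- 2 * \<theta> * \<kappa>) * (1 - exp (- overlap_lo x y)) * cluster_weight \<zeta> {} x \<le>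
     exp (- 2 * \<theta> * \<kappa>) * (1 - exp (- overlap_lo x y)) * (exp (\<theta> * \<kappa>) * Z \<zeta> {x})"
    using w e by (intro mult_left_mono) auto
  also have "\<dots> = (exp (- 2 * \<theta> * \<kappa>) * exp (\<theta> * \<kappa>)) * (1 - exp (- overlap_lo x y)) * Z \<zeta> {x}"
    by (simp only: mult_ac)
  also have "exp (- 2 * \<theta> * \<kappa>) * exp (\<theta> * \<kappa>) = exp (- (\<theta> * \<kappa>))" by (simp flip: exp_add)
  also note main
  finally show ?thesis using w(1) by (simp add: pos_le_divide_eq)
qed

text \<open>The mixture formula is split exactly into the event that the cluster at x covers y, a
  positive contribution, and the effect of the cut field on uncovered y. Of the latter only the size
  is known, not the sign: it is at most \<open>indirect x y\<close> in absolute value.\<close>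

lemma pair_repulsion_lower:
  assumes \<zeta>: "admissible \<zeta>" and small: "\<theta> * K < 1"
  shows "exp (- l - 3 * \<theta> * \<kappa>) * overlap_lo x y - enn2real (indirect x y) \<le> rho \<zeta> {x} y - rho \<zeta> {} y"
proof -
  note \<Psi> = influence_bound_capped[OF small]
  let ?c = "\<lambda>s. clear (cluster_set {}) {y} s"
  let ?Z = "\<lambda>s. Z (cut \<zeta> {} s) {x}"
  let ?r = "rho \<zeta> {x} y" and ?r' = "\<lambda>s. rho (cut \<zeta> {} s) {x} y"
  let ?w = "cluster_weight \<zeta> {} x"
  have iZ: "integrable (cluster x) ?Z" by (rule cluster_Z_integrable[OF \<zeta>]) auto
  have iZr: "integrable (cluster x) (\<lambda>s. ?Z s * (?c s * ?r' s))"
    by (rule integrable_cluster_term[OF \<zeta>]) auto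
  have mc: "?c \<in> borel_measurable (cluster x)" by (rule measurable_clear_point[OF random_set_cluster]) simp
  have iZc: "integrable (cluster x) (\<lambda>s. ?Z s * ?c s)"
    by (rule Bochner_Integration.integrable_bound[OF iZ]) (use mc iZ in \<open>auto simp: clear_def\<close>)
  have i1: "integrable (cluster x) (\<lambda>s. ?Z s * (1 - ?c s))"
    using iZ iZc by (simp add: right_diff_distrib)
  have i2: "integrable (cluster x) (\<lambda>s. ?Z s * (?c s * (?r - ?r' s)))"
  proof -
    have "integrable (cluster x) (\<lambda>s. ?r * (?Z s * ?c s) - ?Z s * (?c s * ?r' s))"
      using iZc iZr by simp
    then show ?thesis by (simp add: algebra_simps)
  qed
  have "?r - rho \<zeta> {} y = (LINT s|cluster x. ?Z s * (?r - ?c s * ?r' s)) / ?w"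
    using rho_mixture[OF \<zeta>, of "{}" x y] by simp
  also have "(LINT s|cluster x. ?Z s * (?r - ?c s * ?r' s)) = (LINT s|cluster x. ?r * (?Z s * (1 - ?c s)) + ?Z s * (?c s * (?r - ?r' s)))"
    by (simp add: algebra_simps)
  also have "\<dots> = ?r * (LINT s|cluster x. ?Z s * (1 - ?c s)) + (LINT s|cluster x. ?Z s * (?c s * (?r - ?r' s)))"
    using i1 i2 by simp
  finally have eq: "?r - rho \<zeta> {} y = ?r * ((LINT s|cluster x. ?Z s * (1 - ?c s)) / ?w)
      + (LINT s|cluster x. ?Z s * (?c s * (?r - ?r' s))) / ?w"
    by (simp add: add_divide_distrib)
  have mdiff: "(\<lambda>s. ennreal (exp (\<theta> * cluster_vol s)) * ennreal \<bar>?c s * (?r - ?r' s)\<bar>) \<in> borel_measurable (cluster x)"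
    using measurable_rho_cut[OF \<zeta>, of "{}" "{x}" y x] measurable_cluster_vol[of x] mc by simp
  have "(\<integral>\<^sup>+s. ennreal (exp (\<theta> * cluster_vol s)) * ennreal \<bar>?c s * (?r - ?r' s)\<bar> \<partial>cluster x) \<le>
     (\<integral>\<^sup>+s. ennreal (exp (\<theta> * cluster_vol s)) * ennreal \<bar>?r - ?r' s\<bar> \<partial>cluster x)"
    by (intro nn_integral_mono mult_left_mono ennreal_leI) (auto simp: clear_def)
  also have "\<dots> \<le> ennreal \<theta> * (ennreal (exp (\<theta> * \<kappa>)) * (\<integral>\<^sup>+x'. overlap \<theta> x x' * capped x' y \<partial>lborel))"
    by (rule cluster_influence[OF \<Psi> \<zeta>]) auto
  also have "\<dots> = ennreal (exp (\<theta> * \<kappa>)) * (ennreal \<theta> * (\<integral>\<^sup>+x'. overlap \<theta> x x' * capped x' y \<partial>lborel))"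
    by (rule mult.left_commute)
  finally have "ennreal \<bar>(LINT s|cluster x. ?Z s * (?c s * (?r - ?r' s))) / ?w\<bar> \<le>
      ennreal (exp (2 * \<theta> * \<kappa>)) * (ennreal \<theta> * (\<integral>\<^sup>+x'. overlap \<theta> x x' * capped x' y \<partial>lborel))"
    using cluster_average_le[OF \<zeta>, of "{}" x "\<lambda>s. ?c s * (?r - ?r' s)"] i2 mdiff by auto
  also have "\<dots> = indirect x y"
  proof -
    have "(\<lambda>x'. overlap \<theta> x x' * capped x' y) \<in> borel_measurable lborel"
      using measurable_kernelD[OF measurable_overlap] measurable_kernelD[OF \<Psi>(2)] by (intro borel_measurable_times_ennreal)
    then have "(\<integral>\<^sup>+x'. kernel x x' * capped x' y \<partial>lborel) = ennreal (exp (2 * \<theta> * \<kappa>)) * (\<integral>\<^sup>+x'. overlap \<theta> x x' * capped x' y \<partial>lborel)"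
      unfolding kernel_def mult.assoc by (rule nn_integral_cmult)
    then show ?thesis by (simp add: indirect_def mult_ac)
  qed
  finally have "ennreal \<bar>(LINT s|cluster x. ?Z s * (?c s * (?r - ?r' s))) / ?w\<bar> \<le> indirect x y" .
  from enn2real_mono[OF this le_less_trans[OF indirect_finite ennreal_less_top]]
  have "\<bar>(LINT s|cluster x. ?Z s * (?c s * (?r - ?r' s))) / ?w\<bar> \<le> enn2real (indirect x y)"
    by (simp only: enn2real_ennreal abs_ge_zero)
  moreover have "exp (- l - 3 * \<theta> * \<kappa>) * overlap_lo x y \<le> ?r * ((LINT s|cluster x. ?Z s * (1 - ?c s)) / ?w)"
  proof -
    \<comment> \<open>With u = \<open>overlap_lo x y\<close>, exp u - 1 factors into exp u and 1 -
      exp (- u): the first belongs to \<open>rho_lower_pair\<close>, the second to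
      \<open>covered_weight_lower\<close>, and their losses \<theta> \<kappa> and 2 \<theta>
      \<kappa> add up to 3 \<theta> \<kappa>.\<close>
    have "overlap_lo x y \<le> exp (overlap_lo x y) - 1" using exp_ge_add_one_self[of "overlap_lo x y"] by linarith
    then have "exp (- l - 3 * \<theta> * \<kappa>) * overlap_lo x y \<le> exp (- l - 3 * \<theta> * \<kappa>) * (exp (overlap_lo x y) - 1)"
      by (intro mult_left_mono) auto
    also have "\<dots> = exp (- l - \<theta> * \<kappa> + overlap_lo x y) * (exp (- 2 * \<theta> * \<kappa>) * (1 - exp (- overlap_lo x y)))"
    proof -
      have "exp (- l - 3 * \<theta> * \<kappa>) = exp (- l - \<theta> * \<kappa>) * exp (- 2 * \<theta> * \<kappa>)"
        by (simp flip: exp_add)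
      moreover have "exp (overlap_lo x y) - 1 = exp (overlap_lo x y) * (1 - exp (- overlap_lo x y))"
        by (simp add: right_diff_distrib flip: exp_add)
      ultimately show ?thesis by (simp only: exp_add mult_ac)
    qed
    also have "\<dots> \<le> ?r * ((LINT s|cluster x. ?Z s * (1 - ?c s)) / ?w)"
      using rho_bounds[OF \<zeta>, of "{x}" y] overlap_lo_nonneg[of x y]
      by (intro mult_mono rho_lower_pair[OF \<zeta>] covered_weight_lower[OF \<zeta>]) auto
    finally show ?thesis .
  qed
  ultimately show ?thesis unfolding eq by linarith
qed

end

section \<open>The density of vacancies\<close>

lemma integral_lborel_shift:
  fixes f :: "'a::euclidean_space \<Rightarrow> real"
  assumes "f \<in> borel_measurable lborel"
  shows "(LINT x|lborel. f (t + x)) = (LINT x|lborel. f x)"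
proof -
  have "(LINT x|lborel. f x) = (LINT x|distr lborel borel ((+) t). f x)"
    by (simp add: lborel_distr_plus)
  also have "\<dots> = (LINT x|lborel. f (t + x))"
    using assms by (subst integral_distr) auto
  finally show ?thesis by simp
qed

text \<open>Stationarity is expressed by void probabilities and overlaps. The last inequality says
  that the mass of the indirect influence stays below that of the direct one, where \<kappa>' is the
  mass of the overlap kernel tilted by - \<theta>.\<close>

locale stationary_boolean_model = boolean_model \<Lambda> S l M Xi \<theta> \<kappa>
  for \<Lambda> :: "'e measure" and S :: "'e \<Rightarrow> 'a::euclidean_space set" and l :: real
    and M :: "'w measure" and Xi :: "'w \<Rightarrow> 'a set" and \<theta> \<kappa> :: real +
  fixes \<kappa>' :: real
  assumes overlap_shift: "overlap \<theta> (t + x) (t + y) = overlap \<theta> x y" "overlap (- \<theta>) (t + x) (t + y) = overlap (- \<theta>) x y"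
    and hit_measure_shift: "finite A \<Longrightarrow> hit_measure ((+) t ` A) = hit_measure A"
    and \<kappa>'_integral: "has_bochner_integral \<Lambda> (\<lambda>e. hit x e * (vol (S e) * exp (- \<theta> * vol (S e)))) \<kappa>'"
    and contraction: "\<theta> * K < 1"
    and nondegenerate: "\<theta> * K * (K / (1 - \<theta> * K)) < exp (- l - 3 * \<theta> * \<kappa>) * \<kappa>'"
begin

lemma \<kappa>'_nonneg: "0 \<le> \<kappa>'"
proof -
  have "0 \<le> (LINT e|\<Lambda>. hit undefined e * (vol (S e) * exp (- \<theta> * vol (S e))))" by simp
  also have "\<dots> = \<kappa>'" by (rule has_bochner_integral_integral_eq[OF \<kappa>'_integral])
  finally show ?thesis .
qed

lemma ladder_shift: "ladder j (t + x) (t + y) = ladder j x y"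
proof (induction j arbitrary: x y)
  case 0
  then show ?case by (simp add: kernel_def overlap_shift)
next
  case (Suc j)
  have "(\<integral>\<^sup>+x'. kernel (t + x) x' * ladder j x' (t + y) \<partial>lborel) =
     (\<integral>\<^sup>+x'. kernel (t + x) (t + x') * ladder j (t + x') (t + y) \<partial>lborel)"
    using measurable_kernelD[OF measurable_ker] measurable_kernelD[OF measurable_ladder]
    by (intro nn_integral_lborel_shift[symmetric] borel_measurable_times_ennreal)
  then show ?case by (simp add: Suc kernel_def overlap_shift)
qed

lemma influence_shift: "influence (t + x) (t + y) = influence x y"
  by (simp add: influence_def ladder_shift)

lemma measurable_influence_section: "influence x \<in> borel_measurable lborel"
  using measurable_kernelD(2)[OF measurable_influence] .

section \<open>Decay of the influence with distance\<close>

definition tail :: "nat \<Rightarrow> ennreal" where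
  "tail n = (\<integral>\<^sup>+y. influence 0 y * indicator (- ball 0 (real n)) y \<partial>lborel)"

lemma tail_shift: "(\<integral>\<^sup>+y. influence x y * indicator (- ball x (real n)) y \<partial>lborel) = tail n"
proof -
  have [measurable]: "influence x \<in> borel_measurable borel" using measurable_influence_section[of x] by simp
  have "(\<integral>\<^sup>+y. influence x y * indicator (- ball x (real n)) y \<partial>lborel) =
     (\<integral>\<^sup>+y. influence x (x + y) * indicator (- ball x (real n)) (x + y) \<partial>lborel)"
    by (rule nn_integral_lborel_shift[symmetric]) measurable
  also have "\<dots> = tail n"
    unfolding tail_def
  proof (rule nn_integral_cong)
    fix y
    show "influence x (x + y) * indicator (- ball x (real n)) (x + y) = influence 0 y * indicator (- ball 0 (real n)) y"
      using influence_shift[of x 0 y] by (auto simp: indicator_def dist_norm)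
  qed
  finally show ?thesis .
qed

lemma tail_limit: "tail \<longlonglongrightarrow> 0"
proof -
  have [measurable]: "influence 0 \<in> borel_measurable borel" using measurable_influence_section[of 0] by simp
  have "(\<lambda>n. \<integral>\<^sup>+y. influence 0 y * indicator (- ball 0 (real n)) y \<partial>lborel) \<longlonglongrightarrow> (\<integral>\<^sup>+y. 0 \<partial>(lborel :: 'a measure))"
  proof (rule nn_integral_dominated_convergence[where w="influence 0"])
    show "(\<integral>\<^sup>+y. influence 0 y \<partial>lborel) < \<infinity>"
      using nn_integral_influence[OF contraction, of 0] by (rule le_less_trans) simp
    show "AE y in lborel. (\<lambda>n. influence 0 y * indicator (- ball 0 (real n)) y) \<longlonglongrightarrow> 0"
    proof (rule AE_I2)
      fix y :: 'a
      obtain N where N: "norm y < real N" using reals_Archimedean2 by blast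
      have "\<forall>\<^sub>F n in sequentially. influence 0 y * indicator (- ball 0 (real n)) y = 0"
        using eventually_ge_at_top[of N] by eventually_elim (use N in \<open>auto simp: indicator_def\<close>)
      then show "(\<lambda>n. influence 0 y * indicator (- ball 0 (real n)) y) \<longlonglongrightarrow> 0"
        by (rule tendsto_eventually)
    qed
    show "AE y in lborel. influence 0 y * indicator (- ball 0 (real n)) y \<le> influence 0 y" for n
      by (auto simp: indicator_def)
  qed (measurable, auto)
  then show ?thesis by (simp add: tail_def[abs_def])
qed

lemma tail_finite: "tail n < \<infinity>"
proof -
  have "tail n \<le> (\<integral>\<^sup>+y. influence 0 y \<partial>lborel)"
    unfolding tail_def by (intro nn_integral_mono) (auto simp: indicator_def)
  also have "\<dots> < \<infinity>" using nn_integral_influence[OF contraction, of 0] by (rule le_less_trans) simp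
  finally show ?thesis .
qed

definition tail_bound :: "nat \<Rightarrow> real" where "tail_bound n = \<theta> * enn2real (tail n)"

lemma tail_bound_eq: "ennreal (tail_bound n) = ennreal \<theta> * tail n"
  using tail_finite[of n] \<theta>_nonneg by (simp add: tail_bound_def ennreal_mult less_top)

lemma tail_bound_limit: "tail_bound \<longlonglongrightarrow> 0"
proof -
  have "(\<lambda>n. enn2real (tail n)) \<longlonglongrightarrow> enn2real 0"
    by (rule tendsto_enn2real) (use tail_limit in auto)
  then have "(\<lambda>n. \<theta> * enn2real (tail n)) \<longlonglongrightarrow> \<theta> * 0" by (intro tendsto_mult_left) simp
  then show ?thesis by (simp add: tail_bound_def[abs_def])
qed

section \<open>Local approximation of the vacancy density\<close>

definition field :: "real \<Rightarrow> 'a set \<Rightarrow> 'a \<Rightarrow> real" where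
  "field t W = (\<lambda>x. t * indicator W x)"

lemma field_admissible:
  assumes "\<bar>t\<bar> \<le> \<theta>" "W \<in> sets lborel" "emeasure lborel W < \<infinity>"
  shows "admissible (field t W)"
  unfolding admissible_def field_def
proof (intro conjI allI)
  show "integrable lborel (\<lambda>x. t * indicator W x)"
    by (intro integrable_mult_right integrable_real_indicator assms)
  show "\<bar>t * indicator W x\<bar> \<le> \<theta>" for x
    using assms(1) \<theta>_nonneg by (auto simp: indicator_def)
qed

lemma ball_admissible: "\<bar>t\<bar> \<le> \<theta> \<Longrightarrow> admissible (field t (ball x r))"
  by (rule field_admissible) (auto simp: emeasure_bounded_finite[OF bounded_ball, simplified])

text \<open>The fields agree on the ball, so only points at distance at least n from y contribute.
  The version of \<open>rho_field_diff\<close> with y in the first place of the kernel is the right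
  one, because the influence is integrable in its second argument.\<close>

lemma rho_window:
  assumes t: "\<bar>t\<bar> \<le> \<theta>" and W: "W \<in> sets lborel" "emeasure lborel W < \<infinity>" and sub: "ball y (real n) \<subseteq> W"
  shows "\<bar>rho (field t W) {} y - rho (field t (ball y (real n))) {} y\<bar> \<le> tail_bound n"
proof -
  have "ennreal \<bar>rho (field t W) {} y - rho (field t (ball y (real n))) {} y\<bar>
     \<le> (\<integral>\<^sup>+x. ennreal \<bar>field t W x - field t (ball y (real n)) x\<bar> * influence y x \<partial>lborel)"
    by (rule rho_field_diff(2)[OF influence_bound_influence[OF contraction] field_admissible[OF t W] ball_admissible[OF t]]) simp
  also have "\<dots> \<le> (\<integral>\<^sup>+x. ennreal \<theta> * (influence y x * indicator (- ball y (real n)) x) \<partial>lborel)"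
  proof (rule nn_integral_mono)
    fix x
    show "ennreal \<bar>field t W x - field t (ball y (real n)) x\<bar> * influence y x \<le> ennreal \<theta> * (influence y x * indicator (- ball y (real n)) x)"
    proof (cases "x \<in> ball y (real n)")
      case True
      then have "field t W x = field t (ball y (real n)) x" using sub by (auto simp: field_def)
      then show ?thesis by simp
    next
      case False
      have "ennreal \<bar>field t W x - field t (ball y (real n)) x\<bar> \<le> ennreal \<theta>"
        using False t \<theta>_nonneg by (intro ennreal_leI) (auto simp: field_def indicator_def)
      then show ?thesis using False by (auto simp: indicator_def intro!: mult_right_mono)
    qed
  qed
  also have "\<dots> = ennreal \<theta> * tail n"
  proof -
    have [measurable]: "influence y \<in> borel_measurable borel" using measurable_influence_section[of y] by simp
    have "(\<lambda>x. influence y x * indicator (- ball y (real n)) x) \<in> borel_measurable lborel" by measurable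
    then show ?thesis by (subst nn_integral_cmult) (simp_all only: tail_shift)
  qed
  finally have "ennreal \<bar>rho (field t W) {} y - rho (field t (ball y (real n))) {} y\<bar> \<le> ennreal (tail_bound n)"
    by (simp only: tail_bound_eq)
  then show ?thesis using \<theta>_nonneg by (subst (asm) ennreal_le_iff) (simp_all add: tail_bound_def)
qed

text \<open>No translation acts on the sample space. The shifted set and the original have the same
  void probabilities by \<open>hit_measure_shift\<close>, which is enough to equate their
  exponential functionals.\<close>

lemma Z_shift:
  assumes \<zeta>: "admissible \<zeta>" and A: "finite A"
  shows "Z (\<lambda>x. \<zeta> (x - t)) ((+) t ` A) = Z \<zeta> A"
proof -
  define Xi2 where "Xi2 \<omega> = (+) t ` Xi \<omega>" for \<omega>
  have in_iff: "x \<in> Xi2 \<omega> \<longleftrightarrow> x - t \<in> Xi \<omega>" for x \<omega>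
    unfolding Xi2_def by (force simp: image_iff)
  have cl: "clear Xi2 C \<omega> = clear Xi ((+) (- t) ` C) \<omega>" for C \<omega>
    unfolding clear_def disjoint_iff in_iff by (auto simp: image_iff)
  have R: "random_set M Xi2"
  proof -
    have "Measurable.pred (lborel \<Otimes>\<^sub>M M) (\<lambda>p. (\<lambda>q. fst q \<in> Xi (snd q)) (fst p - t, snd p))"
      by (rule measurable_compose[OF _ Xi_measurable[unfolded random_set_def]]) measurable
    then show ?thesis by (simp add: random_set_def in_iff)
  qed
  have int: "integrable lborel (\<lambda>x. \<zeta> (x - t))"
  proof -
    have "integrable (distr lborel borel ((+) (- t))) \<zeta>"
      using admissibleD(1)[OF \<zeta>] by (simp add: lborel_distr_plus)
    then show ?thesis by (subst (asm) integrable_distr_eq) (use admissibleD(2)[OF \<zeta>] in auto)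
  qed
  have vac: "vacant_int Xi2 (\<lambda>x. \<zeta> (x - t)) \<omega> = vacant_int Xi \<zeta> \<omega>" if "\<omega> \<in> space M" for \<omega>
  proof -
    have "(\<lambda>x. \<zeta> x * clear Xi {x} \<omega>) \<in> borel_measurable lborel"
      using admissibleD(2)[OF \<zeta>] measurable_clear_section[OF Xi_measurable that] by simp
    from integral_lborel_shift[OF this, of "- t"] show ?thesis
      by (simp add: vacant_int_def cl)
  qed
  have "Z (\<lambda>x. \<zeta> (x - t)) ((+) t ` A) = (LINT \<omega>|M. clear Xi A \<omega> * exp (vacant_int Xi2 (\<lambda>x. \<zeta> (x - t)) \<omega>))"
    unfolding Z_def
  proof (rule exp_vacant_int_cong[where B=1])
    fix C :: "'a set" assume C: "finite C"
    have "(+) (- t) ` ((+) t ` A \<union> C) = A \<union> (+) (- t) ` C" by (simp add: image_Un image_image)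
    then have eq: "hit_measure ((+) t ` A \<union> C) = hit_measure (A \<union> (+) (- t) ` C)"
      using hit_measure_shift[of "(+) t ` A \<union> C" "- t"] A C by simp
    have "(LINT \<omega>|M. clear Xi ((+) t ` A) \<omega> * clear Xi C \<omega>) = exp (- hit_measure ((+) t ` A \<union> C))"
      using vacancy[of "(+) t ` A \<union> C"] A C by (simp add: clear_Un)
    also have "\<dots> = (LINT \<omega>|M. clear Xi A \<omega> * clear Xi2 C \<omega>)"
      using vacancy[of "A \<union> (+) (- t) ` C"] A C by (simp add: eq clear_Un cl)
    finally show "(LINT \<omega>|M. clear Xi ((+) t ` A) \<omega> * clear Xi C \<omega>) = (LINT \<omega>|M. clear Xi A \<omega> * clear Xi2 C \<omega>)" .
  qed (use A int R Xi_measurable measurable_clear[OF Xi_measurable] M.finite_measure_axioms in auto)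
  also have "\<dots> = Z \<zeta> A"
    unfolding Z_def by (intro Bochner_Integration.integral_cong) (auto simp: vac)
  finally show ?thesis .
qed

definition ball_density :: "real \<Rightarrow> nat \<Rightarrow> real" where
  "ball_density t n = rho (field t (ball 0 (real n))) {} 0"

lemma rho_ball:
  assumes "\<bar>t\<bar> \<le> \<theta>" shows "rho (field t (ball y (real n))) {} y = ball_density t n"
proof -
  have f: "field t (ball y (real n)) = (\<lambda>x. field t (ball 0 (real n)) (x - y))"
    by (rule ext) (auto simp: field_def indicator_def dist_norm norm_minus_commute)
  show ?thesis
    unfolding ball_density_def rho_def f
    using Z_shift[OF ball_admissible[OF assms, of 0 n], of "{0}" y] Z_shift[OF ball_admissible[OF assms, of 0 n], of "{}" y] by simp
qed

definition limit_density :: "real \<Rightarrow> real" where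
  "limit_density t = lim (ball_density t)"

lemma ball_density_diff:
  assumes "\<bar>t\<bar> \<le> \<theta>" "n \<le> m" shows "\<bar>ball_density t m - ball_density t n\<bar> \<le> tail_bound n"
proof -
  have "\<bar>rho (field t (ball 0 (real m))) {} 0 - rho (field t (ball 0 (real n))) {} 0\<bar> \<le> tail_bound n"
    by (rule rho_window) (use assms in \<open>auto simp: emeasure_bounded_finite[OF bounded_ball, simplified]\<close>)
  then show ?thesis by (simp add: ball_density_def)
qed

text \<open>Concentric balls are a case of the comparison of windows, so the sequence is Cauchy. As
  \<open>tail_bound\<close> does not involve t, the approximation is uniform in the tilt, and the
  mean vacant volume inherits this.\<close>

lemma ball_density_limit:
  assumes "\<bar>t\<bar> \<le> \<theta>"
  shows "ball_density t \<longlonglongrightarrow> limit_density t" "\<bar>limit_density t - ball_density t n\<bar> \<le> tail_bound n"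
proof -
  have "Cauchy (ball_density t)"
  proof (rule metric_CauchyI)
    fix e :: real assume "0 < e"
    then have "\<forall>\<^sub>F n in sequentially. tail_bound n < e / 2"
      by (intro order_tendstoD(2)[OF tail_bound_limit]) simp
    then obtain N where N: "tail_bound N < e / 2" by (auto simp: eventually_sequentially)
    show "\<exists>N. \<forall>m\<ge>N. \<forall>n\<ge>N. dist (ball_density t m) (ball_density t n) < e"
    proof (intro exI allI impI)
      fix m n assume "N \<le> m" "N \<le> n"
      then show "dist (ball_density t m) (ball_density t n) < e"
        using ball_density_diff[OF assms, of N m] ball_density_diff[OF assms, of N n] N by (auto simp: dist_real_def)
    qed
  qed
  then have "convergent (ball_density t)" by (simp add: Cauchy_convergent_iff)
  then show lim: "ball_density t \<longlonglongrightarrow> limit_density t" by (simp add: convergent_LIMSEQ_iff limit_density_def)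
  have "(\<lambda>m. \<bar>ball_density t m - ball_density t n\<bar>) \<longlonglongrightarrow> \<bar>limit_density t - ball_density t n\<bar>"
    by (intro tendsto_intros lim)
  then show "\<bar>limit_density t - ball_density t n\<bar> \<le> tail_bound n"
    by (rule LIMSEQ_le_const2) (use ball_density_diff[OF assms] in auto)
qed

lemma limit_density_bounds:
  assumes "\<bar>t\<bar> \<le> \<theta>" shows "0 \<le> limit_density t" "limit_density t \<le> 1"
proof -
  have "0 \<le> ball_density t n" "ball_density t n \<le> 1" for n
    using rho_bounds[OF ball_admissible[OF assms, of 0 n], of "{}" 0] by (auto simp: ball_density_def)
  then show "0 \<le> limit_density t" "limit_density t \<le> 1"
    using LIMSEQ_le_const[OF ball_density_limit(1)[OF assms]] LIMSEQ_le_const2[OF ball_density_limit(1)[OF assms]] by auto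
qed

text \<open>The bound is paid twice, once for passing from the window to the ball and once from the
  ball to the limit.\<close>

lemma rho_deep:
  assumes t: "\<bar>t\<bar> \<le> \<theta>" and W: "W \<in> sets lborel" "emeasure lborel W < \<infinity>" and sub: "ball y (real n) \<subseteq> W"
  shows "\<bar>rho (field t W) {} y - limit_density t\<bar> \<le> 2 * tail_bound n"
  using rho_window[OF assms] ball_density_limit(2)[OF t, of n] rho_ball[OF t, of y n] by linarith

text \<open>Without tilt \<open>rho\<close> is the plain void probability of a point, whose
  \<open>hit_measure\<close> is l.\<close>

lemma limit_density_zero: "limit_density 0 = exp (- l)"
proof -
  have "ball_density 0 n = exp (- l)" for n
  proof -
    have v: "vacant_int Xi (field 0 (ball 0 (real n))) \<omega> = 0" for \<omega> by (simp add: vacant_int_def field_def)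
    have "hit_measure {0} = l" using hit_measure_insert[of "{}" 0] hit_integral by (simp add: hit_measure_def)
    moreover have "hit_measure {} = 0" by (simp add: hit_measure_def)
    ultimately show ?thesis using vacancy[of "{0}"] vacancy[of "{}"] by (simp add: ball_density_def rho_def Z_def v)
  qed
  then have "ball_density 0 = (\<lambda>_. exp (- l))" by (rule ext)
  then have "ball_density 0 \<longlonglongrightarrow> exp (- l)" by (simp only: tendsto_const)
  then show ?thesis using ball_density_limit(1)[of 0] \<theta>_nonneg LIMSEQ_unique by auto
qed

end

section \<open>Mean and variance of the vacant volume\<close>

context stationary_boolean_model
begin

text \<open>Bounds the integral of \<open>indirect x\<close> over the second point: \<theta> K for
  the passage to the intermediate point, and K / (1 - \<theta> K) for the mass of the whole series
  from there.\<close>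

definition coupling_mass :: real where "coupling_mass = \<theta> * K * (K / (1 - \<theta> * K))"

lemma coupling_mass_nonneg: "0 \<le> coupling_mass"
  using \<theta>_nonneg K_nonneg contraction by (simp add: coupling_mass_def)

section \<open>Masses of the direct and the indirect influence\<close>

lemma measurable_indirect: "(\<lambda>y. indirect x y) \<in> borel_measurable lborel"
  unfolding indirect_def
  using measurable_kernelD(2)[OF measurable_kernel_compose[OF measurable_ker influence_bound_capped(2)[OF contraction]], of x]
  by (intro borel_measurable_times_ennreal) auto

lemma indirect_integral:
  "integrable lborel (\<lambda>y. enn2real (indirect x y))" "(LINT y|lborel. enn2real (indirect x y)) \<le> coupling_mass"
proof -
  have "(\<integral>\<^sup>+y. indirect x y \<partial>lborel) = ennreal \<theta> * (\<integral>\<^sup>+y. (\<integral>\<^sup>+x'. kernel x x' * capped x' y \<partial>lborel) \<partial>lborel)"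
    unfolding indirect_def
    by (rule nn_integral_cmult)
       (rule measurable_kernelD(2)[OF measurable_kernel_compose[OF measurable_ker influence_bound_capped(2)[OF contraction]]])
  also have "\<dots> \<le> ennreal \<theta> * (ennreal K * ennreal (K / (1 - \<theta> * K)))"
  proof (intro mult_left_mono nn_integral_kernel_compose influence_bound_capped(2)[OF contraction])
    show "(\<integral>\<^sup>+y. capped x y \<partial>lborel) \<le> ennreal (K / (1 - \<theta> * K))" for x
      by (rule order_trans[OF nn_integral_mono[of lborel "capped x" "influence x"] nn_integral_influence[OF contraction]]) (simp add: capped_def)
  qed simp
  also have "\<dots> = ennreal coupling_mass"
    using \<theta>_nonneg K_nonneg contraction by (simp add: coupling_mass_def mult.assoc flip: ennreal_mult)
  finally have le: "(\<integral>\<^sup>+y. indirect x y \<partial>lborel) \<le> ennreal coupling_mass" .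
  have eq: "(\<integral>\<^sup>+y. ennreal (enn2real (indirect x y)) \<partial>lborel) = (\<integral>\<^sup>+y. indirect x y \<partial>lborel)"
    by (intro nn_integral_cong ennreal_enn2real le_less_trans[OF indirect_finite]) simp
  have m: "(\<lambda>y. enn2real (indirect x y)) \<in> borel_measurable lborel"
    using measurable_indirect[of x] by simp
  show i: "integrable lborel (\<lambda>y. enn2real (indirect x y))"
    by (rule integrableI_nonneg[OF m]) (auto simp: eq intro: le_less_trans[OF le])
  have "ennreal (LINT y|lborel. enn2real (indirect x y)) \<le> ennreal coupling_mass"
    using nn_integral_eq_integral[OF i] eq le by simp
  then show "(LINT y|lborel. enn2real (indirect x y)) \<le> coupling_mass"
    using coupling_mass_nonneg by (subst (asm) ennreal_le_iff) simp_all
qed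

lemma overlap_lo_integral: "has_bochner_integral lborel (overlap_lo x) \<kappa>'"
proof (rule has_bochner_integral_nn_integral)
  have "(\<lambda>y. enn2real (overlap (- \<theta>) x y)) \<in> borel_measurable lborel"
    using measurable_kernelD(2)[OF measurable_overlap] by simp
  then show "overlap_lo x \<in> borel_measurable lborel"
    by (simp add: overlap_lo_eq overlap_lo_nonneg)
  have "(\<integral>\<^sup>+y. ennreal (overlap_lo x y) \<partial>lborel) = (\<integral>\<^sup>+e. ennreal (hit x e * (vol (S e) * exp (- \<theta> * vol (S e)))) \<partial>\<Lambda>)"
    by (simp only: overlap_lo_eq[symmetric] nn_integral_overlap_vol)
  also have "\<dots> = ennreal \<kappa>'"
    using \<kappa>'_integral[of x] by (subst nn_integral_eq_integral) (auto simp: has_bochner_integral_iff)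
  finally show "(\<integral>\<^sup>+y. ennreal (overlap_lo x y) \<partial>lborel) = ennreal \<kappa>'" .
qed (use overlap_lo_nonneg \<kappa>'_nonneg in auto)

lemma overlap_lo_shift: "overlap_lo (t + x) (t + y) = overlap_lo x y"
  using overlap_shift(2)[of t x y] overlap_lo_nonneg[of x y] overlap_lo_nonneg[of "t + x" "t + y"]
  by (simp add: overlap_lo_eq)

text \<open>The part of the direct mass \<kappa>' within distance n, all of which a window contains
  around its points of depth n.\<close>

definition near :: "nat \<Rightarrow> real" where
  "near n = (LINT y|lborel. indicator (ball 0 (real n)) y * overlap_lo 0 y)"

lemma near_limit: "near \<longlonglongrightarrow> \<kappa>'"
proof -
  have i: "integrable lborel (overlap_lo 0)" and v: "(LINT y|lborel. overlap_lo 0 y) = \<kappa>'"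
    using overlap_lo_integral[of 0] by (auto simp: has_bochner_integral_iff)
  have [measurable]: "overlap_lo 0 \<in> borel_measurable borel" using i by auto
  have "(\<lambda>n. LINT y|lborel. indicator (ball 0 (real n)) y * overlap_lo 0 y) \<longlonglongrightarrow> (LINT y|lborel. overlap_lo 0 y)"
  proof (rule integral_dominated_convergence[where w="overlap_lo 0"])
    show "AE y in lborel. (\<lambda>n. indicator (ball 0 (real n)) y * overlap_lo 0 y) \<longlonglongrightarrow> overlap_lo 0 y"
    proof (rule AE_I2)
      fix y :: 'a
      obtain N where N: "norm y < real N" using reals_Archimedean2 by blast
      have "\<forall>\<^sub>F n in sequentially. indicator (ball 0 (real n)) y * overlap_lo 0 y = overlap_lo 0 y"
        using eventually_ge_at_top[of N] by eventually_elim (use N in \<open>auto simp: indicator_def\<close>)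
      then show "(\<lambda>n. indicator (ball 0 (real n)) y * overlap_lo 0 y) \<longlonglongrightarrow> overlap_lo 0 y"
        by (rule tendsto_eventually)
    qed
  qed (use i overlap_lo_nonneg in \<open>auto simp: indicator_def intro!: AE_I2\<close>)
  then show ?thesis by (simp add: near_def[abs_def] v)
qed

lemma near_shift: "(LINT y|lborel. indicator (ball x (real n)) y * overlap_lo x y) = near n"
proof -
  have [measurable]: "overlap_lo x \<in> borel_measurable borel" using overlap_lo_integral[of x] by (auto simp: has_bochner_integral_iff)
  have "(LINT y|lborel. indicator (ball x (real n)) y * overlap_lo x y) = (LINT y|lborel. indicator (ball x (real n)) (x + y) * overlap_lo x (x + y))"
    by (intro integral_lborel_shift[symmetric] borel_measurable_times borel_measurable_indicator) auto
  also have "\<dots> = near n"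
    unfolding near_def
  proof (intro Bochner_Integration.integral_cong refl)
    fix y
    show "indicator (ball x (real n)) (x + y) * overlap_lo x (x + y) = indicator (ball 0 (real n)) y * overlap_lo 0 y"
      using overlap_lo_shift[of x 0 y] by (auto simp: indicator_def dist_norm)
  qed
  finally show ?thesis .
qed

context
  fixes W :: "'a set"
  assumes W: "W \<in> sets lborel" "emeasure lborel W < \<infinity>"
begin

abbreviation "vac \<equiv> vacant_int Xi (indicator W)"

definition part :: "real \<Rightarrow> real" where "part t = (LINT \<omega>|M. exp (t * vac \<omega>))"
definition part1 :: "real \<Rightarrow> real" where "part1 t = (LINT \<omega>|M. vac \<omega> * exp (t * vac \<omega>))"
definition part2 :: "real \<Rightarrow> real" where "part2 t = (LINT \<omega>|M. vac \<omega> * vac \<omega> * exp (t * vac \<omega>))"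

section \<open>Tilted moments of the vacant volume of one window\<close>

lemma ind_integrable: "integrable lborel (indicator W :: 'a \<Rightarrow> real)"
  using W by (intro integrable_real_indicator) auto

lemma vac_measurable: "vac \<in> borel_measurable M"
  by (rule measurable_vacant_int[OF Xi_measurable]) (use W in simp)

lemma vac_bound: "\<omega> \<in> space M \<Longrightarrow> \<bar>vac \<omega>\<bar> \<le> vol W"
  using vacant_int_le[OF Xi_measurable ind_integrable] W by simp

lemma exp_vac_bound: "\<omega> \<in> space M \<Longrightarrow> \<bar>exp (t * vac \<omega>)\<bar> \<le> exp (\<bar>t\<bar> * vol W)"
proof -
  assume \<omega>: "\<omega> \<in> space M"
  have "t * vac \<omega> \<le> \<bar>t\<bar> * \<bar>vac \<omega>\<bar>" by (simp flip: abs_mult)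
  also have "\<dots> \<le> \<bar>t\<bar> * vol W" by (intro mult_left_mono vac_bound \<omega>) simp
  finally show ?thesis by simp
qed

lemma vacant_int_field: "vacant_int Xi (field t W) \<omega> = t * vac \<omega>"
  by (simp add: vacant_int_def field_def mult.assoc)

lemma Z_field: "Z (field t W) A = (LINT \<omega>|M. clear Xi A \<omega> * exp (t * vac \<omega>))"
  by (simp add: Z_def vacant_int_field)

lemma part_eq: "part t = Z (field t W) {}"
  by (simp add: part_def Z_field)

lemma part_derivative:
  "(part has_real_derivative part1 t) (at t)" "(part1 has_real_derivative part2 t) (at t)"
  using M.exp_tilt_derivative[of "\<lambda>_. 1" "\<lambda>_. 0" vac 1 0 "vol W" t] M.exp_tilt_derivative[of vac "\<lambda>_. 0" vac "vol W" 0 "vol W" t]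
    vac_measurable vac_bound
  by (simp_all add: part_def[abs_def] part1_def[abs_def] part2_def)

lemma part_pos: "0 < part t"
proof -
  have "exp (- \<bar>t\<bar> * vol W) \<le> exp (t * vac \<omega>)" if \<omega>: "\<omega> \<in> space M" for \<omega>
  proof -
    have "- (\<bar>t\<bar> * \<bar>vac \<omega>\<bar>) \<le> t * vac \<omega>" by (simp add: abs_mult[symmetric])
    moreover have "\<bar>t\<bar> * \<bar>vac \<omega>\<bar> \<le> \<bar>t\<bar> * vol W" by (intro mult_left_mono vac_bound \<omega>) simp
    ultimately show ?thesis by simp
  qed
  then have "(LINT \<omega>|M. exp (- \<bar>t\<bar> * vol W)) \<le> part t"
    unfolding part_def using vac_measurable exp_vac_bound
    by (intro integral_mono M.integrable_bounded[of _ "exp (\<bar>t\<bar> * vol W)"]) auto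
  then show ?thesis by (simp add: M.prob_space less_le_trans[OF exp_gt_zero])
qed

lemma part1_eq: "part1 t = (LINT x|lborel. indicator W x * Z (field t W) {x})"
proof -
  have "part1 t = (LINT \<omega>|M. exp (t * vac \<omega>) * vac \<omega>)" by (simp add: part1_def mult.commute)
  also have "\<dots> = (LINT x|lborel. indicator W x * (LINT \<omega>|M. exp (t * vac \<omega>) * clear Xi {x} \<omega>))"
    by (rule M.campbell_vacant[OF Xi_measurable ind_integrable _ exp_vac_bound]) (use vac_measurable in measurable)
  finally show ?thesis by (simp add: Z_field mult.commute)
qed

definition mean_vac :: "real \<Rightarrow> real" where "mean_vac t = part1 t / part t"

lemma mean_vac_eq: "mean_vac t = (LINT x|lborel. indicator W x * rho (field t W) {} x)"
  by (simp add: mean_vac_def part1_eq rho_def part_eq)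

lemma log_part_derivative: "((\<lambda>t. ln (part t)) has_real_derivative mean_vac t) (at t)"
  using DERIV_chain2[OF DERIV_ln_divide[OF part_pos] part_derivative(1), of t] by (simp add: mean_vac_def)

definition var_vac :: "real \<Rightarrow> real" where "var_vac t = part2 t / part t - (mean_vac t)\<^sup>2"

lemma mean_vac_derivative: "(mean_vac has_real_derivative var_vac t) (at t)"
proof -
  have "((\<lambda>t. part1 t / part t) has_real_derivative (part2 t * part t - part1 t * part1 t) / (part t * part t)) (at t)"
    by (intro DERIV_divide part_derivative) (use part_pos[of t] in auto)
  moreover have "(part2 t * part t - part1 t * part1 t) / (part t * part t) = var_vac t"
    using part_pos[of t] by (simp add: var_vac_def mean_vac_def power2_eq_square field_simps)
  ultimately show ?thesis by (simp add: mean_vac_def[abs_def])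
qed

text \<open>Campbell's formula applied twice makes the variance a double integral of covariances
  over the window. The inner integral \<Delta> x is kept apart, since it admits a lower bound for
  each fixed x.\<close>

lemma var_vac_eq:
  assumes t: "\<bar>t\<bar> \<le> \<theta>"
  defines "\<Delta> \<equiv> \<lambda>x. LINT y|lborel. indicator W y * (rho (field t W) {x} y - rho (field t W) {} y)"
  shows "var_vac t = (LINT x|lborel. indicator W x * (rho (field t W) {} x * \<Delta> x))"
    "integrable lborel (\<lambda>x. indicator W x * (rho (field t W) {} x * \<Delta> x))"
proof -
  let ?z = "field t W"
  have adm: "admissible ?z" by (rule field_admissible[OF t W])
  have iW: "integrable lborel (\<lambda>y. indicator W y * rho ?z A y)" if "finite A" for A
  proof (rule Bochner_Integration.integrable_bound[OF ind_integrable])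
    show "(\<lambda>y. indicator W y * rho ?z A y) \<in> borel_measurable lborel"
      using measurable_rho(1)[OF adm that] W by simp
    show "AE y in lborel. norm (indicator W y * rho ?z A y) \<le> norm (indicator W y :: real)"
    proof (rule AE_I2)
      fix y show "norm (indicator W y * rho ?z A y) \<le> norm (indicator W y :: real)"
        using rho_bounds[OF adm that, of y] by (auto simp: indicator_def)
    qed
  qed
  define A where "A x = (LINT \<omega>|M. (vac \<omega> * exp (t * vac \<omega>)) * clear Xi {x} \<omega>)" for x
  have mve: "(\<lambda>\<omega>. vac \<omega> * exp (t * vac \<omega>)) \<in> borel_measurable M" using vac_measurable by measurable
  have bve: "\<bar>vac \<omega> * exp (t * vac \<omega>)\<bar> \<le> vol W * exp (\<bar>t\<bar> * vol W)" if "\<omega> \<in> space M" for \<omega>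
    unfolding abs_mult by (intro mult_mono vac_bound exp_vac_bound that) auto
  have p2: "part2 t = (LINT x|lborel. indicator W x * A x)"
    using M.campbell_vacant[OF Xi_measurable ind_integrable mve bve] by (simp add: part2_def A_def mult_ac)
  have Aeq: "A x = (LINT y|lborel. indicator W y * Z ?z (insert y {x}))" for x
  proof -
    have "A x = (LINT \<omega>|M. (clear Xi {x} \<omega> * exp (t * vac \<omega>)) * vac \<omega>)" by (simp add: A_def mult_ac)
    also have "\<dots> = (LINT y|lborel. indicator W y * (LINT \<omega>|M. (clear Xi {x} \<omega> * exp (t * vac \<omega>)) * clear Xi {y} \<omega>))"
    proof (rule M.campbell_vacant[OF Xi_measurable ind_integrable])
      show "(\<lambda>\<omega>. clear Xi {x} \<omega> * exp (t * vac \<omega>)) \<in> borel_measurable M"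
        using vac_measurable measurable_clear_point[OF Xi_measurable, of x] by measurable
      show "\<bar>clear Xi {x} \<omega> * exp (t * vac \<omega>)\<bar> \<le> 1 * exp (\<bar>t\<bar> * vol W)" if "\<omega> \<in> space M" for \<omega>
        unfolding abs_mult by (intro mult_mono exp_vac_bound that) auto
    qed
    finally show ?thesis by (simp add: Z_field clear_insert[of Xi _ "{x}"] mult_ac)
  qed
  have Zx: "0 < Z ?z {x}" for x using Z_pos[OF adm, of "{x}"] by simp
  have A\<Delta>: "rho ?z {} x * \<Delta> x = A x / part t - rho ?z {} x * mean_vac t" for x
  proof -
    have "\<Delta> x = (LINT y|lborel. indicator W y * rho ?z {x} y - indicator W y * rho ?z {} y)"
      by (simp add: \<Delta>_def right_diff_distrib)
    also have "\<dots> = (LINT y|lborel. indicator W y * rho ?z {x} y) - mean_vac t"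
      using iW[of "{x}"] iW[of "{}"] by (simp add: mean_vac_eq)
    also have "(LINT y|lborel. indicator W y * rho ?z {x} y) = A x / Z ?z {x}"
      by (simp add: Aeq rho_def)
    finally have "rho ?z {} x * \<Delta> x = rho ?z {} x * (A x / Z ?z {x}) - rho ?z {} x * mean_vac t"
      by (simp add: right_diff_distrib)
    also have "rho ?z {} x * (A x / Z ?z {x}) = A x / part t" using Zx[of x] by (simp add: rho_def part_eq)
    finally show ?thesis .
  qed
  have mA: "A \<in> borel_measurable lborel"
    unfolding A_def[abs_def] by (rule M.measurable_clear_integral[OF Xi_measurable mve])
  have iA: "integrable lborel (\<lambda>x. indicator W x * A x)"
  proof (rule Bochner_Integration.integrable_bound[of _ "\<lambda>x. (vol W * exp (\<bar>t\<bar> * vol W)) * indicator W x"])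
    show "(\<lambda>x. indicator W x * A x) \<in> borel_measurable lborel" using mA W by simp
    have "\<bar>A x\<bar> \<le> vol W * exp (\<bar>t\<bar> * vol W)" for x
    proof -
      have m: "(\<lambda>\<omega>. vac \<omega> * exp (t * vac \<omega>) * clear Xi {x} \<omega>) \<in> borel_measurable M"
        using mve measurable_clear_point[OF Xi_measurable, of x] by simp
      have b: "\<bar>vac \<omega> * exp (t * vac \<omega>) * clear Xi {x} \<omega>\<bar> \<le> vol W * exp (\<bar>t\<bar> * vol W)" if "\<omega> \<in> space M" for \<omega>
        using bve[OF that] by (auto simp: clear_def intro: order_trans[OF abs_ge_zero])
      have "\<bar>A x\<bar> \<le> (LINT \<omega>|M. \<bar>vac \<omega> * exp (t * vac \<omega>) * clear Xi {x} \<omega>\<bar>)" unfolding A_def by (rule integral_abs_bound)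
      also have "\<dots> \<le> (LINT \<omega>|M. vol W * exp (\<bar>t\<bar> * vol W))"
        by (intro integral_mono integrable_abs M.integrable_bounded[OF m b] b) auto
      finally show ?thesis by (simp add: M.prob_space)
    qed
    then show "AE x in lborel. norm (indicator W x * A x) \<le> norm ((vol W * exp (\<bar>t\<bar> * vol W)) * indicator W x)"
      by (intro AE_I2) (auto simp: indicator_def intro: order_trans[OF _ abs_ge_self])
  qed (use ind_integrable in simp)
  have eq: "(\<lambda>x. indicator W x * (rho ?z {} x * \<Delta> x)) = (\<lambda>x. (indicator W x * A x) / part t - (indicator W x * rho ?z {} x) * mean_vac t)"
    by (rule ext) (simp add: A\<Delta> right_diff_distrib)
  show "integrable lborel (\<lambda>x. indicator W x * (rho ?z {} x * \<Delta> x))"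
    unfolding eq using iA iW[of "{}"] by simp
  show "var_vac t = (LINT x|lborel. indicator W x * (rho ?z {} x * \<Delta> x))"
    unfolding eq using iA iW[of "{}"] by (simp add: var_vac_def p2 mean_vac_eq[symmetric] power2_eq_square)
qed

context
  fixes V :: "'a set" and n :: nat
  assumes V: "V \<in> sets lborel" "V \<subseteq> W" and deep: "\<And>x. x \<in> V \<Longrightarrow> ball x (real n) \<subseteq> W"
begin

section \<open>Deep points and the boundary layer\<close>

lemma V_integrable: "integrable lborel (indicator V :: 'a \<Rightarrow> real)"
proof (rule integrable_real_indicator)
  show "emeasure lborel V < \<infinity>" using emeasure_mono[OF V(2)] W by (metis le_less_trans)
qed (rule V(1))

text \<open>Points of V contribute an error of 2 \<open>tail_bound n\<close> each. Off V the bound 1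
  for a difference of probabilities is used, which costs the volume of the boundary layer.\<close>

lemma mean_vac_approx:
  assumes t: "\<bar>t\<bar> \<le> \<theta>"
  shows "\<bar>mean_vac t - limit_density t * vol W\<bar> \<le> 2 * tail_bound n * vol W + (vol W - vol V)"
proof -
  let ?z = "field t W" and ?r = "limit_density t"
  have adm: "admissible ?z" by (rule field_admissible[OF t W])
  have iW: "integrable lborel (\<lambda>y. indicator W y * rho ?z {} y)"
  proof (rule Bochner_Integration.integrable_bound[OF ind_integrable])
    show "(\<lambda>y. indicator W y * rho ?z {} y) \<in> borel_measurable lborel"
      using measurable_rho(1)[OF adm, of "{}"] W by simp
    show "AE y in lborel. norm (indicator W y * rho ?z {} y) \<le> norm (indicator W y :: real)"
    proof (rule AE_I2)
      fix y show "norm (indicator W y * rho ?z {} y) \<le> norm (indicator W y :: real)"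
        using rho_bounds[OF adm, of "{}" y] by (auto simp: indicator_def)
    qed
  qed
  have "mean_vac t - ?r * vol W = (LINT x|lborel. indicator W x * rho ?z {} x - ?r * indicator W x)"
    using iW ind_integrable W by (simp add: mean_vac_eq)
  also have "\<bar>\<dots>\<bar> \<le> (LINT x|lborel. \<bar>indicator W x * rho ?z {} x - ?r * indicator W x\<bar>)" by (rule integral_abs_bound)
  also have "\<dots> \<le> (LINT x|lborel. 2 * tail_bound n * indicator W x + (indicator W x - indicator V x))"
  proof (rule integral_mono)
    show "integrable lborel (\<lambda>x. \<bar>indicator W x * rho ?z {} x - ?r * indicator W x\<bar>)"
      using iW ind_integrable by simp
    show "integrable lborel (\<lambda>x. 2 * tail_bound n * indicator W x + (indicator W x - indicator V x))"
      using V_integrable ind_integrable by simp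
    fix x
    have tb: "0 \<le> tail_bound n" using \<theta>_nonneg by (simp add: tail_bound_def)
    show "\<bar>indicator W x * rho ?z {} x - ?r * indicator W x\<bar> \<le> 2 * tail_bound n * indicator W x + (indicator W x - indicator V x)"
      using rho_bounds[OF adm, of "{}" x] limit_density_bounds[OF t] rho_deep[OF t W deep, of x] V(2) tb
      by (auto simp: indicator_def)
  qed
  also have "\<dots> = 2 * tail_bound n * vol W + (vol W - vol V)"
    using V_integrable ind_integrable V(1) W by simp
  finally show ?thesis .
qed

text \<open>At a deep point the window contains the ball that carries the direct mass
  \<open>near n\<close>, so the total influence is at least \<delta>. Elsewhere the direct part is
  merely nonnegative and the loss is at most \<open>coupling_mass\<close>. The outer factor
  \<open>rho\<close> is bounded below by exp (- l - \<theta> \<kappa>) on V and above by 1 off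
  V.\<close>

lemma var_vac_lower:
  assumes t: "\<bar>t\<bar> \<le> \<theta>" and \<delta>: "0 \<le> \<delta>" "\<delta> \<le> exp (- l - 3 * \<theta> * \<kappa>) * near n - coupling_mass"
  shows "exp (- l - \<theta> * \<kappa>) * \<delta> * vol V - coupling_mass * (vol W - vol V) \<le> var_vac t"
proof -
  let ?z = "field t W"
  have adm: "admissible ?z" by (rule field_admissible[OF t W])
  define \<Delta> where "\<Delta> x = (LINT y|lborel. indicator W y * (rho ?z {x} y - rho ?z {} y))" for x
  let ?c = "exp (- l - 3 * \<theta> * \<kappa>)"
  have io: "integrable lborel (overlap_lo x)" for x using overlap_lo_integral[of x] by (simp add: has_bochner_integral_iff)
  have iB: "integrable lborel (\<lambda>y. indicator B y * f y)" if "integrable lborel f" "B \<in> sets lborel" for f :: "'a \<Rightarrow> real" and B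
    by (rule Bochner_Integration.integrable_bound[OF that(1)]) (use that in \<open>auto simp: indicator_def\<close>)
  \<comment> \<open>The gain is integrated over the window only, the loss over the whole space; this
    is legitimate because \<open>indirect\<close> is nonnegative, and its total mass is what is
    under control.\<close>
  have \<Delta>: "?c * (LINT y|lborel. indicator W y * overlap_lo x y) - coupling_mass \<le> \<Delta> x" for x
  proof -
    have "?c * (LINT y|lborel. indicator W y * overlap_lo x y) - coupling_mass \<le>
       ?c * (LINT y|lborel. indicator W y * overlap_lo x y) - (LINT y|lborel. enn2real (indirect x y))"
      using indirect_integral(2)[of x] by simp
    also have "\<dots> = (LINT y|lborel. ?c * (indicator W y * overlap_lo x y) - enn2real (indirect x y))"
      using iB[OF io W(1)] indirect_integral(1)[of x] by simp
    also have "\<dots> \<le> \<Delta> x" unfolding \<Delta>_def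
    proof (rule integral_mono)
      show "integrable lborel (\<lambda>y. ?c * (indicator W y * overlap_lo x y) - enn2real (indirect x y))"
        using iB[OF io W(1)] indirect_integral(1)[of x] by simp
      show "integrable lborel (\<lambda>y. indicator W y * (rho ?z {x} y - rho ?z {} y))"
      proof (rule Bochner_Integration.integrable_bound[OF ind_integrable])
        show "(\<lambda>y. indicator W y * (rho ?z {x} y - rho ?z {} y)) \<in> borel_measurable lborel"
          using measurable_rho(1)[OF adm, of "{}"] measurable_rho(1)[OF adm, of "{x}"] W by simp
        show "AE y in lborel. norm (indicator W y * (rho ?z {x} y - rho ?z {} y)) \<le> norm (indicator W y :: real)"
        proof (rule AE_I2)
          fix y show "norm (indicator W y * (rho ?z {x} y - rho ?z {} y)) \<le> norm (indicator W y :: real)"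
            using rho_bounds[OF adm, of "{}" y] rho_bounds[OF adm, of "{x}" y] by (auto simp: indicator_def)
        qed
      qed
      fix y
      show "?c * (indicator W y * overlap_lo x y) - enn2real (indirect x y) \<le> indicator W y * (rho ?z {x} y - rho ?z {} y)"
        using pair_repulsion_lower[OF adm contraction, of x y] enn2real_nonneg[of "indirect x y"] by (auto simp: indicator_def)
    qed
    finally show ?thesis .
  qed
  have \<Delta>V: "\<delta> \<le> \<Delta> x" if "x \<in> V" for x
  proof -
    have "near n \<le> (LINT y|lborel. indicator W y * overlap_lo x y)"
      unfolding near_shift[of x n, symmetric]
      by (intro integral_mono iB io mult_right_mono overlap_lo_nonneg) (use W deep[OF that] in \<open>auto simp: indicator_def\<close>)
    then have "?c * near n \<le> ?c * (LINT y|lborel. indicator W y * overlap_lo x y)" by (intro mult_left_mono) auto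
    then show ?thesis using \<Delta>[of x] \<delta>(2) by linarith
  qed
  have \<Delta>W: "- coupling_mass \<le> \<Delta> x" for x
  proof -
    have "0 \<le> ?c * (LINT y|lborel. indicator W y * overlap_lo x y)"
      using overlap_lo_nonneg by (intro mult_nonneg_nonneg integral_nonneg_AE AE_I2) auto
    then show ?thesis using \<Delta>[of x] by linarith
  qed
  have "exp (- l - \<theta> * \<kappa>) * \<delta> * vol V - coupling_mass * (vol W - vol V) =
     (LINT x|lborel. exp (- l - \<theta> * \<kappa>) * \<delta> * indicator V x - coupling_mass * (indicator W x - indicator V x))"
    using V_integrable ind_integrable V(1) W by simp
  also have "\<dots> \<le> (LINT x|lborel. indicator W x * (rho ?z {} x * \<Delta> x))"
  proof (rule integral_mono)
    show "integrable lborel (\<lambda>x. exp (- l - \<theta> * \<kappa>) * \<delta> * indicator V x - coupling_mass * (indicator W x - indicator V x))"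
      using V_integrable ind_integrable by simp
    show "integrable lborel (\<lambda>x. indicator W x * (rho ?z {} x * \<Delta> x))"
      unfolding \<Delta>_def by (rule var_vac_eq(2)[OF t])
    fix x
    have r: "exp (- l - \<theta> * \<kappa>) \<le> rho ?z {} x" "rho ?z {} x \<le> 1" "0 < rho ?z {} x"
      using rho_lower_uniform[OF adm, of "{}" x] rho_bounds[OF adm, of "{}" x] by auto
    consider "x \<in> V" | "x \<in> W" "x \<notin> V" | "x \<notin> W" by blast
    then show "exp (- l - \<theta> * \<kappa>) * \<delta> * indicator V x - coupling_mass * (indicator W x - indicator V x) \<le> indicator W x * (rho ?z {} x * \<Delta> x)"
    proof cases
      case 1
      have "exp (- l - \<theta> * \<kappa>) * \<delta> \<le> rho ?z {} x * \<Delta> x"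
        using r \<Delta>V[OF 1] \<delta>(1) by (intro mult_mono) auto
      then show ?thesis using 1 V(2) by auto
    next
      case 2
      have "rho ?z {} x * (- coupling_mass) \<le> rho ?z {} x * \<Delta> x" using r \<Delta>W[of x] by (intro mult_left_mono) auto
      moreover have "rho ?z {} x * coupling_mass \<le> 1 * coupling_mass" using r coupling_mass_nonneg by (intro mult_right_mono) auto
      ultimately show ?thesis using 2 by simp
    next
      case 3
      then show ?thesis using V(2) by (auto simp: indicator_def)
    qed
  qed
  also have "\<dots> = var_vac t" unfolding \<Delta>_def by (rule var_vac_eq(1)[OF t, symmetric])
  finally show ?thesis .
qed

end
end
end

section \<open>Tails by exponential tilting\<close>

lemma eventually_at_left_less: "\<forall>\<^sub>F t in at_left x. t < x" for x :: real
  by (simp add: eventually_at_filter)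

locale scaled_mgf_limit = prob_space M for M :: "'w measure" +
  fixes V :: "nat \<Rightarrow> 'w \<Rightarrow> real" and a C :: "nat \<Rightarrow> real" and L l :: "real \<Rightarrow> real" and R :: real
  assumes V_measurable: "\<And>n. V n \<in> borel_measurable M"
    and V_bounded: "\<And>n \<omega>. \<omega> \<in> space M \<Longrightarrow> \<bar>V n \<omega>\<bar> \<le> C n"
    and a_pos: "\<And>n. 0 < a n" and a_limit: "filterlim a at_top sequentially"
    and mgf_limit: "\<And>h. \<bar>h\<bar> < R \<Longrightarrow> (\<lambda>n. ln (LINT \<omega>|M. exp (h * V n \<omega>)) / a n) \<longlonglongrightarrow> L h"
    and L_derivative: "\<And>h. \<bar>h\<bar> < R \<Longrightarrow> (L has_real_derivative l h) (at h)"
    and l_continuous: "continuous_on {-R<..<R} l"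
    and l_strict_mono: "\<And>h k. \<lbrakk>-R < h; h < k; k < R\<rbrakk> \<Longrightarrow> l h < l k"
begin

definition mgf :: "nat \<Rightarrow> real \<Rightarrow> real" where "mgf n h = (LINT \<omega>|M. exp (h * V n \<omega>))"

section \<open>Exponential bounds under a tilted law\<close>

lemma exp_integrable: "integrable M (\<lambda>\<omega>. exp (h * V n \<omega>))"
proof (rule integrable_const_bound)
  show "AE \<omega> in M. norm (exp (h * V n \<omega>)) \<le> exp (\<bar>h\<bar> * C n)"
  proof (rule AE_I2)
    fix \<omega> assume "\<omega> \<in> space M"
    have "h * V n \<omega> \<le> \<bar>h\<bar> * \<bar>V n \<omega>\<bar>" by (simp flip: abs_mult)
    also have "\<dots> \<le> \<bar>h\<bar> * C n" by (intro mult_left_mono V_bounded \<open>\<omega> \<in> space M\<close>) simp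
    finally show "norm (exp (h * V n \<omega>)) \<le> exp (\<bar>h\<bar> * C n)" by simp
  qed
qed (use V_measurable in measurable)

lemma mgf_pos: "0 < mgf n h"
proof -
  have "0 \<le> mgf n h" unfolding mgf_def by simp
  moreover have "mgf n h \<noteq> 0"
  proof
    assume "mgf n h = 0"
    then have "AE \<omega> in M. exp (h * V n \<omega>) = 0"
      unfolding mgf_def by (subst (asm) integral_nonneg_eq_0_iff_AE[OF exp_integrable]) auto
    then show False by simp
  qed
  ultimately show ?thesis by simp
qed

text \<open>Exponential Markov inequality under the tilt h: on E the factor
  \<open>exp (t * (V n \<omega> - y * a n))\<close> is at least 1. The sign of t decides which tail
  is covered.\<close>

lemma tilted_event_le:
  assumes E: "E \<in> sets M" and sub: "\<And>\<omega>. \<omega> \<in> E \<Longrightarrow> 0 \<le> t * (V n \<omega> - y * a n)"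
  shows "(LINT \<omega>|M. indicator E \<omega> * exp (h * V n \<omega>)) \<le> exp (- t * y * a n) * mgf n (h + t)"
proof -
  have "(LINT \<omega>|M. indicator E \<omega> * exp (h * V n \<omega>)) \<le> (LINT \<omega>|M. exp (- t * y * a n) * exp ((h + t) * V n \<omega>))"
  proof (rule integral_mono)
    show "integrable M (\<lambda>\<omega>. indicator E \<omega> * exp (h * V n \<omega>))"
      by (rule Bochner_Integration.integrable_bound[OF exp_integrable[of h n]])
         (use E V_measurable[of n] in \<open>auto simp: indicator_def\<close>)
    show "integrable M (\<lambda>\<omega>. exp (- t * y * a n) * exp ((h + t) * V n \<omega>))"
      using exp_integrable by (rule integrable_mult_right)
    fix \<omega>
    show "indicator E \<omega> * exp (h * V n \<omega>) \<le> exp (- t * y * a n) * exp ((h + t) * V n \<omega>)"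
    proof (cases "\<omega> \<in> E")
      case True
      have "h * V n \<omega> \<le> - t * y * a n + (h + t) * V n \<omega>" using sub[OF True] by (simp add: algebra_simps)
      then show ?thesis using True by (simp flip: exp_add)
    qed simp
  qed
  then show ?thesis by (simp add: mgf_def)
qed

text \<open>The logarithm is \<open>a n\<close> times a quantity that converges to the negative
  number \<open>L (h + t) - L h - t * y\<close>, while \<open>a n\<close> tends to infinity.\<close>

lemma tilted_tail_vanishes:
  assumes h: "\<bar>h\<bar> < R" "\<bar>h + t\<bar> < R" and neg: "L (h + t) - L h - t * y < 0"
  shows "(\<lambda>n. exp (- t * y * a n) * mgf n (h + t) / mgf n h) \<longlonglongrightarrow> 0"
proof -
  define c where "c n = ln (mgf n (h + t)) / a n - ln (mgf n h) / a n - t * y" for n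
  have "c \<longlonglongrightarrow> L (h + t) - L h - t * y"
    unfolding c_def[abs_def] mgf_def by (intro tendsto_intros mgf_limit h)
  then have "filterlim (\<lambda>n. c n * a n) at_bot sequentially"
    by (rule filterlim_tendsto_neg_mult_at_bot[OF _ neg a_limit])
  then have "(\<lambda>n. exp (c n * a n)) \<longlonglongrightarrow> 0" by (rule filterlim_compose[OF exp_at_bot])
  moreover have "exp (- t * y * a n) * mgf n (h + t) / mgf n h = exp (c n * a n)" for n
  proof -
    have "c n * a n = ln (mgf n (h + t)) - ln (mgf n h) - t * y * a n"
      using a_pos[of n] by (simp add: c_def algebra_simps)
    then have "exp (c n * a n) = exp (ln (mgf n (h + t))) * exp (- ln (mgf n h)) * exp (- t * y * a n)"
      by (simp flip: exp_add)
    then show ?thesis using mgf_pos[of n h] mgf_pos[of n "h + t"] by (simp add: exp_minus divide_inverse mult_ac)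
  qed
  ultimately show ?thesis by simp
qed

lemma small_shift_right:
  assumes h: "\<bar>h\<bar> < R" and y: "l h < y"
  obtains t where "0 < t" "\<bar>h + t\<bar> < R" "L (h + t) - L h - t * y < 0"
proof -
  have "((\<lambda>t. (L (h + t) - L h) / t) \<longlongrightarrow> l h) (at 0)" using L_derivative[OF h] by (simp add: DERIV_def)
  then have "\<forall>\<^sub>F t in at_right 0. (L (h + t) - L h) / t < y"
    using y by (intro order_tendstoD(2)) (auto simp: filterlim_at_split)
  moreover have "\<forall>\<^sub>F t in at_right 0. t < R - \<bar>h\<bar>"
    using h by (intro order_tendstoD(2)[OF tendsto_ident_at]) auto
  moreover have "\<forall>\<^sub>F t in at_right (0::real). 0 < t" by (rule eventually_at_right_less)
  ultimately have "\<forall>\<^sub>F t in at_right 0. 0 < t \<and> \<bar>h + t\<bar> < R \<and> L (h + t) - L h - t * y < 0"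
    by eventually_elim (auto simp: field_simps)
  then obtain t where "0 < t" "\<bar>h + t\<bar> < R" "L (h + t) - L h - t * y < 0"
    using eventually_happens[of _ "at_right (0::real)"] by auto
  then show ?thesis by (rule that)
qed

lemma small_shift_left:
  assumes h: "\<bar>h\<bar> < R" and y: "y < l h"
  obtains t where "t < 0" "\<bar>h + t\<bar> < R" "L (h + t) - L h - t * y < 0"
proof -
  have "((\<lambda>t. (L (h + t) - L h) / t) \<longlongrightarrow> l h) (at 0)" using L_derivative[OF h] by (simp add: DERIV_def)
  then have "\<forall>\<^sub>F t in at_left 0. y < (L (h + t) - L h) / t"
    using y by (intro order_tendstoD(1)) (auto simp: filterlim_at_split)
  moreover have "\<forall>\<^sub>F t in at_left 0. - (R - \<bar>h\<bar>) < t"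
    using h by (intro order_tendstoD(1)[OF tendsto_ident_at]) auto
  moreover have "\<forall>\<^sub>F t in at_left (0::real). t < 0" by (rule eventually_at_left_less)
  ultimately have "\<forall>\<^sub>F t in at_left 0. t < 0 \<and> \<bar>h + t\<bar> < R \<and> L (h + t) - L h - t * y < 0"
    by eventually_elim (auto simp: field_simps)
  then obtain t where "t < 0" "\<bar>h + t\<bar> < R" "L (h + t) - L h - t * y < 0"
    using eventually_happens[of _ "at_left (0::real)"] by auto
  then show ?thesis by (rule that)
qed

definition tail_prob :: "real \<Rightarrow> nat \<Rightarrow> real" where
  "tail_prob x n = measure M {\<omega> \<in> space M. x * a n \<le> V n \<omega>}"

lemma sets_tail: "{\<omega> \<in> space M. x * a n \<le> V n \<omega>} \<in> sets M"
  using V_measurable[of n] by measurable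

lemma tail_prob_upper:
  assumes "0 \<le> h" shows "tail_prob x n \<le> exp (a n * (ln (mgf n h) / a n - h * x))"
proof -
  let ?E = "{\<omega> \<in> space M. x * a n \<le> V n \<omega>}"
  have "tail_prob x n = (LINT \<omega>|M. indicator ?E \<omega> * exp (0 * V n \<omega>))"
    using sets_tail[of x n] by (simp add: tail_prob_def)
  also have "\<dots> \<le> exp (- h * x * a n) * mgf n (0 + h)"
    by (rule tilted_event_le[OF sets_tail]) (use assms in auto)
  also have "\<dots> = exp (a n * (ln (mgf n h) / a n - h * x))"
  proof -
    have "a n * (ln (mgf n h) / a n - h * x) = ln (mgf n h) + (- h * x * a n)"
      using a_pos[of n] by (simp add: right_diff_distrib mult_ac)
    then show ?thesis using mgf_pos[of n h] by (simp only: exp_add exp_ln mult.commute add_0)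
  qed
  finally show ?thesis .
qed

text \<open>Change of measure: under the law tilted by h, eventually with probability at least 1/2,
  \<open>V n / a n\<close> lies between \<open>l h - \<delta>\<close> and
  \<open>l h + \<delta>\<close>. There the tail event holds, and undoing the tilt costs at most the
  factor \<open>exp (h * (l h + \<delta>) * a n)\<close>, as h is nonnegative.\<close>

lemma tail_prob_lower:
  assumes h: "0 \<le> h" "h < R" and x: "x < l h - \<delta>" and \<delta>: "0 < \<delta>"
  shows "\<forall>\<^sub>F n in sequentially. exp (a n * (ln (mgf n h) / a n - h * (l h + \<delta>))) / 2 \<le> tail_prob x n"
proof -
  have hR: "\<bar>h\<bar> < R" using h by simp
  obtain t where t: "0 < t" "\<bar>h + t\<bar> < R" "L (h + t) - L h - t * (l h + \<delta>) < 0"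
    using small_shift_right[OF hR, of "l h + \<delta>"] \<delta> by auto
  obtain s where s: "s < 0" "\<bar>h + s\<bar> < R" "L (h + s) - L h - s * (l h - \<delta>) < 0"
    using small_shift_left[OF hR, of "l h - \<delta>"] \<delta> by auto
  have "\<forall>\<^sub>F n in sequentially. exp (- t * (l h + \<delta>) * a n) * mgf n (h + t) / mgf n h < 1 / 4"
    using tilted_tail_vanishes[OF hR t(2,3)] by (rule order_tendstoD) simp
  moreover have "\<forall>\<^sub>F n in sequentially. exp (- s * (l h - \<delta>) * a n) * mgf n (h + s) / mgf n h < 1 / 4"
    using tilted_tail_vanishes[OF hR s(2,3)] by (rule order_tendstoD) simp
  ultimately show ?thesis
  proof eventually_elim
    case (elim n)
    define E1 where "E1 = {\<omega> \<in> space M. (l h + \<delta>) * a n \<le> V n \<omega>}"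
    define E2 where "E2 = {\<omega> \<in> space M. V n \<omega> \<le> (l h - \<delta>) * a n}"
    define E where "E = {\<omega> \<in> space M. x * a n \<le> V n \<omega>}"
    have Es: "E1 \<in> sets M" "E2 \<in> sets M" "E \<in> sets M"
      unfolding E1_def E2_def E_def using V_measurable[of n] by measurable
    have mp: "0 < mgf n h" by (rule mgf_pos)
    have ie: "integrable M (\<lambda>\<omega>. indicator A \<omega> * exp (h * V n \<omega>))" if "A \<in> sets M" for A
      by (rule Bochner_Integration.integrable_bound[OF exp_integrable[of h n]])
         (use that V_measurable[of n] in \<open>auto simp: indicator_def\<close>)
    have "(LINT \<omega>|M. indicator E1 \<omega> * exp (h * V n \<omega>)) \<le> exp (- t * (l h + \<delta>) * a n) * mgf n (h + t)"
      by (rule tilted_event_le[OF Es(1)]) (use t in \<open>auto simp: E1_def\<close>)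
    also have "\<dots> \<le> mgf n h / 4" using elim(1) mp by (simp add: field_simps)
    finally have 1: "(LINT \<omega>|M. indicator E1 \<omega> * exp (h * V n \<omega>)) \<le> mgf n h / 4" .
    have "(LINT \<omega>|M. indicator E2 \<omega> * exp (h * V n \<omega>)) \<le> exp (- s * (l h - \<delta>) * a n) * mgf n (h + s)"
      by (rule tilted_event_le[OF Es(2)]) (use s in \<open>auto simp: E2_def intro!: mult_nonpos_nonpos\<close>)
    also have "\<dots> \<le> mgf n h / 4" using elim(2) mp by (simp add: field_simps)
    finally have 2: "(LINT \<omega>|M. indicator E2 \<omega> * exp (h * V n \<omega>)) \<le> mgf n h / 4" .
    let ?c = "exp (h * ((l h + \<delta>) * a n))"
    \<comment> \<open>Outside E1 and E2 the value of \<open>V n\<close> lies in the middle range,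
      which is contained in E because x < l h - \<delta>.\<close>
    have "mgf n h \<le> (LINT \<omega>|M. indicator E1 \<omega> * exp (h * V n \<omega>) + indicator E2 \<omega> * exp (h * V n \<omega>) + indicator E \<omega> * ?c)"
      unfolding mgf_def
    proof (rule integral_mono)
      show "integrable M (\<lambda>\<omega>. exp (h * V n \<omega>))" by (rule exp_integrable)
      show "integrable M (\<lambda>\<omega>. indicator E1 \<omega> * exp (h * V n \<omega>) + indicator E2 \<omega> * exp (h * V n \<omega>) + indicator E \<omega> * ?c)"
        using ie[OF Es(1)] ie[OF Es(2)] Es(3) by (intro Bochner_Integration.integrable_add integrable_mult_left) (auto simp: less_top[symmetric])
      fix \<omega> assume \<omega>: "\<omega> \<in> space M"
      show "exp (h * V n \<omega>) \<le> indicator E1 \<omega> * exp (h * V n \<omega>) + indicator E2 \<omega> * exp (h * V n \<omega>) + indicator E \<omega> * ?c"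
      proof (cases "\<omega> \<in> E1 \<or> \<omega> \<in> E2")
        case True
        then show ?thesis by (auto simp: indicator_def)
      next
        case False
        then have b: "V n \<omega> \<le> (l h + \<delta>) * a n" "(l h - \<delta>) * a n \<le> V n \<omega>" using \<omega> by (auto simp: E1_def E2_def)
        have "x * a n \<le> (l h - \<delta>) * a n" using x a_pos[of n] by (intro mult_right_mono) auto
        then have "\<omega> \<in> E" using b \<omega> by (simp add: E_def)
        moreover have "h * V n \<omega> \<le> h * ((l h + \<delta>) * a n)" using b h by (intro mult_left_mono) auto
        ultimately show ?thesis using False by simp
      qed
    qed
    also have "\<dots> = (LINT \<omega>|M. indicator E1 \<omega> * exp (h * V n \<omega>)) + (LINT \<omega>|M. indicator E2 \<omega> * exp (h * V n \<omega>)) + tail_prob x n * ?c"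
      using ie[OF Es(1)] ie[OF Es(2)] Es(3) by (simp add: tail_prob_def E_def[symmetric] less_top[symmetric])
    finally have "mgf n h / 2 \<le> tail_prob x n * ?c" using 1 2 by linarith
    then have "mgf n h / 2 * exp (- (h * ((l h + \<delta>) * a n))) \<le> tail_prob x n * ?c * exp (- (h * ((l h + \<delta>) * a n)))"
      by (rule mult_right_mono) simp
    also have "\<dots> = tail_prob x n" by (simp add: mult.assoc flip: exp_add)
    also have "mgf n h / 2 * exp (- (h * ((l h + \<delta>) * a n))) = exp (a n * (ln (mgf n h) / a n - h * (l h + \<delta>))) / 2"
    proof -
      have "a n * (ln (mgf n h) / a n - h * (l h + \<delta>)) = ln (mgf n h) + (- (h * ((l h + \<delta>) * a n)))"
        using a_pos[of n] by (simp add: right_diff_distrib mult_ac)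
      then show ?thesis using mp by (simp only: exp_add exp_ln times_divide_eq_left)
    qed
    finally show ?case .
  qed
qed

text \<open>At h0 itself the tilted mean sits on the threshold, so the concentration argument does
  not reach the tail event. The lower bound tilts by some h > h0, where strict monotonicity puts the
  mean above the threshold, and h decreases to h0 by continuity of L and l. The upper bound is
  Chernoff's at h0.\<close>

theorem tail_prob_limit:
  assumes h0: "0 \<le> h0" "h0 < R"
  shows "\<forall>\<^sub>F n in sequentially. 0 < tail_prob (l h0) n"
    "(\<lambda>n. ln (tail_prob (l h0) n) / a n) \<longlonglongrightarrow> L h0 - h0 * l h0"
proof -
  let ?x = "l h0"
  let ?I = "L h0 - h0 * ?x"
  have R0: "\<bar>h0\<bar> < R" using h0 by simp
  have lower: "\<forall>\<^sub>F n in sequentially. 0 < tail_prob ?x n \<and> ?I - e < ln (tail_prob ?x n) / a n" if e: "0 < e" for e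
  proof -
    have "isCont l h0"
      using l_continuous R0 by (auto simp: continuous_on_eq_continuous_at abs_less_iff)
    moreover have "isCont L h0" using L_derivative[OF R0] by (rule DERIV_isCont)
    ultimately have "isCont (\<lambda>h. L h - h * l h) h0" by (intro continuous_intros)
    then have "((\<lambda>h. L h - h * l h) \<longlongrightarrow> ?I) (at_right h0)"
      unfolding isCont_def filterlim_at_split by simp
    then have "\<forall>\<^sub>F h in at_right h0. ?I - e / 3 < L h - h * l h" by (rule order_tendstoD) (use e in simp)
    moreover have "\<forall>\<^sub>F h in at_right h0. h < R" using h0 by (intro order_tendstoD(2)[OF tendsto_ident_at]) auto
    moreover have "\<forall>\<^sub>F h in at_right h0. h0 < h" by (rule eventually_at_right_less)
    ultimately have "\<forall>\<^sub>F h in at_right h0. h0 < h \<and> h < R \<and> ?I - e / 3 < L h - h * l h" by eventually_elim auto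
    then obtain h where h: "h0 < h" "h < R" "?I - e / 3 < L h - h * l h"
      using eventually_happens[of _ "at_right h0"] by auto
    have lh: "?x < l h" using l_strict_mono[of h0 h] h h0 by auto
    \<comment> \<open>The first bound keeps l h - \<delta> above the threshold, the second makes h
      \<delta> at most e / 3; the summand 1 keeps the denominator away from 0.\<close>
    define \<delta> where "\<delta> = min ((l h - ?x) / 2) (e / (3 * (h + 1)))"
    have \<delta>: "0 < \<delta>" "?x < l h - \<delta>" using lh e h h0 by (auto simp: \<delta>_def min_def field_simps)
    have "h * \<delta> \<le> h * (e / (3 * (h + 1)))" using h h0 by (intro mult_left_mono) (auto simp: \<delta>_def)
    also have "\<dots> \<le> e / 3" using h h0 e by (simp add: field_simps)
    finally have h\<delta>: "h * \<delta> \<le> e / 3" .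
    have hR: "\<bar>h\<bar> < R" using h h0 by simp
    have "(\<lambda>n. ln (mgf n h) / a n - h * (l h + \<delta>) - ln 2 / a n) \<longlonglongrightarrow> L h - h * (l h + \<delta>) - 0"
    proof (intro tendsto_diff tendsto_const)
      show "(\<lambda>n. ln (mgf n h) / a n) \<longlonglongrightarrow> L h" using mgf_limit[OF hR] by (simp add: mgf_def)
      show "(\<lambda>n. ln 2 / a n) \<longlonglongrightarrow> 0" by (rule real_tendsto_divide_at_top[OF tendsto_const a_limit])
    qed
    moreover have "?I - e < L h - h * (l h + \<delta>) - 0" using h(3) h\<delta> e by (simp add: distrib_left)
    ultimately have "\<forall>\<^sub>F n in sequentially. ?I - e < ln (mgf n h) / a n - h * (l h + \<delta>) - ln 2 / a n"
      by (rule order_tendstoD)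
    moreover have "\<forall>\<^sub>F n in sequentially. exp (a n * (ln (mgf n h) / a n - h * (l h + \<delta>))) / 2 \<le> tail_prob ?x n"
      by (rule tail_prob_lower) (use h h0 \<delta> in auto)
    ultimately show ?thesis
    proof eventually_elim
      case (elim n)
      have pos: "0 < tail_prob ?x n" by (rule less_le_trans[OF _ elim(2)]) simp
      have "ln (exp (a n * (ln (mgf n h) / a n - h * (l h + \<delta>))) / 2) \<le> ln (tail_prob ?x n)"
        using elim(2) by (intro ln_mono) auto
      then have "a n * (ln (mgf n h) / a n - h * (l h + \<delta>)) - ln 2 \<le> ln (tail_prob ?x n)"
        by (simp add: ln_div)
      then have "(a n * (ln (mgf n h) / a n - h * (l h + \<delta>)) - ln 2) / a n \<le> ln (tail_prob ?x n) / a n"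
        using a_pos[of n] by (intro divide_right_mono) auto
      then have "ln (mgf n h) / a n - h * (l h + \<delta>) - ln 2 / a n \<le> ln (tail_prob ?x n) / a n"
        using a_pos[of n] by (simp add: diff_divide_distrib)
      then show ?case using elim(1) pos by linarith
    qed
  qed
  show "\<forall>\<^sub>F n in sequentially. 0 < tail_prob ?x n"
    using lower[of 1] by (auto elim: eventually_mono)
  show "(\<lambda>n. ln (tail_prob ?x n) / a n) \<longlonglongrightarrow> ?I"
  proof (rule tendstoI)
    fix e :: real assume e: "0 < e"
    have "(\<lambda>n. ln (mgf n h0) / a n - h0 * ?x) \<longlonglongrightarrow> ?I"
      using mgf_limit[OF R0] by (intro tendsto_diff tendsto_const) (simp add: mgf_def)
    then have "\<forall>\<^sub>F n in sequentially. ln (mgf n h0) / a n - h0 * ?x < ?I + e" by (rule order_tendstoD) (use e in simp)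
    then show "\<forall>\<^sub>F n in sequentially. dist (ln (tail_prob ?x n) / a n) ?I < e"
      using lower[OF e]
    proof eventually_elim
      case (elim n)
      have "ln (tail_prob ?x n) \<le> ln (exp (a n * (ln (mgf n h0) / a n - h0 * ?x)))"
        using tail_prob_upper[OF h0(1), of ?x n] elim(2) by (intro ln_mono) auto
      then have "ln (tail_prob ?x n) \<le> a n * (ln (mgf n h0) / a n - h0 * ?x)" by simp
      then have "ln (tail_prob ?x n) / a n \<le> ln (mgf n h0) / a n - h0 * ?x"
        using a_pos[of n] by (simp add: pos_divide_le_eq mult.commute)
      then show ?case using elim unfolding dist_real_def abs_less_iff by linarith
    qed
  qed
qed

text \<open>Tangent inequality for a function with increasing derivative, from the mean value
  theorem on either side of h0.\<close>

lemma rate_minimum: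
  assumes "\<bar>h0\<bar> < R" "\<bar>h\<bar> < R"
  shows "L h0 - h0 * l h0 \<le> L h - h * l h0"
proof (cases h h0 rule: linorder_cases)
  case equal
  then show ?thesis by simp
next
  case less
  obtain z where z: "h < z" "z < h0" "L h0 - L h = (h0 - h) * l z"
    using MVT2[of h h0 L l] less L_derivative assms by (auto simp: abs_if split: if_splits)
  have "l z \<le> l h0" using l_strict_mono[of z h0] z assms less by (auto simp: abs_if split: if_splits)
  then have "(h0 - h) * l z \<le> (h0 - h) * l h0" using less by (intro mult_left_mono) auto
  then show ?thesis using z(3) by (simp add: algebra_simps)
next
  case greater
  obtain z where z: "h0 < z" "z < h" "L h - L h0 = (h - h0) * l z"
    using MVT2[of h0 h L l] greater L_derivative assms by (auto simp: abs_if split: if_splits)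
  have "l h0 \<le> l z" using l_strict_mono[of h0 z] z assms greater by (auto simp: abs_if split: if_splits)
  then have "(h - h0) * l h0 \<le> (h - h0) * l z" using greater by (intro mult_left_mono) auto
  then show ?thesis using z(3) by (simp add: algebra_simps)
qed

text \<open>Monotonicity makes the supremum b over [0, R) the left limit at R. A value below b is
  exceeded somewhere in the interval, and the intermediate value theorem applies from 0 up to that
  place.\<close>

lemma derivative_limit:
  assumes R: "0 < R" and bdd: "\<And>h. \<bar>h\<bar> < R \<Longrightarrow> l h \<le> c"
  obtains b where "(l \<longlongrightarrow> b) (at_left R)"
    "\<And>x. \<lbrakk>l 0 \<le> x; x < b\<rbrakk> \<Longrightarrow> \<exists>h\<in>{0..<R}. l h = x"
proof -
  define b where "b = (SUP h\<in>{0..<R}. l h)"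
  have bdd': "bdd_above (l ` {0..<R})" using bdd by (intro bdd_aboveI[of _ c]) auto
  have up: "l h \<le> b" if "0 \<le> h" "h < R" for h
    unfolding b_def using that bdd' by (intro cSUP_upper) auto
  have reach: "\<exists>h\<in>{0..<R}. x < l h" if "x < b" for x
    using that R bdd' unfolding b_def by (subst (asm) less_cSUP_iff) auto
  have lim: "(l \<longlongrightarrow> b) (at_left R)"
  proof (rule order_tendstoI)
    fix x assume "x < b"
    then obtain h where h: "0 \<le> h" "h < R" "x < l h" using reach[OF \<open>x < b\<close>] by auto
    have "\<forall>\<^sub>F k in at_left R. h < k" using h by (intro order_tendstoD(1)[OF tendsto_ident_at]) auto
    moreover have "\<forall>\<^sub>F k in at_left R. k < R" by (rule eventually_at_left_less)
    ultimately show "\<forall>\<^sub>F k in at_left R. x < l k"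
    proof eventually_elim
      case (elim k)
      have "l h < l k" by (rule l_strict_mono) (use h elim in auto)
      then show ?case using h by simp
    qed
  next
    fix x assume "b < x"
    have "\<forall>\<^sub>F k in at_left R. 0 < k" using R by (intro order_tendstoD(1)[OF tendsto_ident_at]) auto
    moreover have "\<forall>\<^sub>F k in at_left R. k < R" by (rule eventually_at_left_less)
    ultimately show "\<forall>\<^sub>F k in at_left R. l k < x"
    proof eventually_elim
      case (elim k)
      then show ?case using up[of k] \<open>b < x\<close> by simp
    qed
  qed
  show ?thesis
  proof (rule that[OF lim])
    fix x assume x: "l 0 \<le> x" "x < b"
    obtain k where k: "0 \<le> k" "k < R" "x < l k" using reach[OF x(2)] by auto
    have "continuous_on {0..k} l" by (rule continuous_on_subset[OF l_continuous]) (use k R in auto)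
    then obtain h where "0 \<le> h" "h \<le> k" "l h = x" using IVT'[of l 0 x k] x k by auto
    then show "\<exists>h\<in>{0..<R}. l h = x" using k by auto
  qed
qed

end

section \<open>Convex averaging sequences\<close>

lemma emeasure_homothety:
  fixes W :: "'a::euclidean_space set"
  assumes W: "W \<in> sets borel" and r: "0 < r"
  shows "(\<lambda>w. t + r *\<^sub>R w) ` W \<in> sets borel"
    "emeasure lborel ((\<lambda>w. t + r *\<^sub>R w) ` W) = ennreal (r ^ DIM('a)) * emeasure lborel W"
proof -
  have eq: "(\<lambda>w. t + r *\<^sub>R w) ` W = (\<lambda>x. (1 / r) *\<^sub>R (x - t)) -` W \<inter> space borel"
    using r by (auto simp: image_iff intro!: bexI[rotated])
  have m: "(\<lambda>x::'a. (1 / r) *\<^sub>R (x - t)) \<in> borel_measurable borel" by measurable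
  show s: "(\<lambda>w. t + r *\<^sub>R w) ` W \<in> sets borel"
    unfolding eq by (rule measurable_sets[OF m W])
  have vi: "(\<lambda>w. t + r *\<^sub>R w) -` ((\<lambda>w. t + r *\<^sub>R w) ` W) = W"
    using r by (intro inj_vimage_image_eq) (auto simp: inj_on_def)
  have "emeasure lborel ((\<lambda>w. t + r *\<^sub>R w) ` W) =
    (\<integral>\<^sup>+x. ennreal (\<bar>r\<bar> ^ DIM('a)) * indicator ((\<lambda>w. t + r *\<^sub>R w) ` W) x \<partial>distr lborel borel (\<lambda>x. t + r *\<^sub>R x))"
    using r s by (subst lborel_affine[of r t]) (simp_all add: emeasure_density)
  also have "\<dots> = ennreal (r ^ DIM('a)) * emeasure (distr lborel borel (\<lambda>x. t + r *\<^sub>R x)) ((\<lambda>w. t + r *\<^sub>R w) ` W)"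
    using s r by (subst nn_integral_cmult_indicator) auto
  also have "emeasure (distr lborel borel (\<lambda>x. t + r *\<^sub>R x)) ((\<lambda>w. t + r *\<^sub>R w) ` W) = emeasure lborel W"
    using s by (subst emeasure_distr) (auto simp: vi)
  finally show "emeasure lborel ((\<lambda>w. t + r *\<^sub>R w) ` W) = ennreal (r ^ DIM('a)) * emeasure lborel W" .
qed

text \<open>A homothety of a convex set, centred in a ball of radius \<open>\<rho>\<close> inside it and with ratio
  \<open>1 - s / \<rho>\<close>, consists of points at depth \<open>s\<close>.\<close>

lemma convex_deep_points:
  fixes W :: "'a::euclidean_space set"
  assumes W: "convex W" "ball 0 \<rho> \<subseteq> W" and s: "0 < s" "s < \<rho>" and w: "w \<in> W"
  shows "ball ((1 - s / \<rho>) *\<^sub>R w) s \<subseteq> W"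
proof
  fix y assume "y \<in> ball ((1 - s / \<rho>) *\<^sub>R w) s"
  then have y: "norm (y - (1 - s / \<rho>) *\<^sub>R w) < s" by (simp add: dist_norm norm_minus_commute)
  define u where "u = (\<rho> / s) *\<^sub>R (y - (1 - s / \<rho>) *\<^sub>R w)"
  have "norm u = \<rho> / s * norm (y - (1 - s / \<rho>) *\<^sub>R w)" using s by (simp add: u_def)
  also have "\<dots> < \<rho> / s * s" using s y by (intro mult_strict_left_mono) auto
  finally have "u \<in> W" using s W(2) by auto
  then have "(1 - s / \<rho>) *\<^sub>R w + (s / \<rho>) *\<^sub>R u \<in> W"
    using s by (intro convexD[OF W(1) w]) auto
  moreover have "(1 - s / \<rho>) *\<^sub>R w + (s / \<rho>) *\<^sub>R u = y"
    using s by (simp add: u_def)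
  ultimately show "y \<in> W" by simp
qed

context
  fixes W :: "nat \<Rightarrow> 'a::euclidean_space set"
  assumes windows: "convex_averaging_sequence W"
begin

lemma windows_convex: "convex (W n)" and windows_pos: "0 < vol (W n)"
  and windows_sets: "W n \<in> sets lborel" and windows_finite: "emeasure lborel (W n) < \<infinity>"
proof -
  have 1: "compact (W n)" using windows by (simp add: convex_averaging_sequence_def)
  show "convex (W n)" and "0 < vol (W n)"
    using windows by (auto simp: convex_averaging_sequence_def)
  show "W n \<in> sets lborel" using borel_compact[OF 1] by simp
  show "emeasure lborel (W n) < \<infinity>" using emeasure_bounded_finite[OF compact_imp_bounded[OF 1]] by simp
qed

text \<open>A cube is the convex hull of finitely many points. Each of them lies in the windows from
  some index on, and convexity then gives the whole cube.\<close>

lemma windows_cover_cube: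
  assumes \<rho>: "0 < \<rho>"
  shows "\<forall>\<^sub>F n in sequentially. cbox ((- \<rho>) *\<^sub>R One) (\<rho> *\<^sub>R One) \<subseteq> W n"
proof -
  obtain F :: "'a set" where F: "finite F" "cbox (0 - (\<Sum>i\<in>Basis. \<rho> *\<^sub>R i)) (0 + (\<Sum>i\<in>Basis. \<rho> *\<^sub>R i)) = convex hull F"
    using cube_convex_hull[OF \<rho>, of 0] by auto
  have "\<exists>n. x \<in> W n" for x using windows by (auto simp: convex_averaging_sequence_def)
  then obtain N where N: "\<And>x. x \<in> W (N x)" by metis
  have mono: "W m \<subseteq> W n" if "m \<le> n" for m n
    using windows that by (auto simp: convex_averaging_sequence_def incseq_def)
  have "\<forall>\<^sub>F n in sequentially. F \<subseteq> W n"
  proof (rule eventually_sequentiallyI[of "Max (insert 0 (N ` F))"], rule subsetI)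
    fix n x assume n: "Max (insert 0 (N ` F)) \<le> n" and x: "x \<in> F"
    have "N x \<le> Max (insert 0 (N ` F))" using F(1) x by (intro Max_ge) auto
    then show "x \<in> W n" using N[of x] mono[of "N x" n] n by auto
  qed
  then show ?thesis
  proof eventually_elim
    case (elim n)
    then have "convex hull F \<subseteq> W n" by (intro hull_minimal windows_convex)
    then show ?case unfolding F(2)[symmetric] by (simp add: scaleR_sum_right sum_negf[symmetric] scaleR_right.sum)
  qed
qed

lemma windows_cover_ball:
  assumes "0 < \<rho>" shows "\<forall>\<^sub>F n in sequentially. ball 0 \<rho> \<subseteq> W n"
  using windows_cover_cube[OF assms]
proof eventually_elim
  case (elim n)
  have "ball 0 \<rho> \<subseteq> cbox ((- \<rho>) *\<^sub>R One) (\<rho> *\<^sub>R One :: 'a)"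
  proof
    fix x :: 'a assume "x \<in> ball 0 \<rho>"
    then have "\<bar>x \<bullet> i\<bar> \<le> \<rho>" if "i \<in> Basis" for i using Basis_le_norm[OF that, of x] by simp
    then show "x \<in> cbox ((- \<rho>) *\<^sub>R One) (\<rho> *\<^sub>R One)" by (auto simp: mem_box abs_le_iff) (metis minus_le_iff)
  qed
  then show ?case using elim by simp
qed

lemma windows_vol_limit: "filterlim (\<lambda>n. vol (W n)) at_top sequentially"
proof (rule filterlim_at_top[THEN iffD2], rule allI)
  fix c :: real
  \<comment> \<open>At least 1, so that the volume (2 \<rho>)^d of the cube dominates 2 \<rho> in
    every dimension.\<close>
  define \<rho> where "\<rho> = max 1 c"
  have \<rho>: "0 < \<rho>" by (simp add: \<rho>_def)
  show "\<forall>\<^sub>F n in sequentially. c \<le> vol (W n)"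
    using windows_cover_cube[OF \<rho>]
  proof eventually_elim
    case (elim n)
    have "c \<le> 2 * \<rho>" by (simp add: \<rho>_def)
    also have "\<dots> \<le> (2 * \<rho>) ^ DIM('a)" by (rule self_le_power) (auto simp: \<rho>_def)
    also have "\<dots> = vol (cbox ((- \<rho>) *\<^sub>R One) (\<rho> *\<^sub>R One :: 'a))"
      by (subst content_cbox) (auto simp: \<rho>_def)
    also have "\<dots> \<le> vol (W n)"
      using elim windows_sets[of n] windows_finite[of n] by (intro measure_mono_fmeasurable) (auto simp: fmeasurable_def)
    finally show ?case .
  qed
qed

text \<open>The sets V are the windows shrunk by a factor r close to 1. Once a window contains the
  ball of radius s / (1 - r), every point of V has depth s, while only the fraction 1 - r^d of the
  volume is lost.\<close>

lemma windows_deep_sets: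
  assumes s: "0 < s" and \<epsilon>: "0 < \<epsilon>"
  shows "\<forall>\<^sub>F n in sequentially. \<exists>V. V \<in> sets lborel \<and> V \<subseteq> W n \<and> (\<forall>x\<in>V. ball x s \<subseteq> W n) \<and> (1 - \<epsilon>) * vol (W n) \<le> vol V"
proof -
  have "(\<lambda>r::real. r ^ DIM('a)) \<midarrow>1\<rightarrow> 1 ^ DIM('a)" by (intro tendsto_intros)
  then have "\<forall>\<^sub>F r in at_left 1. 1 - \<epsilon> < r ^ DIM('a)"
    using \<epsilon> by (intro order_tendstoD(1)[where y="1 ^ DIM('a)"]) (auto simp: filterlim_at_split)
  moreover have "\<forall>\<^sub>F r in at_left (1::real). 0 < r" by (intro order_tendstoD(1)[OF tendsto_ident_at]) auto
  moreover have "\<forall>\<^sub>F r in at_left (1::real). r < 1" by (simp add: eventually_at_filter)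
  ultimately have "\<forall>\<^sub>F r in at_left (1::real). 1 - \<epsilon> < r ^ DIM('a) \<and> 0 < r \<and> r < 1" by eventually_elim auto
  then obtain r :: real where r: "1 - \<epsilon> < r ^ DIM('a)" "0 < r" "r < 1"
    using eventually_happens[of _ "at_left (1::real)"] by auto
  define \<rho> where "\<rho> = s / (1 - r)"
  have \<rho>: "1 - s / \<rho> = r" "s < \<rho>" "0 < \<rho>" using s r by (auto simp: \<rho>_def field_simps)
  show ?thesis using windows_cover_ball[OF \<rho>(3)]
  proof eventually_elim
    case (elim n)
    define V where "V = (\<lambda>w. 0 + r *\<^sub>R w) ` W n"
    have deep: "ball x s \<subseteq> W n" if "x \<in> V" for x
      using convex_deep_points[OF windows_convex elim s \<rho>(2)] that by (auto simp: V_def \<rho>(1))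
    have "V \<in> sets lborel" unfolding V_def using emeasure_homothety(1)[of "W n" r 0] windows_sets r by simp
    moreover have "V \<subseteq> W n" using deep s by (meson centre_in_ball subsetD subsetI)
    moreover have "(1 - \<epsilon>) * vol (W n) \<le> vol V"
    proof -
      have "vol V = r ^ DIM('a) * vol (W n)"
        unfolding V_def measure_def using emeasure_homothety(2)[of "W n" r 0] windows_sets[of n] r by (simp add: enn2real_mult)
      then show ?thesis using r by (simp add: mult_right_mono)
    qed
    ultimately show ?case using deep by blast
  qed
qed

end

section \<open>The limit of growing windows\<close>

context stationary_boolean_model
begin

context
  fixes W :: "nat \<Rightarrow> 'a set"
  assumes windows: "convex_averaging_sequence W"
begin

text \<open>Neither the depth s nor the shrunken window depends on t, so the approximation is
  uniform in the tilt.\<close>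

lemma mean_vac_uniform:
  assumes e: "0 < e"
  shows "\<forall>\<^sub>F n in sequentially. \<forall>t\<in>{-\<theta>..\<theta>}. \<bar>mean_vac (W n) t / vol (W n) - limit_density t\<bar> \<le> e"
proof -
  have "\<forall>\<^sub>F s in sequentially. tail_bound s < e / 4" by (rule order_tendstoD(2)[OF tail_bound_limit]) (use e in simp)
  then have "\<forall>\<^sub>F s in sequentially. tail_bound s < e / 4 \<and> 0 < s"
    using eventually_gt_at_top[of 0] by eventually_elim auto
  then obtain s where s: "tail_bound s < e / 4" "0 < s" using eventually_happens[of _ sequentially] by auto
  have "0 < real s" "0 < e / 2" using s e by auto
  from windows_deep_sets[OF windows this] show ?thesis
  proof eventually_elim
    case (elim n)
    then obtain V where V: "V \<in> sets lborel" "V \<subseteq> W n" "\<And>x. x \<in> V \<Longrightarrow> ball x (real s) \<subseteq> W n"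
      and vV: "(1 - e / 2) * vol (W n) \<le> vol V" by auto
    show ?case
    proof
    fix t assume t: "t \<in> {-\<theta>..\<theta>}"
    have v: "0 < vol (W n)" by (rule windows_pos[OF windows])
    have "\<bar>mean_vac (W n) t - limit_density t * vol (W n)\<bar> \<le> 2 * tail_bound s * vol (W n) + (vol (W n) - vol V)"
      by (rule mean_vac_approx[OF windows_sets[OF windows] windows_finite[OF windows] V]) (use t in auto)
    also have "\<dots> \<le> (e / 2) * vol (W n) + (e / 2) * vol (W n)"
      using s(1) v vV by (intro add_mono mult_right_mono) (auto simp: algebra_simps)
    also have "\<dots> = e * vol (W n)" by simp
    finally have "\<bar>mean_vac (W n) t - limit_density t * vol (W n)\<bar> \<le> e * vol (W n)" .
    moreover have "mean_vac (W n) t / vol (W n) - limit_density t = (mean_vac (W n) t - limit_density t * vol (W n)) / vol (W n)"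
      using v by (simp add: diff_divide_distrib)
    ultimately show "\<bar>mean_vac (W n) t / vol (W n) - limit_density t\<bar> \<le> e"
      using v by (simp add: abs_divide pos_divide_le_eq)
    qed
  qed
qed

lemma mean_vac_limit:
  assumes "\<bar>t\<bar> \<le> \<theta>" shows "(\<lambda>n. mean_vac (W n) t / vol (W n)) \<longlonglongrightarrow> limit_density t"
proof (rule tendstoI)
  fix e :: real assume "0 < e"
  then have "\<forall>\<^sub>F n in sequentially. \<forall>t\<in>{-\<theta>..\<theta>}. \<bar>mean_vac (W n) t / vol (W n) - limit_density t\<bar> \<le> e / 2"
    by (intro mean_vac_uniform) simp
  then show "\<forall>\<^sub>F n in sequentially. dist (mean_vac (W n) t / vol (W n)) (limit_density t) < e"
  proof eventually_elim
    case (elim n)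
    then have "\<bar>mean_vac (W n) t / vol (W n) - limit_density t\<bar> \<le> e / 2"
      using assms by (intro bspec[OF elim]) auto
    then show ?case using \<open>0 < e\<close> unfolding dist_real_def by linarith
  qed
qed

lemma limit_density_continuous: "continuous_on {-\<theta>..\<theta>} limit_density"
proof (rule uniform_limit_theorem)
  show "\<forall>\<^sub>F n in sequentially. continuous_on {-\<theta>..\<theta>} (\<lambda>t. mean_vac (W n) t / vol (W n))"
    using windows_pos[OF windows]
    by (intro always_eventually allI continuous_intros continuous_at_imp_continuous_on ballI
        DERIV_isCont[OF mean_vac_derivative[OF windows_sets[OF windows] windows_finite[OF windows]]]) (metis less_irrefl)
  show "uniform_limit {-\<theta>..\<theta>} (\<lambda>n t. mean_vac (W n) t / vol (W n)) limit_density sequentially"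
  proof (rule uniform_limitI)
    fix e :: real assume "0 < e"
    then have "\<forall>\<^sub>F n in sequentially. \<forall>t\<in>{-\<theta>..\<theta>}. \<bar>mean_vac (W n) t / vol (W n) - limit_density t\<bar> \<le> e / 2"
      by (intro mean_vac_uniform) simp
    then show "\<forall>\<^sub>F n in sequentially. \<forall>t\<in>{-\<theta>..\<theta>}. dist (mean_vac (W n) t / vol (W n)) (limit_density t) < e"
    proof eventually_elim
      case (elim n)
      show ?case
      proof
        fix t assume "t \<in> {-\<theta>..\<theta>}"
        then have "\<bar>mean_vac (W n) t / vol (W n) - limit_density t\<bar> \<le> e / 2" using elim by auto
        then show "dist (mean_vac (W n) t / vol (W n)) (limit_density t) < e"
          using \<open>0 < e\<close> unfolding dist_real_def by linarith
      qed
    qed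
  qed
qed simp

text \<open>The variance bound makes the derivative of the normalised mean at least a fixed q / 2 in
  all large windows. Such a uniform rate survives the limit, whereas strict monotonicity in each
  window alone would not.\<close>

lemma limit_density_strict_mono:
  assumes t: "- \<theta> \<le> t1" "t1 < t2" "t2 \<le> \<theta>"
  shows "limit_density t1 < limit_density t2"
proof -
  let ?c = "exp (- l - 3 * \<theta> * \<kappa>)" and ?e = "exp (- l - \<theta> * \<kappa>)"
  \<comment> \<open>Half of the margin in \<open>nondegenerate\<close>; the other half is spent on
    truncating the direct mass to a ball.\<close>
  define \<delta> where "\<delta> = (?c * \<kappa>' - coupling_mass) / 2"
  have \<delta>: "0 < \<delta>" unfolding \<delta>_def coupling_mass_def
    by (rule half_gt_zero) (simp only: diff_gt_0_iff_gt nondegenerate)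
  have "?c * \<kappa>' - coupling_mass = 2 * \<delta>" by (simp add: \<delta>_def)
  then have "(\<lambda>s. ?c * near s - coupling_mass) \<longlonglongrightarrow> 2 * \<delta>"
    by (auto intro!: tendsto_eq_intros near_limit)
  then have "\<forall>\<^sub>F s in sequentially. \<delta> < ?c * near s - coupling_mass"
    by (rule order_tendstoD) (use \<delta> in simp)
  then have "\<forall>\<^sub>F s in sequentially. \<delta> < ?c * near s - coupling_mass \<and> 0 < s"
    using eventually_gt_at_top[of 0] by eventually_elim auto
  then obtain s where s: "\<delta> < ?c * near s - coupling_mass" "0 < s" using eventually_happens[of _ sequentially] by auto
  define q where "q = ?e * \<delta>"
  have q: "0 < q" using \<delta> by (simp add: q_def)
  \<comment> \<open>Chosen so that the boundary layer consumes exactly half of q.\<close>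
  define \<epsilon> where "\<epsilon> = q / (2 * (q + coupling_mass))"
  have \<epsilon>: "0 < \<epsilon>" "q - \<epsilon> * (q + coupling_mass) = q / 2"
    using q coupling_mass_nonneg by (auto simp: \<epsilon>_def field_simps)
  have "0 < real s" using s(2) by simp
  from windows_deep_sets[OF windows this \<epsilon>(1)]
  have "\<forall>\<^sub>F n in sequentially. q / 2 * (t2 - t1) \<le> mean_vac (W n) t2 / vol (W n) - mean_vac (W n) t1 / vol (W n)"
  proof eventually_elim
    case (elim n)
    then obtain V where V: "V \<in> sets lborel" "V \<subseteq> W n" "\<And>x. x \<in> V \<Longrightarrow> ball x (real s) \<subseteq> W n"
      and vV: "(1 - \<epsilon>) * vol (W n) \<le> vol V" by auto
    note Wn = windows_sets[OF windows, of n] windows_finite[OF windows, of n]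
    have v: "0 < vol (W n)" by (rule windows_pos[OF windows])
    have var: "q / 2 * vol (W n) \<le> var_vac (W n) t" if "\<bar>t\<bar> \<le> \<theta>" for t
    proof -
      have "q / 2 * vol (W n) = q * ((1 - \<epsilon>) * vol (W n)) - coupling_mass * (vol (W n) - (1 - \<epsilon>) * vol (W n))"
        unfolding \<epsilon>(2)[symmetric] by (simp add: algebra_simps)
      also have "\<dots> \<le> q * vol V - coupling_mass * (vol (W n) - vol V)"
        using vV q coupling_mass_nonneg by (intro diff_mono mult_left_mono) auto
      also have "\<dots> \<le> var_vac (W n) t"
        unfolding q_def by (rule var_vac_lower[OF Wn V that]) (use \<delta> s in auto)
      finally show ?thesis .
    qed
    obtain z where z: "t1 < z" "z < t2" "mean_vac (W n) t2 - mean_vac (W n) t1 = (t2 - t1) * var_vac (W n) z"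
      using MVT2[OF t(2), of "mean_vac (W n)" "var_vac (W n)"] mean_vac_derivative[OF Wn] by auto
    have "(t2 - t1) * (q / 2 * vol (W n)) \<le> (t2 - t1) * var_vac (W n) z"
      using var[of z] z t by (intro mult_left_mono) auto
    then have "q / 2 * (t2 - t1) * vol (W n) \<le> mean_vac (W n) t2 - mean_vac (W n) t1"
      unfolding z(3) by (simp add: mult_ac)
    then have "q / 2 * (t2 - t1) \<le> (mean_vac (W n) t2 - mean_vac (W n) t1) / vol (W n)"
      using v by (simp only: pos_le_divide_eq)
    then show ?case
      by (simp add: diff_divide_distrib)
  qed
  moreover have "(\<lambda>n. mean_vac (W n) t2 / vol (W n) - mean_vac (W n) t1 / vol (W n)) \<longlonglongrightarrow> limit_density t2 - limit_density t1"
    using t by (intro tendsto_diff mean_vac_limit) auto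
  ultimately have "q / 2 * (t2 - t1) \<le> limit_density t2 - limit_density t1"
    using tendsto_lowerbound by fastforce
  moreover have "0 < q / 2 * (t2 - t1)" using q t by simp
  ultimately show ?thesis by linarith
qed

text \<open>Uniform convergence of the derivatives, together with convergence at t = 0, where all
  cumulant generating functions vanish, gives convergence on the whole interval and
  differentiability of the limit.\<close>

theorem log_part_limit:
  obtains L where "\<And>t. \<bar>t\<bar> \<le> \<theta> \<Longrightarrow> (\<lambda>n. ln (part (W n) t) / vol (W n)) \<longlonglongrightarrow> L t"
    "\<And>t. \<bar>t\<bar> < \<theta> \<Longrightarrow> (L has_real_derivative limit_density t) (at t)"
proof -
  have "\<exists>g. \<forall>t\<in>{-\<theta>..\<theta>}. (\<lambda>n. ln (part (W n) t) / vol (W n)) \<longlonglongrightarrow> g t \<and>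
      (g has_derivative (\<lambda>h. limit_density t * h)) (at t within {-\<theta>..\<theta>})"
  proof (rule has_derivative_sequence[where f'="\<lambda>n t h. mean_vac (W n) t / vol (W n) * h" and ?x0.0 = 0 and l = 0])
    show "((\<lambda>t. ln (part (W n) t) / vol (W n)) has_derivative (\<lambda>h. mean_vac (W n) t / vol (W n) * h)) (at t within {-\<theta>..\<theta>})" for n t
    proof -
      have "((\<lambda>t. ln (part (W n) t) / vol (W n)) has_real_derivative mean_vac (W n) t / vol (W n)) (at t)"
        by (rule DERIV_cdivide[OF log_part_derivative[OF windows_sets[OF windows] windows_finite[OF windows]]])
      then show ?thesis unfolding has_field_derivative_def by (rule has_derivative_at_withinI)
    qed
    fix e :: real assume "0 < e"
    from mean_vac_uniform[OF this]
    show "\<forall>\<^sub>F n in sequentially. \<forall>t\<in>{-\<theta>..\<theta>}. \<forall>h. norm (mean_vac (W n) t / vol (W n) * h - limit_density t * h) \<le> e * norm h"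
    proof eventually_elim
      case (elim n)
      show ?case
      proof (intro ballI allI)
        fix t h :: real assume "t \<in> {-\<theta>..\<theta>}"
        then have "\<bar>mean_vac (W n) t / vol (W n) - limit_density t\<bar> * \<bar>h\<bar> \<le> e * \<bar>h\<bar>"
          using elim by (intro mult_right_mono) auto
        then show "norm (mean_vac (W n) t / vol (W n) * h - limit_density t * h) \<le> e * norm h"
          unfolding real_norm_def left_diff_distrib[symmetric] abs_mult .
      qed
    qed
  next
    show "(\<lambda>n. ln (part (W n) 0) / vol (W n)) \<longlonglongrightarrow> 0"
      by (simp add: part_def[OF windows_sets[OF windows] windows_finite[OF windows]] M.prob_space)
  qed (use \<theta>_nonneg in auto)
  then obtain L where L: "\<And>t. t \<in> {-\<theta>..\<theta>} \<Longrightarrow> (\<lambda>n. ln (part (W n) t) / vol (W n)) \<longlonglongrightarrow> L t"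
    "\<And>t. t \<in> {-\<theta>..\<theta>} \<Longrightarrow> (L has_derivative (\<lambda>h. limit_density t * h)) (at t within {-\<theta>..\<theta>})" by blast
  show ?thesis
  proof (rule that)
    show "(\<lambda>n. ln (part (W n) t) / vol (W n)) \<longlonglongrightarrow> L t" if "\<bar>t\<bar> \<le> \<theta>" for t
      using L(1)[of t] that by (auto simp: abs_le_iff)
    show "(L has_real_derivative limit_density t) (at t)" if "\<bar>t\<bar> < \<theta>" for t
    proof -
      have "at t within {-\<theta>..\<theta>} = at t" by (rule at_within_interior) (use that in auto)
      then show ?thesis using L(2)[of t] that by (auto simp: has_field_derivative_def abs_less_iff)
    qed
  qed
qed

end
end

section \<open>Vacancy probabilities of the Poisson grain model\<close>

lemma (in prob_space) indep_set_sym: "indep_set A B \<Longrightarrow> indep_set B A"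
  unfolding indep_sets2_eq by (metis Int_commute mult.commute)

lemma (in prob_space) distr_pair_indep_set:
  assumes X: "X \<in> M \<rightarrow>\<^sub>M S" and Y: "Y \<in> M \<rightarrow>\<^sub>M T"
    and ind: "indep_set (sets (vimage_algebra (space M) X S)) (sets (vimage_algebra (space M) Y T))"
  shows "distr M S X \<Otimes>\<^sub>M distr M T Y = distr M (S \<Otimes>\<^sub>M T) (\<lambda>\<omega>. (X \<omega>, Y \<omega>))"
proof (rule pair_measure_eqI)
  interpret X: prob_space "distr M S X" by (rule prob_space_distr[OF X])
  interpret Y: prob_space "distr M T Y" by (rule prob_space_distr[OF Y])
  show "sigma_finite_measure (distr M S X)" "sigma_finite_measure (distr M T Y)" by unfold_locales
  show "sets (distr M S X \<Otimes>\<^sub>M distr M T Y) = sets (distr M (S \<Otimes>\<^sub>M T) (\<lambda>\<omega>. (X \<omega>, Y \<omega>)))"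
    by (simp cong: sets_pair_measure_cong)
  fix A B assume A: "A \<in> sets (distr M S X)" and B: "B \<in> sets (distr M T Y)"
  have "X -` A \<inter> space M \<in> sets (vimage_algebra (space M) X S)" "Y -` B \<inter> space M \<in> sets (vimage_algebra (space M) Y T)"
    using A B by (auto intro: in_vimage_algebra)
  then have "prob ((X -` A \<inter> space M) \<inter> (Y -` B \<inter> space M)) = prob (X -` A \<inter> space M) * prob (Y -` B \<inter> space M)"
    by (rule indep_setD[OF ind])
  moreover have "(X -` A \<inter> space M) \<inter> (Y -` B \<inter> space M) = (\<lambda>\<omega>. (X \<omega>, Y \<omega>)) -` (A \<times> B) \<inter> space M" by auto
  ultimately show "emeasure (distr M S X) A * emeasure (distr M T Y) B = emeasure (distr M (S \<Otimes>\<^sub>M T) (\<lambda>\<omega>. (X \<omega>, Y \<omega>))) (A \<times> B)"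
    using A B X Y by (simp add: emeasure_distr emeasure_eq_measure ennreal_mult)
qed

section \<open>Measurability with respect to the Hausdorff metric\<close>

lemma space_compacts_borel: "space (compacts_borel :: 'a::euclidean_space set measure) = nonempty_compacts"
  and sets_compacts_borel: "openin (Metric_space.mtopology nonempty_compacts hausdorff_dist) U \<Longrightarrow> U \<in> sets (compacts_borel :: 'a::euclidean_space set measure)"
proof -
  interpret H: Metric_space "nonempty_compacts :: 'a set set" hausdorff_dist by (rule Metric_space_hausdorff_dist)
  have sub: "{U. openin H.mtopology U} \<subseteq> Pow nonempty_compacts" using openin_subset[of H.mtopology] by auto
  show "space compacts_borel = (nonempty_compacts :: 'a set set)" by (simp add: compacts_borel_def space_measure_of[OF sub])
  show "openin H.mtopology U \<Longrightarrow> U \<in> sets (compacts_borel :: 'a set measure)"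
    by (simp add: compacts_borel_def sets_measure_of[OF sub])
qed

lemma infdist_hausdorff:
  assumes K: "K \<in> nonempty_compacts" and K': "K' \<in> nonempty_compacts"
  shows "infdist x K' \<le> infdist x K + hausdorff_dist K K'"
proof -
  obtain y where y: "y \<in> K" "infdist x K = dist x y"
    using infdist_attains_inf[of K x] K by (auto simp: nonempty_compacts_def compact_imp_closed)
  have "infdist y K' \<le> hausdorff_dist K K'" using hausdorff_dist_le_iff[OF K K', of "hausdorff_dist K K'"] y by auto
  then show ?thesis using infdist_triangle[of x K' y] y by linarith
qed

text \<open>The distance from a fixed point is 1-Lipschitz in the Hausdorff metric, so the set is
  open.\<close>

lemma sets_infdist_less:
  "{K \<in> nonempty_compacts. infdist x K < r} \<in> sets (compacts_borel :: 'a::euclidean_space set measure)"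
proof (rule sets_compacts_borel)
  interpret H: Metric_space "nonempty_compacts :: 'a set set" hausdorff_dist by (rule Metric_space_hausdorff_dist)
  show "openin H.mtopology {K \<in> nonempty_compacts. infdist x K < r}"
    unfolding H.openin_mtopology
  proof (intro conjI ballI allI impI)
    fix K assume "K \<in> {K \<in> nonempty_compacts. infdist x K < r}"
    then have K: "K \<in> nonempty_compacts" "infdist x K < r" by auto
    show "\<exists>e>0. H.mball K e \<subseteq> {K \<in> nonempty_compacts. infdist x K < r}"
    proof (intro exI[of _ "r - infdist x K"] conjI subsetI)
      fix K' assume "K' \<in> H.mball K (r - infdist x K)"
      then have "K' \<in> nonempty_compacts" "hausdorff_dist K K' < r - infdist x K" by (auto simp: H.in_mball)
      then show "K' \<in> {K \<in> nonempty_compacts. infdist x K < r}" using infdist_hausdorff[OF K(1), of K' x] by auto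
    qed (use K in simp)
  qed auto
qed

text \<open>For closed K membership means distance zero. This is tested by points of a countable
  dense set that are close both to the given point and to K, which brings in only the measurable
  conditions \<open>infdist q K < r\<close>.\<close>

lemma measurable_mem_compact:
  "Measurable.pred ((borel :: 'a::euclidean_space measure) \<Otimes>\<^sub>M compacts_borel) (\<lambda>p. fst p \<in> snd p)"
proof -
  obtain D :: "'a set" where D: "countable D" "\<And>U. open U \<Longrightarrow> U \<noteq> {} \<Longrightarrow> \<exists>d\<in>D. d \<in> U"
    using countable_dense_setE by blast
  have D0: "D \<noteq> {}" using D(2)[of UNIV] by auto
  define d where "d = from_nat_into D"
  have d: "\<exists>k. d k \<in> U" if "open U" "U \<noteq> {}" for U
    using D(2)[OF that] range_from_nat_into[OF D0 D(1)] unfolding d_def by (metis rangeE)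
  have 1: "Measurable.pred compacts_borel (\<lambda>K. infdist q K < r)" for q :: 'a and r
    unfolding pred_def space_compacts_borel by (rule sets_infdist_less)
  have "Measurable.pred ((borel :: 'a measure) \<Otimes>\<^sub>M compacts_borel) (\<lambda>p. (\<lambda>K. infdist q K < r) (snd p))" for q :: 'a and r
    by (rule measurable_compose[OF measurable_snd 1])
  then have 2: "Measurable.pred ((borel :: 'a measure) \<Otimes>\<^sub>M compacts_borel) (\<lambda>p. infdist q (snd p) < r)" for q :: 'a and r by simp
  moreover have "Measurable.pred ((borel :: 'a measure) \<Otimes>\<^sub>M compacts_borel) (\<lambda>p. dist (fst p) q < r)" for q :: 'a and r
    by measurable
  ultimately have "Measurable.pred ((borel :: 'a measure) \<Otimes>\<^sub>M compacts_borel)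
     (\<lambda>p. \<forall>n::nat. \<exists>k. dist (fst p) (d k) < 1 / real (Suc n) \<and> infdist (d k) (snd p) < 1 / real (Suc n))"
    by (intro pred_intros_countable pred_intros_logic)
  also have "?this \<longleftrightarrow> ?thesis"
  proof (rule measurable_cong)
    fix p :: "'a \<times> 'a set" assume "p \<in> space (borel \<Otimes>\<^sub>M compacts_borel)"
    then have K: "closed (snd p)" "snd p \<noteq> {}"
      by (auto simp: space_pair_measure space_compacts_borel nonempty_compacts_def compact_imp_closed)
    show "(\<forall>n::nat. \<exists>k. dist (fst p) (d k) < 1 / real (Suc n) \<and> infdist (d k) (snd p) < 1 / real (Suc n)) \<longleftrightarrow> fst p \<in> snd p"
    proof
      assume *: "\<forall>n::nat. \<exists>k. dist (fst p) (d k) < 1 / real (Suc n) \<and> infdist (d k) (snd p) < 1 / real (Suc n)"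
      have le: "infdist (fst p) (snd p) \<le> 2 / Suc n" for n
      proof -
        obtain k where "dist (fst p) (d k) < 1 / real (Suc n)" "infdist (d k) (snd p) < 1 / real (Suc n)" using * by blast
        then show ?thesis using infdist_triangle[of "fst p" "snd p" "d k"] by simp
      qed
      have "(\<lambda>n. 2 / real (Suc n)) \<longlonglongrightarrow> 0" by (rule LIMSEQ_Suc[OF lim_const_over_n])
      then have "infdist (fst p) (snd p) \<le> 0" by (rule LIMSEQ_le_const) (use le in auto)
      then have "infdist (fst p) (snd p) = 0" using infdist_nonneg[of "fst p" "snd p"] by linarith
      then show "fst p \<in> snd p" using in_closed_iff_infdist_zero[OF K] by simp
    next
      assume in_K: "fst p \<in> snd p"
      show "\<forall>n::nat. \<exists>k. dist (fst p) (d k) < 1 / real (Suc n) \<and> infdist (d k) (snd p) < 1 / real (Suc n)"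
      proof
        fix n :: nat
        obtain k where k: "d k \<in> ball (fst p) (1 / real (Suc n))" using d[of "ball (fst p) (1 / real (Suc n))"] by auto
        have "infdist (d k) (snd p) \<le> dist (d k) (fst p)" by (rule infdist_le[OF in_K])
        then show "\<exists>k. dist (fst p) (d k) < 1 / real (Suc n) \<and> infdist (d k) (snd p) < 1 / real (Suc n)"
          using k by (intro exI[of _ k]) (auto simp: dist_commute)
      qed
    qed
  qed
  finally show ?thesis .
qed

context poisson_grain_model
begin

lemma grain_random_set: "random_set M (G i)"
proof -
  have "Measurable.pred (lborel \<Otimes>\<^sub>M M) (\<lambda>q. (\<lambda>p. fst p \<in> (snd p :: 'a set)) (fst q, G i (snd q)))"
    by (rule measurable_compose[OF _ measurable_mem_compact])
       (intro measurable_Pair measurable_compose[OF measurable_snd grain_measurable], simp)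
  then show ?thesis by (simp add: random_set_def)
qed

lemma grain_union_random_set: "random_set M (grain_union X G)"
proof -
  have "(\<lambda>p. indicator (grain_union X G (snd p)) (fst p) :: real) \<in> borel_measurable (lborel \<Otimes>\<^sub>M M)"
    using jointly_measurable by (simp add: split_beta' measurable_cong_sets[OF sets_pair_measure_cong[OF sets_lborel refl] refl])
  then have "Measurable.pred (lborel \<Otimes>\<^sub>M M) (\<lambda>p. indicator (grain_union X G (snd p)) (fst p) = (1::real))"
    by measurable
  then show ?thesis by (simp add: random_set_def indicator_eq_1_iff)
qed

lemma X_measurable: "1 \<le> i \<Longrightarrow> X i \<in> borel_measurable M"
  using points_poisson by (auto simp: poisson_process_def)

definition avoid :: "'a set \<Rightarrow> 'a \<Rightarrow> 'a set \<Rightarrow> real" where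
  "avoid A x K = (if (\<lambda>y. y + x) ` K \<inter> A = {} then 1 else 0)"

lemma avoid_bounds [simp]: "0 \<le> avoid A x K" "avoid A x K \<le> 1"
  by (auto simp: avoid_def)

lemma measurable_avoid:
  assumes "finite A" shows "(\<lambda>p. avoid A (fst p) (snd p)) \<in> borel_measurable (borel \<Otimes>\<^sub>M compacts_borel)"
proof -
  have 1: "Measurable.pred (borel \<Otimes>\<^sub>M compacts_borel) (\<lambda>q. (\<lambda>p. fst p \<in> (snd p :: 'a set)) (a - fst q, snd q))" for a
    by (rule measurable_compose[OF _ measurable_mem_compact]) measurable
  have "(\<lambda>p. avoid A (fst p) (snd p)) = (\<lambda>p. \<Prod>a\<in>A. if a - fst p \<in> snd p then 0 else 1)"
  proof
    fix p :: "'a \<times> 'a set"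
    have "(\<lambda>y. y + fst p) ` snd p \<inter> A = {} \<longleftrightarrow> (\<forall>a\<in>A. a - fst p \<notin> snd p)"
      by (force simp: image_iff)
    then show "avoid A (fst p) (snd p) = (\<Prod>a\<in>A. if a - fst p \<in> snd p then 0 else 1)"
      using assms by (auto simp: avoid_def prod_zero_iff)
  qed
  also have "\<dots> \<in> borel_measurable (borel \<Otimes>\<^sub>M compacts_borel)"
    using 1 by (intro borel_measurable_prod measurable_If) auto
  finally show ?thesis .
qed

definition typical_avoid :: "'a set \<Rightarrow> 'a \<Rightarrow> real" where
  "typical_avoid A x = (LINT \<omega>|M. avoid A x (G 0 \<omega>))"

lemma typical_avoid_bounds: "0 \<le> typical_avoid A x" "finite A \<Longrightarrow> typical_avoid A x \<le> 1"
proof -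
  show "0 \<le> typical_avoid A x" unfolding typical_avoid_def by simp
  assume A: "finite A"
  have "(\<lambda>\<omega>. (\<lambda>p. avoid A (fst p) (snd p)) (x, G 0 \<omega>)) \<in> borel_measurable M"
    by (rule measurable_compose[OF _ measurable_avoid[OF A]]) (intro measurable_Pair grain_measurable, simp)
  then have "typical_avoid A x \<le> (LINT \<omega>|M. 1)" unfolding typical_avoid_def
    by (intro integral_mono integrable_const_bound[of _ 1]) auto
  then show "typical_avoid A x \<le> 1" by (simp add: prob_space)
qed

lemma measurable_typical_avoid: "finite A \<Longrightarrow> typical_avoid A \<in> borel_measurable borel"
proof -
  assume A: "finite A"
  have "(\<lambda>q. (\<lambda>p. avoid A (fst p) (snd p)) (fst q, G 0 (snd q))) \<in> borel_measurable (borel \<Otimes>\<^sub>M M)"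
    by (rule measurable_compose[OF _ measurable_avoid[OF A]])
       (intro measurable_Pair measurable_compose[OF measurable_snd grain_measurable], simp)
  then have "(\<lambda>(x, \<omega>). avoid A x (G 0 \<omega>)) \<in> borel_measurable (borel \<Otimes>\<^sub>M M)" by (simp add: split_beta')
  then show ?thesis unfolding typical_avoid_def[abs_def] by (rule borel_measurable_lebesgue_integral)
qed

text \<open>Given the points, the grains are independent copies of the typical one, so each factor
  may be replaced by its conditional mean. Independence of the two sequences makes their joint law a
  product, and the law of the grains is itself a product over the indices.\<close>

lemma marking:
  assumes A: "finite A"
  shows "(LINT \<omega>|M. (\<Prod>i\<in>{1..N}. avoid A (X i \<omega>) (G i \<omega>))) = (LINT \<omega>|M. (\<Prod>i\<in>{1..N}. typical_avoid A (X i \<omega>)))"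
proof -
  let ?I = "{1..} :: nat set"
  let ?PG = "\<Pi>\<^sub>M i\<in>?I. (compacts_borel :: 'a set measure)" and ?PX = "\<Pi>\<^sub>M i\<in>?I. (borel :: 'a measure)"
  let ?Y = "\<lambda>\<omega>. \<lambda>i\<in>?I. G i \<omega>" and ?X = "\<lambda>\<omega>. \<lambda>i\<in>?I. X i \<omega>"
  let ?Q = "distr M compacts_borel (G 0)"
  interpret Q: prob_space ?Q by (rule prob_space_distr[OF grain_measurable])
  have Ym: "?Y \<in> M \<rightarrow>\<^sub>M ?PG" using grain_measurable by (intro measurable_restrict)
  have Xm: "?X \<in> M \<rightarrow>\<^sub>M ?PX" using X_measurable by (intro measurable_restrict) auto
  have "indep_set (sets (vimage_algebra (space M) ?X ?PX)) (sets (vimage_algebra (space M) ?Y ?PG))"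
    by (rule indep_set_sym[OF grains_points_indep])
  from distr_pair_indep_set[OF Xm Ym this]
  have joint: "distr M (?PX \<Otimes>\<^sub>M ?PG) (\<lambda>\<omega>. (?X \<omega>, ?Y \<omega>)) = distr M ?PX ?X \<Otimes>\<^sub>M distr M ?PG ?Y"
    by (rule sym)
  have "distr M ?PG ?Y = (\<Pi>\<^sub>M i\<in>?I. distr M compacts_borel (G i))"
    by (rule iffD1[OF indep_vars_iff_distr_eq_PiM' grains_indep]) (simp, rule grain_measurable)
  also have "\<dots> = (\<Pi>\<^sub>M i\<in>?I. ?Q)" by (intro PiM_cong refl grains_distr)
  finally have Yd: "distr M ?PG ?Y = (\<Pi>\<^sub>M i\<in>?I. ?Q)" .
  have PGQ: "sets (\<Pi>\<^sub>M i\<in>?I. ?Q) = sets ?PG" by (intro sets_PiM_cong) auto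
  interpret PQ: prob_space "\<Pi>\<^sub>M i\<in>?I. ?Q" by (rule prob_space_PiM) (rule Q.prob_space_axioms)
  let ?F = "\<lambda>x g. \<Prod>i\<in>{1..N}. ennreal (avoid A (x i) (g i))"
  have Fm: "(\<lambda>p. ?F (fst p) (snd p)) \<in> borel_measurable (?PX \<Otimes>\<^sub>M ?PG)"
  proof (intro borel_measurable_prod_ennreal measurable_compose[OF _ measurable_ennreal])
    fix i assume "i \<in> {1..N}"
    then have "(\<lambda>q. (fst q i, snd q i)) \<in> ?PX \<Otimes>\<^sub>M ?PG \<rightarrow>\<^sub>M borel \<Otimes>\<^sub>M compacts_borel"
      by (intro measurable_Pair measurable_compose[OF measurable_fst measurable_component_singleton]
          measurable_compose[OF measurable_snd measurable_component_singleton]) auto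
    from measurable_compose[OF this measurable_avoid[OF A]]
    show "(\<lambda>p. avoid A (fst p i) (snd p i)) \<in> borel_measurable (?PX \<Otimes>\<^sub>M ?PG)" by simp
  qed
  have pair: "(\<lambda>\<omega>. (?X \<omega>, ?Y \<omega>)) \<in> M \<rightarrow>\<^sub>M ?PX \<Otimes>\<^sub>M ?PG" using Xm Ym by (rule measurable_Pair)
  have "(\<integral>\<^sup>+\<omega>. (\<Prod>i\<in>{1..N}. ennreal (avoid A (X i \<omega>) (G i \<omega>))) \<partial>M) =
     (\<integral>\<^sup>+p. ?F (fst p) (snd p) \<partial>distr M (?PX \<Otimes>\<^sub>M ?PG) (\<lambda>\<omega>. (?X \<omega>, ?Y \<omega>)))"
    by (subst nn_integral_distr[OF pair]) (use Fm in simp, auto intro!: nn_integral_cong prod.cong)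
  also have "\<dots> = (\<integral>\<^sup>+x. \<integral>\<^sup>+g. ?F x g \<partial>(\<Pi>\<^sub>M i\<in>?I. ?Q) \<partial>distr M ?PX ?X)"
    unfolding joint Yd
    by (subst PQ.nn_integral_fst[symmetric]) (use Fm in \<open>simp_all add: measurable_cong_sets[OF sets_pair_measure_cong[OF sets_distr PGQ] refl]\<close>)
  also have "\<dots> = (\<integral>\<^sup>+x. (\<Prod>i\<in>{1..N}. ennreal (typical_avoid A (x i))) \<partial>distr M ?PX ?X)"
  proof (rule nn_integral_cong)
    fix x :: "nat \<Rightarrow> 'a"
    have m: "(\<lambda>K. avoid A (x i) K) \<in> borel_measurable compacts_borel" for i
    proof -
      have "(\<lambda>K. (\<lambda>p. avoid A (fst p) (snd p)) (x i, K)) \<in> borel_measurable compacts_borel"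
        by (rule measurable_compose[OF _ measurable_avoid[OF A]]) simp
      then show ?thesis by simp
    qed
    have "(\<integral>\<^sup>+g. ?F x g \<partial>(\<Pi>\<^sub>M i\<in>?I. ?Q)) = (\<Prod>i\<in>{1..N}. \<integral>\<^sup>+K. ennreal (avoid A (x i) K) \<partial>?Q)"
      by (rule nn_integral_PiM_prod) (use m Q.prob_space_axioms in auto)
    also have "\<dots> = (\<Prod>i\<in>{1..N}. ennreal (typical_avoid A (x i)))"
    proof (rule prod.cong[OF refl])
      fix i
      have mG: "(\<lambda>\<omega>. avoid A (x i) (G 0 \<omega>)) \<in> borel_measurable M" by (rule measurable_compose[OF grain_measurable m])
      have "(\<integral>\<^sup>+K. ennreal (avoid A (x i) K) \<partial>?Q) = (\<integral>\<^sup>+\<omega>. ennreal (avoid A (x i) (G 0 \<omega>)) \<partial>M)"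
        using m grain_measurable by (subst nn_integral_distr) auto
      also have "\<dots> = ennreal (typical_avoid A (x i))" unfolding typical_avoid_def
        by (rule nn_integral_eq_integral) (use mG in \<open>auto intro!: integrable_const_bound[of _ 1]\<close>)
      finally show "(\<integral>\<^sup>+K. ennreal (avoid A (x i) K) \<partial>?Q) = ennreal (typical_avoid A (x i))" .
    qed
    finally show "(\<integral>\<^sup>+g. ?F x g \<partial>(\<Pi>\<^sub>M i\<in>?I. ?Q)) = (\<Prod>i\<in>{1..N}. ennreal (typical_avoid A (x i)))" .
  qed
  also have "\<dots> = (\<integral>\<^sup>+\<omega>. (\<Prod>i\<in>{1..N}. ennreal (typical_avoid A (X i \<omega>))) \<partial>M)"
  proof -
    have "(\<lambda>x. \<Prod>i\<in>{1..N}. ennreal (typical_avoid A (x i))) \<in> borel_measurable ?PX"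
    proof (intro borel_measurable_prod_ennreal measurable_compose[OF _ measurable_ennreal])
      fix i assume "i \<in> {1..N}"
      then have "(\<lambda>x. x i) \<in> ?PX \<rightarrow>\<^sub>M borel" by (intro measurable_component_singleton) auto
      then show "(\<lambda>x. typical_avoid A (x i)) \<in> borel_measurable ?PX"
        by (rule measurable_compose[OF _ measurable_typical_avoid[OF A]])
    qed
    then show ?thesis
      by (subst nn_integral_distr[OF Xm]) (simp, auto intro!: nn_integral_cong prod.cong)
  qed
  finally have nn: "(\<integral>\<^sup>+\<omega>. ennreal (\<Prod>i\<in>{1..N}. avoid A (X i \<omega>) (G i \<omega>)) \<partial>M) = (\<integral>\<^sup>+\<omega>. ennreal (\<Prod>i\<in>{1..N}. typical_avoid A (X i \<omega>)) \<partial>M)"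
    by (simp add: prod_ennreal typical_avoid_bounds)
  have m1: "(\<lambda>\<omega>. \<Prod>i\<in>{1..N}. avoid A (X i \<omega>) (G i \<omega>)) \<in> borel_measurable M"
  proof (rule borel_measurable_prod)
    fix i assume "i \<in> {1..N}"
    then have "(\<lambda>\<omega>. (\<lambda>p. avoid A (fst p) (snd p)) (X i \<omega>, G i \<omega>)) \<in> borel_measurable M"
      by (intro measurable_compose[OF _ measurable_avoid[OF A]] measurable_Pair grain_measurable X_measurable) auto
    then show "(\<lambda>\<omega>. avoid A (X i \<omega>) (G i \<omega>)) \<in> borel_measurable M" by simp
  qed
  have m2: "(\<lambda>\<omega>. \<Prod>i\<in>{1..N}. typical_avoid A (X i \<omega>)) \<in> borel_measurable M"
    by (intro borel_measurable_prod measurable_compose[OF X_measurable measurable_typical_avoid[OF A]]) auto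
  show ?thesis
    using nn m1 m2 by (simp add: integral_eq_nn_integral prod_nonneg typical_avoid_bounds)
qed

end

text \<open>The value at \<infinity> is 0 even for c = 1, so \<open>thin 1\<close> is the indicator
  of a finite count.\<close>

definition thin :: "real \<Rightarrow> enat \<Rightarrow> real" where
  "thin c n = (case n of enat k \<Rightarrow> c ^ k | \<infinity> \<Rightarrow> 0)"

lemma thin_simps [simp]: "thin c (enat k) = c ^ k" "thin c \<infinity> = 0"
  by (simp_all add: thin_def)

lemma thin_bounds: "0 \<le> c \<Longrightarrow> 0 \<le> thin c n" "0 \<le> c \<Longrightarrow> c \<le> 1 \<Longrightarrow> thin c n \<le> 1"
  by (cases n; simp add: power_le_one)+

context poisson_grain_model
begin

section \<open>The generating functional of the points\<close>

lemma count_measurable: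
  assumes "bounded B" "B \<in> sets borel"
  shows "point_count X B \<in> M \<rightarrow>\<^sub>M count_space UNIV"
proof -
  have "indep_vars (\<lambda>_. count_space UNIV) (\<lambda>j. point_count X ((\<lambda>_::nat. B) j)) {0}"
    using points_poisson assms unfolding poisson_process_def by (auto simp: disjoint_family_on_def)
  then show ?thesis by (auto simp: indep_vars_def)
qed

lemma count_thin:
  assumes B: "bounded B" "B \<in> sets borel" and c: "0 \<le> c" "c \<le> 1"
  shows "(\<lambda>\<omega>. thin c (point_count X B \<omega>)) \<in> borel_measurable M"
    "(LINT \<omega>|M. thin c (point_count X B \<omega>)) = exp (- lam * (vol B * (1 - c)))"
proof -
  let ?N = "point_count X B" and ?v = "lam * vol B"
  have v: "0 \<le> ?v" using intensity_pos by simp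
  show m: "(\<lambda>\<omega>. thin c (?N \<omega>)) \<in> borel_measurable M"
    by (rule measurable_compose[OF count_measurable[OF B]]) simp
  have sets: "{\<omega> \<in> space M. ?N \<omega> = enat k} \<in> sets M" for k
    using measurable_sets[OF count_measurable[OF B], of "{enat k}"] by (simp add: vimage_def Int_def conj_commute)
  have pt: "ennreal (thin c (?N \<omega>)) = (\<Sum>k. ennreal (c ^ k) * indicator {\<omega> \<in> space M. ?N \<omega> = enat k} \<omega>)" if "\<omega> \<in> space M" for \<omega>
  proof (cases "?N \<omega>")
    case (enat m)
    have "(\<Sum>k. ennreal (c ^ k) * indicator {\<omega> \<in> space M. ?N \<omega> = enat k} \<omega>) =
        (\<Sum>k\<in>{m}. ennreal (c ^ k) * indicator {\<omega> \<in> space M. ?N \<omega> = enat k} \<omega>)"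
      by (rule suminf_finite) (auto simp: enat indicator_def)
    then show ?thesis using that enat by simp
  next
    case infinity
    then show ?thesis by (simp add: indicator_def)
  qed
  have pr: "emeasure M {\<omega> \<in> space M. ?N \<omega> = enat k} = ennreal (?v ^ k / fact k * exp (- ?v))" for k
    using points_poisson B unfolding poisson_process_def emeasure_eq_measure by auto
  have "(\<integral>\<^sup>+\<omega>. ennreal (thin c (?N \<omega>)) \<partial>M) = (\<integral>\<^sup>+\<omega>. (\<Sum>k. ennreal (c ^ k) * indicator {\<omega> \<in> space M. ?N \<omega> = enat k} \<omega>) \<partial>M)"
    by (rule nn_integral_cong) (rule pt)
  also have "\<dots> = (\<Sum>k. \<integral>\<^sup>+\<omega>. ennreal (c ^ k) * indicator {\<omega> \<in> space M. ?N \<omega> = enat k} \<omega> \<partial>M)"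
    by (rule nn_integral_suminf) (use sets in simp)
  also have "\<dots> = (\<Sum>k. ennreal (exp (- ?v) * ((c * ?v) ^ k / fact k)))"
  proof (rule suminf_cong)
    fix k
    have "(\<integral>\<^sup>+\<omega>. ennreal (c ^ k) * indicator {\<omega> \<in> space M. ?N \<omega> = enat k} \<omega> \<partial>M) = ennreal (c ^ k) * ennreal (?v ^ k / fact k * exp (- ?v))"
      by (simp only: nn_integral_cmult_indicator[OF sets] pr)
    also have "\<dots> = ennreal (c ^ k * (?v ^ k / fact k * exp (- ?v)))" using c v by (intro ennreal_mult[symmetric]) auto
    also have "c ^ k * (?v ^ k / fact k * exp (- ?v)) = exp (- ?v) * ((c * ?v) ^ k / fact k)"
      by (simp add: power_mult_distrib)
    finally show "(\<integral>\<^sup>+\<omega>. ennreal (c ^ k) * indicator {\<omega> \<in> space M. ?N \<omega> = enat k} \<omega> \<partial>M) = ennreal (exp (- ?v) * ((c * ?v) ^ k / fact k))" .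
  qed
  also have "\<dots> = ennreal (\<Sum>k. exp (- ?v) * ((c * ?v) ^ k / fact k))"
    using c v summable_exp[of "c * ?v"]
    by (intro suminf_ennreal2 summable_mult) (auto simp: divide_inverse mult.commute)
  also have "(\<Sum>k. exp (- ?v) * ((c * ?v) ^ k / fact k)) = exp (- ?v) * exp (c * ?v)"
    using summable_exp[of "c * ?v"] by (subst suminf_mult) (auto simp: divide_inverse mult.commute exp_def)
  also have "\<dots> = exp (- lam * (vol B * (1 - c)))" by (simp add: exp_add[symmetric] algebra_simps)
  finally show "(LINT \<omega>|M. thin c (?N \<omega>)) = exp (- lam * (vol B * (1 - c)))"
    using m thin_bounds(1)[OF c(1)] by (simp add: integral_eq_nn_integral)
qed

text \<open>The Poisson probabilities sum to 1, which is the case c = 1 of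
  \<open>count_thin\<close>.\<close>

lemma count_finite:
  assumes B: "bounded B" "B \<in> sets borel"
  shows "AE \<omega> in M. point_count X B \<omega> \<noteq> \<infinity>"
proof -
  note t = count_thin[OF B, of 1, simplified]
  have i: "integrable M (\<lambda>\<omega>. thin 1 (point_count X B \<omega>))"
    by (rule integrable_const_bound[of _ 1]) (use t(1) thin_bounds[of 1] in auto)
  have "(LINT \<omega>|M. 1 - thin 1 (point_count X B \<omega>)) = 0" using i t(2) by (simp add: prob_space)
  then have "AE \<omega> in M. 1 - thin 1 (point_count X B \<omega>) = 0"
    using i thin_bounds(2)[of 1] by (subst (asm) integral_nonneg_eq_0_iff_AE) auto
  then show ?thesis
  proof eventually_elim
    case (elim \<omega>)
    then show ?case by (cases "point_count X B \<omega>") auto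
  qed
qed

text \<open>Only finitely many factors differ from 1, so the product is constant from the largest
  index of a point in B on.\<close>

lemma point_product_limit:
  assumes "point_count X B \<omega> \<noteq> \<infinity>"
  shows "(\<lambda>N. \<Prod>i\<in>{1..N}. if X i \<omega> \<in> B then c else 1) \<longlonglongrightarrow> thin c (point_count X B \<omega>)"
proof -
  let ?I = "{i. 1 \<le> i \<and> X i \<omega> \<in> B}"
  have fin: "finite ?I" using assms by (auto simp: point_count_def split: if_splits)
  have "(\<Prod>i\<in>{1..N}. if X i \<omega> \<in> B then c else 1) = thin c (point_count X B \<omega>)" if N: "Max (insert 0 ?I) \<le> N" for N
  proof -
    have sub: "?I \<subseteq> {1..N}"
    proof
      fix i assume i: "i \<in> ?I"
      have "i \<le> Max (insert 0 ?I)" using fin i by (intro Max_ge) auto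
      then show "i \<in> {1..N}" using i N by simp
    qed
    have "(\<Prod>i\<in>{1..N}. if X i \<omega> \<in> B then c else 1) = (\<Prod>i\<in>?I. if X i \<omega> \<in> B then c else 1)"
      by (rule prod.mono_neutral_right[OF _ sub]) auto
    also have "\<dots> = (\<Prod>i\<in>?I. c)" by (rule prod.cong) auto
    finally show ?thesis using fin by (simp add: point_count_def)
  qed
  then have "\<forall>\<^sub>F N in sequentially. (\<Prod>i\<in>{1..N}. if X i \<omega> \<in> B then c else 1) = thin c (point_count X B \<omega>)"
    by (rule eventually_sequentiallyI)
  then show ?thesis by (rule tendsto_eventually)
qed

text \<open>The enumeration of the points is arbitrary, and the functional is truncated to its first
  N entries; for functions with values in [0, 1] the truncations decrease in N.\<close>

definition point_pgf :: "('a \<Rightarrow> real) \<Rightarrow> nat \<Rightarrow> real" where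
  "point_pgf f N = (LINT \<omega>|M. (\<Prod>i\<in>{1..N}. f (X i \<omega>)))"

lemma point_product:
  fixes f :: "'a \<Rightarrow> real"
  assumes f: "f \<in> borel_measurable borel" "\<And>x. 0 \<le> f x" "\<And>x. f x \<le> 1"
  shows "(\<lambda>\<omega>. \<Prod>i\<in>{1..N}. f (X i \<omega>)) \<in> borel_measurable M" "integrable M (\<lambda>\<omega>. \<Prod>i\<in>{1..N}. f (X i \<omega>))"
    "0 \<le> (\<Prod>i\<in>{1..N}. f (X i \<omega>))" "(\<Prod>i\<in>{1..N}. f (X i \<omega>)) \<le> 1"
proof -
  show m: "(\<lambda>\<omega>. \<Prod>i\<in>{1..N}. f (X i \<omega>)) \<in> borel_measurable M"
  proof (rule borel_measurable_prod)
    show "(\<lambda>\<omega>. f (X i \<omega>)) \<in> borel_measurable M" if "i \<in> {1..N}" for i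
      by (rule measurable_compose[OF X_measurable f(1)]) (use that in simp)
  qed
  show b: "0 \<le> (\<Prod>i\<in>{1..N}. f (X i \<omega>))" "(\<Prod>i\<in>{1..N}. f (X i \<omega>)) \<le> 1" for \<omega>
    using f by (auto intro!: prod_nonneg prod_le_1)
  show "integrable M (\<lambda>\<omega>. \<Prod>i\<in>{1..N}. f (X i \<omega>))"
    by (rule integrable_const_bound[of _ 1]) (use m b in auto)
qed

text \<open>For a product of step factors the points may be regrouped by the sets into which they
  fall. The limit is the mean of a product of independent thinned counts, each with a Poisson
  generating function.\<close>

lemma point_pgf_simple:
  fixes B :: "nat \<Rightarrow> 'a set"
  assumes J: "finite J" and B: "\<And>j. j \<in> J \<Longrightarrow> bounded (B j)" "\<And>j. j \<in> J \<Longrightarrow> B j \<in> sets borel"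
    and disj: "disjoint_family_on B J" and c: "\<And>j. j \<in> J \<Longrightarrow> 0 \<le> c j" "\<And>j. j \<in> J \<Longrightarrow> c j \<le> 1"
  shows "point_pgf (\<lambda>x. \<Prod>j\<in>J. if x \<in> B j then c j else 1) \<longlonglongrightarrow> exp (- lam * (\<Sum>j\<in>J. vol (B j) * (1 - c j)))"
proof -
  let ?f = "\<lambda>x. \<Prod>j\<in>J. if x \<in> B j then c j else 1"
  have f: "?f \<in> borel_measurable borel" "0 \<le> ?f x" "?f x \<le> 1" for x
    using B(2) c by (auto intro!: borel_measurable_prod prod_nonneg prod_le_1 measurable_If)
  have "indep_vars (\<lambda>_. count_space UNIV) (\<lambda>j. point_count X (B j)) J"
    using points_poisson J B disj unfolding poisson_process_def by auto
  then have ind: "indep_vars (\<lambda>_. borel) (\<lambda>j \<omega>. thin (c j) (point_count X (B j) \<omega>)) J"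
    by (rule indep_vars_compose2) simp
  have it: "integrable M (\<lambda>\<omega>. thin (c j) (point_count X (B j) \<omega>))" if "j \<in> J" for j
    by (rule integrable_const_bound[of _ 1])
       (use count_thin(1)[OF B(1,2)[OF that] c(1,2)[OF that]] thin_bounds[OF c(1)[OF that]] c(2)[OF that] in auto)
  have "(LINT \<omega>|M. (\<Prod>j\<in>J. thin (c j) (point_count X (B j) \<omega>))) = (\<Prod>j\<in>J. LINT \<omega>|M. thin (c j) (point_count X (B j) \<omega>))"
    by (rule indep_vars_lebesgue_integral[OF J ind it])
  also have "\<dots> = (\<Prod>j\<in>J. exp (- lam * (vol (B j) * (1 - c j))))"
    by (rule prod.cong[OF refl]) (rule count_thin(2), use B c in auto)
  also have "\<dots> = exp (- lam * (\<Sum>j\<in>J. vol (B j) * (1 - c j)))"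
    using J by (simp add: exp_sum sum_distrib_left)
  finally have E: "(LINT \<omega>|M. (\<Prod>j\<in>J. thin (c j) (point_count X (B j) \<omega>))) = exp (- lam * (\<Sum>j\<in>J. vol (B j) * (1 - c j)))" .
  have "(\<lambda>N. LINT \<omega>|M. (\<Prod>i\<in>{1..N}. ?f (X i \<omega>))) \<longlonglongrightarrow> (LINT \<omega>|M. (\<Prod>j\<in>J. thin (c j) (point_count X (B j) \<omega>)))"
  proof (rule integral_dominated_convergence[where w="\<lambda>_. 1"])
    have "AE \<omega> in M. \<forall>j\<in>J. point_count X (B j) \<omega> \<noteq> \<infinity>"
      using J count_finite[OF B] by (intro AE_finite_allI) auto
    then show "AE \<omega> in M. (\<lambda>N. \<Prod>i\<in>{1..N}. ?f (X i \<omega>)) \<longlonglongrightarrow> (\<Prod>j\<in>J. thin (c j) (point_count X (B j) \<omega>))"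
    proof eventually_elim
      case (elim \<omega>)
      have "(\<lambda>N. \<Prod>j\<in>J. \<Prod>i\<in>{1..N}. if X i \<omega> \<in> B j then c j else 1) \<longlonglongrightarrow> (\<Prod>j\<in>J. thin (c j) (point_count X (B j) \<omega>))"
        by (intro tendsto_prod point_product_limit) (use elim in auto)
      then show ?case by (subst prod.swap)
    qed
    show "(\<lambda>\<omega>. \<Prod>j\<in>J. thin (c j) (point_count X (B j) \<omega>)) \<in> borel_measurable M"
      using count_thin(1) B c by (intro borel_measurable_prod) auto
  qed (use point_product[OF f] in auto)
  then show ?thesis unfolding E point_pgf_def[abs_def] .
qed

lemma point_pgf_antimono:
  assumes f: "f \<in> borel_measurable borel" "\<And>x. 0 \<le> f x" "\<And>x. f x \<le> 1" and "N \<le> N'"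
  shows "point_pgf f N' \<le> point_pgf f N"
  unfolding point_pgf_def
proof (rule integral_mono[OF point_product(2)[OF f] point_product(2)[OF f]])
  fix \<omega>
  have "(\<Prod>i\<in>{1..N'}. f (X i \<omega>)) = (\<Prod>i\<in>{1..N}. f (X i \<omega>)) * (\<Prod>i\<in>{Suc N..N'}. f (X i \<omega>))"
    using \<open>N \<le> N'\<close> by (subst prod.union_disjoint[symmetric]) (auto intro!: prod.cong)
  also have "\<dots> \<le> (\<Prod>i\<in>{1..N}. f (X i \<omega>)) * 1"
    using f by (intro mult_left_mono prod_le_1 prod_nonneg) auto
  finally show "(\<Prod>i\<in>{1..N'}. f (X i \<omega>)) \<le> (\<Prod>i\<in>{1..N}. f (X i \<omega>))" by simp
qed

lemma point_pgf_mono: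
  assumes f: "f \<in> borel_measurable borel" "\<And>x. 0 \<le> f x" "\<And>x. f x \<le> 1"
    and g: "g \<in> borel_measurable borel" "\<And>x. g x \<le> 1" and le: "\<And>x. f x \<le> g x"
  shows "point_pgf f N \<le> point_pgf g N"
  unfolding point_pgf_def
proof (rule integral_mono[OF point_product(2)[OF f] point_product(2)[OF g(1) _ g(2)]])
  show "0 \<le> g x" for x using f(2)[of x] le[of x] by linarith
  show "(\<Prod>i\<in>{1..N}. f (X i \<omega>)) \<le> (\<Prod>i\<in>{1..N}. g (X i \<omega>))" for \<omega>
    by (rule prod_mono) (simp add: f(2) le)
qed

text \<open>Discretisation of \<open>p\<close> in steps of \<open>1 / m\<close>, equal to \<open>1\<close> outside the ball of radius \<open>m\<close>.\<close>

definition level :: "('a \<Rightarrow> real) \<Rightarrow> nat \<Rightarrow> nat \<Rightarrow> 'a set" where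
  "level p m j = {x. norm x < real m \<and> \<lfloor>real m * (1 - p x)\<rfloor> = int j}"

definition stepped :: "('a \<Rightarrow> real) \<Rightarrow> nat \<Rightarrow> 'a \<Rightarrow> real" where
  "stepped p m x = (\<Prod>j\<in>{1..m}. if x \<in> level p m j then 1 - real j / real m else 1)"

lemma stepped_eq:
  assumes p: "0 \<le> p x" "p x \<le> 1" and m: "0 < m"
  shows "stepped p m x = (if norm x < real m then 1 - \<lfloor>real m * (1 - p x)\<rfloor> / real m else 1)"
proof (cases "norm x < real m")
  case True
  define k where "k = nat \<lfloor>real m * (1 - p x)\<rfloor>"
  have "0 \<le> \<lfloor>real m * (1 - p x)\<rfloor>" using p m by simp
  then have k: "int k = \<lfloor>real m * (1 - p x)\<rfloor>" by (simp add: k_def)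
  have "real m * (1 - p x) \<le> real m" using p m by (simp add: mult_left_le)
  then have km: "k \<le> m" using k by linarith
  have lev: "x \<in> level p m j \<longleftrightarrow> j = k" for j using True k by (auto simp: level_def)
  have "stepped p m x = (\<Prod>j\<in>{1..m}. if j = k then 1 - real k / real m else 1)"
    unfolding stepped_def lev by (rule prod.cong) auto
  also have "\<dots> = 1 - real k / real m"
    by (subst prod.delta) (use km in auto)
  finally show ?thesis using True by (simp only: if_True k[symmetric] of_int_of_nat_eq)
next
  case False
  then show ?thesis by (auto simp: stepped_def level_def)
qed

lemma stepped_bounds:
  assumes p: "0 \<le> p x" "p x \<le> 1" and m: "0 < m"
  shows "p x \<le> stepped p m x" "stepped p m x \<le> 1"
proof -
  have "\<lfloor>real m * (1 - p x)\<rfloor> / real m \<le> (real m * (1 - p x)) / real m"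
    by (intro divide_right_mono of_int_floor_le) simp
  then have 1: "\<lfloor>real m * (1 - p x)\<rfloor> / real m \<le> 1 - p x" using m by simp
  have "0 \<le> \<lfloor>real m * (1 - p x)\<rfloor>" using p m by simp
  then have 2: "0 \<le> \<lfloor>real m * (1 - p x)\<rfloor> / real m" by (intro divide_nonneg_nonneg) auto
  show "p x \<le> stepped p m x" "stepped p m x \<le> 1" using 1 2 p by (auto simp: stepped_eq[of p, OF p m])
qed

lemma stepped_limit:
  assumes p: "0 \<le> p x" "p x \<le> 1"
  shows "(\<lambda>m. stepped p (Suc m) x) \<longlonglongrightarrow> p x"
proof (rule tendsto_sandwich)
  show "\<forall>\<^sub>F m in sequentially. p x \<le> stepped p (Suc m) x"
    using stepped_bounds(1)[of p, OF p] by simp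
  obtain N where N: "norm x < real N" using reals_Archimedean2 by blast
  show "\<forall>\<^sub>F m in sequentially. stepped p (Suc m) x \<le> p x + 1 / real (Suc m)"
    using eventually_ge_at_top[of N]
  proof eventually_elim
    case (elim m)
    have "real (Suc m) * (1 - p x) - 1 \<le> \<lfloor>real (Suc m) * (1 - p x)\<rfloor>" by linarith
    then have "(real (Suc m) * (1 - p x) - 1) / real (Suc m) \<le> \<lfloor>real (Suc m) * (1 - p x)\<rfloor> / real (Suc m)"
      by (rule divide_right_mono) simp
    then have "1 - p x - 1 / real (Suc m) \<le> \<lfloor>real (Suc m) * (1 - p x)\<rfloor> / real (Suc m)"
      by (simp add: diff_divide_distrib)
    moreover have "norm x < real (Suc m)" using N elim by simp
    ultimately show ?case by (simp only: stepped_eq[of p, OF p zero_less_Suc] if_True)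
  qed
  show "(\<lambda>m. p x + 1 / real (Suc m)) \<longlonglongrightarrow> p x"
    using tendsto_add[OF tendsto_const LIMSEQ_inverse_real_of_nat, of "p x"] by (simp add: inverse_eq_divide)
qed simp

lemma level_sets:
  assumes "p \<in> borel_measurable borel"
  shows "bounded (level p m j)" "level p m j \<in> sets borel" "disjoint_family_on (level p m) J"
proof -
  show "bounded (level p m j)" by (rule bounded_subset[OF bounded_ball[of 0 "real m"]]) (auto simp: level_def)
  show "level p m j \<in> sets borel" unfolding level_def using assms by measurable
  show "disjoint_family_on (level p m) J" by (auto simp: disjoint_family_on_def level_def)
qed

lemma measurable_stepped: "p \<in> borel_measurable borel \<Longrightarrow> stepped p m \<in> borel_measurable borel"
  unfolding stepped_def[abs_def] using level_sets(2) by (intro borel_measurable_prod measurable_If) auto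

lemma stepped_integral:
  assumes p: "p \<in> borel_measurable borel" and m: "0 < m"
  shows "(LINT x|lborel. 1 - stepped p m x) = (\<Sum>j\<in>{1..m}. vol (level p m j) * (1 - (1 - real j / real m)))"
proof -
  have "1 - stepped p m x = (\<Sum>j\<in>{1..m}. (real j / real m) * indicator (level p m j) x)" for x
  proof (cases "\<exists>j\<in>{1..m}. x \<in> level p m j")
    case True
    then obtain k where k: "k \<in> {1..m}" "x \<in> level p m k" by auto
    have lev: "x \<in> level p m j \<longleftrightarrow> j = k" for j using k by (auto simp: level_def)
    have "stepped p m x = (\<Prod>j\<in>{1..m}. if j = k then 1 - real k / real m else 1)"
      unfolding stepped_def lev by (rule prod.cong) auto
    moreover have "(\<Sum>j\<in>{1..m}. (real j / real m) * indicator (level p m j) x) = (\<Sum>j\<in>{1..m}. if j = k then real k / real m else 0)"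
      by (rule sum.cong) (auto simp: indicator_def lev)
    ultimately show ?thesis using k(1) by (simp add: prod.delta)
  next
    case False
    then show ?thesis by (auto simp: stepped_def indicator_def)
  qed
  then have "(LINT x|lborel. 1 - stepped p m x) = (LINT x|lborel. (\<Sum>j\<in>{1..m}. (real j / real m) * indicator (level p m j) x))"
    by simp
  also have "\<dots> = (\<Sum>j\<in>{1..m}. LINT x|lborel. (real j / real m) * indicator (level p m j) x)"
    using level_sets[OF p] emeasure_bounded_finite[OF level_sets(1)[OF p]]
    by (intro Bochner_Integration.integral_sum integrable_mult_right integrable_real_indicator) auto
  also have "\<dots> = (\<Sum>j\<in>{1..m}. vol (level p m j) * (1 - (1 - real j / real m)))"
    using level_sets(2)[OF p] by (intro sum.cong) auto
  finally show ?thesis .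
qed

text \<open>Rounding p up gives step functions f m for which the limit is known. The limits in m and
  N are exchanged by monotonicity: in N it gives the lower bound at each fixed N as m grows, in p
  the upper bound for each fixed m as N grows.\<close>

theorem point_pgf_limit:
  assumes p: "p \<in> borel_measurable borel" "\<And>x. 0 \<le> p x" "\<And>x. p x \<le> 1" and int: "integrable lborel (\<lambda>x. 1 - p x)"
  shows "point_pgf p \<longlonglongrightarrow> exp (- lam * (LINT x|lborel. 1 - p x))"
proof -
  define f where "f m = stepped p (Suc m)" for m
  define I where "I = (LINT x|lborel. 1 - p x)"
  define J where "J m = (LINT x|lborel. 1 - f m x)" for m
  have f: "f m \<in> borel_measurable borel" "p x \<le> f m x" "f m x \<le> 1" "0 \<le> f m x" for m x
    using measurable_stepped[OF p(1)] stepped_bounds[of p x "Suc m", OF p(2,3)] p(2)[of x] by (auto simp: f_def)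
  have lim_m: "point_pgf (f m) \<longlonglongrightarrow> exp (- lam * J m)" for m
  proof -
    have "point_pgf (stepped p (Suc m)) \<longlonglongrightarrow> exp (- lam * (\<Sum>j\<in>{1..Suc m}. vol (level p (Suc m) j) * (1 - (1 - real j / real (Suc m)))))"
      unfolding stepped_def[abs_def] by (rule point_pgf_simple) (use level_sets[OF p(1)] in auto)
    then show ?thesis by (simp only: f_def J_def stepped_integral[OF p(1) zero_less_Suc])
  qed
  have "(\<lambda>m. LINT x|lborel. 1 - f m x) \<longlonglongrightarrow> (LINT x|lborel. 1 - p x)"
  proof (rule integral_dominated_convergence[OF _ _ int])
    show "AE x in lborel. (\<lambda>m. 1 - f m x) \<longlonglongrightarrow> 1 - p x"
      unfolding f_def by (intro AE_I2 tendsto_diff tendsto_const stepped_limit p)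
    show "AE x in lborel. norm (1 - f m x) \<le> 1 - p x" for m using f by auto
  qed (use f(1) p(1) in auto)
  then have JI: "J \<longlonglongrightarrow> I" by (simp add: J_def[abs_def] I_def)
  have iJ: "integrable lborel (\<lambda>x. 1 - f m x)" for m
    by (rule Bochner_Integration.integrable_bound[OF int]) (use f p in auto)
  have J_le: "J m \<le> I" for m
    unfolding J_def I_def by (intro integral_mono iJ int) (use f in auto)
  have lower: "exp (- lam * I) \<le> point_pgf p N" for N
  proof -
    have "exp (- lam * I) \<le> point_pgf (f m) N" for m
    proof -
      have "exp (- lam * I) \<le> exp (- lam * J m)" using J_le intensity_pos by simp
      also have "\<dots> \<le> point_pgf (f m) N"
        by (rule LIMSEQ_le_const2[OF lim_m]) (use point_pgf_antimono[OF f(1,4,3)] in auto)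
      finally show ?thesis .
    qed
    moreover have "(\<lambda>m. point_pgf (f m) N) \<longlonglongrightarrow> point_pgf p N"
      unfolding point_pgf_def
    proof (rule integral_dominated_convergence[where w="\<lambda>_. 1"])
      show "AE \<omega> in M. (\<lambda>m. \<Prod>i\<in>{1..N}. f m (X i \<omega>)) \<longlonglongrightarrow> (\<Prod>i\<in>{1..N}. p (X i \<omega>))"
        unfolding f_def by (intro AE_I2 tendsto_prod stepped_limit p)
    qed (use point_product[OF p] point_product[OF f(1,4,3)] in auto)
    ultimately show ?thesis by (intro LIMSEQ_le_const) auto
  qed
  show ?thesis unfolding I_def[symmetric]
  proof (rule order_tendstoI)
    fix y assume "y < exp (- lam * I)"
    then show "\<forall>\<^sub>F N in sequentially. y < point_pgf p N" using lower by (intro always_eventually allI) (rule less_le_trans)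
  next
    fix y assume y: "exp (- lam * I) < y"
    have "(\<lambda>m. exp (- lam * J m)) \<longlonglongrightarrow> exp (- lam * I)" by (intro tendsto_intros JI)
    then have "\<forall>\<^sub>F m in sequentially. exp (- lam * J m) < y" using y by (rule order_tendstoD)
    then obtain m where m: "exp (- lam * J m) < y" using eventually_happens[of _ sequentially] by auto
    show "\<forall>\<^sub>F N in sequentially. point_pgf p N < y"
      using order_tendstoD(2)[OF lim_m m]
    proof eventually_elim
      case (elim N)
      have "point_pgf p N \<le> point_pgf (f m) N" by (rule point_pgf_mono[OF p f(1,3,2)])
      then show ?case using elim by simp
    qed
  qed
qed

text \<open>The indicator that A is vacant is the limit of products over the first N grains. Marking
  replaces each grain by its mean avoidance function, and the generating functional of the points
  evaluates the rest.\<close>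

theorem vacancy_probability:
  assumes A: "finite A" and int: "integrable lborel (\<lambda>x. 1 - typical_avoid A x)"
  shows "(LINT \<omega>|M. clear (grain_union X G) A \<omega>) = exp (- lam * (LINT x|lborel. 1 - typical_avoid A x))"
proof -
  have m: "(\<lambda>\<omega>. avoid A (X i \<omega>) (G i \<omega>)) \<in> borel_measurable M" if "1 \<le> i" for i
  proof -
    have "(\<lambda>\<omega>. (\<lambda>p. avoid A (fst p) (snd p)) (X i \<omega>, G i \<omega>)) \<in> borel_measurable M"
      by (intro measurable_compose[OF _ measurable_avoid[OF A]] measurable_Pair grain_measurable X_measurable that)
    then show ?thesis by simp
  qed
  have "(\<lambda>N. LINT \<omega>|M. (\<Prod>i\<in>{1..N}. avoid A (X i \<omega>) (G i \<omega>))) \<longlonglongrightarrow> (LINT \<omega>|M. clear (grain_union X G) A \<omega>)"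
  proof (rule integral_dominated_convergence[where w="\<lambda>_. 1"])
    show "AE \<omega> in M. (\<lambda>N. \<Prod>i\<in>{1..N}. avoid A (X i \<omega>) (G i \<omega>)) \<longlonglongrightarrow> clear (grain_union X G) A \<omega>"
    proof (rule AE_I2)
      fix \<omega>
      show "(\<lambda>N. \<Prod>i\<in>{1..N}. avoid A (X i \<omega>) (G i \<omega>)) \<longlonglongrightarrow> clear (grain_union X G) A \<omega>"
      proof (cases "\<exists>i\<ge>1. avoid A (X i \<omega>) (G i \<omega>) = 0")
        case True
        then obtain i where i: "1 \<le> i" "avoid A (X i \<omega>) (G i \<omega>) = 0" by auto
        then have "clear (grain_union X G) A \<omega> = 0"
          by (auto simp: avoid_def clear_def grain_union_def split: if_splits)
        moreover have "\<forall>\<^sub>F N in sequentially. (\<Prod>i\<in>{1..N}. avoid A (X i \<omega>) (G i \<omega>)) = 0"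
          using eventually_ge_at_top[of i] by eventually_elim (use i in \<open>auto intro!: bexI[of _ i]\<close>)
        ultimately show ?thesis by (simp add: tendsto_eventually)
      next
        case False
        then have ne: "avoid A (X i \<omega>) (G i \<omega>) \<noteq> 0" if "1 \<le> i" for i using that by blast
        have "avoid A (X i \<omega>) (G i \<omega>) = 1" "(\<lambda>y. y + X i \<omega>) ` G i \<omega> \<inter> A = {}" if "1 \<le> i" for i
          using ne[OF that] by (simp_all add: avoid_def split: if_splits)
        moreover from this(2) have "clear (grain_union X G) A \<omega> = 1"
          unfolding clear_def grain_union_def by (subst if_P) blast+
        ultimately show ?thesis by simp
      qed
    qed
    show "(\<lambda>\<omega>. \<Prod>i\<in>{1..N}. avoid A (X i \<omega>) (G i \<omega>)) \<in> borel_measurable M" for N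
      using m by (intro borel_measurable_prod) auto
    show "clear (grain_union X G) A \<in> borel_measurable M" by (rule measurable_clear[OF grain_union_random_set A])
    have "0 \<le> (\<Prod>i\<in>{1..N}. avoid A (X i \<omega>) (G i \<omega>))" "(\<Prod>i\<in>{1..N}. avoid A (X i \<omega>) (G i \<omega>)) \<le> 1" for N \<omega>
      by (intro prod_nonneg prod_le_1; simp)+
    then show "AE \<omega> in M. norm (\<Prod>i\<in>{1..N}. avoid A (X i \<omega>) (G i \<omega>)) \<le> 1" for N
      unfolding real_norm_def by (simp only: abs_of_nonneg AE_I2)
  qed simp
  then have "point_pgf (typical_avoid A) \<longlonglongrightarrow> (LINT \<omega>|M. clear (grain_union X G) A \<omega>)"
    by (simp only: marking[OF A] point_pgf_def[abs_def])
  moreover have "point_pgf (typical_avoid A) \<longlonglongrightarrow> exp (- lam * (LINT x|lborel. 1 - typical_avoid A x))"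
    by (rule point_pgf_limit) (use measurable_typical_avoid[OF A] typical_avoid_bounds A int in auto)
  ultimately show ?thesis by (rule LIMSEQ_unique)
qed

end

section \<open>The Poisson process of placed grains\<close>

lemma nn_integral_lborel_reflect:
  fixes f :: "'a::euclidean_space \<Rightarrow> ennreal"
  assumes f: "f \<in> borel_measurable lborel"
  shows "(\<integral>\<^sup>+t. f (x - t) \<partial>lborel) = (\<integral>\<^sup>+t. f t \<partial>lborel)"
proof -
  have "lborel = distr lborel borel (\<lambda>t. x - t)"
    using lborel_affine[of "-1" x] by (simp add: density_1)
  then have "(\<integral>\<^sup>+t. f t \<partial>lborel) = (\<integral>\<^sup>+t. f t \<partial>distr lborel borel (\<lambda>t. x - t))" by simp
  also have "\<dots> = (\<integral>\<^sup>+t. f (x - t) \<partial>lborel)" using f by (subst nn_integral_distr) auto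
  finally show ?thesis by simp
qed

context poisson_grain_model
begin

text \<open>Pairs of a position and a mark, with the sample space itself as mark space: the second
  coordinate acts through \<open>G 0\<close>, so the marks have the law of the typical
  grain.\<close>

definition intensity :: "('a \<times> 'w) measure" where
  "intensity = density (lborel \<Otimes>\<^sub>M M) (\<lambda>_. ennreal lam)"

definition placed :: "'a \<times> 'w \<Rightarrow> 'a set" where
  "placed e = (\<lambda>y. y + fst e) ` G 0 (snd e)"

abbreviation "gvol \<omega> \<equiv> vol (G 0 \<omega>)"

lemma placed_iff: "x \<in> placed e \<longleftrightarrow> x - fst e \<in> G 0 (snd e)"
  by (force simp: placed_def image_iff)

lemma sets_intensity [simp]: "sets intensity = sets (lborel \<Otimes>\<^sub>M M)" and space_intensity [simp]: "space intensity = space (lborel \<Otimes>\<^sub>M M)"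
  by (simp_all add: intensity_def)

lemma measurable_intensity: "borel_measurable intensity = borel_measurable (lborel \<Otimes>\<^sub>M M)"
  by (rule measurable_cong_sets) simp_all

lemma pair_lborel_M: "pair_sigma_finite lborel M" ..

lemma intensity_sigma_finite: "sigma_finite_measure intensity"
proof -
  interpret P: pair_sigma_finite "lborel :: 'a measure" M by (rule pair_lborel_M)
  show ?thesis unfolding intensity_def by (subst P.sigma_finite_iff_density_finite) auto
qed

lemma random_set_placed: "random_set intensity placed"
proof -
  have "Measurable.pred (lborel \<Otimes>\<^sub>M (lborel \<Otimes>\<^sub>M M)) (\<lambda>p. (\<lambda>q. fst q \<in> G 0 (snd q)) (fst p - fst (snd p), snd (snd p)))"
    by (rule measurable_compose[OF _ grain_random_set[unfolded random_set_def]]) measurable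
  then have "Measurable.pred (lborel \<Otimes>\<^sub>M (lborel \<Otimes>\<^sub>M M)) (\<lambda>p. fst p \<in> placed (snd p))"
    by (simp add: placed_iff)
  moreover have "measurable ((lborel :: 'a measure) \<Otimes>\<^sub>M intensity) (count_space UNIV) = measurable (lborel \<Otimes>\<^sub>M (lborel \<Otimes>\<^sub>M M)) (count_space (UNIV :: bool set))"
    by (rule measurable_cong_sets[OF sets_pair_measure_cong]) simp_all
  ultimately show ?thesis unfolding random_set_def by (simp only:)
qed

lemma grain_sets: "\<omega> \<in> space M \<Longrightarrow> G 0 \<omega> \<in> sets borel" and grain_finite: "\<omega> \<in> space M \<Longrightarrow> emeasure lborel (G 0 \<omega>) = ennreal (gvol \<omega>)"
proof -
  assume "\<omega> \<in> space M"
  then have "compact (G 0 \<omega>)"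
    using measurable_space[OF grain_measurable] by (auto simp: space_compacts_borel nonempty_compacts_def)
  then show "G 0 \<omega> \<in> sets borel" "emeasure lborel (G 0 \<omega>) = ennreal (gvol \<omega>)"
    using emeasure_bounded_finite[OF compact_imp_bounded, of "G 0 \<omega>"]
    by (simp add: borel_compact, intro emeasure_eq_ennreal_measure) (simp add: less_top)
qed

lemma placed_eq_vimage: "placed e = (\<lambda>x. x - fst e) -` G 0 (snd e)"
  by (auto simp: placed_iff)

lemma emeasure_placed:
  assumes "\<omega> \<in> space M" shows "emeasure lborel (placed (t, \<omega>)) = ennreal (gvol \<omega>)" "vol (placed (t, \<omega>)) = gvol \<omega>"
proof -
  have m: "(\<lambda>x::'a. x - t) \<in> borel_measurable borel" by measurable
  have s: "placed (t, \<omega>) \<in> sets lborel"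
    using measurable_sets[OF m grain_sets[OF assms]] by (simp add: placed_eq_vimage)
  have "emeasure lborel (placed (t, \<omega>)) = (\<integral>\<^sup>+x. indicator (placed (t, \<omega>)) x \<partial>lborel)" using s by simp
  also have "\<dots> = (\<integral>\<^sup>+x. indicator (G 0 \<omega>) (- t + x) \<partial>lborel)"
    by (intro nn_integral_cong) (auto simp: indicator_def placed_iff)
  also have "\<dots> = (\<integral>\<^sup>+x. indicator (G 0 \<omega>) x \<partial>lborel)"
    by (rule nn_integral_lborel_shift) (use grain_sets[OF assms] in simp)
  also have "\<dots> = ennreal (gvol \<omega>)" using grain_sets[OF assms] grain_finite[OF assms] by simp
  finally show 1: "emeasure lborel (placed (t, \<omega>)) = ennreal (gvol \<omega>)" .
  then show "vol (placed (t, \<omega>)) = gvol \<omega>" by (simp add: measure_def)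
qed

lemma nn_integral_intensity:
  assumes F: "F \<in> borel_measurable (lborel \<Otimes>\<^sub>M M)"
  shows "(\<integral>\<^sup>+e. F e \<partial>intensity) = ennreal lam * (\<integral>\<^sup>+\<omega>. \<integral>\<^sup>+t. F (t, \<omega>) \<partial>lborel \<partial>M)"
proof -
  interpret P: pair_sigma_finite "lborel :: 'a measure" M by (rule pair_lborel_M)
  show ?thesis unfolding intensity_def
    using F by (simp add: nn_integral_density nn_integral_cmult P.nn_integral_snd)
qed

lemma measurable_gvol: "gvol \<in> borel_measurable M"
  by (rule random_set_measurable_vol[OF grain_random_set])

lemma indicator_placed_measurable: "(\<lambda>e. indicator (placed e) x :: real) \<in> borel_measurable (lborel \<Otimes>\<^sub>M M)"
proof -
  have "clear placed {x} \<in> borel_measurable (lborel \<Otimes>\<^sub>M M)"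
    using measurable_clear_point[OF random_set_placed, of x] by (simp add: measurable_intensity)
  then have "(\<lambda>e. 1 - clear placed {x} e) \<in> borel_measurable (lborel \<Otimes>\<^sub>M M)" by simp
  also have "(\<lambda>e. 1 - clear placed {x} e) = (\<lambda>e. indicator (placed e) x)"
    by (auto simp: clear_def indicator_def)
  finally show ?thesis .
qed

lemma vol_placed_measurable: "(\<lambda>e. vol (placed e)) \<in> borel_measurable (lborel \<Otimes>\<^sub>M M)"
  using random_set_measurable_vol[OF random_set_placed] by (simp add: measurable_intensity)

text \<open>A grain placed at t covers x exactly if x - t lies in the unplaced grain, so reflecting
  t turns the integral over positions into the volume. Passing to the grains through a point is size
  biasing.\<close>

lemma nn_integral_hit:
  assumes \<phi>: "\<phi> \<in> borel_measurable borel" "\<And>v. 0 \<le> \<phi> v"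
  shows "(\<integral>\<^sup>+e. ennreal (indicator (placed e) x * \<phi> (vol (placed e))) \<partial>intensity) = ennreal lam * (\<integral>\<^sup>+\<omega>. ennreal (gvol \<omega> * \<phi> (gvol \<omega>)) \<partial>M)"
proof -
  have "(\<lambda>e. \<phi> (vol (placed e))) \<in> borel_measurable (lborel \<Otimes>\<^sub>M M)"
    by (rule measurable_compose[OF vol_placed_measurable \<phi>(1)])
  then have "(\<lambda>e. ennreal (indicator (placed e) x * \<phi> (vol (placed e)))) \<in> borel_measurable (lborel \<Otimes>\<^sub>M M)"
    using indicator_placed_measurable[of x] by simp
  from nn_integral_intensity[OF this]
  have "(\<integral>\<^sup>+e. ennreal (indicator (placed e) x * \<phi> (vol (placed e))) \<partial>intensity) =
     ennreal lam * (\<integral>\<^sup>+\<omega>. \<integral>\<^sup>+t. ennreal (indicator (placed (t, \<omega>)) x * \<phi> (vol (placed (t, \<omega>)))) \<partial>lborel \<partial>M)" .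
  also have "(\<integral>\<^sup>+\<omega>. \<integral>\<^sup>+t. ennreal (indicator (placed (t, \<omega>)) x * \<phi> (vol (placed (t, \<omega>)))) \<partial>lborel \<partial>M) = (\<integral>\<^sup>+\<omega>. ennreal (gvol \<omega> * \<phi> (gvol \<omega>)) \<partial>M)"
  proof (rule nn_integral_cong)
    fix \<omega> assume \<omega>: "\<omega> \<in> space M"
    have "(\<integral>\<^sup>+t. ennreal (indicator (placed (t, \<omega>)) x * \<phi> (vol (placed (t, \<omega>)))) \<partial>lborel) =
       (\<integral>\<^sup>+t. ennreal (\<phi> (gvol \<omega>)) * indicator (G 0 \<omega>) (x - t) \<partial>lborel)"
      by (intro nn_integral_cong) (auto simp: emeasure_placed[OF \<omega>] indicator_def placed_iff)
    also have "\<dots> = (\<integral>\<^sup>+t. ennreal (\<phi> (gvol \<omega>)) * indicator (G 0 \<omega>) t \<partial>lborel)"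
      using grain_sets[OF \<omega>] by (intro nn_integral_lborel_reflect) simp
    also have "\<dots> = ennreal (\<phi> (gvol \<omega>)) * ennreal (gvol \<omega>)"
      using grain_sets[OF \<omega>] grain_finite[OF \<omega>] by (simp add: nn_integral_cmult_indicator)
    also have "\<dots> = ennreal (gvol \<omega> * \<phi> (gvol \<omega>))" using \<phi>(2) by (simp add: ennreal_mult mult.commute)
    finally show "(\<integral>\<^sup>+t. ennreal (indicator (placed (t, \<omega>)) x * \<phi> (vol (placed (t, \<omega>)))) \<partial>lborel) = ennreal (gvol \<omega> * \<phi> (gvol \<omega>))" .
  qed
  finally show ?thesis .
qed

lemma has_integral_hit:
  assumes \<phi>: "\<phi> \<in> borel_measurable borel" "\<And>v. 0 \<le> \<phi> v" and int: "integrable M (\<lambda>\<omega>. gvol \<omega> * \<phi> (gvol \<omega>))"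
  shows "has_bochner_integral intensity (\<lambda>e. indicator (placed e) x * \<phi> (vol (placed e))) (lam * (LINT \<omega>|M. gvol \<omega> * \<phi> (gvol \<omega>)))"
proof (rule has_bochner_integral_nn_integral)
  show "(\<lambda>e. indicator (placed e) x * \<phi> (vol (placed e))) \<in> borel_measurable intensity"
    using indicator_placed_measurable[of x] measurable_compose[OF vol_placed_measurable \<phi>(1)] by (simp add: measurable_intensity)
  have "(\<integral>\<^sup>+\<omega>. ennreal (gvol \<omega> * \<phi> (gvol \<omega>)) \<partial>M) = ennreal (LINT \<omega>|M. gvol \<omega> * \<phi> (gvol \<omega>))"
    by (rule nn_integral_eq_integral[OF int]) (use \<phi> in simp)
  then show "(\<integral>\<^sup>+e. ennreal (indicator (placed e) x * \<phi> (vol (placed e))) \<partial>intensity) = ennreal (lam * (LINT \<omega>|M. gvol \<omega> * \<phi> (gvol \<omega>)))"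
    using intensity_pos \<phi>(2) by (subst nn_integral_hit[OF \<phi>]) (simp add: ennreal_mult'[symmetric])
qed (use intensity_pos \<phi>(2) in auto)

text \<open>Size biasing with constant weight 1 gives the mean number \<lambda> E|\<Xi>0| of grains
  through a point, whatever the point.\<close>

lemma grain_intensity_placed:
  assumes int: "integrable M gvol" and pos: "0 < (LINT \<omega>|M. gvol \<omega>)"
  shows "grain_intensity intensity placed (lam * (LINT \<omega>|M. gvol \<omega>))"
proof -
  interpret sigma_finite_measure intensity by (rule intensity_sigma_finite)
  show ?thesis
  proof
    show "random_set intensity placed" by (rule random_set_placed)
    show "0 < lam * (LINT \<omega>|M. gvol \<omega>)" using intensity_pos pos by simp
    show "emeasure lborel (placed e) < \<infinity>" if "e \<in> space intensity" for e
      using emeasure_placed(1)[of "snd e" "fst e"] that by (auto simp: space_pair_measure)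
    fix x
    have "{e \<in> space intensity. x \<in> placed e} = (\<lambda>e. indicator (placed e) x :: real) -` {1} \<inter> space (lborel \<Otimes>\<^sub>M M)"
      by (auto simp: indicator_def)
    then have "{e \<in> space intensity. x \<in> placed e} \<in> sets intensity"
      using measurable_sets[OF indicator_placed_measurable, of "{1}" x] by simp
    then have "emeasure intensity {e \<in> space intensity. x \<in> placed e} = (\<integral>\<^sup>+e. indicator {e \<in> space intensity. x \<in> placed e} e \<partial>intensity)"
      by simp
    also have "\<dots> = (\<integral>\<^sup>+e. ennreal (indicator (placed e) x * (\<lambda>_. 1) (vol (placed e))) \<partial>intensity)"
      by (intro nn_integral_cong) (auto simp: indicator_def)
    also have "\<dots> = ennreal lam * (\<integral>\<^sup>+\<omega>. ennreal (gvol \<omega>) \<partial>M)"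
      by (subst nn_integral_hit) auto
    also have "\<dots> = ennreal (lam * (LINT \<omega>|M. gvol \<omega>))"
      using int intensity_pos by (simp add: nn_integral_eq_integral ennreal_mult)
    finally show "emeasure intensity {e \<in> space intensity. x \<in> placed e} = ennreal (lam * (LINT \<omega>|M. gvol \<omega>))" .
  qed
qed

lemma clear_placed: "clear placed A (t, \<omega>) = avoid A t (G 0 \<omega>)"
  by (simp add: clear_def avoid_def placed_def)

lemma typical_avoid_shift: "typical_avoid ((+) t ` A) x = typical_avoid A (x - t)"
proof -
  have "((\<lambda>y. y + x) ` K \<inter> (+) t ` A = {}) = ((\<lambda>y. y + (x - t)) ` K \<inter> A = {})" for K
  proof -
    have "(\<lambda>y. y + x) ` K \<inter> (+) t ` A = (+) t ` ((\<lambda>y. y + (x - t)) ` K \<inter> A)"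
      by (subst image_Int) (auto simp: image_image algebra_simps)
    then show ?thesis by simp
  qed
  then show ?thesis by (simp add: typical_avoid_def avoid_def)
qed

section \<open>Parameters of the Boolean model from the law of the typical grain\<close>

context
  assumes int: "integrable M gvol" and pos: "0 < (LINT \<omega>|M. gvol \<omega>)"
begin

interpretation I: grain_intensity intensity placed "lam * (LINT \<omega>|M. gvol \<omega>)"
  by (rule grain_intensity_placed[OF int pos])

text \<open>Fubini over position and mark identifies the mass of grains that meet A with the
  exponent found in \<open>vacancy_probability\<close>.\<close>

lemma hit_measure_eq:
  assumes A: "finite A"
  shows "integrable lborel (\<lambda>x. 1 - typical_avoid A x)" "I.hit_measure A = lam * (LINT x|lborel. 1 - typical_avoid A x)"
proof -
  interpret P: pair_sigma_finite "lborel :: 'a measure" M by (rule pair_lborel_M)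
  have i: "integrable (lborel \<Otimes>\<^sub>M M) (\<lambda>e. lam * (1 - clear placed A e))"
    using I.integrable_hit_set[OF A] measurable_clear[OF random_set_placed A] intensity_pos
    unfolding intensity_def by (subst (asm) integrable_density) (auto simp: measurable_intensity[unfolded intensity_def])
  then have i': "integrable (lborel \<Otimes>\<^sub>M M) (\<lambda>e. 1 - clear placed A e)"
    using integrable_mult_right[OF i, of "1 / lam"] intensity_pos by simp
  have m: "(\<lambda>\<omega>. avoid A x (G 0 \<omega>)) \<in> borel_measurable M" for x
  proof -
    have "(\<lambda>\<omega>. (\<lambda>p. avoid A (fst p) (snd p)) (x, G 0 \<omega>)) \<in> borel_measurable M"
      by (rule measurable_compose[OF _ measurable_avoid[OF A]]) (intro measurable_Pair grain_measurable, simp)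
    then show ?thesis by simp
  qed
  have inner: "(LINT \<omega>|M. 1 - clear placed A (x, \<omega>)) = 1 - typical_avoid A x" for x
  proof -
    have "integrable M (\<lambda>\<omega>. avoid A x (G 0 \<omega>))" by (rule integrable_const_bound[of _ 1]) (use m in auto)
    then show ?thesis by (simp add: clear_placed typical_avoid_def prob_space)
  qed
  show "integrable lborel (\<lambda>x. 1 - typical_avoid A x)" using P.integrable_fst'[OF i'] by (simp add: inner)
  have "I.hit_measure A = (LINT e|(lborel \<Otimes>\<^sub>M M). lam * (1 - clear placed A e))"
  proof -
    have "(\<lambda>e. 1 - clear placed A e) \<in> borel_measurable (lborel \<Otimes>\<^sub>M M)"
      using measurable_clear[OF random_set_placed A] by (simp add: measurable_intensity)
    then have "(LINT e|intensity. 1 - clear placed A e) = (LINT e|(lborel \<Otimes>\<^sub>M M). lam * (1 - clear placed A e))"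
      unfolding intensity_def using intensity_pos by (subst integral_density) auto
    then show ?thesis by (simp only: I.hit_measure_def)
  qed
  also have "\<dots> = lam * (LINT e|(lborel \<Otimes>\<^sub>M M). 1 - clear placed A e)" by simp
  also have "(LINT e|(lborel \<Otimes>\<^sub>M M). 1 - clear placed A e) = (LINT x|lborel. LINT \<omega>|M. 1 - clear placed A (x, \<omega>))"
    by (rule P.integral_fst'[OF i', symmetric])
  finally show "I.hit_measure A = lam * (LINT x|lborel. 1 - typical_avoid A x)" by (simp add: inner)
qed

lemma boolean_model_placed:
  assumes \<theta>: "0 \<le> \<theta>" and i: "integrable M (\<lambda>\<omega>. (gvol \<omega>)\<^sup>2 * exp (\<theta> * gvol \<omega>))"
  shows "boolean_model intensity placed (lam * (LINT \<omega>|M. gvol \<omega>)) M (grain_union X G) \<theta> (lam * (LINT \<omega>|M. (gvol \<omega>)\<^sup>2 * exp (\<theta> * gvol \<omega>)))"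
proof
  show "random_set M (grain_union X G)" by (rule grain_union_random_set)
  show "(LINT \<omega>|M. clear (grain_union X G) A \<omega>) = exp (- I.hit_measure A)" if "finite A" for A
    using vacancy_probability[OF that hit_measure_eq(1)[OF that]] hit_measure_eq(2)[OF that] by simp
  show "0 \<le> \<theta>" by fact
  show "has_bochner_integral intensity (\<lambda>e. I.hit x e * (vol (placed e) * exp (\<theta> * vol (placed e)))) (lam * (LINT \<omega>|M. (gvol \<omega>)\<^sup>2 * exp (\<theta> * gvol \<omega>)))" for x
    \<comment> \<open>The absolute value makes the weight nonnegative on all reals, as
      \<open>has_integral_hit\<close> demands; on volumes it has no effect.\<close>
    using has_integral_hit[of "\<lambda>v. \<bar>v\<bar> * exp (\<theta> * v)" x] i
    by (simp add: I.hit_eq power2_eq_square mult.assoc)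
qed

lemma hit_measure_shift: "finite A \<Longrightarrow> I.hit_measure ((+) t ` A) = I.hit_measure A"
proof -
  assume A: "finite A"
  have "(LINT x|lborel. 1 - typical_avoid A (- t + x)) = (LINT x|lborel. 1 - typical_avoid A x)"
    by (rule integral_lborel_shift) (use measurable_typical_avoid[OF A] in simp)
  then show ?thesis using A by (simp add: hit_measure_eq typical_avoid_shift)
qed

text \<open>A translation of both points is undone by translating the position of the grain, under
  which Lebesgue measure is invariant.\<close>

lemma overlap_shift:
  "(\<integral>\<^sup>+e. ennreal (I.hit (t + x) e * I.hit (t + y) e * exp (c * vol (placed e))) \<partial>intensity) =
   (\<integral>\<^sup>+e. ennreal (I.hit x e * I.hit y e * exp (c * vol (placed e))) \<partial>intensity)"
proof -
  have m: "(\<lambda>e. ennreal (I.hit x e * I.hit y e * exp (c * vol (placed e)))) \<in> borel_measurable (lborel \<Otimes>\<^sub>M M)" for x y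
    using indicator_placed_measurable[of x] indicator_placed_measurable[of y] vol_placed_measurable
    unfolding I.hit_eq by simp
  have "(\<integral>\<^sup>+u. ennreal (I.hit (t + x) (u, \<omega>) * I.hit (t + y) (u, \<omega>) * exp (c * vol (placed (u, \<omega>)))) \<partial>lborel) =
        (\<integral>\<^sup>+u. ennreal (I.hit x (u, \<omega>) * I.hit y (u, \<omega>) * exp (c * vol (placed (u, \<omega>)))) \<partial>lborel)" if \<omega>: "\<omega> \<in> space M" for \<omega>
  proof -
    have m': "(\<lambda>u. ennreal (I.hit (t + x) (u, \<omega>) * I.hit (t + y) (u, \<omega>) * exp (c * vol (placed (u, \<omega>))))) \<in> borel_measurable lborel"
      by (rule measurable_compose[OF _ m]) (use \<omega> in simp)
    have eq: "I.hit (t + x) (t + u, \<omega>) = I.hit x (u, \<omega>)" for x u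
      by (simp add: I.hit_eq indicator_def placed_iff)
    show ?thesis
      by (subst nn_integral_lborel_shift[OF m', of t, symmetric]) (simp add: eq emeasure_placed[OF \<omega>])
  qed
  then show ?thesis by (simp add: nn_integral_intensity[OF m] cong: nn_integral_cong)
qed

end

end

section \<open>The radius of tilting\<close>

text \<open>From x / 2 \<le> exp (x / 2 - 1) and e \<ge> 5 / 2 follows 5 x / 4 \<le> exp (x / 2);
  squaring gives 16 / 25 = (4 / 5)^2, slightly above the optimal constant 4 / e^2.\<close>

lemma square_le_exp:
  fixes x :: real
  assumes "0 \<le> x" shows "x\<^sup>2 \<le> 16 / 25 * exp x"
proof -
  have "x / 2 \<le> exp (x / 2 - 1)" using exp_ge_add_one_self[of "x / 2 - 1"] by simp
  moreover have "(5 / 2) * exp (x / 2 - 1) \<le> exp (x / 2)"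
  proof -
    have "5 / 2 \<le> exp (1 :: real)" using exp_lower_Taylor_quadratic[of 1] by simp
    then have "(5 / 2) * exp (x / 2 - 1) \<le> exp 1 * exp (x / 2 - 1)" by (rule mult_right_mono) simp
    then show ?thesis by (simp flip: exp_add)
  qed
  ultimately have "5 / 4 * x \<le> exp (x / 2)" by linarith
  then have "(5 / 4 * x)\<^sup>2 \<le> (exp (x / 2))\<^sup>2" using assms by (intro power_mono) auto
  also have "(exp (x / 2))\<^sup>2 = exp x" by (simp add: power2_eq_square flip: exp_add)
  finally show ?thesis by (simp add: power_mult_distrib power_divide)
qed

lemma square_exp_le:
  fixes v a c :: real
  assumes v: "0 \<le> v" and c: "c < a"
  shows "v\<^sup>2 * exp (c * v) \<le> 16 / 25 / (a - c)\<^sup>2 * exp (a * v)"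
proof -
  have "((a - c) * v)\<^sup>2 \<le> 16 / 25 * exp ((a - c) * v)" by (rule square_le_exp) (use v c in simp)
  then have "((a - c) * v)\<^sup>2 * exp (c * v) \<le> 16 / 25 * exp ((a - c) * v) * exp (c * v)" by (rule mult_right_mono) simp
  also have "\<dots> = 16 / 25 * exp (a * v)" by (simp add: algebra_simps flip: exp_add)
  finally have "(a - c)\<^sup>2 * (v\<^sup>2 * exp (c * v)) \<le> 16 / 25 * exp (a * v)" by (simp add: power_mult_distrib mult_ac)
  then show ?thesis using c by (simp add: pos_le_divide_eq mult_ac)
qed

text \<open>The constant \<open>8 (a + \<lambda> M) (1 + exp l)\<close> leaves ample room: \<open>\<theta> \<kappa> \<le> 1 / 20\<close>, while the
  factor \<open>1 + exp l\<close> absorbs the density \<open>exp (- l)\<close> of the vacancies in the variance bound.\<close>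

lemma parameter_bounds:
  fixes a lam M0 l \<theta> \<kappa> \<kappa>' \<kappa>3 :: real
  assumes a: "0 < a" and lam: "0 < lam" and M0: "0 \<le> M0" and l: "0 \<le> l"
    and \<theta>: "\<theta> = a\<^sup>2 / (8 * (a + lam * M0) * (1 + exp l))"
    and \<kappa>: "0 \<le> \<kappa>" "\<kappa> \<le> lam * (16 / 25 / (a - \<theta>)\<^sup>2 * M0)"
    and \<kappa>3: "\<kappa>3 \<le> lam * (16 / 25 / (a - 3 * \<theta>)\<^sup>2 * M0)"
    and CS: "\<kappa>\<^sup>2 \<le> \<kappa>' * \<kappa>3" and \<kappa>': "0 < \<kappa>'"
  shows "\<theta> * (exp (2 * \<theta> * \<kappa>) * \<kappa>) < 1"
    "\<theta> * (exp (2 * \<theta> * \<kappa>) * \<kappa>) * ((exp (2 * \<theta> * \<kappa>) * \<kappa>) / (1 - \<theta> * (exp (2 * \<theta> * \<kappa>) * \<kappa>))) < exp (- l - 3 * \<theta> * \<kappa>) * \<kappa>'"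
proof -
  define m where "m = lam * M0"
  have m: "0 \<le> m" using lam M0 by (simp add: m_def)
  define D where "D = 8 * (a + m) * (1 + exp l)"
  have e: "1 \<le> exp l" using l by simp
  have D: "0 < D" unfolding D_def using a m by (intro mult_pos_pos add_pos_nonneg add_pos_pos) auto
  have th: "\<theta> = a\<^sup>2 / D" by (simp add: \<theta> D_def m_def)
  have th0: "0 < \<theta>" using a D by (simp add: th)
  have D1: "16 * (a + m) \<le> D"
  proof -
    have "8 * (a + m) * 2 \<le> D" unfolding D_def using a m e by (intro mult_left_mono) auto
    then show ?thesis by simp
  qed
  have D2: "8 * ((a + m) * exp l) \<le> D"
  proof -
    have "8 * (a + m) * exp l \<le> D" unfolding D_def using a m by (intro mult_left_mono) auto
    then show ?thesis by (simp only: mult.assoc)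
  qed
  have thD: "\<theta> * D = a\<^sup>2" using D by (simp add: th)
  have "\<theta> * (16 * a) \<le> \<theta> * D" using D1 m th0 by (intro mult_left_mono) auto
  then have "\<theta> * 16 * a \<le> a * a" using thD by (simp add: power2_eq_square)
  \<comment> \<open>This keeps the tilts away from a: the gaps a - \<theta> and a - 3 \<theta> are
    at least 15/16 and 13/16 of a.\<close>
  then have tha: "\<theta> \<le> a / 16" using a by (simp add: mult_le_cancel_right)
  have "\<theta> * (16 * m) \<le> \<theta> * D" using D1 a th0 by (intro mult_left_mono) auto
  then have tm: "\<theta> * m \<le> a\<^sup>2 / 16" using thD by simp
  have "8 * (m * exp l) \<le> 8 * ((a + m) * exp l)" using a by simp
  then have "\<theta> * (8 * (m * exp l)) \<le> \<theta> * D" using order_trans[OF _ D2] th0 by (intro mult_left_mono) auto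
  then have tml: "\<theta> * m * exp l \<le> a\<^sup>2 / 8" using thD by (simp add: mult_ac)
  have q1: "(15 / 16 * a)\<^sup>2 \<le> (a - \<theta>)\<^sup>2" using tha a by (intro power_mono) auto
  have q3: "(13 / 16 * a)\<^sup>2 \<le> (a - 3 * \<theta>)\<^sup>2" using tha a by (intro power_mono) auto
  have a2: "0 < a\<^sup>2" using a by simp
  have k1: "\<theta> * \<kappa> \<le> 1 / 20"
  proof -
    have "\<theta> * \<kappa> \<le> \<theta> * (lam * (16 / 25 / (a - \<theta>)\<^sup>2 * M0))" using \<kappa>(2) th0 by (intro mult_left_mono) auto
    also have "\<dots> = 16 / 25 * (\<theta> * m) / (a - \<theta>)\<^sup>2" by (simp add: m_def)
    also have "\<dots> \<le> 16 / 25 * (a\<^sup>2 / 16) / (15 / 16 * a)\<^sup>2"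
      using tm q1 m th0 a2 by (intro frac_le mult_left_mono) auto
    also have "\<dots> \<le> 1 / 20" using a by (simp add: power_mult_distrib power_divide)
    finally show ?thesis .
  qed
  \<comment> \<open>Here the factor 1 + exp l in \<Delta>(a) absorbs exp l, through
    \<open>tml\<close>. The constants leave 0.08 / (13/16)^2, about 0.121.\<close>
  have k3: "\<theta> * \<kappa>3 * exp l \<le> 13 / 100"
  proof -
    have "\<theta> * \<kappa>3 * exp l \<le> \<theta> * (lam * (16 / 25 / (a - 3 * \<theta>)\<^sup>2 * M0)) * exp l"
      using \<kappa>3 th0 by (intro mult_right_mono mult_left_mono) auto
    also have "\<dots> = 16 / 25 * (\<theta> * m * exp l) / (a - 3 * \<theta>)\<^sup>2" by (simp add: m_def)
    also have "\<dots> \<le> 16 / 25 * (a\<^sup>2 / 8) / (13 / 16 * a)\<^sup>2"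
      using tml q3 m th0 a2 by (intro frac_le mult_left_mono) auto
    also have "\<dots> \<le> 13 / 100" using a by (simp add: power_mult_distrib power_divide)
    finally show ?thesis .
  qed
  have eb: "exp x \<le> 1 + x + x\<^sup>2" if "0 \<le> x" "x \<le> 1" for x :: real
    using exp_bound[OF that] .
  define E where "E = exp (2 * \<theta> * \<kappa>)"
  have x0: "0 \<le> \<theta> * \<kappa>" using th0 \<kappa> by simp
  have "exp (1 / 10 :: real) \<le> 12 / 10" using eb[of "1 / 10"] by (simp add: power2_eq_square)
  moreover have "2 * \<theta> * \<kappa> \<le> 1 / 10" using k1 by linarith
  then have "E \<le> exp (1 / 10)" by (simp only: E_def exp_le_cancel_iff)
  ultimately have E: "E \<le> 12 / 10" by linarith
  have E0: "0 < E" by (simp add: E_def)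
  have "\<theta> * (E * \<kappa>) = E * (\<theta> * \<kappa>)" by simp
  also have "\<dots> \<le> 12 / 10 * (1 / 20)" using E E0 k1 x0 by (intro mult_mono) auto
  finally have tK: "\<theta> * (E * \<kappa>) \<le> 1 / 10" by simp
  then show "\<theta> * (exp (2 * \<theta> * \<kappa>) * \<kappa>) < 1" by (simp only: E_def[symmetric])
  \<comment> \<open>The exponent collects 4 \<theta> \<kappa> from E * E and 3 \<theta> \<kappa>
    from the right-hand side of the claim.\<close>
  have F: "exp (7 * (\<theta> * \<kappa>)) \<le> 15 / 10"
  proof -
    have "7 * (\<theta> * \<kappa>) \<le> 35 / 100" using k1 by linarith
    then have "exp (7 * (\<theta> * \<kappa>)) \<le> exp (35 / 100)" by (simp only: exp_le_cancel_iff)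
    also have "\<dots> \<le> 15 / 10" using eb[of "35 / 100"] by (simp add: power2_eq_square)
    finally show ?thesis .
  qed
  have "\<theta> * (E * \<kappa>) * (E * \<kappa> / (1 - \<theta> * (E * \<kappa>))) = \<theta> * (E * E) * \<kappa>\<^sup>2 / (1 - \<theta> * (E * \<kappa>))"
    by (simp add: power2_eq_square)
  \<comment> \<open>No quantitative lower bound for \<kappa>' is at hand, so it has to appear as a
    factor on both sides: Cauchy-Schwarz replaces the square of \<kappa> by \<kappa>'
    \<kappa>3.\<close>
  also have "\<dots> \<le> \<theta> * (E * E) * (\<kappa>' * \<kappa>3) / (9 / 10)"
  proof (rule frac_le)
    have EE: "0 \<le> \<theta> * (E * E)" using th0 E0 by simp
    show "0 \<le> \<theta> * (E * E) * (\<kappa>' * \<kappa>3)"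
      by (rule mult_nonneg_nonneg[OF EE order_trans[OF zero_le_power2 CS]])
    show "\<theta> * (E * E) * \<kappa>\<^sup>2 \<le> \<theta> * (E * E) * (\<kappa>' * \<kappa>3)" by (rule mult_left_mono[OF CS EE])
    show "9 / 10 \<le> 1 - \<theta> * (E * \<kappa>)" using tK by simp
  qed simp
  also have "\<dots> < exp (- l - 3 * \<theta> * \<kappa>) * \<kappa>'"
  proof -
    have "(\<theta> * \<kappa>3 * exp l) * exp (7 * (\<theta> * \<kappa>)) \<le> (13 / 100) * (15 / 10)"
    proof -
      have "(\<theta> * \<kappa>3 * exp l) * exp (7 * (\<theta> * \<kappa>)) \<le> (13 / 100) * exp (7 * (\<theta> * \<kappa>))"
        using k3 by (rule mult_right_mono) simp
      also have "\<dots> \<le> (13 / 100) * (15 / 10)" using F by (intro mult_left_mono) auto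
      finally show ?thesis .
    qed
    then have "(\<theta> * \<kappa>3 * exp l) * exp (7 * (\<theta> * \<kappa>)) < 9 / 10" by simp
    then have "(\<theta> * \<kappa>3 * exp l) * exp (7 * (\<theta> * \<kappa>)) * exp (- l - 3 * \<theta> * \<kappa>) < 9 / 10 * exp (- l - 3 * \<theta> * \<kappa>)"
      by (rule mult_strict_right_mono) simp
    also have "(\<theta> * \<kappa>3 * exp l) * exp (7 * (\<theta> * \<kappa>)) * exp (- l - 3 * \<theta> * \<kappa>) = \<theta> * (E * E) * \<kappa>3"
    proof -
      have "exp l * (exp (7 * (\<theta> * \<kappa>)) * exp (- l - 3 * \<theta> * \<kappa>)) = E * E"
        unfolding E_def by (simp flip: exp_add)
      then show ?thesis by (simp add: mult_ac)
    qed
    finally have "\<theta> * (E * E) * \<kappa>3 * \<kappa>' < 9 / 10 * exp (- l - 3 * \<theta> * \<kappa>) * \<kappa>'"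
      using \<kappa>' by (rule mult_strict_right_mono)
    then show ?thesis by (simp add: mult_ac)
  qed
  finally show "\<theta> * (exp (2 * \<theta> * \<kappa>) * \<kappa>) * ((exp (2 * \<theta> * \<kappa>) * \<kappa>) / (1 - \<theta> * (exp (2 * \<theta> * \<kappa>) * \<kappa>))) < exp (- l - 3 * \<theta> * \<kappa>) * \<kappa>'"
    by (simp add: E_def)
qed

context poisson_grain_model
begin

text \<open>The tilt is taken to be the full radius R. Then \<kappa> and \<kappa>' are \<lambda>
  times the second moments of the grain volume tilted by R and - R; the moment tilted by 3 R serves
  to compare the two.\<close>

lemma stationary_boolean_model_placed:
  assumes a: "0 < a" and exp_moment: "integrable M (\<lambda>\<omega>. exp (a * gvol \<omega>))" and mean: "0 < (LINT \<omega>|M. gvol \<omega>)"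
  defines "R \<equiv> 1 / Delta M lam (G 0) a"
  shows "0 < R"
    "\<exists>\<kappa> \<kappa>'. stationary_boolean_model intensity placed (lam * (LINT \<omega>|M. gvol \<omega>)) M (grain_union X G) R \<kappa> \<kappa>'"
proof -
  define M0 where "M0 = (LINT \<omega>|M. exp (a * gvol \<omega>))"
  define l where "l = lam * (LINT \<omega>|M. gvol \<omega>)"
  note [measurable] = measurable_gvol
  have M0: "0 \<le> M0" unfolding M0_def by simp
  have l: "0 < l" using intensity_pos mean by (simp add: l_def)
  have R: "R = a\<^sup>2 / (8 * (a + lam * M0) * (1 + exp l))"
    by (simp add: R_def Delta_def M0_def l_def)
  have den: "0 < 8 * (a + lam * M0) * (1 + exp l)"
    using a intensity_pos M0 by (intro mult_pos_pos add_pos_nonneg) auto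
  show R0: "0 < R" unfolding R using a den by (intro divide_pos_pos) auto
  have Ra: "3 * R < a"
  proof -
    have "8 * a * 1 \<le> 8 * (a + lam * M0) * (1 + exp l)" using a intensity_pos M0 by (intro mult_mono) auto
    then have "R \<le> a\<^sup>2 / (8 * a)" unfolding R using a by (intro divide_left_mono) auto
    also have "\<dots> = a / 8" using a by (simp add: power2_eq_square)
    finally show ?thesis using a by simp
  qed
  have gi: "integrable M gvol"
  proof (rule Bochner_Integration.integrable_bound[of _ "\<lambda>\<omega>. exp (a * gvol \<omega>) / a"])
    show "AE \<omega> in M. norm (gvol \<omega>) \<le> norm (exp (a * gvol \<omega>) / a)"
    proof (rule AE_I2)
      fix \<omega>
      have "a * gvol \<omega> \<le> exp (a * gvol \<omega>)" using exp_ge_add_one_self[of "a * gvol \<omega>"] by linarith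
      then show "norm (gvol \<omega>) \<le> norm (exp (a * gvol \<omega>) / a)" using a by (simp add: field_simps)
    qed
  qed (use exp_moment in auto)
  \<comment> \<open>The square consists of the volume in the definition of \<kappa> and of the size
    bias of a grain through a point.\<close>
  define q where "q c = (\<lambda>\<omega>. (gvol \<omega>)\<^sup>2 * exp (c * gvol \<omega>))" for c
  have q_le: "q c \<omega> \<le> 16 / 25 / (a - c)\<^sup>2 * exp (a * gvol \<omega>)" if "c < a" for c \<omega>
    unfolding q_def by (rule square_exp_le) (use that in auto)
  have qi: "integrable M (q c)" if "c < a" for c
  proof (rule Bochner_Integration.integrable_bound[of _ "\<lambda>\<omega>. 16 / 25 / (a - c)\<^sup>2 * exp (a * gvol \<omega>)"])
    show "AE \<omega> in M. norm (q c \<omega>) \<le> norm (16 / 25 / (a - c)\<^sup>2 * exp (a * gvol \<omega>))"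
    proof (rule AE_I2)
      fix \<omega>
      have "norm (q c \<omega>) = q c \<omega>" by (simp add: q_def)
      also have "\<dots> \<le> 16 / 25 / (a - c)\<^sup>2 * exp (a * gvol \<omega>)" by (rule q_le[OF that])
      finally show "norm (q c \<omega>) \<le> norm (16 / 25 / (a - c)\<^sup>2 * exp (a * gvol \<omega>))" by simp
    qed
  qed (use exp_moment in \<open>auto simp: q_def\<close>)
  have qv: "(LINT \<omega>|M. q c \<omega>) \<le> 16 / 25 / (a - c)\<^sup>2 * M0" if "c < a" for c
  proof -
    have "(LINT \<omega>|M. q c \<omega>) \<le> (LINT \<omega>|M. 16 / 25 / (a - c)\<^sup>2 * exp (a * gvol \<omega>))"
      by (intro integral_mono qi that q_le integrable_mult_right exp_moment)
    also have "\<dots> = 16 / 25 / (a - c)\<^sup>2 * M0" unfolding M0_def by (rule integral_mult_right_zero)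
    finally show ?thesis .
  qed
  define k where "k c = (LINT \<omega>|M. q c \<omega>)" for c
  have k0: "0 \<le> k c" for c unfolding k_def q_def by (intro integral_nonneg_AE) auto
  \<comment> \<open>If the moment vanished, the grain volume would be 0 almost surely, against its
    positive mean.\<close>
  have kpos: "0 < k c" if c: "c < a" for c
  proof (rule ccontr)
    assume "\<not> 0 < k c"
    then have "k c = 0" using k0[of c] by simp
    then have "AE \<omega> in M. q c \<omega> = 0"
      unfolding k_def by (subst (asm) integral_nonneg_eq_0_iff_AE[OF qi[OF c]]) (auto simp: q_def)
    then have "AE \<omega> in M. gvol \<omega> = 0" by eventually_elim (simp add: q_def)
    then have "(LINT \<omega>|M. gvol \<omega>) = (LINT \<omega>|M. 0)" by (intro integral_cong_AE) auto
    then show False using mean by simp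
  qed
  have c3: "3 * R < a" and c1: "R < a" and cm: "- R < a" using Ra R0 a by auto
  \<comment> \<open>Cauchy-Schwarz, with R the midpoint of - R and 3 R: the integral of a square is
    nonnegative, and t is the minimiser of the resulting quadratic.\<close>
  have CS: "(k R)\<^sup>2 \<le> k (- R) * k (3 * R)"
  proof -
    define t where "t = k R / k (3 * R)"
    have k3: "0 < k (3 * R)" by (rule kpos[OF c3])
    have "0 \<le> (LINT \<omega>|M. q (- R) \<omega> - 2 * t * q R \<omega> + t\<^sup>2 * q (3 * R) \<omega>)"
    proof (intro integral_nonneg_AE AE_I2)
      fix \<omega>
      let ?v = "gvol \<omega>"
      have "q (- R) \<omega> - 2 * t * q R \<omega> + t\<^sup>2 * q (3 * R) \<omega> = ?v\<^sup>2 * exp (- R * ?v) * (1 - t * exp (2 * R * ?v))\<^sup>2"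
      proof -
        have e1: "exp (R * ?v) = exp (- R * ?v) * exp (2 * R * ?v)" by (simp flip: exp_add)
        have e3: "exp (3 * R * ?v) = exp (- R * ?v) * (exp (2 * R * ?v) * exp (2 * R * ?v))" by (simp flip: exp_add)
        show ?thesis unfolding q_def e1 e3 by (simp add: power2_eq_square algebra_simps)
      qed
      then show "0 \<le> q (- R) \<omega> - 2 * t * q R \<omega> + t\<^sup>2 * q (3 * R) \<omega>" by simp
    qed
    also have "\<dots> = k (- R) - 2 * t * k R + t\<^sup>2 * k (3 * R)"
      using qi[OF cm] qi[OF c1] qi[OF c3] by (simp add: k_def)
    also have "\<dots> = k (- R) - (k R)\<^sup>2 / k (3 * R)" using k3 by (simp add: t_def power2_eq_square)
    finally show ?thesis using k3 by (simp add: pos_divide_le_eq)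
  qed
  interpret B: boolean_model intensity placed l M "grain_union X G" R "lam * k R"
    unfolding l_def k_def q_def
    by (rule boolean_model_placed[OF gi mean]) (use R0 qi[OF c1] in \<open>auto simp: q_def\<close>)
  have C: "R * (exp (2 * R * (lam * k R)) * (lam * k R)) < 1"
    "R * (exp (2 * R * (lam * k R)) * (lam * k R)) * ((exp (2 * R * (lam * k R)) * (lam * k R)) / (1 - R * (exp (2 * R * (lam * k R)) * (lam * k R))))
       < exp (- l - 3 * R * (lam * k R)) * (lam * k (- R))"
  proof -
    have b1: "lam * k R \<le> lam * (16 / 25 / (a - R)\<^sup>2 * M0)" "lam * k (3 * R) \<le> lam * (16 / 25 / (a - 3 * R)\<^sup>2 * M0)"
      unfolding k_def by (intro mult_left_mono qv c1 c3, use intensity_pos in simp)+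
    have b2: "(lam * k R)\<^sup>2 \<le> (lam * k (- R)) * (lam * k (3 * R))"
    proof -
      have "lam\<^sup>2 * (k R)\<^sup>2 \<le> lam\<^sup>2 * (k (- R) * k (3 * R))" by (intro mult_left_mono CS) simp
      then show ?thesis by (simp add: power2_eq_square mult_ac)
    qed
    have b3: "0 \<le> lam * k R" "0 < lam * k (- R)" using intensity_pos k0 kpos[OF cm] by auto
    note cc = parameter_bounds[OF a intensity_pos M0 less_imp_le[OF l] R b3(1) b1 b2 b3(2)]
    show "R * (exp (2 * R * (lam * k R)) * (lam * k R)) < 1" by (rule cc(1))
    show "R * (exp (2 * R * (lam * k R)) * (lam * k R)) * ((exp (2 * R * (lam * k R)) * (lam * k R)) / (1 - R * (exp (2 * R * (lam * k R)) * (lam * k R))))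
       < exp (- l - 3 * R * (lam * k R)) * (lam * k (- R))" by (rule cc(2))
  qed
  have "stationary_boolean_model intensity placed l M (grain_union X G) R (lam * k R) (lam * k (- R))"
  proof
    show "B.overlap R (t + x) (t + y) = B.overlap R x y" "B.overlap (- R) (t + x) (t + y) = B.overlap (- R) x y" for t x y
      unfolding B.overlap_def l_def by (rule overlap_shift[OF gi mean])+
    show "B.hit_measure ((+) t ` A) = B.hit_measure A" if "finite A" for A t
      using hit_measure_shift[OF gi mean that] by simp
    show "has_bochner_integral intensity (\<lambda>e. B.hit x e * (vol (placed e) * exp (- R * vol (placed e)))) (lam * k (- R))" for x
      using has_integral_hit[of "\<lambda>v. \<bar>v\<bar> * exp (- R * v)" x] qi[OF cm]
      by (simp add: B.hit_eq q_def k_def power2_eq_square mult.assoc)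
    show "R * B.K < 1" unfolding B.K_def by (rule C(1))
    show "R * B.K * (B.K / (1 - R * B.K)) < exp (- l - 3 * R * (lam * k R)) * (lam * k (- R))" unfolding B.K_def by (rule C(2))
  qed
  then show "\<exists>\<kappa> \<kappa>'. stationary_boolean_model intensity placed (lam * (LINT \<omega>|M. gvol \<omega>)) M (grain_union X G) R \<kappa> \<kappa>'"
    unfolding l_def by blast
qed

end

section \<open>Large deviations of the volume fraction\<close>

context scaled_mgf_limit
begin

text \<open>The lower tail of V is the upper tail of - V, so one treatment serves both.\<close>

lemma reflected: "scaled_mgf_limit M (\<lambda>n \<omega>. - V n \<omega>) a C (\<lambda>h. L (- h)) (\<lambda>h. - l (- h)) R"
proof
  show "(\<lambda>\<omega>. - V n \<omega>) \<in> borel_measurable M" for n using V_measurable by simp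
  show "\<bar>- V n \<omega>\<bar> \<le> C n" if "\<omega> \<in> space M" for n \<omega> using V_bounded[OF that] by simp
  show "(\<lambda>n. ln (LINT \<omega>|M. exp (h * - V n \<omega>)) / a n) \<longlonglongrightarrow> L (- h)" if "\<bar>h\<bar> < R" for h
    using mgf_limit[of "- h"] that by simp
  show "((\<lambda>h. L (- h)) has_real_derivative - l (- h)) (at h)" if "\<bar>h\<bar> < R" for h
  proof -
    have "((\<lambda>h. L (- h)) has_real_derivative l (- h) * - 1) (at h)"
      by (rule DERIV_chain2[of L, OF L_derivative]) (use that in \<open>auto intro!: derivative_eq_intros\<close>)
    then show ?thesis by simp
  qed
  show "continuous_on {-R<..<R} (\<lambda>h. - l (- h))"
    by (intro continuous_intros continuous_on_compose2[OF l_continuous]) auto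
  show "- l (- h) < - l (- k)" if "- R < h" "h < k" "k < R" for h k
    using l_strict_mono[of "- k" "- h"] that by simp
qed (rule a_pos a_limit)+

text \<open>Strict monotonicity makes the critical point unique, the tangent inequality makes it a
  minimiser on the half interval, and the tail limit is read off at the slope l h0 = x.\<close>

lemma tail_rate:
  assumes R: "0 < R" and bdd: "\<And>h. \<bar>h\<bar> < R \<Longrightarrow> l h \<le> c"
  obtains b where "(l \<longlongrightarrow> b) (at_left R)"
    "\<And>x. \<lbrakk>l 0 \<le> x; x < b\<rbrakk> \<Longrightarrow> \<exists>h0. {h \<in> {0..<R}. l h = x} = {h0} \<and>
       (\<forall>h\<in>{0..<R}. L h0 - h0 * x \<le> L h - h * x) \<and>
       (\<forall>\<^sub>F n in sequentially. 0 < tail_prob x n) \<and> (\<lambda>n. ln (tail_prob x n) / a n) \<longlonglongrightarrow> L h0 - h0 * x"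
proof -
  obtain b where lim: "(l \<longlongrightarrow> b) (at_left R)"
    and reach: "\<And>x. \<lbrakk>l 0 \<le> x; x < b\<rbrakk> \<Longrightarrow> \<exists>h\<in>{0..<R}. l h = x"
    using derivative_limit[OF R bdd] by blast
  show ?thesis
  proof (rule that[OF lim])
    fix x assume x: "l 0 \<le> x" "x < b"
    obtain h0 where h0: "0 \<le> h0" "h0 < R" and eq: "l h0 = x" using reach[OF x] by auto
    have unique: "h = h0" if "0 \<le> h" "h < R" "l h = x" for h
      using l_strict_mono[of h h0] l_strict_mono[of h0 h] that h0 R eq by (cases h h0 rule: linorder_cases) auto
    have "L h0 - h0 * x \<le> L h - h * x" if "0 \<le> h" "h < R" for h
      using rate_minimum[of h0 h] that h0 eq by auto
    moreover have "{h \<in> {0..<R}. l h = x} = {h0}"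
    proof -
      have "h \<in> {0..<R} \<and> l h = x \<longleftrightarrow> h = h0" for h using unique[of h] h0 eq by auto
      then show ?thesis by (simp only: singleton_conv)
    qed
    moreover note tail_prob_limit[OF h0, unfolded eq]
    ultimately show "\<exists>h0. {h \<in> {0..<R}. l h = x} = {h0} \<and>
       (\<forall>h\<in>{0..<R}. L h0 - h0 * x \<le> L h - h * x) \<and>
       (\<forall>\<^sub>F n in sequentially. 0 < tail_prob x n) \<and> (\<lambda>n. ln (tail_prob x n) / a n) \<longlonglongrightarrow> L h0 - h0 * x"
      by (intro exI[of _ h0] conjI ballI) simp_all
  qed
qed

end

section \<open>From vacant to covered volume\<close>

lemma covered_volume:
  assumes Xi: "random_set M Xi" and \<omega>: "\<omega> \<in> space M" and W: "W \<in> sets lborel" "emeasure lborel W < \<infinity>"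
  shows "vol (Xi \<omega> \<inter> W) = vol W - vacant_int Xi (indicator W) \<omega>"
proof -
  have m: "Xi \<omega> \<inter> W \<in> sets lborel" using random_set_section[OF Xi \<omega>] W by (intro sets.Int)
  have "vacant_int Xi (indicator W) \<omega> = (LINT x|lborel. indicator (W - (Xi \<omega> \<inter> W)) x)"
    unfolding vacant_int_def by (intro Bochner_Integration.integral_cong) (auto simp: clear_def indicator_def)
  also have "\<dots> = vol (W - (Xi \<omega> \<inter> W))" using m W by simp
  also have "\<dots> = vol W - vol (Xi \<omega> \<inter> W)" using m W by (intro measure_Diff) auto
  finally show ?thesis by simp
qed

context stationary_boolean_model
begin

text \<open>Covered and vacant volume add up to the volume of the window, so the rate at h is h plus
  the rate of the vacant volume at - h. The reflection of h also preserves strict monotonicity of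
  the derivative.\<close>

lemma covered_volume_mgf_limit:
  fixes W :: "nat \<Rightarrow> 'a set"
  assumes windows: "convex_averaging_sequence W"
  defines "L \<equiv> \<lambda>h. lim (log_mgf_rate M Xi W h)"
  shows "\<And>h. \<bar>h\<bar> < \<theta> \<Longrightarrow> convergent (log_mgf_rate M Xi W h)"
    "scaled_mgf_limit M (\<lambda>n \<omega>. vol (Xi \<omega> \<inter> W n)) (\<lambda>n. vol (W n)) (\<lambda>n. vol (W n)) L (\<lambda>h. 1 - limit_density (- h)) \<theta>"
proof -
  note ws = windows_sets[OF windows] and wf = windows_finite[OF windows] and wp = windows_pos[OF windows]
  note cv = covered_volume[OF Xi_measurable _ ws wf]
  obtain L0 where L0: "\<And>t. \<bar>t\<bar> \<le> \<theta> \<Longrightarrow> (\<lambda>n. ln (part (W n) t) / vol (W n)) \<longlonglongrightarrow> L0 t"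
    and L0': "\<And>t. \<bar>t\<bar> < \<theta> \<Longrightarrow> (L0 has_real_derivative limit_density t) (at t)"
    using log_part_limit[OF windows] by blast
  have rate: "log_mgf_rate M Xi W h n = h + ln (part (W n) (- h)) / vol (W n)" for h n
  proof -
    have "(LINT \<omega>|M. exp (h * vol (Xi \<omega> \<inter> W n))) = (LINT \<omega>|M. exp (h * vol (W n)) * exp (- h * vacant_int Xi (indicator (W n)) \<omega>))"
      by (intro Bochner_Integration.integral_cong refl) (simp add: cv right_diff_distrib flip: exp_add)
    also have "\<dots> = exp (h * vol (W n)) * part (W n) (- h)"
      by (simp add: part_def[OF ws wf])
    finally show ?thesis
      using wp[of n] part_pos[OF ws wf, of n "- h"] by (simp add: log_mgf_rate_def ln_mult add_divide_distrib)
  qed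
  have lim: "log_mgf_rate M Xi W h \<longlonglongrightarrow> h + L0 (- h)" if "\<bar>h\<bar> < \<theta>" for h
    unfolding rate[abs_def] by (intro tendsto_intros L0) (use that in simp)
  then show "\<And>h. \<bar>h\<bar> < \<theta> \<Longrightarrow> convergent (log_mgf_rate M Xi W h)" by (auto simp: convergent_def)
  have L: "L h = h + L0 (- h)" if "\<bar>h\<bar> < \<theta>" for h unfolding L_def by (rule limI[OF lim[OF that]])
  show "scaled_mgf_limit M (\<lambda>n \<omega>. vol (Xi \<omega> \<inter> W n)) (\<lambda>n. vol (W n)) (\<lambda>n. vol (W n)) L (\<lambda>h. 1 - limit_density (- h)) \<theta>"
  proof
    show "(\<lambda>\<omega>. vol (Xi \<omega> \<inter> W n)) \<in> borel_measurable M" for n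
    proof -
      have "(\<lambda>\<omega>. vol (W n) - vacant_int Xi (indicator (W n)) \<omega>) \<in> borel_measurable M"
        using vac_measurable[OF ws wf] by measurable
      also have "?this \<longleftrightarrow> ?thesis" by (intro measurable_cong) (simp add: cv)
      finally show ?thesis .
    qed
    show "\<bar>vol (Xi \<omega> \<inter> W n)\<bar> \<le> vol (W n)" if "\<omega> \<in> space M" for n \<omega>
      using random_set_section[OF Xi_measurable that] ws[of n] wf[of n]
      by (simp, intro measure_mono_fmeasurable) (auto simp: fmeasurable_def)
    show "0 < vol (W n)" for n by (rule wp)
    show "filterlim (\<lambda>n. vol (W n)) at_top sequentially" by (rule windows_vol_limit[OF windows])
    show "(\<lambda>n. ln (LINT \<omega>|M. exp (h * vol (Xi \<omega> \<inter> W n))) / vol (W n)) \<longlonglongrightarrow> L h" if "\<bar>h\<bar> < \<theta>" for h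
      using lim[OF that] unfolding L[OF that] log_mgf_rate_def[abs_def] .
    show "(L has_real_derivative 1 - limit_density (- h)) (at h)" if h: "\<bar>h\<bar> < \<theta>" for h
    proof (rule has_field_derivative_transform_within_open)
      have "((\<lambda>h. h + L0 (- h)) has_real_derivative 1 + limit_density (- h) * - 1) (at h)"
        by (rule DERIV_add[OF DERIV_ident DERIV_chain2[of L0, OF L0']]) (use h in \<open>auto intro!: derivative_eq_intros\<close>)
      then show "((\<lambda>h. h + L0 (- h)) has_real_derivative 1 - limit_density (- h)) (at h)" by simp
      show "open {- \<theta><..<\<theta>}" by simp
      show "h \<in> {- \<theta><..<\<theta>}" using h by auto
      show "k + L0 (- k) = L k" if "k \<in> {- \<theta><..<\<theta>}" for k using that by (intro L[symmetric]) auto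
    qed
    show "continuous_on {- \<theta><..<\<theta>} (\<lambda>h. 1 - limit_density (- h))"
      by (intro continuous_intros continuous_on_compose2[OF limit_density_continuous[OF windows]]) auto
    show "1 - limit_density (- h) < 1 - limit_density (- k)" if "- \<theta> < h" "h < k" "k < \<theta>" for h k
      using limit_density_strict_mono[OF windows, of "- k" "- h"] that by simp
  qed
qed

lemma coverage_probability: "measure M {\<omega> \<in> space M. 0 \<in> Xi \<omega>} = 1 - limit_density 0"
proof -
  let ?C = "{\<omega> \<in> space M. 0 \<in> Xi \<omega>}"
  have cl: "clear Xi {0} \<omega> = 1 - indicator ?C \<omega>" if "\<omega> \<in> space M" for \<omega>
    using that by (auto simp: clear_def)
  have C: "?C \<in> sets M"
  proof -
    have "?C = {\<omega> \<in> space M. clear Xi {0} \<omega> = 0}" by (auto simp: clear_def)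
    then show ?thesis using measurable_clear_point[OF Xi_measurable, of 0] by simp
  qed
  have "(LINT \<omega>|M. clear Xi {0} \<omega>) = (LINT \<omega>|M. 1 - indicator ?C \<omega>)"
    by (intro Bochner_Integration.integral_cong refl cl)
  also have "\<dots> = 1 - measure M ?C" using C by (simp add: M.prob_space less_top[symmetric])
  finally have "1 - measure M ?C = exp (- hit_measure {0})" using vacancy[of "{0}"] by simp
  moreover have "hit_measure {0} = l" using hit_measure_insert[of "{}" 0] hit_integral by (simp add: hit_measure_def)
  ultimately show ?thesis by (simp add: limit_density_zero)
qed

end

lemma INF_minimum:
  fixes g :: "real \<Rightarrow> real"
  assumes "h0 \<in> A" "\<And>h. h \<in> A \<Longrightarrow> g h0 \<le> g h"
  shows "(INF h\<in>A. g h) = g h0"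
proof (rule cInf_eq_minimum)
  show "g h0 \<in> g ` A" using assms(1) by (rule imageI)
  show "g h0 \<le> x" if "x \<in> g ` A" for x using that assms(2) by blast
qed

text \<open>\<open>lim\<close>, \<open>deriv\<close> and \<open>ln\<close> are total functions.
  Convergence, differentiability and eventual positivity of the probabilities are therefore part of
  the conclusion, as is the existence of the limits that bound \<epsilon>; uniqueness of h0 is
  expressed by singleton sets.\<close>

theorem theorem4:
  fixes M :: "'w measure" and lam a :: real
    and X :: "nat \<Rightarrow> 'w \<Rightarrow> 'a::euclidean_space"
    and G :: "nat \<Rightarrow> 'w \<Rightarrow> 'a set"
    and W :: "nat \<Rightarrow> 'a set"
  assumes model: "poisson_grain_model M lam X G"
    and a_pos: "0 < a"
    and exp_moment: "integrable M (\<lambda>\<omega>. exp (a * vol (G 0 \<omega>)))"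
    and mean_pos: "0 < (LINT \<omega>|M. vol (G 0 \<omega>))"
    and windows: "convex_averaging_sequence W"
  shows
    "let Xi = grain_union X G;
         p = measure M {\<omega> \<in> space M. 0 \<in> Xi \<omega>};
         phat = (\<lambda>n \<omega>. vol (Xi \<omega> \<inter> W n) / vol (W n));
         R = 1 / Delta M lam (G 0) a;
         L = (\<lambda>h. lim (log_mgf_rate M Xi W h))
     in
       (\<forall>h. \<bar>h\<bar> < R \<longrightarrow> convergent (log_mgf_rate M Xi W h) \<and> L differentiable (at h)) \<and>
       (\<exists>eps_max. ((\<lambda>h. deriv L h - p) \<longlongrightarrow> eps_max) (at_left R) \<and>
         (\<forall>eps. 0 \<le> eps \<and> eps < eps_max \<longrightarrow>
           (let g = (\<lambda>h. L h - h * (eps + p));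
                P = (\<lambda>n. measure M {\<omega> \<in> space M. phat n \<omega> - p \<ge> eps})
            in \<exists>h0.
                {h \<in> {0..<R}. deriv g h = 0} = {h0} \<and>
                {h \<in> {0..<R}. deriv L h = eps + p} = {h0} \<and>
                (INF h\<in>{0..<R}. g h) = g h0 \<and>
                (\<forall>\<^sub>F n in sequentially. 0 < P n) \<and>
                (\<lambda>n. ln (P n) / vol (W n)) \<longlonglongrightarrow> (INF h\<in>{0..<R}. g h)))) \<and>
       (\<exists>eps_max. ((\<lambda>h. p - deriv L h) \<longlongrightarrow> eps_max) (at_right (- R)) \<and>
         (\<forall>eps. 0 \<le> eps \<and> eps < eps_max \<longrightarrow>
           (let g = (\<lambda>h. L h - h * (p - eps));
                P = (\<lambda>n. measure M {\<omega> \<in> space M. phat n \<omega> - p \<le> - eps})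
            in \<exists>h0.
                {h \<in> {-R<..0}. deriv g h = 0} = {h0} \<and>
                {h \<in> {-R<..0}. deriv L h = p - eps} = {h0} \<and>
                (INF h\<in>{-R<..0}. g h) = g h0 \<and>
                (\<forall>\<^sub>F n in sequentially. 0 < P n) \<and>
                (\<lambda>n. ln (P n) / vol (W n)) \<longlonglongrightarrow> (INF h\<in>{-R<..0}. g h))))"
proof -
  interpret PGM: poisson_grain_model M lam X G by (rule model)
  define Xi where "Xi = grain_union X G"
  define p where "p = measure M {\<omega> \<in> space M. 0 \<in> Xi \<omega>}"
  define R where "R = 1 / Delta M lam (G 0) a"
  define L where "L = (\<lambda>h. lim (log_mgf_rate M Xi W h))"
  note placed = PGM.stationary_boolean_model_placed[OF a_pos exp_moment mean_pos]
  have R: "0 < R" using placed(1) by (simp add: R_def)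
  obtain \<kappa> \<kappa>' where "stationary_boolean_model PGM.intensity PGM.placed (lam * (LINT \<omega>|M. vol (G 0 \<omega>))) M Xi R \<kappa> \<kappa>'"
    using placed(2) unfolding R_def Xi_def by blast
  then interpret B: stationary_boolean_model PGM.intensity PGM.placed "lam * (LINT \<omega>|M. vol (G 0 \<omega>))" M Xi R \<kappa> \<kappa>' .
  \<comment> \<open>The derivative of L, the limiting mean coverage under the tilt h; its value at 0
    is p.\<close>
  define \<mu> where "\<mu> h = 1 - B.limit_density (- h)" for h
  have \<mu>_bounds: "0 \<le> \<mu> h" "\<mu> h \<le> 1" if "\<bar>h\<bar> < R" for h
    using B.limit_density_bounds[of "- h"] that by (auto simp: \<mu>_def)
  have \<mu>_zero: "\<mu> 0 = p" using B.coverage_probability by (simp add: \<mu>_def p_def)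
  note wp = windows_pos[OF windows]
  interpret U: scaled_mgf_limit M "\<lambda>n \<omega>. vol (Xi \<omega> \<inter> W n)" "\<lambda>n. vol (W n)" "\<lambda>n. vol (W n)" L \<mu> R
    using B.covered_volume_mgf_limit(2)[OF windows] unfolding L_def \<mu>_def[abs_def] .
  interpret D: scaled_mgf_limit M "\<lambda>n \<omega>. - vol (Xi \<omega> \<inter> W n)" "\<lambda>n. vol (W n)" "\<lambda>n. vol (W n)"
    "\<lambda>h. L (- h)" "\<lambda>h. - \<mu> (- h)" R by (rule U.reflected)
  have convergent: "convergent (log_mgf_rate M Xi W h)" if "\<bar>h\<bar> < R" for h
    by (rule B.covered_volume_mgf_limit(1)[OF windows that])
  have dL: "deriv L h = \<mu> h" if "\<bar>h\<bar> < R" for h by (rule DERIV_imp_deriv[OF U.L_derivative[OF that]])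
  have dg: "deriv (\<lambda>h. L h - h * x) h = \<mu> h - x" if "\<bar>h\<bar> < R" for h x
    by (rule DERIV_imp_deriv) (use U.L_derivative[OF that] in \<open>auto intro!: derivative_eq_intros\<close>)
  have diff: "L differentiable (at h)" if "\<bar>h\<bar> < R" for h
    using U.L_derivative[OF that] by (auto simp: real_differentiable_def)
  have critical: "{h \<in> A. deriv (\<lambda>h. L h - h * x) h = 0} = {h \<in> A. \<mu> h = x}"
    "{h \<in> A. deriv L h = x} = {h \<in> A. \<mu> h = x}" if "\<And>h. h \<in> A \<Longrightarrow> \<bar>h\<bar> < R" for A x
    using dL dg that by auto
  have upper: "\<exists>eps_max. ((\<lambda>h. deriv L h - p) \<longlongrightarrow> eps_max) (at_left R) \<and>
      (\<forall>eps. 0 \<le> eps \<and> eps < eps_max \<longrightarrow>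
        (\<exists>h0. {h \<in> {0..<R}. deriv (\<lambda>h. L h - h * (eps + p)) h = 0} = {h0} \<and>
          {h \<in> {0..<R}. deriv L h = eps + p} = {h0} \<and>
          (INF h\<in>{0..<R}. L h - h * (eps + p)) = L h0 - h0 * (eps + p) \<and>
          (\<forall>\<^sub>F n in sequentially. 0 < measure M {\<omega> \<in> space M. vol (Xi \<omega> \<inter> W n) / vol (W n) - p \<ge> eps}) \<and>
          (\<lambda>n. ln (measure M {\<omega> \<in> space M. vol (Xi \<omega> \<inter> W n) / vol (W n) - p \<ge> eps}) / vol (W n))
            \<longlonglongrightarrow> (INF h\<in>{0..<R}. L h - h * (eps + p))))"
  proof -
    obtain b where b: "(\<mu> \<longlongrightarrow> b) (at_left R)"
      and rate: "\<And>x. \<lbrakk>\<mu> 0 \<le> x; x < b\<rbrakk> \<Longrightarrow> \<exists>h0. {h \<in> {0..<R}. \<mu> h = x} = {h0} \<and>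
         (\<forall>h\<in>{0..<R}. L h0 - h0 * x \<le> L h - h * x) \<and>
         (\<forall>\<^sub>F n in sequentially. 0 < U.tail_prob x n) \<and> (\<lambda>n. ln (U.tail_prob x n) / vol (W n)) \<longlonglongrightarrow> L h0 - h0 * x"
      using U.tail_rate[OF R \<mu>_bounds(2)] by blast
    have "\<forall>\<^sub>F h in at_left R. \<mu> h - p = deriv L h - p"
    proof -
      have "\<forall>\<^sub>F h in at_left R. 0 < h" using R by (intro order_tendstoD(1)[OF tendsto_ident_at]) auto
      moreover have "\<forall>\<^sub>F h in at_left R. h < R" by (rule eventually_at_left_less)
      ultimately show ?thesis by eventually_elim (simp add: dL)
    qed
    moreover have "((\<lambda>h. \<mu> h - p) \<longlongrightarrow> b - p) (at_left R)" by (intro tendsto_intros b)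
    ultimately have "((\<lambda>h. deriv L h - p) \<longlongrightarrow> b - p) (at_left R)" by (rule Lim_transform_eventually[rotated])
    moreover have "\<exists>h0. {h \<in> {0..<R}. deriv (\<lambda>h. L h - h * (eps + p)) h = 0} = {h0} \<and>
          {h \<in> {0..<R}. deriv L h = eps + p} = {h0} \<and>
          (INF h\<in>{0..<R}. L h - h * (eps + p)) = L h0 - h0 * (eps + p) \<and>
          (\<forall>\<^sub>F n in sequentially. 0 < measure M {\<omega> \<in> space M. vol (Xi \<omega> \<inter> W n) / vol (W n) - p \<ge> eps}) \<and>
          (\<lambda>n. ln (measure M {\<omega> \<in> space M. vol (Xi \<omega> \<inter> W n) / vol (W n) - p \<ge> eps}) / vol (W n))
            \<longlonglongrightarrow> (INF h\<in>{0..<R}. L h - h * (eps + p))" if eps: "0 \<le> eps" "eps < b - p" for eps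
    proof -
      have "\<mu> 0 \<le> eps + p" "eps + p < b" using eps \<mu>_zero by auto
      from rate[OF this] obtain h0 where h0: "{h \<in> {0..<R}. \<mu> h = eps + p} = {h0}"
        and min: "\<And>h. h \<in> {0..<R} \<Longrightarrow> L h0 - h0 * (eps + p) \<le> L h - h * (eps + p)"
        and tail: "\<forall>\<^sub>F n in sequentially. 0 < U.tail_prob (eps + p) n"
          "(\<lambda>n. ln (U.tail_prob (eps + p) n) / vol (W n)) \<longlonglongrightarrow> L h0 - h0 * (eps + p)"
        by blast
      have "h0 \<in> {0..<R}" using h0 by blast
      then have inf: "(INF h\<in>{0..<R}. L h - h * (eps + p)) = L h0 - h0 * (eps + p)" using min by (rule INF_minimum)
      have "(eps \<le> v / vol (W n) - p) = ((eps + p) * vol (W n) \<le> v)" for v n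
        using wp[of n] by (simp add: le_diff_eq pos_le_divide_eq)
      then have event: "measure M {\<omega> \<in> space M. vol (Xi \<omega> \<inter> W n) / vol (W n) - p \<ge> eps} = U.tail_prob (eps + p) n" for n
        unfolding U.tail_prob_def by (simp only:)
      have "\<bar>h\<bar> < R" if "h \<in> {0..<R}" for h using that by auto
      note c = critical[OF this]
      show ?thesis
        unfolding event inf by (intro exI[of _ h0] conjI tail) (simp_all only: c h0)
    qed
    ultimately show ?thesis by blast
  qed
  have lower: "\<exists>eps_max. ((\<lambda>h. p - deriv L h) \<longlongrightarrow> eps_max) (at_right (- R)) \<and>
      (\<forall>eps. 0 \<le> eps \<and> eps < eps_max \<longrightarrow>
        (\<exists>h0. {h \<in> {-R<..0}. deriv (\<lambda>h. L h - h * (p - eps)) h = 0} = {h0} \<and>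
          {h \<in> {-R<..0}. deriv L h = p - eps} = {h0} \<and>
          (INF h\<in>{-R<..0}. L h - h * (p - eps)) = L h0 - h0 * (p - eps) \<and>
          (\<forall>\<^sub>F n in sequentially. 0 < measure M {\<omega> \<in> space M. vol (Xi \<omega> \<inter> W n) / vol (W n) - p \<le> - eps}) \<and>
          (\<lambda>n. ln (measure M {\<omega> \<in> space M. vol (Xi \<omega> \<inter> W n) / vol (W n) - p \<le> - eps}) / vol (W n))
            \<longlonglongrightarrow> (INF h\<in>{-R<..0}. L h - h * (p - eps))))"
  proof -
    obtain b where b: "((\<lambda>h. - \<mu> (- h)) \<longlongrightarrow> b) (at_left R)"
      and rate: "\<And>x. \<lbrakk>- \<mu> (- 0) \<le> x; x < b\<rbrakk> \<Longrightarrow> \<exists>h0. {h \<in> {0..<R}. - \<mu> (- h) = x} = {h0} \<and>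
         (\<forall>h\<in>{0..<R}. L (- h0) - h0 * x \<le> L (- h) - h * x) \<and>
         (\<forall>\<^sub>F n in sequentially. 0 < D.tail_prob x n) \<and> (\<lambda>n. ln (D.tail_prob x n) / vol (W n)) \<longlonglongrightarrow> L (- h0) - h0 * x"
    proof -
      have "- \<mu> (- h) \<le> 0" if "\<bar>h\<bar> < R" for h using \<mu>_bounds(1)[of "- h"] that by simp
      from D.tail_rate[OF R this] show thesis using that by blast
    qed
    have "\<forall>\<^sub>F h in at_left R. p + - \<mu> (- h) = p - deriv L (- h)"
    proof -
      have "\<forall>\<^sub>F h in at_left R. 0 < h" using R by (intro order_tendstoD(1)[OF tendsto_ident_at]) auto
      moreover have "\<forall>\<^sub>F h in at_left R. h < R" by (rule eventually_at_left_less)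
      ultimately show ?thesis by eventually_elim (simp add: dL)
    qed
    moreover have "((\<lambda>h. p + - \<mu> (- h)) \<longlongrightarrow> p + b) (at_left R)" by (intro tendsto_add tendsto_const b)
    ultimately have "((\<lambda>h. p - deriv L (- h)) \<longlongrightarrow> p + b) (at_left R)" by (rule Lim_transform_eventually[rotated])
    \<comment> \<open>The left limit at R of the reflected function is the right limit at -
      R.\<close>
    then have "((\<lambda>h. p - deriv L h) \<longlongrightarrow> p + b) (at_right (- R))"
      by (simp add: at_right_minus filterlim_filtermap)
    moreover have "\<exists>h0. {h \<in> {-R<..0}. deriv (\<lambda>h. L h - h * (p - eps)) h = 0} = {h0} \<and>
          {h \<in> {-R<..0}. deriv L h = p - eps} = {h0} \<and>
          (INF h\<in>{-R<..0}. L h - h * (p - eps)) = L h0 - h0 * (p - eps) \<and>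
          (\<forall>\<^sub>F n in sequentially. 0 < measure M {\<omega> \<in> space M. vol (Xi \<omega> \<inter> W n) / vol (W n) - p \<le> - eps}) \<and>
          (\<lambda>n. ln (measure M {\<omega> \<in> space M. vol (Xi \<omega> \<inter> W n) / vol (W n) - p \<le> - eps}) / vol (W n))
            \<longlonglongrightarrow> (INF h\<in>{-R<..0}. L h - h * (p - eps))" if eps: "0 \<le> eps" "eps < p + b" for eps
    proof -
      have "- \<mu> (- 0) \<le> eps - p" "eps - p < b" using eps \<mu>_zero by auto
      from rate[OF this] obtain k where k: "{h \<in> {0..<R}. - \<mu> (- h) = eps - p} = {k}"
        and min: "\<And>h. h \<in> {0..<R} \<Longrightarrow> L (- k) - k * (eps - p) \<le> L (- h) - h * (eps - p)"
        and tail: "\<forall>\<^sub>F n in sequentially. 0 < D.tail_prob (eps - p) n"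
          "(\<lambda>n. ln (D.tail_prob (eps - p) n) / vol (W n)) \<longlonglongrightarrow> L (- k) - k * (eps - p)"
        by blast
      \<comment> \<open>The reflection carries [0, R) to (- R, 0] and the critical point k of the
        reflected problem to - k.\<close>
      have h0: "{h \<in> {-R<..0}. \<mu> h = p - eps} = {- k}"
      proof -
        have "h \<in> {-R<..0} \<and> \<mu> h = p - eps \<longleftrightarrow> - h \<in> {h \<in> {0..<R}. - \<mu> (- h) = eps - p}" for h by auto
        also have "- h \<in> {h \<in> {0..<R}. - \<mu> (- h) = eps - p} \<longleftrightarrow> h = - k" for h unfolding k by auto
        finally show ?thesis by (simp only: singleton_conv)
      qed
      have val: "L (- k) - k * (eps - p) = L (- k) - - k * (p - eps)" by (simp add: algebra_simps)
      have "- k \<in> {-R<..0}" using h0 by blast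
      then have inf: "(INF h\<in>{-R<..0}. L h - h * (p - eps)) = L (- k) - - k * (p - eps)"
      proof (rule INF_minimum)
        fix h assume "h \<in> {-R<..0}"
        then have "L (- k) - k * (eps - p) \<le> L (- (- h)) - - h * (eps - p)" by (intro min) auto
        then show "L (- k) - - k * (p - eps) \<le> L h - h * (p - eps)" unfolding val by (simp add: algebra_simps)
      qed
      have "(v / vol (W n) - p \<le> - eps) = ((eps - p) * vol (W n) \<le> - v)" for v n
        using wp[of n] by (simp add: field_simps)
      then have event: "measure M {\<omega> \<in> space M. vol (Xi \<omega> \<inter> W n) / vol (W n) - p \<le> - eps} = D.tail_prob (eps - p) n" for n
        unfolding D.tail_prob_def by (simp only:)
      have "\<bar>h\<bar> < R" if "h \<in> {-R<..0}" for h using that by auto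
      note c = critical[OF this]
      show ?thesis
        unfolding event inf by (intro exI[of _ "- k"] conjI tail[unfolded val]) (simp_all only: c h0)
    qed
    ultimately show ?thesis by blast
  qed
  have lim_eq: "lim (log_mgf_rate M Xi W h) = L h" for h by (simp add: L_def)
  show ?thesis
    unfolding Let_def Xi_def[symmetric] p_def[symmetric] R_def[symmetric] lim_eq
    by (intro conjI allI impI upper lower convergent diff)
qed

end
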